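(* Let $\Lambda$ be a $G$-algebra. Then the functors $$-\otimes^{\mathbf L}_\Lambda\Lambda G:\mathcal D^b(\Lambda)\to\mathcal D^b(\Lambda G)\quad\text{and}\quad \mathrm{Res}:\mathcal D^b(\Lambda G)\to\mathcal D^b(\Lambda)$$ induce a bijection $$\{G\text{-tilting subcategories of }\mathcal D^b(\Lambda)\}\longleftrightarrow\{\widehat G\text{-tilting subcategories of }\mathcal D^b(\Lambda G)\}.$$
   Context: $G$ is a finite abelian group, $k$ is a field whose characteristic does not divide $|G|$, and $\widehat G=\mathrm{Hom}(G,k^\times)$ is the dual (character) group of $G$. For a finite abelian group $H$, an $H$-algebra is a finite dimensional $k$-algebra with an action of $H$ by automorphisms. For a $G$-algebra $\Lambda$, the skew-group algebra is $\Lambda G=\Lambda\otimes_k kG$ with multiplication $(\lambda\otimes g)(\mu\otimes h)=\lambda g(\mu)\otimes gh$; it is a $\widehat G$-algebra via $\chi(\lambda\otimes g)=\chi(g)\lambda\otimes g$. The map $\Lambda\to\Lambda G$, $\lambda\mapsto\lambda\otimes1$, is an algebra monomorphism, and $\mathrm{Res}$ is restriction along it. Modules are right modules and $\mathcal D^b(\Lambda)=\mathcal D^b(\mathrm{mod}\,\Lambda)$. For an $H$-algebra $B$ and $h\in H$, $B_h$ is the $B$-bimodule equal to $B$ as a left module, with right action twisted by $h$: $x\cdot b=x\,h(b)$. Put $X^h:=X\otimes^{\mathbf L}_B B_h$ for $X\in\mathcal D^b(B)$ and $f^h:=f\otimes 1_{B_h}$ for a morphism $f$. An object $X\in\mathcal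 D^b(B)$ is $H$-invariant if there are isomorphisms $\iota_h:X^{h^{-1}}\to X$ for all $h\in H$ such that $\iota_{hh'}=\iota_h\circ(\iota_{h'})^{h^{-1}}$ for all $h,h'\in H$. An object $T\in\mathcal D^b(B)$ is tilting if $\mathrm{thick}(T)=\mathcal D^b(B)$ and $\mathrm{Hom}_{\mathcal D^b(B)}(T,T[i])=0$ for all integers $i\neq0$. If $T$ is an $H$-invariant tilting object of $\mathcal D^b(B)$, the category $\mathrm{add}(T)$ is called an $H$-tilting subcategory of $\mathcal D^b(B)$. The induced maps are $\mathrm{add}(T)\mapsto\mathrm{add}(T\otimes^{\mathbf L}_\Lambda\Lambda G)$ and $\mathrm{add}(U)\mapsto\mathrm{add}(\mathrm{Res}\,U)$.
   Formalization: The formal theorem additionally assumes that the dual group Hom(G,k^×) has as many elements as G (k has enough roots of unity); without it the claim fails, e.g. k=ℚ, G=ℤ/3, Λ=ℚ with trivial action. *)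

theory Defs
  imports
    "HOL-Algebra.Algebra"
    "HOL-Algebra.Algebraic_Closure_Type"
    "HOL-Library.Function_Algebras"
begin

text \<open>Free the name \<open>X\<close>, which HOL-Algebra uses for a polynomial variable.\<close>

no_notation Polynomials.var (\<open>X\<index>\<close>)

section \<open>Algebras and group actions\<close>

text \<open>
  The ground field is a type \<open>'k\<close> of class \<open>field\<close>. A \<open>k\<close>-algebra is a record
  of type \<open>('k, 'a) module\<close> (a ring together with a scalar multiplication); the locale
  \<open>algebra\<close> of HOL-Algebra is not used since it only covers commutative algebras.
\<close>

definition fd_algebra :: "('k::field, 'a) module \<Rightarrow> bool" where
  "fd_algebra A \<longleftrightarrow>
     ring A \<and> module (ring_of_type_algebra :: 'k ring) A \<and>
     (\<forall>c. \<forall>x\<in>carrier A. \<forall>y\<in>carrier A.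
        (c \<odot>\<^bsub>A\<^esub> x) \<otimes>\<^bsub>A\<^esub> y = c \<odot>\<^bsub>A\<^esub> (x \<otimes>\<^bsub>A\<^esub> y) \<and> x \<otimes>\<^bsub>A\<^esub> (c \<odot>\<^bsub>A\<^esub> y) = c \<odot>\<^bsub>A\<^esub> (x \<otimes>\<^bsub>A\<^esub> y)) \<and>
     (\<exists>S. finite S \<and> S \<subseteq> carrier A \<and>
        (\<forall>x\<in>carrier A. \<exists>c. x = (\<Oplus>\<^bsub>A\<^esub> s\<in>S. c s \<odot>\<^bsub>A\<^esub> s)))"

text \<open>
  \<open>group_action\<close> makes every \<open>act h\<close> a bijection of \<open>carrier A\<close> that is \<open>undefined\<close>
  outside of \<open>carrier A\<close>.
\<close>

definition H_algebra :: "'h monoid \<Rightarrow> ('k::field, 'a) module \<Rightarrow> ('h \<Rightarrow> 'a \<Rightarrow> 'a) \<Rightarrow> bool" where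
  "H_algebra H A act \<longleftrightarrow>
     comm_group H \<and> finite (carrier H) \<and> fd_algebra A \<and>
     group_action H (carrier A) act \<and>
     (\<forall>h\<in>carrier H. act h \<in> ring_hom A A \<and>
        (\<forall>c. \<forall>x\<in>carrier A. act h (c \<odot>\<^bsub>A\<^esub> x) = c \<odot>\<^bsub>A\<^esub> act h x))"

text \<open>\<open>Hom(G, k\<^sup>\<times>)\<close>; characters are \<open>undefined\<close> outside of \<open>carrier G\<close>.
  This group has as many elements as \<open>G\<close> iff \<open>k\<close> contains a primitive root of unity of order
  the exponent of \<open>G\<close>.\<close>

definition dual_group :: "'g monoid \<Rightarrow> ('g \<Rightarrow> 'k::field) monoid" where
  "dual_group G =
     \<lparr>carrier = hom G (units_of (ring_of_type_algebra :: 'k ring)) \<inter> extensional (carrier G),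
      monoid.mult = (\<lambda>\<chi> \<psi>. \<lambda>g\<in>carrier G. \<chi> g * \<psi> g),
      one = (\<lambda>g\<in>carrier G. 1)\<rparr>"

text \<open>
  \<open>\<Lambda> \<otimes>\<^sub>k kG\<close> is modelled by the functions \<open>carrier G \<rightarrow> carrier \<Lambda>\<close>, where \<open>f\<close> stands for
  the sum of all \<open>f g \<otimes> g\<close>; \<open>skew_pure G \<Lambda> l g\<close> is the element \<open>l \<otimes> g\<close>.
\<close>

definition skew_pure :: "'g monoid \<Rightarrow> ('k, 'a) module \<Rightarrow> 'a \<Rightarrow> 'g \<Rightarrow> 'g \<Rightarrow> 'a" where
  "skew_pure G A l g = (\<lambda>x\<in>carrier G. if x = g then l else \<zero>\<^bsub>A\<^esub>)"

definition skew_group_algebra ::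
  "'g monoid \<Rightarrow> ('k, 'a) module \<Rightarrow> ('g \<Rightarrow> 'a \<Rightarrow> 'a) \<Rightarrow> ('k, 'g \<Rightarrow> 'a) module" where
  "skew_group_algebra G A act =
     \<lparr>carrier = (\<Pi>\<^sub>E g\<in>carrier G. carrier A),
      monoid.mult = (\<lambda>f f'. \<lambda>x\<in>carrier G.
        (\<Oplus>\<^bsub>A\<^esub> g\<in>carrier G. f g \<otimes>\<^bsub>A\<^esub> act g (f' (inv\<^bsub>G\<^esub> g \<otimes>\<^bsub>G\<^esub> x)))),
      one = skew_pure G A \<one>\<^bsub>A\<^esub> \<one>\<^bsub>G\<^esub>,
      ring.zero = (\<lambda>x\<in>carrier G. \<zero>\<^bsub>A\<^esub>),
      ring.add = (\<lambda>f f'. \<lambda>x\<in>carrier G. f x \<oplus>\<^bsub>A\<^esub> f' x),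
      module.smult = (\<lambda>c f. \<lambda>x\<in>carrier G. c \<odot>\<^bsub>A\<^esub> f x)\<rparr>"

definition dual_action ::
  "'g monoid \<Rightarrow> ('k, 'a) module \<Rightarrow> ('g \<Rightarrow> 'k) \<Rightarrow> ('g \<Rightarrow> 'a) \<Rightarrow> ('g \<Rightarrow> 'a)" where
  "dual_action G A \<chi> =
     (\<lambda>f\<in>(\<Pi>\<^sub>E g\<in>carrier G. carrier A). \<lambda>g\<in>carrier G. \<chi> g \<odot>\<^bsub>A\<^esub> f g)"


section \<open>Finite dimensional right modules\<close>

text \<open>
  The carriers of all modules are finite dimensional subspaces of the vector space of
  sequences in \<open>'k\<close>. Every finite dimensional module is isomorphic to one of this form, so
  this replaces the category of all finite dimensional modules by an equivalent small one.
\<close>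

type_synonym 'k vec = "nat \<Rightarrow> 'k"

definition vscale :: "'k::field \<Rightarrow> 'k vec \<Rightarrow> 'k vec" where
  "vscale c x = (\<lambda>i. c * x i)"

interpretation vs: vector_space "vscale :: 'k::field \<Rightarrow> 'k vec \<Rightarrow> 'k vec"
  by unfold_locales (auto simp: vscale_def algebra_simps fun_eq_iff)

definition linear_on :: "'k::field vec set \<Rightarrow> ('k vec \<Rightarrow> 'k vec) \<Rightarrow> bool" where
  "linear_on V f \<longleftrightarrow>
     (\<forall>x\<in>V. \<forall>y\<in>V. f (x + y) = f x + f y) \<and> (\<forall>c. \<forall>x\<in>V. f (vscale c x) = vscale c (f x))"

record ('k, 'a) rmodule =
  space :: "'k vec set"
  ract :: "'k vec \<Rightarrow> 'a \<Rightarrow> 'k vec"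

definition right_module :: "('k::field, 'a) module \<Rightarrow> ('k, 'a) rmodule \<Rightarrow> bool" where
  "right_module A M \<longleftrightarrow>
     (\<exists>S. finite S \<and> space M = vs.span S) \<and>
     (\<forall>x\<in>space M. \<forall>a\<in>carrier A. ract M x a \<in> space M) \<and>
     (\<forall>a\<in>carrier A. linear_on (space M) (\<lambda>x. ract M x a)) \<and>
     (\<forall>x\<in>space M. \<forall>a\<in>carrier A. \<forall>b\<in>carrier A.
        ract M x (a \<oplus>\<^bsub>A\<^esub> b) = ract M x a + ract M x b \<and>
        ract M x (a \<otimes>\<^bsub>A\<^esub> b) = ract M (ract M x a) b) \<and>
     (\<forall>c. \<forall>x\<in>space M. \<forall>a\<in>carrier A. ract M x (c \<odot>\<^bsub>A\<^esub> a) = vscale c (ract M x a)) \<and>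
     (\<forall>x\<in>space M. ract M x \<one>\<^bsub>A\<^esub> = x)"

definition rmodule_hom ::
  "('k::field, 'a) module \<Rightarrow> ('k, 'a) rmodule \<Rightarrow> ('k, 'a) rmodule \<Rightarrow> ('k vec \<Rightarrow> 'k vec) \<Rightarrow> bool" where
  "rmodule_hom A M N f \<longleftrightarrow>
     linear_on (space M) f \<and> f ` space M \<subseteq> space N \<and>
     (\<forall>x\<in>space M. \<forall>a\<in>carrier A. f (ract M x a) = ract N (f x) a)"

definition zero_module :: "('k::field, 'a) rmodule" where
  "zero_module = \<lparr>space = {0}, ract = (\<lambda>x a. 0)\<rparr>"

text \<open>Direct sums are formed by interleaving sequences.\<close>

definition vpair :: "'k vec \<Rightarrow> 'k vec \<Rightarrow> 'k vec" where
  "vpair x y = (\<lambda>i. if even i then x (i div 2) else y (i div 2))"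

definition vfst :: "'k vec \<Rightarrow> 'k vec" where
  "vfst z = (\<lambda>i. z (2 * i))"

definition vsnd :: "'k vec \<Rightarrow> 'k vec" where
  "vsnd z = (\<lambda>i. z (2 * i + 1))"

definition dsum_module :: "('k, 'a) rmodule \<Rightarrow> ('k, 'a) rmodule \<Rightarrow> ('k, 'a) rmodule" where
  "dsum_module M N =
     \<lparr>space = {vpair x y | x y. x \<in> space M \<and> y \<in> space N},
      ract = (\<lambda>z a. vpair (ract M (vfst z) a) (ract N (vsnd z) a))\<rparr>"


section \<open>Bounded complexes\<close>

record ('k, 'a) cpx =
  obj :: "int \<Rightarrow> ('k, 'a) rmodule"
  diff :: "int \<Rightarrow> 'k vec \<Rightarrow> 'k vec"

type_synonym 'k cmap = "int \<Rightarrow> 'k vec \<Rightarrow> 'k vec"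

definition bounded_complex :: "('k::field, 'a) module \<Rightarrow> ('k, 'a) cpx \<Rightarrow> bool" where
  "bounded_complex A X \<longleftrightarrow>
     (\<forall>i. right_module A (obj X i)) \<and>
     (\<forall>i. rmodule_hom A (obj X i) (obj X (i + 1)) (diff X i)) \<and>
     (\<forall>i. \<forall>x\<in>space (obj X i). diff X (i + 1) (diff X i x) = 0) \<and>
     (\<exists>n. \<forall>i. \<bar>i\<bar> > n \<longrightarrow> space (obj X i) = {0})"

definition chain_map ::
  "('k::field, 'a) module \<Rightarrow> ('k, 'a) cpx \<Rightarrow> ('k, 'a) cpx \<Rightarrow> 'k cmap \<Rightarrow> bool" where
  "chain_map A X Y f \<longleftrightarrow>
     bounded_complex A X \<and> bounded_complex A Y \<and>
     (\<forall>i. rmodule_hom A (obj X i) (obj Y i) (f i)) \<and>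
     (\<forall>i. \<forall>x\<in>space (obj X i). f (i + 1) (diff X i x) = diff Y i (f i x))"

definition cycles :: "('k::field, 'a) cpx \<Rightarrow> int \<Rightarrow> 'k vec set" where
  "cycles X i = {x \<in> space (obj X i). diff X i x = 0}"

definition boundaries :: "('k::field, 'a) cpx \<Rightarrow> int \<Rightarrow> 'k vec set" where
  "boundaries X i = diff X (i - 1) ` space (obj X (i - 1))"

definition cohomology :: "('k::field, 'a) cpx \<Rightarrow> int \<Rightarrow> 'k vec set set" where
  "cohomology X i = cycles X i // {(x, y). x \<in> cycles X i \<and> y \<in> cycles X i \<and> y - x \<in> boundaries X i}"

definition cohomology_map ::
  "('k::field, 'a) cpx \<Rightarrow> 'k cmap \<Rightarrow> int \<Rightarrow> 'k vec set \<Rightarrow> 'k vec set" where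
  "cohomology_map Y f i c = {y \<in> cycles Y i. \<exists>x\<in>c. y - f i x \<in> boundaries Y i}"

definition quasi_iso ::
  "('k::field, 'a) module \<Rightarrow> ('k, 'a) cpx \<Rightarrow> ('k, 'a) cpx \<Rightarrow> 'k cmap \<Rightarrow> bool" where
  "quasi_iso A X Y s \<longleftrightarrow>
     chain_map A X Y s \<and>
     (\<forall>i. bij_betw (cohomology_map Y s i) (cohomology X i) (cohomology Y i))"

definition zero_cpx :: "('k::field, 'a) cpx" where
  "zero_cpx = \<lparr>obj = (\<lambda>i. zero_module), diff = (\<lambda>i x. 0)\<rparr>"

definition dsum :: "('k, 'a) cpx \<Rightarrow> ('k, 'a) cpx \<Rightarrow> ('k, 'a) cpx" where
  "dsum X Y =
     \<lparr>obj = (\<lambda>i. dsum_module (obj X i) (obj Y i)),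
      diff = (\<lambda>i z. vpair (diff X i (vfst z)) (diff Y i (vsnd z)))\<rparr>"

primrec dsum_power :: "nat \<Rightarrow> ('k::field, 'a) cpx \<Rightarrow> ('k, 'a) cpx" where
  "dsum_power 0 X = zero_cpx"
| "dsum_power (Suc n) X = dsum X (dsum_power n X)"

definition shift :: "int \<Rightarrow> ('k::field, 'a) cpx \<Rightarrow> ('k, 'a) cpx" where
  "shift n X =
     \<lparr>obj = (\<lambda>i. obj X (i + n)),
      diff = (\<lambda>i x. if even n then diff X (i + n) x else - diff X (i + n) x)\<rparr>"

definition cone :: "('k::field, 'a) cpx \<Rightarrow> 'k cmap \<Rightarrow> ('k, 'a) cpx \<Rightarrow> ('k, 'a) cpx" where
  "cone X f Y =
     \<lparr>obj = (\<lambda>i. dsum_module (obj X (i + 1)) (obj Y i)),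
      diff = (\<lambda>i z. vpair (- diff X (i + 1) (vfst z)) (f (i + 1) (vfst z) + diff Y i (vsnd z)))\<rparr>"


section \<open>The bounded derived category\<close>

text \<open>
  \<open>D\<^sup>b(A)\<close> is the localization (in the sense of Gabriel and Zisman) of the category of
  bounded complexes at the quasi-isomorphisms. Its objects are the bounded complexes; its
  morphisms are represented by formal composites of chain maps \<open>Arr X f Y\<close> (from \<open>X\<close> to \<open>Y\<close>)
  and formal inverses \<open>Inv X s Y\<close> (from \<open>Y\<close> to \<open>X\<close>) of quasi-isomorphisms \<open>s\<close> from \<open>X\<close> to \<open>Y\<close>.
  Two representatives define the same morphism iff they are related by \<open>dequiv\<close>, the
  smallest congruence for which \<open>Arr\<close> is a functor and \<open>Inv\<close> gives inverses. Chain maps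
  matter only on the modules of the complex, hence \<open>dequiv_cong_arr\<close>.
\<close>

datatype ('k, 'a) zigzag =
    Arr "('k, 'a) cpx" "'k cmap" "('k, 'a) cpx"
  | Inv "('k, 'a) cpx" "'k cmap" "('k, 'a) cpx"
  | Comp "('k, 'a) zigzag" "('k, 'a) zigzag"

inductive dhom ::
  "('k::field, 'a) module \<Rightarrow> ('k, 'a) cpx \<Rightarrow> ('k, 'a) cpx \<Rightarrow> ('k, 'a) zigzag \<Rightarrow> bool"
  for A where
  dhom_arr: "chain_map A X Y f \<Longrightarrow> dhom A X Y (Arr X f Y)"
| dhom_inv: "quasi_iso A X Y s \<Longrightarrow> dhom A Y X (Inv X s Y)"
| dhom_comp: "dhom A X Y u \<Longrightarrow> dhom A Y Z v \<Longrightarrow> dhom A X Z (Comp v u)"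

definition did :: "('k::field, 'a) cpx \<Rightarrow> ('k, 'a) zigzag" where
  "did X = Arr X (\<lambda>i x. x) X"

inductive dequiv ::
  "('k::field, 'a) module \<Rightarrow> ('k, 'a) zigzag \<Rightarrow> ('k, 'a) zigzag \<Rightarrow> bool"
  for A where
  dequiv_refl: "dhom A X Y u \<Longrightarrow> dequiv A u u"
| dequiv_sym: "dequiv A u v \<Longrightarrow> dequiv A v u"
| dequiv_trans: "dequiv A u v \<Longrightarrow> dequiv A v w \<Longrightarrow> dequiv A u w"
| dequiv_comp: "dhom A X Y u \<Longrightarrow> dhom A Y Z v \<Longrightarrow> dequiv A u u' \<Longrightarrow> dequiv A v v' \<Longrightarrow>
    dequiv A (Comp v u) (Comp v' u')"
| dequiv_assoc: "dhom A X Y u \<Longrightarrow> dhom A Y Z v \<Longrightarrow> dhom A Z W w \<Longrightarrow>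
    dequiv A (Comp w (Comp v u)) (Comp (Comp w v) u)"
| dequiv_id_left: "dhom A X Y u \<Longrightarrow> dequiv A (Comp (did Y) u) u"
| dequiv_id_right: "dhom A X Y u \<Longrightarrow> dequiv A (Comp u (did X)) u"
| dequiv_cong_arr: "chain_map A X Y f \<Longrightarrow> chain_map A X Y f' \<Longrightarrow>
    (\<And>i x. x \<in> space (obj X i) \<Longrightarrow> f i x = f' i x) \<Longrightarrow> dequiv A (Arr X f Y) (Arr X f' Y)"
| dequiv_arr_comp: "chain_map A X Y f \<Longrightarrow> chain_map A Y Z g \<Longrightarrow>
    dequiv A (Comp (Arr Y g Z) (Arr X f Y)) (Arr X (\<lambda>i x. g i (f i x)) Z)"
| dequiv_inv_left: "quasi_iso A X Y s \<Longrightarrow> dequiv A (Comp (Inv X s Y) (Arr X s Y)) (did X)"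
| dequiv_inv_right: "quasi_iso A X Y s \<Longrightarrow> dequiv A (Comp (Arr X s Y) (Inv X s Y)) (did Y)"

definition diso ::
  "('k::field, 'a) module \<Rightarrow> ('k, 'a) cpx \<Rightarrow> ('k, 'a) cpx \<Rightarrow> ('k, 'a) zigzag \<Rightarrow> bool" where
  "diso A X Y u \<longleftrightarrow>
     dhom A X Y u \<and>
     (\<exists>v. dhom A Y X v \<and> dequiv A (Comp v u) (did X) \<and> dequiv A (Comp u v) (did Y))"

text \<open>
  The smallest full subcategory of \<open>D\<^sup>b(A)\<close> that contains \<open>T\<close> and is closed under isomorphisms,
  shifts, cones and direct summands. Every distinguished triangle is isomorphic in \<open>D\<^sup>b(A)\<close> to
  the mapping cone triangle of a chain map, so closure under isomorphisms, shifts and cones of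
  chain maps is closure under distinguished triangles.
\<close>

inductive_set thick :: "('k::field, 'a) module \<Rightarrow> ('k, 'a) cpx \<Rightarrow> ('k, 'a) cpx set"
  for A T where
  thick_base: "bounded_complex A T \<Longrightarrow> T \<in> thick A T"
| thick_iso: "X \<in> thick A T \<Longrightarrow> diso A X Y u \<Longrightarrow> Y \<in> thick A T"
| thick_shift: "X \<in> thick A T \<Longrightarrow> shift n X \<in> thick A T"
| thick_cone: "X \<in> thick A T \<Longrightarrow> Y \<in> thick A T \<Longrightarrow> chain_map A X Y f \<Longrightarrow> cone X f Y \<in> thick A T"
| thick_summand: "dsum X Y \<in> thick A T \<Longrightarrow> bounded_complex A X \<Longrightarrow> bounded_complex A Y \<Longrightarrow>
    X \<in> thick A T"

text \<open>\<open>add(T)\<close>, as the set of objects of a full subcategory.\<close>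

definition add_cat :: "('k::field, 'a) module \<Rightarrow> ('k, 'a) cpx \<Rightarrow> ('k, 'a) cpx set" where
  "add_cat A T =
     {X. bounded_complex A X \<and>
         (\<exists>Y n u. bounded_complex A Y \<and> diso A (dsum X Y) (dsum_power n T) u)}"

definition tilting :: "('k::field, 'a) module \<Rightarrow> ('k, 'a) cpx \<Rightarrow> bool" where
  "tilting A T \<longleftrightarrow>
     bounded_complex A T \<and> thick A T = {X. bounded_complex A X} \<and>
     (\<forall>i u. i \<noteq> 0 \<longrightarrow> dhom A T (shift i T) u \<longrightarrow> dequiv A u (Arr T (\<lambda>j x. 0) (shift i T)))"


section \<open>Tensor products\<close>

record ('b, 'c, 'n) bimodule =
  bspace :: "'n set"
  badd :: "'n \<Rightarrow> 'n \<Rightarrow> 'n"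
  blact :: "'b \<Rightarrow> 'n \<Rightarrow> 'n"
  bract :: "'n \<Rightarrow> 'c \<Rightarrow> 'n"

definition balanced ::
  "('k::field, 'b) module \<Rightarrow> ('k, 'b) rmodule \<Rightarrow> ('b, 'c, 'n) bimodule \<Rightarrow>
   ('k vec \<Rightarrow> 'n \<Rightarrow> 'k vec) \<Rightarrow> bool" where
  "balanced B M N \<beta> \<longleftrightarrow>
     (\<forall>n\<in>bspace N. linear_on (space M) (\<lambda>x. \<beta> x n)) \<and>
     (\<forall>x\<in>space M. \<forall>n\<in>bspace N. \<forall>n'\<in>bspace N. \<beta> x (badd N n n') = \<beta> x n + \<beta> x n') \<and>
     (\<forall>x\<in>space M. \<forall>b\<in>carrier B. \<forall>n\<in>bspace N. \<beta> (ract M x b) n = \<beta> x (blact N b n))"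

text \<open>
  The right \<open>C\<close>-module \<open>T\<close> together with \<open>\<tau>\<close> is a tensor product over \<open>B\<close> of \<open>M\<close> and the
  \<open>B\<close>-\<open>C\<close>-bimodule \<open>N\<close>, with \<open>\<tau> x n\<close> in the role of \<open>x \<otimes> n\<close>.
\<close>

definition is_tensor ::
  "('k::field, 'b) module \<Rightarrow> ('k, 'c) module \<Rightarrow> ('k, 'b) rmodule \<Rightarrow> ('b, 'c, 'n) bimodule \<Rightarrow>
   ('k, 'c) rmodule \<times> ('k vec \<Rightarrow> 'n \<Rightarrow> 'k vec) \<Rightarrow> bool" where
  "is_tensor B C M N = (\<lambda>(T, \<tau>).
     right_module C T \<and> balanced B M N \<tau> \<and>
     (\<forall>x\<in>space M. \<forall>n\<in>bspace N. \<tau> x n \<in> space T \<and>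
        (\<forall>c\<in>carrier C. ract T (\<tau> x n) c = \<tau> x (bract N n c))) \<and>
     (\<forall>\<beta>. balanced B M N \<beta> \<longrightarrow>
        (\<exists>\<phi>. linear_on (space T) \<phi> \<and> (\<forall>x\<in>space M. \<forall>n\<in>bspace N. \<phi> (\<tau> x n) = \<beta> x n) \<and>
           (\<forall>\<psi>. linear_on (space T) \<psi> \<and> (\<forall>x\<in>space M. \<forall>n\<in>bspace N. \<psi> (\<tau> x n) = \<beta> x n) \<longrightarrow>
              (\<forall>t\<in>space T. \<psi> t = \<phi> t)))))"

definition tensor ::
  "('k::field, 'b) module \<Rightarrow> ('k, 'c) module \<Rightarrow> ('k, 'b) rmodule \<Rightarrow> ('b, 'c, 'n) bimodule \<Rightarrow>
   ('k, 'c) rmodule \<times> ('k vec \<Rightarrow> 'n \<Rightarrow> 'k vec)" where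
  "tensor B C M N = (SOME p. is_tensor B C M N p)"

text \<open>
  The choice in \<open>tensor\<close> is not vacuous: for the existence of a tensor product it suffices
  that \<open>N\<close> is finitely generated as a left \<open>B\<close>-module. The proof takes the span of a balanced map with values in a space of maximal dimension.
\<close>

lemma linear_onD:
  "linear_on V f \<Longrightarrow> x \<in> V \<Longrightarrow> y \<in> V \<Longrightarrow> f (x + y) = f x + f y"
  "linear_on V f \<Longrightarrow> x \<in> V \<Longrightarrow> f (vscale c x) = vscale c (f x)"
  by (auto simp: linear_on_def)

lemma linear_on_zero: "linear_on V f \<Longrightarrow> 0 \<in> V \<Longrightarrow> f 0 = 0"
  using linear_onD(1)[of V f 0 0] by simp

lemma linear_on_span_into:
  assumes f: "linear_on (vs.span S) f" "f ` S \<subseteq> vs.span T" and x: "x \<in> vs.span S"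
  shows "f x \<in> vs.span T"
proof -
  have "x \<in> vs.span S \<and> f x \<in> vs.span T"
    using x
  proof (rule vs.span_induct_alt)
    show "0 \<in> vs.span S \<and> f 0 \<in> vs.span T"
      using linear_on_zero[OF f(1) vs.span_zero] vs.span_zero by metis
    fix c x y assume s: "x \<in> S" "y \<in> vs.span S \<and> f y \<in> vs.span T"
    then have x: "x \<in> vs.span S" "vscale c x \<in> vs.span S"
      by (auto intro: vs.span_base vs.span_scale)
    have "f (vscale c x + y) = vscale c (f x) + f y"
      using s linear_onD(1)[OF f(1) x(2)] linear_onD(2)[OF f(1) x(1)] by simp
    then show "vscale c x + y \<in> vs.span S \<and> f (vscale c x + y) \<in> vs.span T"
      using f(2) s x(2) vs.span_add[OF x(2), of y] vs.span_add[of "vscale c (f x)" T "f y"] vs.span_scale[of "f x" T c]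
      by (simp only: image_subset_iff)
  qed
  then show ?thesis by simp
qed

lemma linear_on_span_eq:
  assumes f: "linear_on (vs.span S) f" and g: "linear_on (vs.span S) g"
    and eq: "\<And>x. x \<in> S \<Longrightarrow> f x = g x" and x: "x \<in> vs.span S"
  shows "f x = g x"
proof -
  have "x \<in> vs.span S \<and> f x = g x"
    using x
  proof (rule vs.span_induct_alt)
    show "0 \<in> vs.span S \<and> f 0 = g 0"
      using linear_on_zero[OF f vs.span_zero] linear_on_zero[OF g vs.span_zero] vs.span_zero by metis
    fix c x y assume s: "x \<in> S" "y \<in> vs.span S \<and> f y = g y"
    then have x: "x \<in> vs.span S" "vscale c x \<in> vs.span S"
      by (auto intro: vs.span_base vs.span_scale)
    have "f (vscale c x + y) = g (vscale c x + y)"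
      using s linear_onD(1)[OF f x(2)] linear_onD(2)[OF f x(1)]
        linear_onD(1)[OF g x(2)] linear_onD(2)[OF g x(1)] eq by simp
    then show "vscale c x + y \<in> vs.span S \<and> f (vscale c x + y) = g (vscale c x + y)"
      using s x vs.span_add by metis
  qed
  then show ?thesis by simp
qed

lemma vpair_simps [simp]: "vfst (vpair x y) = x" "vsnd (vpair x y) = y"
  by (auto simp: vfst_def vsnd_def vpair_def)

lemma linear_vfst: "Vector_Spaces.linear vscale vscale (vfst :: 'k::field vec \<Rightarrow> 'k vec)"
  by unfold_locales (auto simp: vfst_def vscale_def algebra_simps fun_eq_iff)

lemma vpair_add: "vpair (x + x') (y + y') = vpair x y + vpair x' y'"
  by (auto simp: vpair_def fun_eq_iff)
lemma vpair_scale: "vpair (vscale c x) (vscale c y) = vscale c (vpair x y)"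
  by (auto simp: vpair_def fun_eq_iff vscale_def)
lemma vsnd_add: "vsnd (x + y) = vsnd x + vsnd y" "vsnd (vscale c x) = vscale c (vsnd x)"
  by (auto simp: vsnd_def vscale_def fun_eq_iff)
lemma vfst_add: "vfst (x + y) = vfst x + vfst y" "vfst (vscale c x) = vscale c (vfst x)"
  by (auto simp: vfst_def vscale_def fun_eq_iff)

lemma basis_in:
  obtains D where "D \<subseteq> E" "vs.independent D" "vs.span D = vs.span E"
proof -
  obtain D where D: "D \<subseteq> E" "vs.independent D" "E \<subseteq> vs.span D"
    using vs.maximal_independent_subset[of E] by blast
  have "vs.span E \<subseteq> vs.span D" using D(3) by (rule vs.span_minimal) (rule vs.subspace_span)
  with vs.span_mono[OF D(1)] D that show ?thesis by blast
qed

inductive_set left_gen :: "'b set \<Rightarrow> ('b, 'c, 'n) bimodule \<Rightarrow> 'n set \<Rightarrow> 'n set" for B N S where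
  "b \<in> B \<Longrightarrow> s \<in> S \<Longrightarrow> blact N b s \<in> left_gen B N S"
| "n \<in> left_gen B N S \<Longrightarrow> n' \<in> left_gen B N S \<Longrightarrow> badd N n n' \<in> left_gen B N S"

definition bilin_span :: "('k::field, 'b) rmodule \<Rightarrow> ('b, 'c, 'n) bimodule \<Rightarrow> ('k vec \<Rightarrow> 'n \<Rightarrow> 'k vec) \<Rightarrow> 'k vec set" where
  "bilin_span M N \<beta> = vs.span {\<beta> x n | x n. x \<in> space M \<and> n \<in> bspace N}"

lemma bound:
  assumes M: "right_module B M" and S: "finite S" "space M = vs.span S"
    and F: "finite F" "F \<subseteq> bspace N" "bspace N \<subseteq> left_gen (carrier B) N F" "left_gen (carrier B) N F \<subseteq> bspace N"
    and b: "balanced B M N \<beta>"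
  shows "\<exists>E. finite E \<and> card E \<le> card S * card F \<and> bilin_span M N \<beta> = vs.span E"
proof -
  let ?E = "(\<lambda>(s, f). \<beta> s f) ` (S \<times> F)"
  have *: "\<forall>x\<in>space M. \<beta> x n \<in> vs.span ?E" if "n \<in> left_gen (carrier B) N F" for n
    using that
  proof induction
    case (1 c s)
    show ?case
    proof
      fix x assume x: "x \<in> space M"
      have "\<beta> x (blact N c s) = \<beta> (ract M x c) s"
        using b x 1 F(2) by (auto simp: balanced_def)
      moreover have "ract M x c \<in> vs.span S" using M x 1 S unfolding right_module_def by auto
      moreover have "linear_on (vs.span S) (\<lambda>x. \<beta> x s)" using b 1 F S by (auto simp: balanced_def)
      moreover have "(\<lambda>x. \<beta> x s) ` S \<subseteq> vs.span ?E" using 1 by (auto intro!: vs.span_base)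
      ultimately show "\<beta> x (blact N c s) \<in> vs.span ?E"
        using linear_on_span_into by metis
    qed
  next
    case (2 n n')
    show ?case
    proof
      fix x assume x: "x \<in> space M"
      have "n \<in> bspace N" "n' \<in> bspace N" using 2 F(4) by auto
      then have "\<beta> x (badd N n n') = \<beta> x n + \<beta> x n'" using b x by (auto simp: balanced_def)
      moreover have "\<beta> x n + \<beta> x n' \<in> vs.span ?E"
        by (rule vs.span_add) (use 2 x in blast)+
      ultimately show "\<beta> x (badd N n n') \<in> vs.span ?E" by (simp only:)
    qed
  qed
  have "bilin_span M N \<beta> = vs.span ?E"
    unfolding bilin_span_def
  proof
    show "vs.span {\<beta> x n |x n. x \<in> space M \<and> n \<in> bspace N} \<subseteq> vs.span ?E"
      by (rule vs.span_minimal[OF _ vs.subspace_span]) (use * F(3) in blast)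
    show "vs.span ?E \<subseteq> vs.span {\<beta> x n |x n. x \<in> space M \<and> n \<in> bspace N}"
    proof (rule vs.span_mono, rule subsetI)
      fix z assume "z \<in> ?E"
      then obtain s f where z: "z = \<beta> s f" "s \<in> S" "f \<in> F" by auto
      have "s \<in> space M" unfolding S(2) using z(2) by (rule vs.span_base)
      then show "z \<in> {\<beta> x n |x n. x \<in> space M \<and> n \<in> bspace N}" using z F(2) by blast
    qed
  qed
  moreover have "card ?E \<le> card S * card F"
    using card_image_le[of "S \<times> F" "\<lambda>(s, f). \<beta> s f"] S(1) F(1) by (simp only: card_cartesian_product finite_cartesian_product)
  moreover have "finite ?E" using S(1) F(1) by simp
  ultimately show ?thesis by (intro exI[of _ ?E] conjI)
qed

lemma universal_exists:
  fixes M :: "('a::field, 'b) rmodule" and N :: "('b, 'c, 'n) bimodule"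
  assumes M: "right_module B M"
    and F: "finite F" "F \<subseteq> bspace N" "bspace N = left_gen (carrier B) N F"
  obtains \<tau> where "balanced B M N \<tau>" "\<exists>E. finite E \<and> bilin_span M N \<tau> = vs.span E"
    "\<And>\<gamma>. balanced B M N \<gamma> \<Longrightarrow> \<exists>\<phi>. linear_on (bilin_span M N \<tau>) \<phi> \<and>
       (\<forall>x\<in>space M. \<forall>n\<in>bspace N. \<phi> (\<tau> x n) = \<gamma> x n)"
proof -
  obtain S where S: "finite S" "space M = vs.span S" using M unfolding right_module_def by auto
  note bd = bound[OF M S F(1,2) eq_refl[OF F(3)] eq_refl[OF F(3)[symmetric]]]
  let ?P = "\<lambda>k. \<exists>\<beta>. balanced B M N \<beta> \<and> vs.dim (bilin_span M N \<beta>) = k"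
  have dimb: "vs.dim (bilin_span M N \<beta>) \<le> card S * card F" if b: "balanced B M N \<beta>" for \<beta>
  proof -
    obtain E where E: "finite E" "card E \<le> card S * card F" "bilin_span M N \<beta> = vs.span E"
      using bd[OF b] by auto
    then show ?thesis using vs.dim_le_card[OF vs.span_superset E(1)] vs.dim_span[of E] by (simp only:)
  qed
  have "balanced B M N (\<lambda>x n. 0)" by (auto simp: balanced_def linear_on_def)
  then have "?P (vs.dim (bilin_span M N (\<lambda>x n. 0)))" by blast
  then obtain k where k: "?P k" "\<And>j. ?P j \<Longrightarrow> j \<le> k"
    using Nat.ex_has_greatest_nat[of ?P _ "card S * card F"] dimb by blast
  then obtain \<tau> where t: "balanced B M N \<tau>" "vs.dim (bilin_span M N \<tau>) = k" by auto
  have "\<exists>\<phi>. linear_on (bilin_span M N \<tau>) \<phi> \<and> (\<forall>x\<in>space M. \<forall>n\<in>bspace N. \<phi> (\<tau> x n) = \<gamma> x n)"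
    if g: "balanced B M N \<gamma>" for \<gamma>
  proof -
    interpret L: Vector_Spaces.linear vscale vscale "vfst :: 'a vec \<Rightarrow> _" by (rule linear_vfst)
    define \<delta> where "\<delta> = (\<lambda>x n. vpair (\<tau> x n) (\<gamma> x n))"
    have d: "balanced B M N \<delta>"
      using t(1) g unfolding balanced_def \<delta>_def linear_on_def by (simp add: vpair_add[symmetric] vpair_scale[symmetric] del: plus_fun_apply)
    have im: "vfst ` bilin_span M N \<delta> = bilin_span M N \<tau>"
    proof -
      have *: "vfst ` {\<delta> x n |x n. x \<in> space M \<and> n \<in> bspace N} = {\<tau> x n |x n. x \<in> space M \<and> n \<in> bspace N}"
        by (force simp: \<delta>_def image_iff)
      show ?thesis unfolding bilin_span_def L.span_image[symmetric] * ..
    qed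
    obtain E where E: "finite E" "bilin_span M N \<delta> = vs.span E" using bd[OF d] by auto
    obtain D where D: "D \<subseteq> E" "vs.independent D" "vs.span D = vs.span E"
      by (rule basis_in)
    have fD: "finite D" by (rule finite_subset[OF D(1) E(1)])
    have "card D = vs.dim (bilin_span M N \<delta>)"
      unfolding E(2) by (rule vs.dim_eq_card[symmetric]) (simp_all only: D vs.span_span not_False_eq_True)
    also have "\<dots> \<le> k" by (rule k(2)) (use d in blast)
    finally have cD: "card D \<le> k" .
    have sp: "vs.span (vfst ` D) = bilin_span M N \<tau>"
      using im E D by (simp add: L.span_image)
    obtain D' where D': "D' \<subseteq> vfst ` D" "vs.independent D'" "vs.span D' = vs.span (vfst ` D)"
      by (rule basis_in)
    have "card D' = k" unfolding t(2)[symmetric] sp[symmetric]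
      by (rule vs.dim_eq_card[symmetric]) (simp_all only: D' vs.span_span not_False_eq_True)
    moreover have "card D' \<le> card (vfst ` D)" by (rule card_mono[OF finite_imageI[OF fD] D'(1)])
    moreover have "card (vfst ` D) \<le> card D" using fD by (rule card_image_le)
    ultimately have ce: "card (vfst ` D) = card D" "card D' = card (vfst ` D)" using cD by linarith+
    have inj: "inj_on vfst D" by (rule eq_card_imp_inj_on[OF fD ce(1)])
    have "D' = vfst ` D" by (rule card_subset_eq[OF finite_imageI[OF fD] D'(1) ce(2)])
    then have ind: "vs.independent (vfst ` D)" using D'(2) by metis
    have inj': "inj_on vfst (bilin_span M N \<delta>)"
      unfolding E(2) D(3)[symmetric] by (rule L.inj_on_span_independent_image[OF ind inj])
    define \<phi> where "\<phi> = (\<lambda>t. vsnd (inv_into (bilin_span M N \<delta>) vfst t))"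
    have \<phi>: "\<phi> (vfst z) = vsnd z" if "z \<in> bilin_span M N \<delta>" for z
      using that inj' by (simp add: \<phi>_def)
    have cl: "x + y \<in> bilin_span M N \<delta>"
      if "x \<in> bilin_span M N \<delta>" "y \<in> bilin_span M N \<delta>" for x y
      using that unfolding bilin_span_def by (rule vs.span_add)
    have cl': "vscale c x \<in> bilin_span M N \<delta>" if "x \<in> bilin_span M N \<delta>" for x c
      using that unfolding bilin_span_def by (rule vs.span_scale)
    have "linear_on (bilin_span M N \<tau>) \<phi>"
      unfolding linear_on_def im[symmetric]
    proof (intro conjI ballI allI; elim imageE; hypsubst)
      fix z w assume "z \<in> bilin_span M N \<delta>" "w \<in> bilin_span M N \<delta>"
      then show "\<phi> (vfst z + vfst w) = \<phi> (vfst z) + \<phi> (vfst w)"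
        using \<phi>[OF cl[of z w]] \<phi>[of z] \<phi>[of w] by (simp only: vfst_add[symmetric] vsnd_add)
    next
      fix c z assume "z \<in> bilin_span M N \<delta>"
      then show "\<phi> (vscale c (vfst z)) = vscale c (\<phi> (vfst z))"
        using \<phi>[OF cl'[of z c]] \<phi>[of z] by (simp only: vfst_add[symmetric] vsnd_add)
    qed
    moreover have "\<phi> (\<tau> x n) = \<gamma> x n" if "x \<in> space M" "n \<in> bspace N" for x n
    proof -
      have "\<delta> x n \<in> bilin_span M N \<delta>" unfolding bilin_span_def using that by (auto intro!: vs.span_base)
      from \<phi>[OF this] show ?thesis by (simp add: \<delta>_def)
    qed
    ultimately show ?thesis by blast
  qed
  then show ?thesis using that[OF t(1)] bd[OF t(1)] by blast
qed


lemma tensor_exists: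
  fixes M :: "('k::field, 'b) rmodule" and N :: "('b, 'c, 'n) bimodule"
  assumes M: "right_module B M"
    and F: "finite F" "F \<subseteq> bspace N" "bspace N = left_gen (carrier B) N F"
    and B: "fd_algebra B" and C: "fd_algebra C"
    and cl: "\<And>n c. n \<in> bspace N \<Longrightarrow> c \<in> carrier C \<Longrightarrow> bract N n c \<in> bspace N"
    and addl: "\<And>n n' c. n \<in> bspace N \<Longrightarrow> n' \<in> bspace N \<Longrightarrow> c \<in> carrier C \<Longrightarrow>
        bract N (badd N n n') c = badd N (bract N n c) (bract N n' c)"
    and addr: "\<And>n c c'. n \<in> bspace N \<Longrightarrow> c \<in> carrier C \<Longrightarrow> c' \<in> carrier C \<Longrightarrow>
        bract N n (c \<oplus>\<^bsub>C\<^esub> c') = badd N (bract N n c) (bract N n c')"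
    and assoc: "\<And>n c c'. n \<in> bspace N \<Longrightarrow> c \<in> carrier C \<Longrightarrow> c' \<in> carrier C \<Longrightarrow>
        bract N n (c \<otimes>\<^bsub>C\<^esub> c') = bract N (bract N n c) c'"
    and lr: "\<And>b n c. b \<in> carrier B \<Longrightarrow> n \<in> bspace N \<Longrightarrow> c \<in> carrier C \<Longrightarrow>
        bract N (blact N b n) c = blact N b (bract N n c)"
    and one: "\<And>n. n \<in> bspace N \<Longrightarrow> bract N n \<one>\<^bsub>C\<^esub> = n"
    and sm: "\<And>n c k. n \<in> bspace N \<Longrightarrow> c \<in> carrier C \<Longrightarrow>
        bract N n (k \<odot>\<^bsub>C\<^esub> c) = blact N (k \<odot>\<^bsub>B\<^esub> \<one>\<^bsub>B\<^esub>) (bract N n c)"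
  shows "\<exists>p. is_tensor B C M N p"
proof -
  obtain \<tau> where t: "balanced B M N \<tau>" "\<exists>E. finite E \<and> bilin_span M N \<tau> = vs.span E"
    and u: "\<And>\<gamma>. balanced B M N \<gamma> \<Longrightarrow> \<exists>\<phi>. linear_on (bilin_span M N \<tau>) \<phi> \<and>
       (\<forall>x\<in>space M. \<forall>n\<in>bspace N. \<phi> (\<tau> x n) = \<gamma> x n)"
    using universal_exists[OF M F] by metis
  let ?V = "bilin_span M N \<tau>"
  have tin: "\<tau> x n \<in> ?V" if "x \<in> space M" "n \<in> bspace N" for x n
    unfolding bilin_span_def using that by (intro vs.span_base) blast
  have uniq: "f v = g v" if "linear_on ?V f" "linear_on ?V g" "v \<in> ?V"
    "\<And>x n. x \<in> space M \<Longrightarrow> n \<in> bspace N \<Longrightarrow> f (\<tau> x n) = g (\<tau> x n)" for f g v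
    by (rule linear_on_span_eq[OF that(1)[unfolded bilin_span_def] that(2)[unfolded bilin_span_def] _
          that(3)[unfolded bilin_span_def]]) (use that(4) in auto)
  have "balanced B M N (\<lambda>x n. \<tau> x (bract N n c))" if "c \<in> carrier C" for c
    using t(1) that cl addl lr unfolding balanced_def by simp
  then have "\<forall>c. \<exists>\<phi>. c \<in> carrier C \<longrightarrow> linear_on ?V \<phi> \<and>
       (\<forall>x\<in>space M. \<forall>n\<in>bspace N. \<phi> (\<tau> x n) = \<tau> x (bract N n c))"
    using u by blast
  then obtain r where r: "\<And>c. c \<in> carrier C \<Longrightarrow> linear_on ?V (r c)"
      "\<And>c x n. c \<in> carrier C \<Longrightarrow> x \<in> space M \<Longrightarrow> n \<in> bspace N \<Longrightarrow> r c (\<tau> x n) = \<tau> x (bract N n c)"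
    by metis
  have Vadd: "v + w \<in> ?V" if "v \<in> ?V" "w \<in> ?V" for v w
    using that unfolding bilin_span_def by (rule vs.span_add)
  have Vsc: "vscale k v \<in> ?V" if "v \<in> ?V" for k v
    using that unfolding bilin_span_def by (rule vs.span_scale)
  have rV: "r c v \<in> ?V" if "c \<in> carrier C" "v \<in> ?V" for c v
    unfolding bilin_span_def
  proof (rule linear_on_span_into[OF r(1)[OF that(1), unfolded bilin_span_def] _ that(2)[unfolded bilin_span_def]], rule subsetI, elim imageE)
    fix z y assume "z = r c y" "y \<in> {\<tau> x n |x n. x \<in> space M \<and> n \<in> bspace N}"
    then obtain x n where z: "z = r c (\<tau> x n)" "x \<in> space M" "n \<in> bspace N" by blast
    then have "z = \<tau> x (bract N n c)" using r(2)[OF that(1) z(2,3)] by (simp only:)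
    then show "z \<in> vs.span {\<tau> x n |x n. x \<in> space M \<and> n \<in> bspace N}"
      using tin[of x "bract N n c"] cl that(1) z by (simp only: bilin_span_def)
  qed
  interpret C: ring C using C by (simp add: fd_algebra_def)
  interpret B: ring B using B by (simp add: fd_algebra_def)
  interpret mB: module "ring_of_type_algebra :: 'k ring" B using B by (simp add: fd_algebra_def)
  interpret mC: module "ring_of_type_algebra :: 'k ring" C using C by (simp add: fd_algebra_def)
  have scB: "k \<odot>\<^bsub>B\<^esub> b \<in> carrier B" if "b \<in> carrier B" for k b
    using mB.smult_closed[of k b] that by (simp add: ring_of_type_algebra_def)
  have scC: "k \<odot>\<^bsub>C\<^esub> b \<in> carrier C" if "b \<in> carrier C" for k b
    using mC.smult_closed[of k b] that by (simp add: ring_of_type_algebra_def)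
  let ?T = "\<lparr>space = ?V, ract = (\<lambda>v c. r c v)\<rparr>"
  have linc: "linear_on ?V (\<lambda>v. f v + g v)" if "linear_on ?V f" "linear_on ?V g" for f g
    using that by (simp add: linear_on_def vs.scale_right_distrib del: plus_fun_apply)
  have lins: "linear_on ?V (\<lambda>v. vscale k (f v))" if "linear_on ?V f" for f k
    using that by (simp add: linear_on_def vs.scale_right_distrib mult.commute del: plus_fun_apply)
  have radd: "r (c \<oplus>\<^bsub>C\<^esub> c') v = r c v + r c' v" if "c \<in> carrier C" "c' \<in> carrier C" "v \<in> ?V" for c c' v
    by (rule uniq[OF r(1) linc[OF r(1) r(1)]])
      (use that r(2) t(1) cl addr in \<open>simp_all add: balanced_def\<close>)
  have rmul: "r (c \<otimes>\<^bsub>C\<^esub> c') v = r c' (r c v)" if "c \<in> carrier C" "c' \<in> carrier C" "v \<in> ?V" for c c' v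
  proof (rule uniq[OF r(1) _ that(3)])
    show "linear_on ?V (\<lambda>v. r c' (r c v))"
      using r(1) rV that by (simp add: linear_on_def)
  qed (use that r(2) cl assoc in simp_all)
  have rone: "r \<one>\<^bsub>C\<^esub> v = v" if "v \<in> ?V" for v
    by (rule uniq[OF r(1) _ that]) (use r(2) one in \<open>simp_all add: linear_on_def\<close>)
  have rsc: "r (k \<odot>\<^bsub>C\<^esub> c) v = vscale k (r c v)" if "c \<in> carrier C" "v \<in> ?V" for c k v
  proof (rule uniq[OF r(1) lins[OF r(1)] that(2)])
    fix x n assume x: "x \<in> space M" "n \<in> bspace N"
    have "\<tau> x (blact N (k \<odot>\<^bsub>B\<^esub> \<one>\<^bsub>B\<^esub>) (bract N n c)) = \<tau> (ract M x (k \<odot>\<^bsub>B\<^esub> \<one>\<^bsub>B\<^esub>)) (bract N n c)"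
      using t(1) x cl that scB by (simp add: balanced_def)
    also have "ract M x (k \<odot>\<^bsub>B\<^esub> \<one>\<^bsub>B\<^esub>) = vscale k x"
      using M x by (simp add: right_module_def)
    finally show "r (k \<odot>\<^bsub>C\<^esub> c) (\<tau> x n) = vscale k (r c (\<tau> x n))"
      using r(2) x that scC sm t(1) cl by (simp add: balanced_def linear_on_def)
  qed (use that scC in auto)
  have "right_module C ?T"
    unfolding right_module_def
    using t(2) rV r(1) radd rmul rone rsc by simp
  moreover have "\<exists>\<phi>. linear_on ?V \<phi> \<and> (\<forall>x\<in>space M. \<forall>n\<in>bspace N. \<phi> (\<tau> x n) = \<beta> x n) \<and>
           (\<forall>\<psi>. linear_on ?V \<psi> \<and> (\<forall>x\<in>space M. \<forall>n\<in>bspace N. \<psi> (\<tau> x n) = \<beta> x n) \<longrightarrow>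
              (\<forall>t\<in>?V. \<psi> t = \<phi> t))" if bb: "balanced B M N \<beta>" for \<beta>
  proof -
    obtain \<phi> where p: "linear_on ?V \<phi>" "\<forall>x\<in>space M. \<forall>n\<in>bspace N. \<phi> (\<tau> x n) = \<beta> x n"
      using u[OF bb] by (elim exE conjE)
    show ?thesis
    proof (intro exI[of _ \<phi>] conjI allI impI ballI p(1))
      fix x n assume "x \<in> space M" "n \<in> bspace N" then show "\<phi> (\<tau> x n) = \<beta> x n" using p(2) by blast
    next
      fix \<psi> t assume q: "linear_on ?V \<psi> \<and> (\<forall>x\<in>space M. \<forall>n\<in>bspace N. \<psi> (\<tau> x n) = \<beta> x n)" "t \<in> ?V"
      show "\<psi> t = \<phi> t"
        by (rule uniq[OF conjunct1[OF q(1)] p(1) q(2)]) (simp only: p(2) conjunct2[OF q(1)])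
    qed
  qed
  ultimately have "is_tensor B C M N (?T, \<tau>)"
    using t(1) tin r(2) unfolding is_tensor_def by (simp del: ex_simps all_simps)
  then show ?thesis by blast
qed

definition tensor_module ::
  "('k::field, 'b) module \<Rightarrow> ('k, 'c) module \<Rightarrow> ('k, 'b) rmodule \<Rightarrow> ('b, 'c, 'n) bimodule \<Rightarrow>
   ('k, 'c) rmodule" where
  "tensor_module B C M N = fst (tensor B C M N)"

definition tensor_elt ::
  "('k::field, 'b) module \<Rightarrow> ('k, 'c) module \<Rightarrow> ('k, 'b) rmodule \<Rightarrow> ('b, 'c, 'n) bimodule \<Rightarrow>
   'k vec \<Rightarrow> 'n \<Rightarrow> 'k vec" where
  "tensor_elt B C M N = snd (tensor B C M N)"

text \<open>The map \<open>f \<otimes> 1\<close>; it is unique on \<open>M \<otimes>\<^sub>B N\<close>.\<close>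

definition tensor_map ::
  "('k::field, 'b) module \<Rightarrow> ('k, 'c) module \<Rightarrow> ('k, 'b) rmodule \<Rightarrow> ('k, 'b) rmodule \<Rightarrow>
   ('b, 'c, 'n) bimodule \<Rightarrow> ('k vec \<Rightarrow> 'k vec) \<Rightarrow> 'k vec \<Rightarrow> 'k vec" where
  "tensor_map B C M M' N f =
     (SOME \<phi>. linear_on (space (tensor_module B C M N)) \<phi> \<and>
        (\<forall>x\<in>space M. \<forall>n\<in>bspace N. \<phi> (tensor_elt B C M N x n) = tensor_elt B C M' N (f x) n))"

text \<open>
  The functor \<open>- \<otimes>\<^sub>B N\<close> on complexes and on morphisms of derived categories. Below it is used
  only for bimodules \<open>N\<close> that are free of finite rank as left \<open>B\<close>-modules. For these it is
  exact, so that \<open>N\<close> is its own flat resolution, \<open>X \<otimes>\<^sup>L\<^sub>B N\<close> is the complex \<open>X \<otimes>\<^sub>B N\<close>, and \<open>u \<otimes>\<^sup>L\<^sub>B N\<close> is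
  obtained by applying \<open>- \<otimes>\<^sub>B N\<close> to the chain maps that occur in \<open>u\<close>.
\<close>

definition tensor_cpx ::
  "('k::field, 'b) module \<Rightarrow> ('k, 'c) module \<Rightarrow> ('b, 'c, 'n) bimodule \<Rightarrow> ('k, 'b) cpx \<Rightarrow>
   ('k, 'c) cpx" where
  "tensor_cpx B C N X =
     \<lparr>obj = (\<lambda>i. tensor_module B C (obj X i) N),
      diff = (\<lambda>i. tensor_map B C (obj X i) (obj X (i + 1)) N (diff X i))\<rparr>"

definition tensor_cmap ::
  "('k::field, 'b) module \<Rightarrow> ('k, 'c) module \<Rightarrow> ('b, 'c, 'n) bimodule \<Rightarrow> ('k, 'b) cpx \<Rightarrow>
   'k cmap \<Rightarrow> ('k, 'b) cpx \<Rightarrow> 'k cmap" where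
  "tensor_cmap B C N X f Y = (\<lambda>i. tensor_map B C (obj X i) (obj Y i) N (f i))"

primrec tensor_zigzag ::
  "('k::field, 'b) module \<Rightarrow> ('k, 'c) module \<Rightarrow> ('b, 'c, 'n) bimodule \<Rightarrow> ('k, 'b) zigzag \<Rightarrow>
   ('k, 'c) zigzag" where
  "tensor_zigzag B C N (Arr X f Y) =
     Arr (tensor_cpx B C N X) (tensor_cmap B C N X f Y) (tensor_cpx B C N Y)"
| "tensor_zigzag B C N (Inv X s Y) =
     Inv (tensor_cpx B C N X) (tensor_cmap B C N X s Y) (tensor_cpx B C N Y)"
| "tensor_zigzag B C N (Comp v u) = Comp (tensor_zigzag B C N v) (tensor_zigzag B C N u)"


section \<open>Invariant objects\<close>

text \<open>The bimodule \<open>B\<^sub>h\<close>.\<close>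

definition twist_bimodule ::
  "('k, 'b) module \<Rightarrow> ('h \<Rightarrow> 'b \<Rightarrow> 'b) \<Rightarrow> 'h \<Rightarrow> ('b, 'b, 'b) bimodule" where
  "twist_bimodule B act h =
     \<lparr>bspace = carrier B, badd = ring.add B, blact = monoid.mult B, bract = (\<lambda>x b. x \<otimes>\<^bsub>B\<^esub> act h b)\<rparr>"

lemma twist_tensor_exists:
  fixes B :: "('k::field, 'b) module"
  assumes "right_module B M" "H_algebra H B act" "h \<in> carrier H"
  shows "\<exists>p. is_tensor B B M (twist_bimodule B act h) p"
proof -
  have fd: "fd_algebra B" and hom: "act h \<in> ring_hom B B"
    and sc: "\<And>k x. x \<in> carrier B \<Longrightarrow> act h (k \<odot>\<^bsub>B\<^esub> x) = k \<odot>\<^bsub>B\<^esub> act h x"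
    using assms by (auto simp: H_algebra_def)
  interpret B: ring B using fd by (simp add: fd_algebra_def)
  interpret mB: module "ring_of_type_algebra :: 'k ring" B using fd by (simp add: fd_algebra_def)
  have scB: "k \<odot>\<^bsub>B\<^esub> b \<in> carrier B" if "b \<in> carrier B" for k b
    using mB.smult_closed[of k b] that by (simp add: ring_of_type_algebra_def)
  have k: "(k \<odot>\<^bsub>B\<^esub> x) \<otimes>\<^bsub>B\<^esub> y = k \<odot>\<^bsub>B\<^esub> (x \<otimes>\<^bsub>B\<^esub> y)" "x \<otimes>\<^bsub>B\<^esub> (k \<odot>\<^bsub>B\<^esub> y) = k \<odot>\<^bsub>B\<^esub> (x \<otimes>\<^bsub>B\<^esub> y)"
    if "x \<in> carrier B" "y \<in> carrier B" for x y k
    using fd that by (auto simp: fd_algebra_def)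
  have g: "left_gen (carrier B) (twist_bimodule B act h) {\<one>\<^bsub>B\<^esub>} = carrier B" (is "?G = _")
  proof
    show "?G \<subseteq> carrier B"
    proof
      fix x assume "x \<in> ?G" then show "x \<in> carrier B"
        by induction (auto simp: twist_bimodule_def)
    qed
    show "carrier B \<subseteq> ?G"
    proof
      fix x assume x: "x \<in> carrier B"
      then have "blact (twist_bimodule B act h) x \<one>\<^bsub>B\<^esub> \<in> ?G" by (intro left_gen.intros) auto
      then show "x \<in> ?G" using x by (simp add: twist_bimodule_def)
    qed
  qed
  note hh = ring_hom_closed[OF hom] ring_hom_mult[OF hom] ring_hom_add[OF hom] ring_hom_one[OF hom]
  show ?thesis
    by (rule tensor_exists[OF assms(1), where F="{\<one>\<^bsub>B\<^esub>}"])
      (insert fd g, auto simp: twist_bimodule_def hh sc k scB B.l_distr B.r_distr B.m_assoc)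
qed

abbreviation twist ::
  "('k::field, 'b) module \<Rightarrow> ('h \<Rightarrow> 'b \<Rightarrow> 'b) \<Rightarrow> 'h \<Rightarrow> ('k, 'b) cpx \<Rightarrow> ('k, 'b) cpx" where
  "twist B act h \<equiv> tensor_cpx B B (twist_bimodule B act h)"

abbreviation twist_mor ::
  "('k::field, 'b) module \<Rightarrow> ('h \<Rightarrow> 'b \<Rightarrow> 'b) \<Rightarrow> 'h \<Rightarrow> ('k, 'b) zigzag \<Rightarrow> ('k, 'b) zigzag" where
  "twist_mor B act h \<equiv> tensor_zigzag B B (twist_bimodule B act h)"

text \<open>
  The canonical isomorphism from \<open>(X\<^sup>h)\<^sup>h\<^sup>'\<close> to \<open>X\<^sup>h\<^sup>h\<^sup>'\<close>, induced by the bimodule isomorphism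
  \<open>b \<otimes> b' \<mapsto> b h(b')\<close> from \<open>B\<^sub>h \<otimes>\<^sub>B B\<^sub>h\<^sub>'\<close> to \<open>B\<^sub>h\<^sub>h\<^sub>'\<close>.
\<close>

definition twist_twist_map ::
  "'h monoid \<Rightarrow> ('k::field, 'b) module \<Rightarrow> ('h \<Rightarrow> 'b \<Rightarrow> 'b) \<Rightarrow> 'h \<Rightarrow> 'h \<Rightarrow> ('k, 'b) cpx \<Rightarrow> 'k cmap" where
  "twist_twist_map H B act h h' X = (\<lambda>i.
     let M = obj X i; N = twist_bimodule B act h; N' = twist_bimodule B act h';
         MN = tensor_module B B M N
     in SOME \<phi>. linear_on (space (tensor_module B B MN N')) \<phi> \<and>
          (\<forall>x\<in>space M. \<forall>b\<in>carrier B. \<forall>b'\<in>carrier B.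
             \<phi> (tensor_elt B B MN N' (tensor_elt B B M N x b) b') =
             tensor_elt B B M (twist_bimodule B act (h \<otimes>\<^bsub>H\<^esub> h')) x (b \<otimes>\<^bsub>B\<^esub> act h b')))"

definition twist_twist ::
  "'h monoid \<Rightarrow> ('k::field, 'b) module \<Rightarrow> ('h \<Rightarrow> 'b \<Rightarrow> 'b) \<Rightarrow> 'h \<Rightarrow> 'h \<Rightarrow> ('k, 'b) cpx \<Rightarrow>
   ('k, 'b) zigzag" where
  "twist_twist H B act h h' X =
     Arr (twist B act h' (twist B act h X)) (twist_twist_map H B act h h' X)
         (twist B act (h \<otimes>\<^bsub>H\<^esub> h') X)"

text \<open>
  The condition \<open>\<iota>\<^sub>h\<^sub>h\<^sub>' = \<iota>\<^sub>h \<circ> (\<iota>\<^sub>h\<^sub>')\<close> twisted by the inverse of \<open>h\<close>, with the canonical identification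
  of its two sources written out.
\<close>

definition H_invariant ::
  "'h monoid \<Rightarrow> ('k::field, 'b) module \<Rightarrow> ('h \<Rightarrow> 'b \<Rightarrow> 'b) \<Rightarrow> ('k, 'b) cpx \<Rightarrow> bool" where
  "H_invariant H B act X \<longleftrightarrow>
     (\<exists>\<iota>. (\<forall>h\<in>carrier H. diso B (twist B act (inv\<^bsub>H\<^esub> h) X) X (\<iota> h)) \<and>
          (\<forall>h\<in>carrier H. \<forall>h'\<in>carrier H.
             dequiv B (Comp (\<iota> (h \<otimes>\<^bsub>H\<^esub> h')) (twist_twist H B act (inv\<^bsub>H\<^esub> h') (inv\<^bsub>H\<^esub> h) X))
                      (Comp (\<iota> h) (twist_mor B act (inv\<^bsub>H\<^esub> h) (\<iota> h')))))"

definition invariant_tilting ::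
  "'h monoid \<Rightarrow> ('k::field, 'b) module \<Rightarrow> ('h \<Rightarrow> 'b \<Rightarrow> 'b) \<Rightarrow> ('k, 'b) cpx \<Rightarrow> bool" where
  "invariant_tilting H B act T \<longleftrightarrow> tilting B T \<and> H_invariant H B act T"

definition tilting_subcategories ::
  "'h monoid \<Rightarrow> ('k::field, 'b) module \<Rightarrow> ('h \<Rightarrow> 'b \<Rightarrow> 'b) \<Rightarrow> ('k, 'b) cpx set set" where
  "tilting_subcategories H B act = {add_cat B T | T. invariant_tilting H B act T}"


section \<open>Induction and restriction\<close>

text \<open>\<open>\<Lambda>G\<close> as a \<open>\<Lambda>\<close>-\<open>\<Lambda>G\<close>-bimodule, along \<open>l \<mapsto> l \<otimes> 1\<close>.\<close>

definition skew_bimodule ::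
  "'g monoid \<Rightarrow> ('k, 'a) module \<Rightarrow> ('g \<Rightarrow> 'a \<Rightarrow> 'a) \<Rightarrow> ('a, 'g \<Rightarrow> 'a, 'g \<Rightarrow> 'a) bimodule" where
  "skew_bimodule G A act =
     \<lparr>bspace = carrier (skew_group_algebra G A act),
      badd = ring.add (skew_group_algebra G A act),
      blact = (\<lambda>l n. skew_pure G A l \<one>\<^bsub>G\<^esub> \<otimes>\<^bsub>skew_group_algebra G A act\<^esub> n),
      bract = monoid.mult (skew_group_algebra G A act)\<rparr>"

definition skew_induction ::
  "'g monoid \<Rightarrow> ('k::field, 'a) module \<Rightarrow> ('g \<Rightarrow> 'a \<Rightarrow> 'a) \<Rightarrow> ('k, 'a) cpx \<Rightarrow>
   ('k, 'g \<Rightarrow> 'a) cpx" where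
  "skew_induction G A act = tensor_cpx A (skew_group_algebra G A act) (skew_bimodule G A act)"

definition skew_restriction ::
  "'g monoid \<Rightarrow> ('k, 'a) module \<Rightarrow> ('k, 'g \<Rightarrow> 'a) cpx \<Rightarrow> ('k, 'a) cpx" where
  "skew_restriction G A U =
     \<lparr>obj = (\<lambda>i. \<lparr>space = space (obj U i),
                  ract = (\<lambda>x l. ract (obj U i) x (skew_pure G A l \<one>\<^bsub>G\<^esub>))\<rparr>),
      diff = diff U\<rparr>"

end

theory Submission
  imports Defs
begin

text \<open>
  Write \<open>F\<close> for induction and \<open>R\<close> for restriction. As complexes of modules, \<open>R (F X)\<close> is the direct sum
  of the twists of \<open>X\<close> by the elements of \<open>G\<close>, and \<open>F (R Y)\<close> is the direct sum of the twists of \<open>Y\<close> by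
  the characters of \<open>G\<close> (orthogonality of characters). Hence every object is a natural direct summand
  of its image under \<open>R F\<close> or \<open>F R\<close>, so that \<open>F\<close> and \<open>R\<close> detect the vanishing of morphisms and their
  images generate. On an invariant object all twists are isomorphic to the object itself, so \<open>R F T\<close>
  is a power of \<open>T\<close>; this transfers the tilting property and shows that the two maps are mutually inverse.
  The invariance of \<open>F T\<close> and \<open>R U\<close> holds on the level of complexes.
\<close>

section \<open>Complexes and quasi-isomorphisms\<close>

text \<open>Morphisms of the derived category are given as zigzags modulo a generated congruence,
  without a calculus of fractions or an addition of morphisms. Every statement about all morphisms
  therefore passes through an induction over zigzags, whose critical case is a formal inverse. What
  additivity would give, that a morphism out of X \<oplus> Y vanishes if it vanishes on X and on Y,
  comes instead from naturality of the codiagonal and of the diagonal. The tensor products are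
  chosen by \<open>SOME\<close> from their universal property, so their elements are opaque;
  coordinates in copies of the original module make them accessible, and exactness and the
  compatibility with sums, shifts and cones are checked once in coordinates for induction,
  restriction and twists alike. The composite F R is computed directly by a Fourier transform over
  the characters, not through an iterated skew group algebra. Invertibility of |G| in k enters
  through the independence of the characters and the inverse transform, the number of characters
  through their completeness.\<close>

declare zero_fun_apply [simp del] plus_fun_apply [simp del] minus_apply [simp del] uminus_apply [simp del]

text \<open>\<open>linear_on\<close> prescribes values on V only, so the rules for negatives,
  differences and sums are derived inside a subspace V; a negative is the multiple by -1.\<close>

lemma linear_on_subspace:
  assumes "linear_on V f" "vs.subspace V"
  shows "f 0 = 0"
    and "x \<in> V \<Longrightarrow> f (- x) = - f x"
    and "x \<in> V \<Longrightarrow> y \<in> V \<Longrightarrow> f (x - y) = f x - f y"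
    and "(\<And>j. j \<in> J \<Longrightarrow> g j \<in> V) \<Longrightarrow> f (sum g J) = (\<Sum>j\<in>J. f (g j))"
proof -
  show zero: "f 0 = 0" by (rule linear_on_zero[OF assms(1) vs.subspace_0[OF assms(2)]])
  show neg: "f (- x) = - f x" if "x \<in> V" for x
    using linear_onD(2)[OF assms(1) that, of "-1"] by simp
  show "f (x - y) = f x - f y" if "x \<in> V" "y \<in> V"
    using linear_onD(1)[OF assms(1) that(1), of "- y"] neg[OF that(2)] vs.subspace_neg[OF assms(2) that(2)]
    by simp
  show "f (sum g J) = (\<Sum>j\<in>J. f (g j))" if "\<And>j. j \<in> J \<Longrightarrow> g j \<in> V"
    using that
  proof (induction J rule: infinite_finite_induct)
    case (insert j J)
    then show ?case
      using linear_onD(1)[OF assms(1), of "g j" "sum g J"] vs.subspace_sum[OF assms(2), of J g] by simp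
  qed (simp_all add: zero)
qed

lemma linear_on_subspace_image:
  assumes "linear_on V f" "vs.subspace V"
  shows "vs.subspace (f ` V)"
  unfolding vs.subspace_def
proof (intro conjI allI ballI)
  show "0 \<in> f ` V"
    using linear_on_subspace(1)[OF assms] vs.subspace_0[OF assms(2)] by (metis image_eqI)
  fix x y assume "x \<in> f ` V" "y \<in> f ` V"
  then show "x + y \<in> f ` V"
    using linear_onD(1)[OF assms(1)] vs.subspace_add[OF assms(2)] by (auto simp: image_iff) metis
next
  fix c x assume "x \<in> f ` V"
  then show "vscale c x \<in> f ` V"
    using linear_onD(2)[OF assms(1)] vs.subspace_scale[OF assms(2)] by (auto simp: image_iff) metis
qed

lemma right_module_subspace: "right_module A M \<Longrightarrow> vs.subspace (space M)"
  by (auto simp: right_module_def)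

lemma right_moduleD:
  assumes "right_module A M"
  shows "x \<in> space M \<Longrightarrow> a \<in> carrier A \<Longrightarrow> ract M x a \<in> space M"
    and "a \<in> carrier A \<Longrightarrow> linear_on (space M) (\<lambda>x. ract M x a)"
    and "x \<in> space M \<Longrightarrow> a \<in> carrier A \<Longrightarrow> b \<in> carrier A \<Longrightarrow>
      ract M x (a \<oplus>\<^bsub>A\<^esub> b) = ract M x a + ract M x b"
    and "x \<in> space M \<Longrightarrow> a \<in> carrier A \<Longrightarrow> b \<in> carrier A \<Longrightarrow>
      ract M x (a \<otimes>\<^bsub>A\<^esub> b) = ract M (ract M x a) b"
    and "x \<in> space M \<Longrightarrow> a \<in> carrier A \<Longrightarrow> ract M x (c \<odot>\<^bsub>A\<^esub> a) = vscale c (ract M x a)"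
    and "x \<in> space M \<Longrightarrow> ract M x \<one>\<^bsub>A\<^esub> = x"
  using assms by (auto simp: right_module_def)

lemma rmodule_homD:
  assumes "rmodule_hom A M N f"
  shows "linear_on (space M) f"
    and "x \<in> space M \<Longrightarrow> f x \<in> space N"
    and "x \<in> space M \<Longrightarrow> a \<in> carrier A \<Longrightarrow> f (ract M x a) = ract N (f x) a"
  using assms by (auto simp: rmodule_hom_def)

lemma rmodule_hom_comp:
  assumes "rmodule_hom A M N f" "rmodule_hom A N P g"
  shows "rmodule_hom A M P (\<lambda>x. g (f x))"
  using assms unfolding rmodule_hom_def linear_on_def by (simp add: image_subset_iff)

lemma bounded_complexD:
  assumes "bounded_complex A X"
  shows "right_module A (obj X i)"
    and "rmodule_hom A (obj X i) (obj X (i + 1)) (diff X i)"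
    and "x \<in> space (obj X i) \<Longrightarrow> diff X (i + 1) (diff X i x) = 0"
    and "vs.subspace (space (obj X i))"
    and "linear_on (space (obj X i)) (diff X i)"
    and "x \<in> space (obj X i) \<Longrightarrow> diff X i x \<in> space (obj X (i + 1))"
    and "diff X i 0 = 0"
  using assms right_module_subspace[of A "obj X i"]
    linear_on_zero[of "space (obj X i)" "diff X i"] vs.subspace_0[of "space (obj X i)"]
  by (auto simp: bounded_complex_def rmodule_hom_def)

lemma chain_mapD:
  assumes "chain_map A X Y f"
  shows "bounded_complex A X" "bounded_complex A Y"
    and "rmodule_hom A (obj X i) (obj Y i) (f i)"
    and "x \<in> space (obj X i) \<Longrightarrow> f (i + 1) (diff X i x) = diff Y i (f i x)"
    and "linear_on (space (obj X i)) (f i)"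
    and "x \<in> space (obj X i) \<Longrightarrow> f i x \<in> space (obj Y i)"
    and "f i 0 = 0"
proof -
  show X: "bounded_complex A X" and "bounded_complex A Y"
    and h: "rmodule_hom A (obj X i) (obj Y i) (f i)"
    and "x \<in> space (obj X i) \<Longrightarrow> f (i + 1) (diff X i x) = diff Y i (f i x)"
    using assms by (auto simp: chain_map_def)
  show l: "linear_on (space (obj X i)) (f i)"
    and "x \<in> space (obj X i) \<Longrightarrow> f i x \<in> space (obj Y i)"
    using rmodule_homD[OF h] by auto
  show "f i 0 = 0"
    by (rule linear_on_subspace(1)[OF l bounded_complexD(4)[OF X]])
qed

lemma subspace_cycles: "bounded_complex A X \<Longrightarrow> vs.subspace (cycles X i)"
  using bounded_complexD(4,5,7)[of A X i] linear_onD[of "space (obj X i)" "diff X i"]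
  by (auto simp: vs.subspace_def cycles_def)

lemma subspace_boundaries: "bounded_complex A X \<Longrightarrow> vs.subspace (boundaries X i)"
  unfolding boundaries_def by (intro linear_on_subspace_image) (auto dest: bounded_complexD)

lemma chain_map_cycles:
  "chain_map A X Y f \<Longrightarrow> x \<in> cycles X i \<Longrightarrow> f i x \<in> cycles Y i"
  using chain_mapD(4,6)[of A X Y f x i] chain_mapD(7)[of A X Y f "i + 1"] by (auto simp: cycles_def)

lemma chain_map_boundaries:
  assumes "chain_map A X Y f" "x \<in> boundaries X i"
  shows "f i x \<in> boundaries Y i"
proof -
  obtain w where "w \<in> space (obj X (i - 1))" "x = diff X (i - 1) w"
    using assms(2) by (auto simp: boundaries_def)
  with chain_mapD(4,6)[OF assms(1), of w "i - 1"] show ?thesis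
    by (auto simp: boundaries_def)
qed

lemma chain_mapI:
  assumes "bounded_complex A X" "bounded_complex A Y"
    and "\<And>i. rmodule_hom A (obj X i) (obj Y i) (f i)"
    and "\<And>i x. x \<in> space (obj X i) \<Longrightarrow> f (i + 1) (diff X i x) = diff Y i (f i x)"
  shows "chain_map A X Y f"
  using assms by (simp add: chain_map_def)

lemma chain_map_comp:
  assumes f: "chain_map A X Y f" and g: "chain_map A Y Z g"
  shows "chain_map A X Z (\<lambda>i x. g i (f i x))"
proof (rule chain_mapI[OF chain_mapD(1)[OF f] chain_mapD(2)[OF g]])
  show "rmodule_hom A (obj X i) (obj Z i) (\<lambda>x. g i (f i x))" for i
    by (rule rmodule_hom_comp[OF chain_mapD(3)[OF f] chain_mapD(3)[OF g]])
  show "g (i + 1) (f (i + 1) (diff X i x)) = diff Z i (g i (f i x))" if "x \<in> space (obj X i)" for i x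
    using chain_mapD(4,6)[OF f that] chain_mapD(4)[OF g] by simp
qed

lemma chain_map_id: "bounded_complex A X \<Longrightarrow> chain_map A X X (\<lambda>i x. x)"
  by (auto simp: chain_map_def rmodule_hom_def linear_on_def)

lemma chain_map_zero:
  assumes "bounded_complex A X" "bounded_complex A Y"
  shows "chain_map A X Y (\<lambda>i x. 0)"
proof -
  have "ract (obj Y i) 0 a = 0" if "a \<in> carrier A" for i a
    by (rule linear_on_subspace(1)[OF right_moduleD(2)[OF bounded_complexD(1)[OF assms(2)] that]
          bounded_complexD(4)[OF assms(2)]])
  then show ?thesis
    using assms bounded_complexD(4)[OF assms(2)] bounded_complexD(7)[OF assms(2)]
    by (auto simp: chain_map_def rmodule_hom_def linear_on_def vs.subspace_0)
qed

text \<open>Cohomology is a set of cosets, so the bijection is unpacked into elements: the induced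
  map is additive, hence injective iff its kernel is trivial, and it is surjective iff every cycle
  of Y comes from a cycle of X up to a boundary. Later proofs that a map is a quasi-isomorphism rest
  on this form.\<close>

theorem quasi_iso_iff:
  fixes X :: "('k::field, 'a) cpx"
  shows "quasi_iso A X Y s \<longleftrightarrow> chain_map A X Y s \<and>
     (\<forall>i. \<forall>x\<in>cycles X i. s i x \<in> boundaries Y i \<longrightarrow> x \<in> boundaries X i) \<and>
     (\<forall>i. \<forall>y\<in>cycles Y i. \<exists>x\<in>cycles X i. y - s i x \<in> boundaries Y i)"
proof (cases "chain_map A X Y s")
  case False
  then show ?thesis by (simp add: quasi_iso_def)
next
  case True
  note X = chain_mapD(1)[OF True] and Y = chain_mapD(2)[OF True]
  \<comment> \<open>\<open>cl Z i x\<close> is the cohomology class of the cycle x, as a set of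
    cycles.\<close>
  define cl where "cl = (\<lambda>(Z :: ('k, 'a) cpx) i x. {y \<in> cycles Z i. y - x \<in> boundaries Z i})"
  have coh: "cohomology Z i = cl Z i ` cycles Z i" for Z :: "('k, 'a) cpx" and i
    by (auto simp: cohomology_def quotient_def cl_def)
  have cl_eq: "cl Z i x = cl Z i x' \<longleftrightarrow> x - x' \<in> boundaries Z i"
    if Z: "bounded_complex A Z" and x: "x \<in> cycles Z i" "x' \<in> cycles Z i"
    for Z :: "('k, 'a) cpx" and i x x'
  proof
    note B = subspace_boundaries[OF Z, of i]
    { assume "cl Z i x = cl Z i x'"
      moreover have "x \<in> cl Z i x" using x vs.subspace_0[OF B] by (simp add: cl_def)
      ultimately show "x - x' \<in> boundaries Z i" by (auto simp: cl_def) }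
    assume d: "x - x' \<in> boundaries Z i"
    have "y - x \<in> boundaries Z i \<longleftrightarrow> y - x' \<in> boundaries Z i" for y
      using vs.subspace_add[OF B _ d, of "y - x"] vs.subspace_diff[OF B _ d, of "y - x'"] by auto
    then show "cl Z i x = cl Z i x'" by (auto simp: cl_def)
  qed
  have lin: "s i (x - x') = s i x - s i x'" if "x \<in> cycles X i" "x' \<in> cycles X i" for x x' i
    using linear_on_subspace(3)[OF chain_mapD(5)[OF True] bounded_complexD(4)[OF X]] that
    by (auto simp: cycles_def)
  have map: "cohomology_map Y s i (cl X i x) = cl Y i (s i x)" if x: "x \<in> cycles X i" for x i
  proof -
    note B = subspace_boundaries[OF Y, of i]
    have "(\<exists>w\<in>cl X i x. y - s i w \<in> boundaries Y i) \<longleftrightarrow> y - s i x \<in> boundaries Y i" for y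
    proof
      assume "\<exists>w\<in>cl X i x. y - s i w \<in> boundaries Y i"
      then obtain w where w: "w \<in> cycles X i" "w - x \<in> boundaries X i" "y - s i w \<in> boundaries Y i"
        by (auto simp: cl_def)
      show "y - s i x \<in> boundaries Y i"
        using vs.subspace_add[OF B w(3) chain_map_boundaries[OF True w(2)]] lin[OF w(1) x] by simp
    next
      assume "y - s i x \<in> boundaries Y i"
      moreover have "x \<in> cl X i x"
        using x vs.subspace_0[OF subspace_boundaries[OF X]] by (simp add: cl_def)
      ultimately show "\<exists>w\<in>cl X i x. y - s i w \<in> boundaries Y i" by blast
    qed
    then show ?thesis by (auto simp: cohomology_map_def cl_def)
  qed
  have "bij_betw (cohomology_map Y s i) (cohomology X i) (cohomology Y i) \<longleftrightarrow>
      (\<forall>x\<in>cycles X i. s i x \<in> boundaries Y i \<longrightarrow> x \<in> boundaries X i) \<and>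
      (\<forall>y\<in>cycles Y i. \<exists>x\<in>cycles X i. y - s i x \<in> boundaries Y i)" for i
  proof -
    have "inj_on (cohomology_map Y s i) (cohomology X i) \<longleftrightarrow>
        (\<forall>x\<in>cycles X i. \<forall>x'\<in>cycles X i. s i (x - x') \<in> boundaries Y i \<longrightarrow> x - x' \<in> boundaries X i)"
      using cl_eq[OF X] cl_eq[OF Y] chain_map_cycles[OF True]
      by (auto simp: inj_on_def coh map lin)
    \<comment> \<open>Differences of cycles are cycles, and conversely every cycle is its own
      difference with 0.\<close>
    also have "\<dots> \<longleftrightarrow> (\<forall>x\<in>cycles X i. s i x \<in> boundaries Y i \<longrightarrow> x \<in> boundaries X i)"
      using vs.subspace_diff[OF subspace_cycles[OF X]] vs.subspace_0[OF subspace_cycles[OF X, of i]]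
      by (metis diff_zero)
    finally have inj: "inj_on (cohomology_map Y s i) (cohomology X i) \<longleftrightarrow> \<dots>" .
    have "cohomology_map Y s i ` cohomology X i = cohomology Y i \<longleftrightarrow>
        cl Y i ` cycles Y i \<subseteq> (\<lambda>x. cl Y i (s i x)) ` cycles X i"
      using chain_map_cycles[OF True] by (auto simp: coh map image_image)
    also have "\<dots> \<longleftrightarrow> (\<forall>y\<in>cycles Y i. \<exists>x\<in>cycles X i. y - s i x \<in> boundaries Y i)"
      using cl_eq[OF Y] chain_map_cycles[OF True] by (fastforce simp: image_subset_iff image_iff)
    finally show ?thesis using inj by (simp add: bij_betw_def)
  qed
  then show ?thesis by (auto simp: quasi_iso_def True)
qed

lemma quasi_isoD:
  assumes "quasi_iso A X Y s"
  shows "chain_map A X Y s"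
    and "x \<in> cycles X i \<Longrightarrow> s i x \<in> boundaries Y i \<Longrightarrow> x \<in> boundaries X i"
    and "y \<in> cycles Y i \<Longrightarrow> \<exists>x\<in>cycles X i. y - s i x \<in> boundaries Y i"
  using assms by (auto simp: quasi_iso_iff)

text \<open>No inverse chain map is constructed: cycles and boundaries of Y are pulled back element
  by element along the bijections. The formal inverse of f then makes it an isomorphism of the
  derived category, which is how most explicit isomorphisms below arise.\<close>

lemma bij_chain_map_quasi_iso:
  assumes f: "chain_map A X Y f"
    and bij: "\<And>i. bij_betw (f i) (space (obj X i)) (space (obj Y i))"
  shows "quasi_iso A X Y f"
  unfolding quasi_iso_iff
proof (intro conjI allI ballI impI f)
  note X = chain_mapD(1)[OF f] and Y = chain_mapD(2)[OF f]
  have sur: "\<exists>x\<in>space (obj X i). y = f i x" if "y \<in> space (obj Y i)" for y i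
    using bij[of i] that by (auto simp: bij_betw_def)
  have inj: "x = x'" if "f i x = f i x'" "x \<in> space (obj X i)" "x' \<in> space (obj X i)" for x x' i
    using bij[of i] that by (auto simp: bij_betw_def dest: inj_onD)
  {
    fix i x assume x: "x \<in> cycles X i" "f i x \<in> boundaries Y i"
    then obtain w where w: "w \<in> space (obj Y (i - 1))" "f i x = diff Y (i - 1) w"
      by (auto simp: boundaries_def)
    then obtain v where v: "v \<in> space (obj X (i - 1))" "w = f (i - 1) v" using sur by blast
    have "f i (diff X (i - 1) v) = f i x" using chain_mapD(4)[OF f v(1)] w(2) v(2) by simp
    moreover have "diff X (i - 1) v \<in> space (obj X i)" using bounded_complexD(6)[OF X v(1)] by simp
    moreover have "x \<in> space (obj X i)" using x by (simp add: cycles_def)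
    ultimately have "diff X (i - 1) v = x" by (rule inj)
    then show "x \<in> boundaries X i" using v by (auto simp: boundaries_def)
  next
    fix i y assume y: "y \<in> cycles Y i"
    then have "y \<in> space (obj Y i)" by (simp add: cycles_def)
    then obtain x where x: "x \<in> space (obj X i)" "y = f i x" using sur by blast
    have "diff Y i (f i x) = 0" using y x(2) by (simp add: cycles_def)
    then have "f (i + 1) (diff X i x) = f (i + 1) 0"
      by (simp only: chain_mapD(4)[OF f x(1)] chain_mapD(7)[OF f])
    then have "diff X i x = 0"
      by (rule inj) (use bounded_complexD(6)[OF X x(1)] vs.subspace_0[OF bounded_complexD(4)[OF X]] in simp_all)
    then have "x \<in> cycles X i" using x(1) by (simp add: cycles_def)
    moreover have "y - f i x \<in> boundaries Y i"
      using x(2) vs.subspace_0[OF subspace_boundaries[OF Y]] by simp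
    ultimately show "\<exists>x\<in>cycles X i. y - f i x \<in> boundaries Y i" by blast
  }
qed

section \<open>Direct sums and shifts\<close>

lemma vpair_vfst_vsnd [simp]: "vpair (vfst z) (vsnd z) = z"
  by (auto simp: vpair_def vfst_def vsnd_def fun_eq_iff)

lemma vpair_eq_iff [simp]: "vpair x y = vpair x' y' \<longleftrightarrow> x = x' \<and> y = y'"
  by (metis vpair_simps)

lemma vfst_zero [simp]: "vfst 0 = 0" and vsnd_zero [simp]: "vsnd 0 = 0" and vpair_zero [simp]: "vpair 0 0 = 0"
  by (auto simp: vpair_def vfst_def vsnd_def fun_eq_iff zero_fun_apply)

lemma vpair_minus: "vpair (- x) (- y) = - vpair x y" "vpair (x - x') (y - y') = vpair x y - vpair x' y'"
  and vfst_minus: "vfst (- x) = - vfst x" "vfst (x - x') = vfst x - vfst x'"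
  and vsnd_minus: "vsnd (- x) = - vsnd x" "vsnd (x - x') = vsnd x - vsnd x'"
  by (auto simp: vpair_def vfst_def vsnd_def fun_eq_iff minus_apply uminus_apply)

lemma vfst_vsnd_zero_iff: "vfst z = 0 \<and> vsnd z = 0 \<longleftrightarrow> z = 0"
  by (metis vpair_vfst_vsnd vpair_zero vfst_zero vsnd_zero)

text \<open>Every sequence is the interleaving of its two halves, so membership in a direct sum can
  be tested on the halves instead of through the existential in the definition.\<close>

lemma dsum_module_simps [simp]:
  "z \<in> space (dsum_module M N) \<longleftrightarrow> vfst z \<in> space M \<and> vsnd z \<in> space N"
  "ract (dsum_module M N) z a = vpair (ract M (vfst z) a) (ract N (vsnd z) a)"
  by (auto simp: dsum_module_def) (metis vpair_vfst_vsnd)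

lemma dsum_simps [simp]:
  "obj (dsum X Y) i = dsum_module (obj X i) (obj Y i)"
  "diff (dsum X Y) i z = vpair (diff X i (vfst z)) (diff Y i (vsnd z))"
  by (auto simp: dsum_def)

lemma cone_simps [simp]:
  "obj (cone X f Y) i = dsum_module (obj X (i + 1)) (obj Y i)"
  "diff (cone X f Y) i z = vpair (- diff X (i + 1) (vfst z)) (f (i + 1) (vfst z) + diff Y i (vsnd z))"
  by (auto simp: cone_def)

lemma shift_simps [simp]:
  "obj (shift n X) i = obj X (i + n)"
  "diff (shift n X) i x = (if even n then diff X (i + n) x else - diff X (i + n) x)"
  by (auto simp: shift_def)

lemma zero_cpx_simps [simp]:
  "space (obj zero_cpx i) = {0}" "ract (obj zero_cpx i) x a = 0" "diff zero_cpx i x = 0"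
  by (auto simp: zero_cpx_def zero_module_def)

text \<open>The two inclusions are linear, so the spanning sets of the summands, moved along them,
  together span the sum.\<close>

lemma right_module_dsum:
  fixes A :: "('k::field, 'a) module"
  assumes M: "right_module A M" and N: "right_module A N"
  shows "right_module A (dsum_module M N)"
proof -
  obtain S T where S: "finite S" "space M = vs.span S" and T: "finite T" "space N = vs.span T"
    using M N by (auto simp: right_module_def)
  interpret L: Vector_Spaces.linear vscale vscale "\<lambda>x :: 'k vec. vpair x 0"
    by unfold_locales (auto simp: vpair_def vscale_def fun_eq_iff algebra_simps plus_fun_apply zero_fun_apply)
  interpret R: Vector_Spaces.linear vscale vscale "\<lambda>x :: 'k vec. vpair 0 x"
    by unfold_locales (auto simp: vpair_def vscale_def fun_eq_iff algebra_simps plus_fun_apply zero_fun_apply)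
  have "space (dsum_module M N) = vs.span ((\<lambda>x. vpair x 0) ` S \<union> (\<lambda>x. vpair 0 x) ` T)"
    unfolding vs.span_Un L.span_image R.span_image S(2)[symmetric] T(2)[symmetric]
  proof (intro equalityI subsetI)
    fix z assume z: "z \<in> space (dsum_module M N)"
    then have "z = vpair (vfst z) 0 + vpair 0 (vsnd z)" by (simp add: vpair_add[symmetric])
    then show "z \<in> {x + y |x y. x \<in> (\<lambda>x. vpair x 0) ` space M \<and> y \<in> vpair 0 ` space N}"
      using z by auto
  qed (auto simp: vpair_add[symmetric])
  moreover have "finite ((\<lambda>x. vpair x 0) ` S \<union> (\<lambda>x. vpair 0 x) ` T)" using S T by simp
  ultimately have *: "\<exists>S. finite S \<and> space (dsum_module M N) = vs.span S" by blast
  show ?thesis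
    unfolding right_module_def
    using * right_moduleD[OF M] right_moduleD[OF N]
    by (simp add: linear_on_def vfst_add vsnd_add vpair_add vpair_scale)
qed

lemma right_module_zero:
  fixes A :: "('k::field, 'a) module"
  shows "right_module A zero_module"
proof -
  have "finite {} \<and> space (zero_module :: ('k, 'a) rmodule) = vs.span {}" by (simp add: zero_module_def)
  then show ?thesis
    unfolding right_module_def by (auto simp: zero_module_def linear_on_def)
qed

lemma bounded_complexI:
  assumes "\<And>i. right_module A (obj X i)"
    and "\<And>i. rmodule_hom A (obj X i) (obj X (i + 1)) (diff X i)"
    and "\<And>i x. x \<in> space (obj X i) \<Longrightarrow> diff X (i + 1) (diff X i x) = 0"
    and "\<And>i. \<bar>i\<bar> > n \<Longrightarrow> space (obj X i) \<subseteq> {0}"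
  shows "bounded_complex A X"
proof -
  have "space (obj X i) = {0}" if "\<bar>i\<bar> > n" for i
    using assms(4)[OF that] vs.subspace_0[OF right_module_subspace[OF assms(1)[of i]]] by blast
  then show ?thesis unfolding bounded_complex_def using assms(1-3) by blast
qed

lemma bounded_complex_bound:
  assumes "bounded_complex A X"
  obtains n where "\<And>i. \<bar>i\<bar> > n \<Longrightarrow> space (obj X i) = {0}"
  using assms by (auto simp: bounded_complex_def)

lemma bounded_complex_zero: "bounded_complex A zero_cpx"
proof (rule bounded_complexI[where n = 0])
  show "right_module A (obj zero_cpx i)" for i using right_module_zero by (simp add: zero_cpx_def)
qed (auto simp: rmodule_hom_def linear_on_def)

lemma bounded_complex_dsum:
  assumes X: "bounded_complex A X" and Y: "bounded_complex A Y"
  shows "bounded_complex A (dsum X Y)"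
proof -
  obtain n m where n: "\<And>i. \<bar>i\<bar> > n \<Longrightarrow> space (obj X i) = {0}" and m: "\<And>i. \<bar>i\<bar> > m \<Longrightarrow> space (obj Y i) = {0}"
    using bounded_complex_bound[OF X] bounded_complex_bound[OF Y] by metis
  show ?thesis
  proof (rule bounded_complexI[where n = "max n m"])
    show "right_module A (obj (dsum X Y) i)" for i
      by (simp add: right_module_dsum bounded_complexD(1)[OF X] bounded_complexD(1)[OF Y])
    show "rmodule_hom A (obj (dsum X Y) i) (obj (dsum X Y) (i + 1)) (diff (dsum X Y) i)" for i
      using rmodule_homD[OF bounded_complexD(2)[OF X]] rmodule_homD[OF bounded_complexD(2)[OF Y]]
      by (auto simp: rmodule_hom_def linear_on_def vfst_add vsnd_add vpair_add vpair_scale)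
    show "diff (dsum X Y) (i + 1) (diff (dsum X Y) i x) = 0" if "x \<in> space (obj (dsum X Y) i)" for i x
      using that bounded_complexD(3)[OF X] bounded_complexD(3)[OF Y] by simp
    show "space (obj (dsum X Y) i) \<subseteq> {0}" if "\<bar>i\<bar> > max n m" for i
      using n[of i] m[of i] that by (simp add: subset_iff vfst_vsnd_zero_iff)
  qed
qed

lemma chain_map_dsum:
  assumes f: "chain_map A X X' f" and g: "chain_map A Y Y' g"
  shows "chain_map A (dsum X Y) (dsum X' Y') (\<lambda>i z. vpair (f i (vfst z)) (g i (vsnd z)))"
proof (rule chain_mapI)
  show "rmodule_hom A (obj (dsum X Y) i) (obj (dsum X' Y') i) (\<lambda>z. vpair (f i (vfst z)) (g i (vsnd z)))" for i
    using rmodule_homD[OF chain_mapD(3)[OF f]] rmodule_homD[OF chain_mapD(3)[OF g]]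
    by (auto simp: rmodule_hom_def linear_on_def vfst_add vsnd_add vpair_add vpair_scale)
qed (use chain_mapD(4)[OF f] chain_mapD(4)[OF g] in
      \<open>simp_all add: bounded_complex_dsum chain_mapD(1,2)[OF f] chain_mapD(1,2)[OF g]\<close>)

lemma chain_map_vpair:
  assumes f: "chain_map A Z X f" and g: "chain_map A Z Y g"
  shows "chain_map A Z (dsum X Y) (\<lambda>i z. vpair (f i z) (g i z))"
proof (rule chain_mapI)
  show "rmodule_hom A (obj Z i) (obj (dsum X Y) i) (\<lambda>z. vpair (f i z) (g i z))" for i
    using rmodule_homD[OF chain_mapD(3)[OF f]] rmodule_homD[OF chain_mapD(3)[OF g]]
    by (auto simp: rmodule_hom_def linear_on_def vpair_add vpair_scale)
qed (use chain_mapD(4)[OF f] chain_mapD(4)[OF g] in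
      \<open>simp_all add: bounded_complex_dsum chain_mapD(1,2)[OF f] chain_mapD(1,2)[OF g]\<close>)

lemma chain_map_vfst:
  assumes X: "bounded_complex A X" and Y: "bounded_complex A Y"
  shows "chain_map A (dsum X Y) X (\<lambda>i. vfst)"
  by (rule chain_mapI) (auto simp: bounded_complex_dsum X Y rmodule_hom_def linear_on_def vfst_add)

lemma chain_map_vsnd:
  assumes X: "bounded_complex A X" and Y: "bounded_complex A Y"
  shows "chain_map A (dsum X Y) Y (\<lambda>i. vsnd)"
  by (rule chain_mapI) (auto simp: bounded_complex_dsum X Y rmodule_hom_def linear_on_def vsnd_add)

lemma chain_map_fold:
  assumes X: "bounded_complex A X"
  shows "chain_map A (dsum X X) X (\<lambda>i z. vfst z + vsnd z)"
proof (rule chain_mapI)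
  show "rmodule_hom A (obj (dsum X X) i) (obj X i) (\<lambda>z. vfst z + vsnd z)" for i
    using vs.subspace_add[OF bounded_complexD(4)[OF X]]
      linear_onD(1)[OF right_moduleD(2)[OF bounded_complexD(1)[OF X]]]
    by (auto simp: rmodule_hom_def linear_on_def vfst_add vsnd_add vs.scale_right_distrib)
qed (use linear_onD(1)[OF bounded_complexD(5)[OF X]] in \<open>simp_all add: bounded_complex_dsum X\<close>)

lemma cycles_dsum: "z \<in> cycles (dsum X Y) i \<longleftrightarrow> vfst z \<in> cycles X i \<and> vsnd z \<in> cycles Y i"
proof -
  have "vpair x y = 0 \<longleftrightarrow> x = 0 \<and> y = 0" for x y :: "'a vec"
    by (metis vpair_eq_iff vpair_zero)
  then show ?thesis by (auto simp: cycles_def)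
qed

lemma boundaries_dsum: "z \<in> boundaries (dsum X Y) i \<longleftrightarrow> vfst z \<in> boundaries X i \<and> vsnd z \<in> boundaries Y i"
proof
  assume "z \<in> boundaries (dsum X Y) i"
  then show "vfst z \<in> boundaries X i \<and> vsnd z \<in> boundaries Y i" by (auto simp: boundaries_def)
next
  assume "vfst z \<in> boundaries X i \<and> vsnd z \<in> boundaries Y i"
  then obtain x y where "x \<in> space (obj X (i - 1))" "vfst z = diff X (i - 1) x"
      "y \<in> space (obj Y (i - 1))" "vsnd z = diff Y (i - 1) y"
    by (auto simp: boundaries_def)
  then have "vpair x y \<in> space (obj (dsum X Y) (i - 1))" "z = diff (dsum X Y) (i - 1) (vpair x y)"
    by (simp_all, metis vpair_vfst_vsnd)
  then show "z \<in> boundaries (dsum X Y) i" unfolding boundaries_def by blast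
qed

lemma quasi_iso_dsum:
  assumes f: "quasi_iso A X X' f" and g: "quasi_iso A Y Y' g"
  shows "quasi_iso A (dsum X Y) (dsum X' Y') (\<lambda>i z. vpair (f i (vfst z)) (g i (vsnd z)))"
  unfolding quasi_iso_iff
proof (intro conjI allI ballI impI)
  show "chain_map A (dsum X Y) (dsum X' Y') (\<lambda>i z. vpair (f i (vfst z)) (g i (vsnd z)))"
    by (rule chain_map_dsum[OF quasi_isoD(1)[OF f] quasi_isoD(1)[OF g]])
next
  fix i z assume "z \<in> cycles (dsum X Y) i" "vpair (f i (vfst z)) (g i (vsnd z)) \<in> boundaries (dsum X' Y') i"
  then show "z \<in> boundaries (dsum X Y) i"
    using quasi_isoD(2)[OF f] quasi_isoD(2)[OF g] by (simp add: cycles_dsum boundaries_dsum)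
next
  fix i z assume "z \<in> cycles (dsum X' Y') i"
  then obtain x y where "x \<in> cycles X i" "vfst z - f i x \<in> boundaries X' i"
      "y \<in> cycles Y i" "vsnd z - g i y \<in> boundaries Y' i"
    using quasi_isoD(3)[OF f, of "vfst z" i] quasi_isoD(3)[OF g, of "vsnd z" i] by (auto simp: cycles_dsum)
  then show "\<exists>w\<in>cycles (dsum X Y) i. z - vpair (f i (vfst w)) (g i (vsnd w)) \<in> boundaries (dsum X' Y') i"
    by (intro bexI[of _ "vpair x y"]) (simp_all add: cycles_dsum boundaries_dsum vfst_minus vsnd_minus)
qed

lemma quasi_iso_id: "bounded_complex A X \<Longrightarrow> quasi_iso A X X (\<lambda>i x. x)"
  by (rule bij_chain_map_quasi_iso[OF chain_map_id]) (simp_all add: bij_betw_def)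

text \<open>An equality of complexes and not only an isomorphism, since the sign of the shift
  commutes with \<open>vpair\<close>; it allows shifts of powers to be rewritten.\<close>

lemma shift_dsum: "shift n (dsum X Y) = dsum (shift n X) (shift n Y)"
  by (rule cpx.equality) (simp_all add: fun_eq_iff vpair_minus)

lemma shift_zero_cpx: "shift n zero_cpx = zero_cpx"
  by (rule cpx.equality) (auto simp: fun_eq_iff zero_cpx_def)

section \<open>Shifts and mapping cones\<close>

lemma bounded_complex_shift:
  assumes X: "bounded_complex A X"
  shows "bounded_complex A (shift n X)"
proof -
  obtain m where m: "\<And>i. \<bar>i\<bar> > m \<Longrightarrow> space (obj X i) = {0}"
    using bounded_complex_bound[OF X] by metis
  have a: "i + 1 + n = i + n + 1" for i by simp
  show ?thesis
  proof (rule bounded_complexI[where n = "m + \<bar>n\<bar>"])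
    show "rmodule_hom A (obj (shift n X) i) (obj (shift n X) (i + 1)) (diff (shift n X) i)" for i
      using rmodule_homD[OF bounded_complexD(2)[OF X, of "i + n"]]
        vs.subspace_neg[OF bounded_complexD(4)[OF X, of "i + n + 1"]]
        linear_on_subspace(2)[OF right_moduleD(2)[OF bounded_complexD(1)[OF X]] bounded_complexD(4)[OF X]]
      by (auto simp: rmodule_hom_def linear_on_def a)
    show "diff (shift n X) (i + 1) (diff (shift n X) i x) = 0" if "x \<in> space (obj (shift n X) i)" for i x
      using that bounded_complexD(3,6)[OF X, of x "i + n"]
        linear_on_subspace(2)[OF bounded_complexD(5,4)[OF X], of "diff X (i + n) x" "i + n + 1"]
      by (simp add: a)
    show "space (obj (shift n X) i) \<subseteq> {0}" if "\<bar>i\<bar> > m + \<bar>n\<bar>" for i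
      using m[of "i + n"] that by auto
  qed (simp add: bounded_complexD(1)[OF X])
qed

lemma chain_map_shift:
  assumes f: "chain_map A X Y f"
  shows "chain_map A (shift n X) (shift n Y) (\<lambda>i. f (i + n))"
proof -
  have a: "i + 1 + n = i + n + 1" for i by simp
  show ?thesis
  proof (rule chain_mapI)
    show "f (i + 1 + n) (diff (shift n X) i x) = diff (shift n Y) i (f (i + n) x)"
      if "x \<in> space (obj (shift n X) i)" for i x
      using that chain_mapD(4)[OF f, of x "i + n"] bounded_complexD(6)[OF chain_mapD(1)[OF f], of x "i + n"]
        linear_on_subspace(2)[OF chain_mapD(5)[OF f] bounded_complexD(4)[OF chain_mapD(1)[OF f]], of _ "i + n + 1"]
      by (simp add: a)
  qed (simp_all add: bounded_complex_shift chain_mapD(1,2,3)[OF f])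
qed

lemma cycles_shift: "cycles (shift n X) i = cycles X (i + n)"
  by (auto simp: cycles_def)

text \<open>The sign in the shifted differential does not change its image, because the image of a
  subspace is closed under negation.\<close>

lemma boundaries_shift:
  assumes X: "bounded_complex A X"
  shows "boundaries (shift n X) i = boundaries X (i + n)"
proof -
  have a: "i - 1 + n = i + n - 1" by simp
  note B = bounded_complexD(4,5)[OF X, of "i + n - 1"]
  show ?thesis
    using linear_on_subspace(2)[OF B(2,1)] vs.subspace_neg[OF B(1)]
    by (auto simp: boundaries_def a image_iff) (metis minus_minus)+
qed

lemma quasi_iso_shift:
  assumes f: "quasi_iso A X Y f"
  shows "quasi_iso A (shift n X) (shift n Y) (\<lambda>i. f (i + n))"
  unfolding quasi_iso_iff
  using quasi_isoD(2,3)[OF f] chain_map_shift[OF quasi_isoD(1)[OF f]]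
  by (simp add: cycles_shift boundaries_shift[OF chain_mapD(1)[OF quasi_isoD(1)[OF f]]]
      boundaries_shift[OF chain_mapD(2)[OF quasi_isoD(1)[OF f]]])

lemma bounded_complex_cone:
  assumes f: "chain_map A X Y f"
  shows "bounded_complex A (cone X f Y)"
proof -
  note X = chain_mapD(1)[OF f] and Y = chain_mapD(2)[OF f]
  obtain n m where n: "\<And>i. \<bar>i\<bar> > n \<Longrightarrow> space (obj X i) = {0}" and m: "\<And>i. \<bar>i\<bar> > m \<Longrightarrow> space (obj Y i) = {0}"
    using bounded_complex_bound[OF X] bounded_complex_bound[OF Y] by metis
  note lX = linear_onD[OF bounded_complexD(5)[OF X]] and lY = linear_onD[OF bounded_complexD(5)[OF Y]]
    and lf = linear_onD[OF chain_mapD(5)[OF f]]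
  note cX = bounded_complexD(6)[OF X] and cY = bounded_complexD(6)[OF Y] and cf = chain_mapD(6)[OF f]
  show ?thesis
  \<comment> \<open>The bound for X grows by one, because the cone has X in degree i + 1.\<close>
  proof (rule bounded_complexI[where n = "max (n + 1) m"])
    show "right_module A (obj (cone X f Y) i)" for i
      by (simp add: right_module_dsum bounded_complexD(1)[OF X] bounded_complexD(1)[OF Y])
    show "rmodule_hom A (obj (cone X f Y) i) (obj (cone X f Y) (i + 1)) (diff (cone X f Y) i)" for i
      unfolding rmodule_hom_def
    proof (intro conjI ballI)
      show "linear_on (space (obj (cone X f Y) i)) (diff (cone X f Y) i)"
        by (simp add: linear_on_def vfst_add vsnd_add lX lY lf flip: vpair_add vpair_scale)
           (simp add: vs.scale_right_distrib algebra_simps)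
      show "diff (cone X f Y) i ` space (obj (cone X f Y) i) \<subseteq> space (obj (cone X f Y) (i + 1))"
      proof
        fix w assume "w \<in> diff (cone X f Y) i ` space (obj (cone X f Y) i)"
        then obtain x y where w: "w = vpair (- diff X (i + 1) x) (f (i + 1) x + diff Y i y)"
            "x \<in> space (obj X (i + 1))" "y \<in> space (obj Y i)"
          by auto
        then show "w \<in> space (obj (cone X f Y) (i + 1))"
          unfolding cone_simps dsum_module_simps w(1) vpair_simps
          by (intro conjI vs.subspace_neg vs.subspace_add cX cY cf bounded_complexD(4)[OF X] bounded_complexD(4)[OF Y])
      qed
      fix x a assume x: "x \<in> space (obj (cone X f Y) i)" and a: "a \<in> carrier A"
      have "- ract (obj X (i + 1 + 1)) y a = ract (obj X (i + 1 + 1)) (- y) a"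
        if "y \<in> space (obj X (i + 1 + 1))" for y
        by (rule linear_on_subspace(2)[OF right_moduleD(2)[OF bounded_complexD(1)[OF X] a]
              bounded_complexD(4)[OF X] that, symmetric])
      then show "diff (cone X f Y) i (ract (obj (cone X f Y) i) x a) =
          ract (obj (cone X f Y) (i + 1)) (diff (cone X f Y) i x) a"
        using x a cX[of "vfst x" "i + 1"] cY cf
        by (simp only: cone_simps dsum_module_simps vpair_simps rmodule_homD(3)[OF bounded_complexD(2)[OF X]]
            rmodule_homD(3)[OF bounded_complexD(2)[OF Y]] rmodule_homD(3)[OF chain_mapD(3)[OF f]]
            linear_onD(1)[OF right_moduleD(2)[OF bounded_complexD(1)[OF Y] a]])
    qed
    have X0: "- diff X (j + 1) (- diff X j x) = 0" if "x \<in> space (obj X j)" for j x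
      using linear_on_subspace(2)[OF bounded_complexD(5,4)[OF X] cX[OF that]] bounded_complexD(3)[OF X that] by simp
    \<comment> \<open>The off-diagonal terms of the squared differential cancel thanks to the minus
      sign in the first component of the cone.\<close>
    have f0: "f (j + 1) (- diff X j x) + diff Y j (f j x) = 0" if "x \<in> space (obj X j)" for j x
      using linear_on_subspace(2)[OF chain_mapD(5)[OF f] bounded_complexD(4)[OF X] cX[OF that]] chain_mapD(4)[OF f that]
      by simp
    show "diff (cone X f Y) (i + 1) (diff (cone X f Y) i z) = 0" if z: "z \<in> space (obj (cone X f Y) i)" for i z
    proof -
      from z have z: "vfst z \<in> space (obj X (i + 1))" "vsnd z \<in> space (obj Y i)" by simp_all
      show ?thesis
        unfolding cone_simps vpair_simps X0[OF z(1)] lY(1)[OF cf[OF z(1)] cY[OF z(2)]] bounded_complexD(3)[OF Y z(2)]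
        using f0[OF z(1)] by simp
    qed
    show "space (obj (cone X f Y) i) \<subseteq> {0}" if "\<bar>i\<bar> > max (n + 1) m" for i
      proof -
      have "n < \<bar>i + 1\<bar>" "m < \<bar>i\<bar>" using that by arith+
      then show ?thesis using n[of "i + 1"] m[of i] by (simp add: subset_iff vfst_vsnd_zero_iff)
    qed
  qed
qed

section \<open>Morphisms of the derived category\<close>

lemma dhom_bounded: "dhom A X Y u \<Longrightarrow> bounded_complex A X \<and> bounded_complex A Y"
  by (induction rule: dhom.induct) (auto simp: quasi_iso_def chain_map_def)

text \<open>\<open>dequiv\<close> relates raw zigzags and carries no source or target. Recording
  both ends makes equational chains well typed at every link, so that composites can be formed from
  their results.\<close>

definition deq ::
  "('k::field, 'a) module \<Rightarrow> ('k, 'a) cpx \<Rightarrow> ('k, 'a) cpx \<Rightarrow> ('k, 'a) zigzag \<Rightarrow> ('k, 'a) zigzag \<Rightarrow> bool" where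
  "deq A X Y u v \<longleftrightarrow> dhom A X Y u \<and> dhom A X Y v \<and> dequiv A u v"

lemma deqD: "deq A X Y u v \<Longrightarrow> dhom A X Y u" "deq A X Y u v \<Longrightarrow> dhom A X Y v"
    "deq A X Y u v \<Longrightarrow> dequiv A u v"
  by (auto simp: deq_def)

lemma deq_refl: "dhom A X Y u \<Longrightarrow> deq A X Y u u"
  by (simp add: deq_def dequiv_refl)

lemma deq_sym: "deq A X Y u v \<Longrightarrow> deq A X Y v u"
  by (auto simp: deq_def intro: dequiv_sym)

lemma deq_trans [trans]: "deq A X Y u v \<Longrightarrow> deq A X Y v w \<Longrightarrow> deq A X Y u w"
  by (auto simp: deq_def intro: dequiv_trans)

lemma deq_comp: "deq A X Y u u' \<Longrightarrow> deq A Y Z v v' \<Longrightarrow> deq A X Z (Comp v u) (Comp v' u')"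
  by (auto simp: deq_def intro: dhom_comp dequiv_comp)

lemma deq_comp_left: "dhom A Y Z v \<Longrightarrow> deq A X Y u u' \<Longrightarrow> deq A X Z (Comp v u) (Comp v u')"
  by (rule deq_comp[OF _ deq_refl])

lemma deq_comp_right: "dhom A X Y u \<Longrightarrow> deq A Y Z v v' \<Longrightarrow> deq A X Z (Comp v u) (Comp v' u)"
  by (rule deq_comp[OF deq_refl])

lemma deq_assoc: "dhom A X Y u \<Longrightarrow> dhom A Y Z v \<Longrightarrow> dhom A Z W w \<Longrightarrow>
    deq A X W (Comp (Comp w v) u) (Comp w (Comp v u))"
  by (auto simp: deq_def intro: dhom_comp dequiv_assoc dequiv_sym)

lemma dhom_id: "bounded_complex A X \<Longrightarrow> dhom A X X (did X)"
  by (simp add: did_def dhom_arr chain_map_id)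

lemma deq_id_left: "dhom A X Y u \<Longrightarrow> deq A X Y (Comp (did Y) u) u"
  using dhom_bounded[of A X Y u] by (auto simp: deq_def intro: dhom_comp dhom_id dequiv_id_left)

lemma deq_id_right: "dhom A X Y u \<Longrightarrow> deq A X Y (Comp u (did X)) u"
  using dhom_bounded[of A X Y u] by (auto simp: deq_def intro: dhom_comp dhom_id dequiv_id_right)

lemma deq_arr: "chain_map A X Y f \<Longrightarrow> chain_map A X Y f' \<Longrightarrow>
    (\<And>i x. x \<in> space (obj X i) \<Longrightarrow> f i x = f' i x) \<Longrightarrow> deq A X Y (Arr X f Y) (Arr X f' Y)"
  by (auto simp: deq_def intro: dhom_arr dequiv_cong_arr)

lemma deq_arr_comp:
  assumes "chain_map A X Y f" "chain_map A Y Z g" "chain_map A X Z h"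
    and "\<And>i x. x \<in> space (obj X i) \<Longrightarrow> g i (f i x) = h i x"
  shows "deq A X Z (Comp (Arr Y g Z) (Arr X f Y)) (Arr X h Z)"
proof -
  have "deq A X Z (Comp (Arr Y g Z) (Arr X f Y)) (Arr X (\<lambda>i x. g i (f i x)) Z)"
    using assms chain_map_comp[OF assms(1,2)] by (auto simp: deq_def intro: dhom.intros dequiv_arr_comp)
  also have "deq A X Z \<dots> (Arr X h Z)"
    by (rule deq_arr) (use assms chain_map_comp[OF assms(1,2)] in auto)
  finally show ?thesis .
qed

lemma deq_arr_square:
  assumes "chain_map A X Y f" "chain_map A Y Z g" "chain_map A X Y' f'" "chain_map A Y' Z g'"
    and "\<And>i x. x \<in> space (obj X i) \<Longrightarrow> g i (f i x) = g' i (f' i x)"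
  shows "deq A X Z (Comp (Arr Y g Z) (Arr X f Y)) (Comp (Arr Y' g' Z) (Arr X f' Y'))"
proof -
  have "deq A X Z (Comp (Arr Y g Z) (Arr X f Y)) (Arr X (\<lambda>i x. g' i (f' i x)) Z)"
    using assms chain_map_comp[OF assms(3,4)] by (intro deq_arr_comp) auto
  also have "deq A X Z \<dots> (Comp (Arr Y' g' Z) (Arr X f' Y'))"
    using assms chain_map_comp[OF assms(3,4)] by (intro deq_sym[OF deq_arr_comp]) auto
  finally show ?thesis .
qed

lemma deq_inv_left: "quasi_iso A X Y s \<Longrightarrow> deq A X X (Comp (Inv X s Y) (Arr X s Y)) (did X)"
  using chain_mapD(1)[of A X Y s]
  by (auto simp: deq_def quasi_iso_def intro!: dhom_comp dhom_arr dhom_inv dhom_id dequiv_inv_left)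

lemma deq_inv_right: "quasi_iso A X Y s \<Longrightarrow> deq A Y Y (Comp (Arr X s Y) (Inv X s Y)) (did Y)"
  using chain_mapD(2)[of A X Y s]
  by (auto simp: deq_def quasi_iso_def intro!: dhom_comp dhom_arr dhom_inv dhom_id dequiv_inv_right)

text \<open>\<open>Comp\<close> is associative only up to \<open>dequiv\<close>, so an equation
  between pairs of factors cannot simply be rewritten inside a longer composite. This applies one to
  the two leftmost factors of a right-nested composite and returns a right-nested composite
  again.\<close>

lemma deq_subst2:
  assumes uv: "deq A Y W (Comp v u) (Comp v' u')"
    and "dhom A X Y t" "dhom A Y Z u" "dhom A Z W v" "dhom A Y Z' u'" "dhom A Z' W v'"
  shows "deq A X W (Comp v (Comp u t)) (Comp v' (Comp u' t))"
proof -
  have "deq A X W (Comp v (Comp u t)) (Comp (Comp v u) t)" using assms by (intro deq_sym[OF deq_assoc])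
  also have "deq A X W \<dots> (Comp (Comp v' u') t)" by (rule deq_comp_right[OF assms(2) uv])
  also have "deq A X W \<dots> (Comp v' (Comp u' t))" using assms by (intro deq_assoc)
  finally show ?thesis .
qed

lemma deq_subst1:
  assumes uv: "deq A Y W (Comp v u) w" and "dhom A X Y t" "dhom A Y Z u" "dhom A Z W v"
  shows "deq A X W (Comp v (Comp u t)) (Comp w t)"
proof -
  have "deq A X W (Comp v (Comp u t)) (Comp (Comp v u) t)" using assms by (intro deq_sym[OF deq_assoc])
  also have "deq A X W \<dots> (Comp w t)" by (rule deq_comp_right[OF assms(2) uv])
  finally show ?thesis .
qed

lemma deq_cancel_left:
  assumes "deq A Y Y (Comp v u) (did Y)" "dhom A X Y t" "dhom A Y Z u" "dhom A Z Y v"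
  shows "deq A X Y (Comp v (Comp u t)) t"
  using deq_subst1[OF assms] deq_id_left[OF assms(2)] by (rule deq_trans)

lemma deq_cancel_right:
  assumes "deq A X X (Comp v u) (did X)" "dhom A X Z u" "dhom A Z X v" "dhom A X Y t"
  shows "deq A X Y (Comp t (Comp v u)) t"
  using deq_comp_left[OF assms(4,1)] deq_id_right[OF assms(4)] by (rule deq_trans)

text \<open>Insert the inverse of s' followed by s' on the left, move s across the square, and
  cancel it against its own inverse. This settles the \<open>Inv\<close> case in inductions over
  zigzags: whatever commutes with a quasi-isomorphism commutes with its formal inverse.\<close>

lemma inv_square:
  assumes s: "quasi_iso A X Y s" and s': "quasi_iso A X' Y' s'"
    and a: "dhom A X X' a" and b: "dhom A Y Y' b"
    and sq: "deq A X Y' (Comp b (Arr X s Y)) (Comp (Arr X' s' Y') a)"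
  shows "deq A Y X' (Comp a (Inv X s Y)) (Comp (Inv X' s' Y') b)"
proof -
  let ?i = "Inv X s Y" and ?i' = "Inv X' s' Y'" and ?s = "Arr X s Y" and ?s' = "Arr X' s' Y'"
  note h = dhom_arr[OF quasi_isoD(1)[OF s]] dhom_arr[OF quasi_isoD(1)[OF s']] dhom_inv[OF s] dhom_inv[OF s'] a b
  have "deq A Y X' (Comp a ?i) (Comp ?i' (Comp ?s' (Comp a ?i)))"
    using h by (intro deq_sym[OF deq_cancel_left[OF deq_inv_left[OF s']]] dhom_comp)
  also have "deq A Y X' \<dots> (Comp ?i' (Comp b (Comp ?s ?i)))"
    by (rule deq_comp_left[OF h(4)], rule deq_subst2[OF deq_sym[OF sq]]) (use h in auto)
  also have "deq A Y X' \<dots> (Comp ?i' b)"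
    by (rule deq_comp_left[OF h(4)], rule deq_cancel_right[OF deq_inv_right[OF s]]) (use h in auto)
  finally show ?thesis .
qed

section \<open>Zero morphisms\<close>

abbreviation zero_mor :: "('k::field, 'a) cpx \<Rightarrow> ('k, 'a) cpx \<Rightarrow> ('k, 'a) zigzag" where
  "zero_mor X Y \<equiv> Arr X (\<lambda>i x. 0) Y"

lemma dhom_zero: "bounded_complex A X \<Longrightarrow> bounded_complex A Y \<Longrightarrow> dhom A X Y (zero_mor X Y)"
  by (simp add: dhom_arr chain_map_zero)

text \<open>Absorption is clear for chain maps. For a formal inverse, the zero map out of X is
  rewritten as the zero map out of Y after s, and s then cancels against its inverse.\<close>

lemma zero_comp_left:
  assumes "dhom A X Y u" "bounded_complex A Z"
  shows "deq A X Z (Comp (zero_mor Y Z) u) (zero_mor X Z)"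
  using assms
proof induction
  case (dhom_arr X Y f)
  then show ?case
    using chain_mapD(1,2)[OF dhom_arr(1)] by (intro deq_arr_comp) (auto intro: chain_map_zero)
next
  case (dhom_inv X Y s)
  note s = quasi_isoD(1)[OF dhom_inv(1)]
  note b = chain_mapD(1,2)[OF s] dhom_inv(2)
  note h = dhom.dhom_inv[OF dhom_inv(1)] dhom.dhom_arr[OF s]
  have "deq A Y Z (Comp (zero_mor X Z) (Inv X s Y)) (Comp (Comp (zero_mor Y Z) (Arr X s Y)) (Inv X s Y))"
    by (rule deq_comp_right[OF dhom.dhom_inv[OF dhom_inv(1)] deq_sym[OF deq_arr_comp]])
      (use s b in \<open>auto intro: chain_map_zero\<close>)
  also have "deq A Y Z \<dots> (Comp (zero_mor Y Z) (Comp (Arr X s Y) (Inv X s Y)))"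
    by (rule deq_assoc[OF h dhom_zero[OF b(2,3)]])
  also have "deq A Y Z \<dots> (zero_mor Y Z)"
    by (rule deq_cancel_right[OF deq_inv_right[OF dhom_inv(1)] h dhom_zero[OF b(2,3)]])
  finally show ?case .
next
  case (dhom_comp X Y u W v)
  note b = dhom_bounded[OF dhom_comp(1)] dhom_bounded[OF dhom_comp(2)]
  have "deq A X Z (Comp (zero_mor W Z) (Comp v u)) (Comp (zero_mor Y Z) u)"
    by (rule deq_subst1[OF dhom_comp(4)]) (use dhom_comp b in \<open>auto intro: dhom_zero\<close>)
  also have "deq A X Z \<dots> (zero_mor X Z)" using dhom_comp by auto
  finally show ?case .
qed

lemma zero_comp_right:
  assumes "dhom A X Y u" "bounded_complex A Z"
  shows "deq A Z Y (Comp u (zero_mor Z X)) (zero_mor Z Y)"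
  using assms
proof induction
  case (dhom_arr X Y f)
  then show ?case
    using chain_mapD(1,2,7)[OF dhom_arr(1)] by (intro deq_arr_comp) (auto intro: chain_map_zero)
next
  case (dhom_inv X Y s)
  note s = quasi_isoD(1)[OF dhom_inv(1)]
  note b = chain_mapD(1,2)[OF s] dhom_inv(2)
  note h = dhom.dhom_inv[OF dhom_inv(1)] dhom.dhom_arr[OF s]
  have "deq A Z X (Comp (Inv X s Y) (zero_mor Z Y)) (Comp (Inv X s Y) (Comp (Arr X s Y) (zero_mor Z X)))"
    by (rule deq_comp_left[OF dhom.dhom_inv[OF dhom_inv(1)] deq_sym[OF deq_arr_comp]])
      (use s b chain_mapD(7)[OF s] in \<open>auto intro: chain_map_zero\<close>)
  also have "deq A Z X \<dots> (zero_mor Z X)"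
    by (rule deq_cancel_left[OF deq_inv_left[OF dhom_inv(1)] dhom_zero[OF b(3,1)] h(2,1)])
  finally show ?case .
next
  case (dhom_comp X Y u W v)
  note b = dhom_bounded[OF dhom_comp(1)] dhom_bounded[OF dhom_comp(2)]
  have "deq A Z W (Comp (Comp v u) (zero_mor Z X)) (Comp v (Comp u (zero_mor Z X)))"
    by (rule deq_assoc) (use dhom_comp b in \<open>auto intro: dhom_zero\<close>)
  also have "deq A Z W \<dots> (Comp v (zero_mor Z Y))"
    by (rule deq_comp_left) (use dhom_comp in auto)
  also have "deq A Z W \<dots> (zero_mor Z W)" using dhom_comp by auto
  finally show ?case .
qed

text \<open>The hypotheses make p a split epimorphism with section s, so u can be recovered from u
  p.\<close>

lemma zero_cancel_right:
  assumes "deq A X X (Comp p s) (did X)" "dhom A X Y s" "dhom A Y X p" "dhom A X Z u"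
    and "deq A Y Z (Comp u p) (zero_mor Y Z)"
  shows "deq A X Z u (zero_mor X Z)"
proof -
  have "deq A X Z u (Comp u (Comp p s))" using assms by (intro deq_sym[OF deq_cancel_right])
  also have "deq A X Z \<dots> (Comp (zero_mor Y Z) s)" by (rule deq_subst1[OF assms(5,2,3,4)])
  also have "deq A X Z \<dots> (zero_mor X Z)"
    using dhom_bounded[OF assms(4)] assms by (intro zero_comp_left) auto
  finally show ?thesis .
qed

lemma zero_cancel_left:
  assumes "deq A Z Z (Comp p s) (did Z)" "dhom A Z Y s" "dhom A Y Z p" "dhom A X Z u"
    and "deq A X Y (Comp s u) (zero_mor X Y)"
  shows "deq A X Z u (zero_mor X Z)"
proof -
  have "deq A X Z u (Comp p (Comp s u))" using assms by (intro deq_sym[OF deq_cancel_left])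
  also have "deq A X Z \<dots> (Comp p (zero_mor X Y))" by (rule deq_comp_left[OF assms(3,5)])
  also have "deq A X Z \<dots> (zero_mor X Z)"
    using dhom_bounded[OF assms(4)] assms by (intro zero_comp_right) auto
  finally show ?thesis .
qed

section \<open>Isomorphisms in the derived category\<close>

definition cpx_iso :: "('k::field, 'a) module \<Rightarrow> ('k, 'a) cpx \<Rightarrow> ('k, 'a) cpx \<Rightarrow> bool" where
  "cpx_iso A X Y \<longleftrightarrow> (\<exists>u. diso A X Y u)"

lemma diso_iff: "diso A X Y u \<longleftrightarrow> dhom A X Y u \<and>
    (\<exists>v. dhom A Y X v \<and> deq A X X (Comp v u) (did X) \<and> deq A Y Y (Comp u v) (did Y))"
  using dhom_bounded[of A X Y u]
  by (auto simp: diso_def deq_def intro: dhom_comp dhom_id)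

lemma diso_inverse:
  assumes "diso A X Y u"
  obtains v where "diso A Y X v" "dhom A X Y u" "dhom A Y X v"
    "deq A X X (Comp v u) (did X)" "deq A Y Y (Comp u v) (did Y)"
  using assms unfolding diso_iff by blast

lemma diso_comp:
  assumes "diso A X Y u" "diso A Y Z v"
  shows "diso A X Z (Comp v u)"
proof -
  obtain u' where u: "dhom A X Y u" "dhom A Y X u'"
      "deq A X X (Comp u' u) (did X)" "deq A Y Y (Comp u u') (did Y)"
    using assms(1) diso_iff by metis
  obtain v' where v: "dhom A Y Z v" "dhom A Z Y v'"
      "deq A Y Y (Comp v' v) (did Y)" "deq A Z Z (Comp v v') (did Z)"
    using assms(2) diso_iff by metis
  have *: "deq A P P (Comp (Comp a b) (Comp c d)) (did P)"
    if "dhom A P Q d" "dhom A Q R c" "dhom A R Q b" "dhom A Q P a"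
      "deq A Q Q (Comp b c) (did Q)" "deq A P P (Comp a d) (did P)" for a b c d P Q R
  proof -
    have "deq A P P (Comp (Comp a b) (Comp c d)) (Comp a (Comp b (Comp c d)))"
      using that by (intro deq_assoc dhom_comp)
    also have "deq A P P \<dots> (Comp a d)"
      using that by (intro deq_comp_left deq_cancel_left)
    also have "deq A P P \<dots> (did P)" by fact
    finally show ?thesis .
  qed
  show ?thesis
    unfolding diso_iff
    using *[OF u(1) v(1,2) u(2) v(3) u(3)] *[OF v(2) u(2) u(1) v(1) u(4) v(4)] u v
    by (blast intro: dhom_comp)
qed

lemma cpx_iso_sym: "cpx_iso A X Y \<Longrightarrow> cpx_iso A Y X"
  unfolding cpx_iso_def by (metis diso_inverse)

lemma cpx_iso_trans [trans]: "cpx_iso A X Y \<Longrightarrow> cpx_iso A Y Z \<Longrightarrow> cpx_iso A X Z"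
  unfolding cpx_iso_def by (metis diso_comp)

lemma quasi_iso_diso:
  assumes "quasi_iso A X Y s"
  shows "diso A X Y (Arr X s Y)"
  using deq_inv_left[OF assms] deq_inv_right[OF assms] dhom_inv[OF assms]
    dhom_arr[OF quasi_isoD(1)[OF assms]] unfolding diso_iff by blast

lemma quasi_iso_cpx_iso: "quasi_iso A X Y s \<Longrightarrow> cpx_iso A X Y"
  unfolding cpx_iso_def by (metis quasi_iso_diso)

lemma bij_chain_map_iso:
  "chain_map A X Y f \<Longrightarrow> (\<And>i. bij_betw (f i) (space (obj X i)) (space (obj Y i))) \<Longrightarrow> cpx_iso A X Y"
  using bij_chain_map_quasi_iso quasi_iso_cpx_iso by blast

lemma cpx_iso_refl: "bounded_complex A X \<Longrightarrow> cpx_iso A X X"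
  using quasi_iso_cpx_iso quasi_iso_id by blast

lemma cpx_iso_bounded: "cpx_iso A X Y \<Longrightarrow> bounded_complex A X \<and> bounded_complex A Y"
  unfolding cpx_iso_def diso_iff using dhom_bounded by blast

section \<open>Functors induced on derived categories\<close>

text \<open>The morphism part \<open>Fm\<close> receives the source and the target as well, because
  a tensored map is chosen relative to the two modules between which it runs.\<close>

primrec zmap ::
  "(('k, 'a) cpx \<Rightarrow> ('k, 'b) cpx) \<Rightarrow> (('k, 'a) cpx \<Rightarrow> ('k, 'a) cpx \<Rightarrow> 'k cmap \<Rightarrow> 'k cmap) \<Rightarrow>
   ('k, 'a) zigzag \<Rightarrow> ('k, 'b) zigzag" where
  "zmap Fo Fm (Arr X f Y) = Arr (Fo X) (Fm X Y f) (Fo Y)"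
| "zmap Fo Fm (Inv X s Y) = Inv (Fo X) (Fm X Y s) (Fo Y)"
| "zmap Fo Fm (Comp v u) = Comp (zmap Fo Fm v) (zmap Fo Fm u)"

text \<open>The laws are required only on the spaces of the complexes, where chain maps matter.
  Preservation of quasi-isomorphisms is what lets the functor descend to the derived categories
  without resolutions.\<close>

locale cpx_functor =
  fixes A :: "('k::field, 'a) module" and B :: "('k, 'b) module"
    and Fo :: "('k, 'a) cpx \<Rightarrow> ('k, 'b) cpx"
    and Fm :: "('k, 'a) cpx \<Rightarrow> ('k, 'a) cpx \<Rightarrow> 'k cmap \<Rightarrow> 'k cmap"
  assumes map_chain_map: "chain_map A X Y f \<Longrightarrow> chain_map B (Fo X) (Fo Y) (Fm X Y f)"
    and map_cong: "chain_map A X Y f \<Longrightarrow> chain_map A X Y f' \<Longrightarrow>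
      (\<And>i x. x \<in> space (obj X i) \<Longrightarrow> f i x = f' i x) \<Longrightarrow>
      x \<in> space (obj (Fo X) i) \<Longrightarrow> Fm X Y f i x = Fm X Y f' i x"
    and map_id: "bounded_complex A X \<Longrightarrow> x \<in> space (obj (Fo X) i) \<Longrightarrow> Fm X X (\<lambda>i x. x) i x = x"
    and map_comp: "chain_map A X Y f \<Longrightarrow> chain_map A Y Z g \<Longrightarrow> x \<in> space (obj (Fo X) i) \<Longrightarrow>
      Fm X Z (\<lambda>i x. g i (f i x)) i x = Fm Y Z g i (Fm X Y f i x)"
    and map_quasi_iso: "quasi_iso A X Y s \<Longrightarrow> quasi_iso B (Fo X) (Fo Y) (Fm X Y s)"
begin

lemma obj_bounded: "bounded_complex A X \<Longrightarrow> bounded_complex B (Fo X)"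
  using map_chain_map[OF chain_map_id] chain_mapD(1) by blast

lemma zmap_dhom: "dhom A X Y u \<Longrightarrow> dhom B (Fo X) (Fo Y) (zmap Fo Fm u)"
  by (induction rule: dhom.induct) (auto intro: dhom.intros map_chain_map map_quasi_iso)

lemma zmap_did: "bounded_complex A X \<Longrightarrow> deq B (Fo X) (Fo X) (zmap Fo Fm (did X)) (did (Fo X))"
  unfolding did_def zmap.simps
  by (intro deq_arr map_chain_map chain_map_id map_id) (auto intro: obj_bounded)

text \<open>The universal property of the localization: each generating relation of the congruence
  is carried to a consequence of the relations in the target, by one of the functor laws.\<close>

lemma zmap_dequiv: "dequiv A u v \<Longrightarrow> dequiv B (zmap Fo Fm u) (zmap Fo Fm v)"
proof (induction rule: dequiv.induct)
  case (dequiv_refl X Y u)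
  then show ?case using zmap_dhom dequiv.dequiv_refl by blast
next
  case (dequiv_sym u v)
  then show ?case using dequiv.dequiv_sym by blast
next
  case (dequiv_trans u v w)
  then show ?case using dequiv.dequiv_trans by blast
next
  case (dequiv_comp X Y u Z v u' v')
  show ?case
    unfolding zmap.simps by (rule dequiv.dequiv_comp[OF zmap_dhom[OF dequiv_comp(1)] zmap_dhom[OF dequiv_comp(2)]]) fact+
next
  case (dequiv_assoc X Y u Z v W w)
  then show ?case
    unfolding zmap.simps by (intro dequiv.dequiv_assoc[OF zmap_dhom zmap_dhom zmap_dhom])
next
  case (dequiv_id_left X Y u)
  note b = dhom_bounded[OF dequiv_id_left]
  have "deq B (Fo X) (Fo Y) (Comp (zmap Fo Fm (did Y)) (zmap Fo Fm u)) (Comp (did (Fo Y)) (zmap Fo Fm u))"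
    by (rule deq_comp_right) (use dequiv_id_left b in \<open>auto intro: zmap_dhom zmap_did\<close>)
  also have "deq B (Fo X) (Fo Y) \<dots> (zmap Fo Fm u)" by (rule deq_id_left[OF zmap_dhom[OF dequiv_id_left]])
  finally show ?case unfolding zmap.simps by (rule deqD(3))
next
  case (dequiv_id_right X Y u)
  note b = dhom_bounded[OF dequiv_id_right]
  have "deq B (Fo X) (Fo Y) (Comp (zmap Fo Fm u) (zmap Fo Fm (did X))) (Comp (zmap Fo Fm u) (did (Fo X)))"
    by (rule deq_comp_left) (use dequiv_id_right b in \<open>auto intro: zmap_dhom zmap_did\<close>)
  also have "deq B (Fo X) (Fo Y) \<dots> (zmap Fo Fm u)" by (rule deq_id_right[OF zmap_dhom[OF dequiv_id_right]])
  finally show ?case unfolding zmap.simps by (rule deqD(3))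
next
  case (dequiv_cong_arr X Y f f')
  then show ?case
    unfolding zmap.simps
    by (intro deqD(3)[OF deq_arr[OF map_chain_map map_chain_map map_cong]])
next
  case (dequiv_arr_comp X Y f Z g)
  note f = dequiv_arr_comp
  show ?case
    unfolding zmap.simps
    by (rule deqD(3)[OF deq_arr_comp[OF map_chain_map[OF f(1)] map_chain_map[OF f(2)]
            map_chain_map[OF chain_map_comp[OF f]] map_comp[OF f, symmetric]]])
next
  case (dequiv_inv_left X Y s)
  note b = chain_mapD(1)[OF quasi_isoD(1)[OF dequiv_inv_left]]
  show ?case
    using deqD(3)[OF deq_trans[OF deq_inv_left[OF map_quasi_iso[OF dequiv_inv_left]] deq_sym[OF zmap_did[OF b]]]]
    by simp
next
  case (dequiv_inv_right X Y s)
  note b = chain_mapD(2)[OF quasi_isoD(1)[OF dequiv_inv_right]]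
  show ?case
    using deqD(3)[OF deq_trans[OF deq_inv_right[OF map_quasi_iso[OF dequiv_inv_right]] deq_sym[OF zmap_did[OF b]]]]
    by simp
qed

lemma zmap_deq: "deq A X Y u v \<Longrightarrow> deq B (Fo X) (Fo Y) (zmap Fo Fm u) (zmap Fo Fm v)"
  by (simp add: deq_def zmap_dhom zmap_dequiv)

lemma zmap_diso:
  assumes "diso A X Y u"
  shows "diso B (Fo X) (Fo Y) (zmap Fo Fm u)"
proof -
  obtain v where v: "dhom A X Y u" "dhom A Y X v" "deq A X X (Comp v u) (did X)" "deq A Y Y (Comp u v) (did Y)"
    using assms diso_iff by metis
  then show ?thesis
    unfolding diso_iff
    using deq_trans[OF zmap_deq[OF v(3)] zmap_did] deq_trans[OF zmap_deq[OF v(4)] zmap_did]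
      dhom_bounded[OF v(1)] zmap_dhom[OF v(1)] zmap_dhom[OF v(2)] by auto
qed

lemma map_iso: "cpx_iso A X Y \<Longrightarrow> cpx_iso B (Fo X) (Fo Y)"
  unfolding cpx_iso_def using zmap_diso by blast

end

text \<open>Naturality with respect to chain maps extends to all morphisms of the localization:
  squares over composites are pasted, and a square over a formal inverse is the inverted square of
  the quasi-isomorphism.\<close>

lemma zmap_natural:
  assumes F: "cpx_functor A B Fo Fm" and F': "cpx_functor A B Fo' Fm'"
    and eta: "\<And>X. bounded_complex A X \<Longrightarrow> chain_map B (Fo X) (Fo' X) (\<eta> X)"
    and nat: "\<And>X Y f i x. chain_map A X Y f \<Longrightarrow> x \<in> space (obj (Fo X) i) \<Longrightarrow>
      \<eta> Y i (Fm X Y f i x) = Fm' X Y f i (\<eta> X i x)"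
    and u: "dhom A X Y u"
  shows "deq B (Fo X) (Fo' Y) (Comp (Arr (Fo Y) (\<eta> Y) (Fo' Y)) (zmap Fo Fm u))
    (Comp (zmap Fo' Fm' u) (Arr (Fo X) (\<eta> X) (Fo' X)))"
  using u
proof induction
  interpret F: cpx_functor A B Fo Fm by fact
  interpret F': cpx_functor A B Fo' Fm' by fact
  {
    case (dhom_arr X Y f)
    then show ?case
      unfolding zmap.simps using chain_mapD(1,2)[OF dhom_arr]
      by (intro deq_arr_square[OF F.map_chain_map eta eta F'.map_chain_map nat])
  next
    case (dhom_inv X Y s)
    note s = quasi_isoD(1)[OF dhom_inv]
    note b = chain_mapD(1,2)[OF s]
    show ?case
      unfolding zmap.simps
      by (rule inv_square[OF F.map_quasi_iso[OF dhom_inv] F'.map_quasi_iso[OF dhom_inv]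
            dhom.dhom_arr[OF eta[OF b(1)]] dhom.dhom_arr[OF eta[OF b(2)]]
            deq_arr_square[OF F.map_chain_map[OF s] eta[OF b(2)] eta[OF b(1)] F'.map_chain_map[OF s] nat[OF s]]])
  next
    case (dhom_comp X Y u Z v)
    note b = dhom_bounded[OF dhom_comp(1)] dhom_bounded[OF dhom_comp(2)]
    note h = F.zmap_dhom[OF dhom_comp(1)] F.zmap_dhom[OF dhom_comp(2)]
      F'.zmap_dhom[OF dhom_comp(1)] F'.zmap_dhom[OF dhom_comp(2)]
    have e: "dhom B (Fo W) (Fo' W) (Arr (Fo W) (\<eta> W) (Fo' W))" if "bounded_complex A W" for W
      using that by (intro dhom.dhom_arr eta)
    have "deq B (Fo X) (Fo' Z) (Comp (Arr (Fo Z) (\<eta> Z) (Fo' Z)) (zmap Fo Fm (Comp v u)))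
        (Comp (zmap Fo' Fm' v) (Comp (Arr (Fo Y) (\<eta> Y) (Fo' Y)) (zmap Fo Fm u)))"
      unfolding zmap.simps by (rule deq_subst2[OF dhom_comp(4)]) (use h b in \<open>auto intro: e\<close>)
    also have "deq B (Fo X) (Fo' Z) \<dots> (Comp (zmap Fo' Fm' v) (Comp (zmap Fo' Fm' u) (Arr (Fo X) (\<eta> X) (Fo' X))))"
      by (rule deq_comp_left[OF h(4) dhom_comp(3)])
    also have "deq B (Fo X) (Fo' Z) \<dots> (Comp (zmap Fo' Fm' (Comp v u)) (Arr (Fo X) (\<eta> X) (Fo' X)))"
      unfolding zmap.simps by (rule deq_sym[OF deq_assoc]) (use h b in \<open>auto intro: e\<close>)
    finally show ?case .
  }
qed

section \<open>Additivity of the derived category\<close>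

abbreviation (input) dsum_map1 :: "('k, 'a) cpx \<Rightarrow> ('k, 'a) cpx \<Rightarrow> 'k cmap \<Rightarrow> 'k cmap" where
  "dsum_map1 X Y f \<equiv> \<lambda>i z. vpair (f i (vfst z)) (vsnd z)"

abbreviation (input) dsum_map2 :: "('k, 'a) cpx \<Rightarrow> ('k, 'a) cpx \<Rightarrow> 'k cmap \<Rightarrow> 'k cmap" where
  "dsum_map2 X Y g \<equiv> \<lambda>i z. vpair (vfst z) (g i (vsnd z))"

abbreviation (input) dsum_map_diag :: "('k, 'a) cpx \<Rightarrow> ('k, 'a) cpx \<Rightarrow> 'k cmap \<Rightarrow> 'k cmap" where
  "dsum_map_diag X Y f \<equiv> \<lambda>i z. vpair (f i (vfst z)) (f i (vsnd z))"

lemma cpx_functor_dsum1: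
  assumes W: "bounded_complex A W"
  shows "cpx_functor A A (\<lambda>X. dsum X W) dsum_map1"
  by unfold_locales
    (auto intro: chain_map_dsum[OF _ chain_map_id[OF W]] quasi_iso_dsum[OF _ quasi_iso_id[OF W]])

lemma cpx_functor_dsum2:
  assumes W: "bounded_complex A W"
  shows "cpx_functor A A (\<lambda>X. dsum W X) dsum_map2"
  by unfold_locales
    (auto intro: chain_map_dsum[OF chain_map_id[OF W]] quasi_iso_dsum[OF quasi_iso_id[OF W]])

lemma cpx_functor_diag: "cpx_functor A A (\<lambda>X. dsum X X) dsum_map_diag"
  by unfold_locales (auto intro: chain_map_dsum quasi_iso_dsum)

text \<open>The sum of two zigzags of different shapes is not a zigzag in any direct way. Sums of
  morphisms are therefore composed from u \<oplus> 1 and 1 \<oplus> v.\<close>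

definition dsum1 :: "('k, 'a) cpx \<Rightarrow> ('k, 'a) zigzag \<Rightarrow> ('k, 'a) zigzag" where
  "dsum1 W = zmap (\<lambda>X. dsum X W) dsum_map1"

definition dsum2 :: "('k, 'a) cpx \<Rightarrow> ('k, 'a) zigzag \<Rightarrow> ('k, 'a) zigzag" where
  "dsum2 W = zmap (\<lambda>X. dsum W X) dsum_map2"

lemma dsum1_simps:
  "dsum1 W (Arr X f Y) = Arr (dsum X W) (\<lambda>i z. vpair (f i (vfst z)) (vsnd z)) (dsum Y W)"
  "dsum1 W (Inv X f Y) = Inv (dsum X W) (\<lambda>i z. vpair (f i (vfst z)) (vsnd z)) (dsum Y W)"
  "dsum1 W (Comp v u) = Comp (dsum1 W v) (dsum1 W u)"
  by (simp_all add: dsum1_def)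

lemma dsum2_simps:
  "dsum2 W (Arr X f Y) = Arr (dsum W X) (\<lambda>i z. vpair (vfst z) (f i (vsnd z))) (dsum W Y)"
  "dsum2 W (Inv X f Y) = Inv (dsum W X) (\<lambda>i z. vpair (vfst z) (f i (vsnd z))) (dsum W Y)"
  "dsum2 W (Comp v u) = Comp (dsum2 W v) (dsum2 W u)"
  by (simp_all add: dsum2_def)

lemma dhom_dsum1: "bounded_complex A W \<Longrightarrow> dhom A X Y u \<Longrightarrow> dhom A (dsum X W) (dsum Y W) (dsum1 W u)"
  unfolding dsum1_def by (rule cpx_functor.zmap_dhom[OF cpx_functor_dsum1])

lemma dhom_dsum2: "bounded_complex A W \<Longrightarrow> dhom A X Y u \<Longrightarrow> dhom A (dsum W X) (dsum W Y) (dsum2 W u)"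
  unfolding dsum2_def by (rule cpx_functor.zmap_dhom[OF cpx_functor_dsum2])

lemma deq_dsum1: "bounded_complex A W \<Longrightarrow> deq A X Y u v \<Longrightarrow> deq A (dsum X W) (dsum Y W) (dsum1 W u) (dsum1 W v)"
  unfolding dsum1_def by (rule cpx_functor.zmap_deq[OF cpx_functor_dsum1])

lemma deq_dsum2: "bounded_complex A W \<Longrightarrow> deq A X Y u v \<Longrightarrow> deq A (dsum W X) (dsum W Y) (dsum2 W u) (dsum2 W v)"
  unfolding dsum2_def by (rule cpx_functor.zmap_deq[OF cpx_functor_dsum2])

text \<open>For a chain map f in place of u, the maps f \<oplus> 1 form a natural transformation
  between the functors X \<oplus> - and Y \<oplus> -, so the square commutes for every zigzag v. An
  induction over u then covers the rest.\<close>

lemma dsum_interchange: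
  assumes u: "dhom A X Y u" and v: "dhom A X' Y' v"
  shows "deq A (dsum X X') (dsum Y Y') (Comp (dsum1 Y' u) (dsum2 X v)) (Comp (dsum2 Y v) (dsum1 X' u))"
  using u
proof induction
  note b' = dhom_bounded[OF v]
  {
    fix X Y f assume f: "chain_map A X Y f"
    have "deq A (dsum X X') (dsum Y Y')
        (Comp (Arr (dsum X Y') (\<lambda>i z. vpair (f i (vfst z)) (vsnd z)) (dsum Y Y')) (dsum2 X v))
        (Comp (dsum2 Y v) (Arr (dsum X X') (\<lambda>i z. vpair (f i (vfst z)) (vsnd z)) (dsum Y X')))"
      unfolding dsum2_def
      by (rule zmap_natural[where \<eta> = "\<lambda>W i z. vpair (f i (vfst z)) (vsnd z)",
            OF cpx_functor_dsum2[OF chain_mapD(1)[OF f]] cpx_functor_dsum2[OF chain_mapD(2)[OF f]]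
            chain_map_dsum[OF f chain_map_id] _ v]) auto
  }
  note * = this
  {
    case (dhom_arr X Y f)
    then show ?case unfolding dsum1_simps by (rule *)
  next
    case (dhom_inv X Y s)
    note s = quasi_isoD(1)[OF dhom_inv]
    note q = quasi_iso_dsum[OF dhom_inv quasi_iso_id]
    show ?case
      unfolding dsum1_simps
      by (rule deq_sym[OF inv_square[OF q q dhom_dsum2[OF _ v] dhom_dsum2[OF _ v] deq_sym[OF *[OF s]]]])
        (use chain_mapD(1,2)[OF s] b' in auto)
  next
    case (dhom_comp X Y u Z w)
    note b = dhom_bounded[OF dhom_comp(1)] dhom_bounded[OF dhom_comp(2)]
    note h1 = dhom_dsum1[OF _ dhom_comp(1)] dhom_dsum1[OF _ dhom_comp(2)] and h2 = dhom_dsum2[OF _ v]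
    have "deq A (dsum X X') (dsum Z Y') (Comp (dsum1 Y' (Comp w u)) (dsum2 X v))
        (Comp (dsum1 Y' w) (Comp (dsum1 Y' u) (dsum2 X v)))"
      unfolding dsum1_simps by (rule deq_assoc[OF h2 h1]) (use b b' in auto)
    also have "deq A (dsum X X') (dsum Z Y') \<dots> (Comp (dsum1 Y' w) (Comp (dsum2 Y v) (dsum1 X' u)))"
      by (rule deq_comp_left[OF h1(2) dhom_comp(3)]) (use b' in auto)
    also have "deq A (dsum X X') (dsum Z Y') \<dots> (Comp (dsum2 Z v) (Comp (dsum1 X' w) (dsum1 X' u)))"
      by (rule deq_subst2[OF dhom_comp(4) h1(1) h2 h1(2) h1(2) h2]) (use b b' in auto)
    finally show ?case unfolding dsum1_simps .
  }
qed

text \<open>The codiagonal and the diagonal are natural for the doubling functor, whereas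
  calculations use the partial sums; this identity connects the two. Composites need
  \<open>dsum_interchange\<close> to bring the factors together.\<close>

lemma zmap_diag:
  assumes "dhom A X Y u"
  shows "deq A (dsum X X) (dsum Y Y) (zmap (\<lambda>X. dsum X X) dsum_map_diag u) (Comp (dsum1 Y u) (dsum2 X u))"
  using assms
proof induction
  case (dhom_arr X Y f)
  note b = chain_mapD(1,2)[OF dhom_arr]
  show ?case
    unfolding zmap.simps dsum1_simps dsum2_simps
    by (rule deq_sym[OF deq_arr_comp]) (use b dhom_arr in \<open>auto intro: chain_map_dsum chain_map_id\<close>)
next
  case (dhom_inv X Y s)
  note q = dhom_inv
  note s = quasi_isoD(1)[OF q]
  note b = chain_mapD(1,2)[OF s]
  note i = dhom.dhom_inv[OF q] and a = dhom.dhom_arr[OF s]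
  let ?D = "\<lambda>i z. vpair (s i (vfst z)) (s i (vsnd z))"
  let ?c = "Comp (dsum1 X (Inv X s Y)) (dsum2 Y (Inv X s Y))"
  note qD = quasi_iso_dsum[OF q q]
  note iD = dhom.dhom_inv[OF qD] and aD = dhom.dhom_arr[OF quasi_isoD(1)[OF qD]]
  note h = dhom_dsum1[OF b(1) i] dhom_dsum2[OF b(2) i] dhom_dsum1[OF b(1) a] dhom_dsum2[OF b(2) a]
  have c: "dhom A (dsum Y Y) (dsum X X) ?c" using h by (auto intro: dhom_comp)
  \<comment> \<open>The composite of the two partial inverses is a left inverse of the doubled
    quasi-isomorphism, hence equal to its formal inverse.\<close>
  have ID: "deq A (dsum X X) (dsum X X) (Comp ?c (Arr (dsum X X) ?D (dsum Y Y))) (did (dsum X X))"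
  proof -
    have "deq A (dsum X X) (dsum X X) (Comp ?c (Arr (dsum X X) ?D (dsum Y Y)))
        (Comp ?c (Comp (dsum2 Y (Arr X s Y)) (dsum1 X (Arr X s Y))))"
      unfolding dsum1_simps dsum2_simps
      by (rule deq_comp_left[OF c[unfolded dsum1_simps dsum2_simps] deq_sym[OF deq_arr_comp]])
        (use b s in \<open>auto intro: chain_map_dsum chain_map_id\<close>)
    also have "deq A (dsum X X) (dsum X X) \<dots> (Comp (dsum1 X (Inv X s Y))
        (Comp (dsum2 Y (Inv X s Y)) (Comp (dsum2 Y (Arr X s Y)) (dsum1 X (Arr X s Y)))))"
      by (rule deq_assoc[OF dhom_comp[OF h(3,4)] h(2,1)])
    also have "deq A (dsum X X) (dsum X X) \<dots> (Comp (dsum1 X (Inv X s Y)) (dsum1 X (Arr X s Y)))"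
    proof (rule deq_comp_left[OF h(1) deq_cancel_left[OF _ h(3,4,2)]])
      show "deq A (dsum Y X) (dsum Y X) (Comp (dsum2 Y (Inv X s Y)) (dsum2 Y (Arr X s Y))) (did (dsum Y X))"
        unfolding dsum2_simps by (rule deq_inv_left[OF quasi_iso_dsum[OF quasi_iso_id[OF b(2)] q]])
    qed
    also have "deq A (dsum X X) (dsum X X) \<dots> (did (dsum X X))"
      unfolding dsum1_simps by (rule deq_inv_left[OF quasi_iso_dsum[OF q quasi_iso_id[OF b(1)]]])
    finally show ?thesis .
  qed
  have "deq A (dsum Y Y) (dsum X X) (Inv (dsum X X) ?D (dsum Y Y))
      (Comp (did (dsum X X)) (Inv (dsum X X) ?D (dsum Y Y)))"
    by (rule deq_sym[OF deq_id_left[OF iD]])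
  also have "deq A (dsum Y Y) (dsum X X) \<dots>
      (Comp (Comp ?c (Arr (dsum X X) ?D (dsum Y Y))) (Inv (dsum X X) ?D (dsum Y Y)))"
    by (rule deq_comp_right[OF iD deq_sym[OF ID]])
  also have "deq A (dsum Y Y) (dsum X X) \<dots>
      (Comp ?c (Comp (Arr (dsum X X) ?D (dsum Y Y)) (Inv (dsum X X) ?D (dsum Y Y))))"
    by (rule deq_assoc[OF iD aD c])
  also have "deq A (dsum Y Y) (dsum X X) \<dots> ?c"
    by (rule deq_cancel_right[OF deq_inv_right[OF qD] iD aD c])
  finally show ?case by simp
next
  case (dhom_comp X Y u Z v)
  note uv = dhom_comp(1,2)
  note b = dhom_bounded[OF uv(1)] dhom_bounded[OF uv(2)]
  let ?D = "zmap (\<lambda>X. dsum X X) dsum_map_diag"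
  note h1 = dhom_dsum1[OF _ uv(1)] dhom_dsum1[OF _ uv(2)] and h2 = dhom_dsum2[OF _ uv(1)] dhom_dsum2[OF _ uv(2)]
  have "deq A (dsum X X) (dsum Z Z) (?D (Comp v u))
      (Comp (Comp (dsum1 Z v) (dsum2 Y v)) (Comp (dsum1 Y u) (dsum2 X u)))"
    using dhom_comp(3,4) by (simp add: deq_comp)
  also have "deq A (dsum X X) (dsum Z Z) \<dots>
      (Comp (dsum1 Z v) (Comp (dsum2 Y v) (Comp (dsum1 Y u) (dsum2 X u))))"
    by (rule deq_assoc[OF dhom.dhom_comp[OF h2(1) h1(1)] h2(2) h1(2)]) (use b in auto)
  also have "deq A (dsum X X) (dsum Z Z) \<dots>
      (Comp (dsum1 Z v) (Comp (dsum1 Z u) (Comp (dsum2 X v) (dsum2 X u))))"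
    by (rule deq_comp_left[OF h1(2) deq_subst2[OF deq_sym[OF dsum_interchange[OF uv]] h2(1) h1(1) h2(2) h2(2) h1(1)]])
      (use b in auto)
  also have "deq A (dsum X X) (dsum Z Z) \<dots> (Comp (dsum1 Z (Comp v u)) (dsum2 X (Comp v u)))"
    unfolding dsum1_simps dsum2_simps
    by (rule deq_sym[OF deq_assoc[OF dhom.dhom_comp[OF h2] h1]]) (use b in auto)
  finally show ?case .
qed

lemma cpx_functor_id: "cpx_functor A A (\<lambda>X. X) (\<lambda>X Y f. f)"
  by unfold_locales auto

lemma zmap_id: "zmap (\<lambda>X. X) (\<lambda>X Y f. f) u = u"
  by (induction u) auto

text \<open>The map (x, y) to x + y commutes with any linear chain map, hence with all morphisms.
  This is the substitute for distributivity of composition over addition of morphisms.\<close>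

lemma fold_natural:
  assumes w: "dhom A P Z w"
  shows "deq A (dsum P P) Z
    (Comp (Arr (dsum Z Z) (\<lambda>i z. vfst z + vsnd z) Z) (Comp (dsum1 Z w) (dsum2 P w)))
    (Comp w (Arr (dsum P P) (\<lambda>i z. vfst z + vsnd z) P))"
proof -
  note b = dhom_bounded[OF w]
  have "deq A (dsum P P) Z
    (Comp (Arr (dsum Z Z) (\<lambda>i z. vfst z + vsnd z) Z) (Comp (dsum1 Z w) (dsum2 P w)))
    (Comp (Arr (dsum Z Z) (\<lambda>i z. vfst z + vsnd z) Z) (zmap (\<lambda>X. dsum X X) dsum_map_diag w))"
    by (rule deq_comp_left[OF dhom_arr[OF chain_map_fold] deq_sym[OF zmap_diag[OF w]]]) (use b in auto)
  also have "deq A (dsum P P) Z \<dots> (Comp (zmap (\<lambda>X. X) (\<lambda>X Y f. f) w) (Arr (dsum P P) (\<lambda>i z. vfst z + vsnd z) P))"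
    by (rule zmap_natural[where \<eta> = "\<lambda>X i z. vfst z + vsnd z", OF cpx_functor_diag cpx_functor_id chain_map_fold _ w])
      (simp_all add: linear_onD(1)[OF chain_mapD(5)])
  finally show ?thesis unfolding zmap_id .
qed

lemma diag_natural:
  assumes w: "dhom A Z P w"
  shows "deq A Z (dsum P P) (Comp (Arr P (\<lambda>i z. vpair z z) (dsum P P)) w)
    (Comp (dsum1 P w) (Comp (dsum2 Z w) (Arr Z (\<lambda>i z. vpair z z) (dsum Z Z))))"
proof -
  note b = dhom_bounded[OF w]
  have dg: "chain_map A X (dsum X X) (\<lambda>i z. vpair z z)" if "bounded_complex A X" for X
    by (rule chain_map_vpair[OF chain_map_id chain_map_id]) (fact that)+
  have "deq A Z (dsum P P) (Comp (Arr P (\<lambda>i z. vpair z z) (dsum P P)) (zmap (\<lambda>X. X) (\<lambda>X Y f. f) w))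
      (Comp (zmap (\<lambda>X. dsum X X) dsum_map_diag w) (Arr Z (\<lambda>i z. vpair z z) (dsum Z Z)))"
    by (rule zmap_natural[where \<eta> = "\<lambda>X i z. vpair z z", OF cpx_functor_id cpx_functor_diag dg _ w]) auto
  also have "deq A Z (dsum P P) \<dots> (Comp (Comp (dsum1 P w) (dsum2 Z w)) (Arr Z (\<lambda>i z. vpair z z) (dsum Z Z)))"
    by (rule deq_comp_right[OF dhom_arr[OF dg] zmap_diag[OF w]]) (use b in auto)
  also have "deq A Z (dsum P P) \<dots> (Comp (dsum1 P w) (Comp (dsum2 Z w) (Arr Z (\<lambda>i z. vpair z z) (dsum Z Z))))"
    by (rule deq_assoc[OF dhom_arr[OF dg] dhom_dsum2[OF _ w] dhom_dsum1[OF _ w]]) (use b in auto)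
  finally show ?thesis unfolding zmap_id .
qed

text \<open>The identity of P = X \<oplus> Y is the codiagonal of P after i1 \<oplus> i2. Naturality
  of the codiagonal turns w into the codiagonal of Z after (w i1) \<oplus> (w i2), and both summands
  vanish. This stands in for the formula w = w i1 p1 + w i2 p2.\<close>

lemma hom_dsum_source_zero:
  assumes w: "dhom A (dsum X Y) Z w" and X: "bounded_complex A X" and Y: "bounded_complex A Y"
    and z1: "deq A X Z (Comp w (Arr X (\<lambda>i x. vpair x 0) (dsum X Y))) (zero_mor X Z)"
    and z2: "deq A Y Z (Comp w (Arr Y (\<lambda>i y. vpair 0 y) (dsum X Y))) (zero_mor Y Z)"
  shows "deq A (dsum X Y) Z w (zero_mor (dsum X Y) Z)"
proof -
  let ?P = "dsum X Y"
  let ?i1 = "Arr X (\<lambda>i x. vpair x 0) ?P" and ?i2 = "Arr Y (\<lambda>i y. vpair 0 y) ?P"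
  let ?nP = "Arr (dsum ?P ?P) (\<lambda>i z. vfst z + vsnd z) ?P" and ?nZ = "Arr (dsum Z Z) (\<lambda>i z. vfst z + vsnd z) Z"
  note b = dhom_bounded[OF w, THEN conjunct1] dhom_bounded[OF w, THEN conjunct2]
  have c1: "chain_map A X ?P (\<lambda>i x. vpair x 0)" by (rule chain_map_vpair[OF chain_map_id[OF X] chain_map_zero[OF X Y]])
  have c2: "chain_map A Y ?P (\<lambda>i y. vpair 0 y)" by (rule chain_map_vpair[OF chain_map_zero[OF Y X] chain_map_id[OF Y]])
  note h1 = dhom_arr[OF c1] and h2 = dhom_arr[OF c2]
  note n = dhom_arr[OF chain_map_fold[OF b(1)]] dhom_arr[OF chain_map_fold[OF b(2)]]
  note a1 = dhom_dsum1[OF b(1) h1] and a1' = dhom_dsum1[OF b(2) h1] and a2 = dhom_dsum2[OF X h2]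
  note k1 = dhom_dsum1[OF b(2) w] and k2 = dhom_dsum2[OF b(1) w] and k2' = dhom_dsum2[OF X w]
  have s1: "deq A ?P (dsum ?P ?P) (Comp (dsum1 ?P ?i1) (dsum2 X ?i2))
      (Arr ?P (\<lambda>i z. vpair (vpair (vfst z) 0) (vpair 0 (vsnd z))) (dsum ?P ?P))"
    unfolding dsum1_simps dsum2_simps
    by (rule deq_arr_comp[OF chain_map_dsum[OF chain_map_id[OF X] c2] chain_map_dsum[OF c1 chain_map_id[OF b(1)]]
          chain_map_dsum[OF c1 c2]]) simp
  have "deq A ?P Z w (Comp w (did ?P))" by (rule deq_sym[OF deq_id_right[OF w]])
  also have "deq A ?P Z \<dots> (Comp w (Comp ?nP (Comp (dsum1 ?P ?i1) (dsum2 X ?i2))))"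
  proof (rule deq_comp_left[OF w deq_sym])
    have "deq A ?P ?P (Comp ?nP (Comp (dsum1 ?P ?i1) (dsum2 X ?i2)))
        (Comp ?nP (Arr ?P (\<lambda>i z. vpair (vpair (vfst z) 0) (vpair 0 (vsnd z))) (dsum ?P ?P)))"
      by (rule deq_comp_left[OF n(1) s1])
    also have "deq A ?P ?P \<dots> (did ?P)"
      unfolding did_def
      by (rule deq_arr_comp[OF chain_map_dsum[OF c1 c2] chain_map_fold[OF b(1)] chain_map_id[OF b(1)]])
        (simp add: vpair_add[symmetric])
    finally show "deq A ?P ?P (Comp ?nP (Comp (dsum1 ?P ?i1) (dsum2 X ?i2))) (did ?P)" .
  qed
  also have "deq A ?P Z \<dots> (Comp (Comp ?nZ (Comp (dsum1 Z w) (dsum2 ?P w))) (Comp (dsum1 ?P ?i1) (dsum2 X ?i2)))"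
    by (rule deq_subst1[OF deq_sym[OF fold_natural[OF w]] dhom_comp[OF a2 a1] n(1) w])
  also have "deq A ?P Z \<dots> (Comp ?nZ (Comp (Comp (dsum1 Z w) (dsum2 ?P w)) (Comp (dsum1 ?P ?i1) (dsum2 X ?i2))))"
    by (rule deq_assoc[OF dhom_comp[OF a2 a1] dhom_comp[OF k2 k1] n(2)])
  also have "deq A ?P Z \<dots> (Comp ?nZ (Comp (dsum1 Z w) (Comp (dsum2 ?P w) (Comp (dsum1 ?P ?i1) (dsum2 X ?i2)))))"
    by (rule deq_comp_left[OF n(2) deq_assoc[OF dhom_comp[OF a2 a1] k2 k1]])
  \<comment> \<open>Interchange moves i1 past the copy of w in the second summand, so that each copy
    of w meets its own inclusion.\<close>
  also have "deq A ?P Z \<dots> (Comp ?nZ (Comp (dsum1 Z w) (Comp (dsum1 Z ?i1) (Comp (dsum2 X w) (dsum2 X ?i2)))))"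
    by (rule deq_comp_left[OF n(2) deq_comp_left[OF k1
            deq_subst2[OF deq_sym[OF dsum_interchange[OF h1 w]] a2 a1 k2 k2' a1']]])
  also have "deq A ?P Z \<dots> (Comp ?nZ (Comp (Comp (dsum1 Z w) (dsum1 Z ?i1)) (Comp (dsum2 X w) (dsum2 X ?i2))))"
    by (rule deq_comp_left[OF n(2) deq_sym[OF deq_assoc[OF dhom_comp[OF a2 k2'] a1' k1]]])
  also have "deq A ?P Z \<dots> (Comp ?nZ (Comp (dsum1 Z (zero_mor X Z)) (dsum2 X (zero_mor Y Z))))"
    by (rule deq_comp_left[OF n(2) deq_comp])
      (use deq_dsum1[OF b(2) z1] deq_dsum2[OF X z2] in \<open>simp_all add: dsum1_simps(3) dsum2_simps(3)\<close>)
  also have "deq A ?P Z \<dots> (Comp ?nZ (zero_mor ?P (dsum Z Z)))"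
    unfolding dsum1_simps dsum2_simps
    by (rule deq_comp_left[OF n(2) deq_arr_comp])
      (use X Y b in \<open>auto intro: chain_map_dsum chain_map_id chain_map_zero bounded_complex_dsum\<close>)
  also have "deq A ?P Z \<dots> (zero_mor ?P Z)"
    by (rule zero_comp_right[OF n(2) b(1)])
  finally show ?thesis .
qed

text \<open>Dually, the identity of X \<oplus> Y is p1 \<oplus> p2 after the diagonal, so w becomes
  (p1 w) \<oplus> (p2 w) after the diagonal of Z.\<close>

lemma hom_dsum_target_zero:
  assumes w: "dhom A Z (dsum X Y) w" and X: "bounded_complex A X" and Y: "bounded_complex A Y"
    and z1: "deq A Z X (Comp (Arr (dsum X Y) (\<lambda>i. vfst) X) w) (zero_mor Z X)"
    and z2: "deq A Z Y (Comp (Arr (dsum X Y) (\<lambda>i. vsnd) Y) w) (zero_mor Z Y)"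
  shows "deq A Z (dsum X Y) w (zero_mor Z (dsum X Y))"
proof -
  let ?P = "dsum X Y"
  let ?p1 = "Arr ?P (\<lambda>i. vfst) X" and ?p2 = "Arr ?P (\<lambda>i. vsnd) Y"
  let ?dP = "Arr ?P (\<lambda>i z. vpair z z) (dsum ?P ?P)" and ?dZ = "Arr Z (\<lambda>i z. vpair z z) (dsum Z Z)"
  note b = dhom_bounded[OF w, THEN conjunct2] dhom_bounded[OF w, THEN conjunct1]
  note c1 = chain_map_vfst[OF X Y] and c2 = chain_map_vsnd[OF X Y]
  note h1 = dhom_arr[OF c1] and h2 = dhom_arr[OF c2]
  have dg: "chain_map A X (dsum X X) (\<lambda>i z. vpair z z)" if "bounded_complex A X" for X
    by (rule chain_map_vpair[OF chain_map_id chain_map_id]) (fact that)+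
  note n = dhom_arr[OF dg[OF b(1)]] dhom_arr[OF dg[OF b(2)]]
  note a1 = dhom_dsum1[OF Y h1] and a2 = dhom_dsum2[OF b(1) h2] and a2' = dhom_dsum2[OF b(2) h2]
  note k1 = dhom_dsum1[OF b(1) w] and k1' = dhom_dsum1[OF Y w] and k2 = dhom_dsum2[OF b(2) w]
  have s1: "deq A (dsum ?P ?P) ?P (Comp (dsum1 Y ?p1) (dsum2 ?P ?p2))
      (Arr (dsum ?P ?P) (\<lambda>i z. vpair (vfst (vfst z)) (vsnd (vsnd z))) ?P)"
    unfolding dsum1_simps dsum2_simps
    by (rule deq_arr_comp[OF chain_map_dsum[OF chain_map_id[OF b(1)] c2] chain_map_dsum[OF c1 chain_map_id[OF Y]]
          chain_map_dsum[OF c1 c2]]) simp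
  have "deq A Z ?P w (Comp (did ?P) w)" by (rule deq_sym[OF deq_id_left[OF w]])
  also have "deq A Z ?P \<dots> (Comp (Comp (Comp (dsum1 Y ?p1) (dsum2 ?P ?p2)) ?dP) w)"
  proof (rule deq_comp_right[OF w deq_sym])
    have "deq A ?P ?P (Comp (Comp (dsum1 Y ?p1) (dsum2 ?P ?p2)) ?dP)
        (Comp (Arr (dsum ?P ?P) (\<lambda>i z. vpair (vfst (vfst z)) (vsnd (vsnd z))) ?P) ?dP)"
      by (rule deq_comp_right[OF n(1) s1])
    also have "deq A ?P ?P \<dots> (did ?P)"
      unfolding did_def
      by (rule deq_arr_comp[OF dg[OF b(1)] chain_map_dsum[OF c1 c2] chain_map_id[OF b(1)]]) simp
    finally show "deq A ?P ?P (Comp (Comp (dsum1 Y ?p1) (dsum2 ?P ?p2)) ?dP) (did ?P)" .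
  qed
  also have "deq A Z ?P \<dots> (Comp (Comp (dsum1 Y ?p1) (dsum2 ?P ?p2)) (Comp ?dP w))"
    by (rule deq_assoc[OF w n(1) dhom_comp[OF a2 a1]])
  also have "deq A Z ?P \<dots> (Comp (Comp (dsum1 Y ?p1) (dsum2 ?P ?p2)) (Comp (dsum1 ?P w) (Comp (dsum2 Z w) ?dZ)))"
    by (rule deq_comp_left[OF dhom_comp[OF a2 a1] diag_natural[OF w]])
  also have "deq A Z ?P \<dots> (Comp (dsum1 Y ?p1) (Comp (dsum2 ?P ?p2) (Comp (dsum1 ?P w) (Comp (dsum2 Z w) ?dZ))))"
    by (rule deq_assoc[OF dhom_comp[OF dhom_comp[OF n(2) k2] k1] a2 a1])
  also have "deq A Z ?P \<dots> (Comp (dsum1 Y ?p1) (Comp (dsum1 Y w) (Comp (dsum2 Z ?p2) (Comp (dsum2 Z w) ?dZ))))"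
    by (rule deq_comp_left[OF a1 deq_subst2[OF deq_sym[OF dsum_interchange[OF w h2]]
            dhom_comp[OF n(2) k2] k1 a2 a2' k1']])
  also have "deq A Z ?P \<dots> (Comp (Comp (dsum1 Y ?p1) (dsum1 Y w)) (Comp (dsum2 Z ?p2) (Comp (dsum2 Z w) ?dZ)))"
    by (rule deq_sym[OF deq_assoc[OF dhom_comp[OF dhom_comp[OF n(2) k2] a2'] k1' a1]])
  also have "deq A Z ?P \<dots> (Comp (dsum1 Y (zero_mor Z X)) (Comp (dsum2 Z (zero_mor Z Y)) ?dZ))"
  proof (rule deq_comp)
    show "deq A (dsum Z Y) ?P (Comp (dsum1 Y ?p1) (dsum1 Y w)) (dsum1 Y (zero_mor Z X))"
      using deq_dsum1[OF Y z1] by (simp add: dsum1_simps(3))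
    show "deq A Z (dsum Z Y) (Comp (dsum2 Z ?p2) (Comp (dsum2 Z w) ?dZ)) (Comp (dsum2 Z (zero_mor Z Y)) ?dZ)"
      by (rule deq_subst1[OF _ n(2) k2 a2'])
        (use deq_dsum2[OF b(2) z2] in \<open>simp add: dsum2_simps(3)\<close>)
  qed
  also have "deq A Z ?P \<dots> (Comp (Comp (dsum1 Y (zero_mor Z X)) (dsum2 Z (zero_mor Z Y))) ?dZ)"
    by (rule deq_sym[OF deq_assoc[OF n(2) dhom_dsum2 dhom_dsum1]]) (use X Y b in \<open>auto intro: dhom_zero\<close>)
  also have "deq A Z ?P \<dots> (Comp (zero_mor (dsum Z Z) ?P) ?dZ)"
    unfolding dsum1_simps dsum2_simps
    by (rule deq_comp_right[OF n(2) deq_arr_comp])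
      (use X Y b in \<open>auto intro: chain_map_dsum chain_map_id chain_map_zero bounded_complex_dsum\<close>)
  also have "deq A Z ?P \<dots> (zero_mor Z ?P)"
    by (rule zero_comp_left[OF n(2) b(1)])
  finally show ?thesis .
qed

section \<open>Vanishing of morphisms between sums and powers\<close>

definition hom_zero :: "('k::field, 'a) module \<Rightarrow> ('k, 'a) cpx \<Rightarrow> ('k, 'a) cpx \<Rightarrow> bool" where
  "hom_zero A X Y \<longleftrightarrow> (\<forall>u. dhom A X Y u \<longrightarrow> deq A X Y u (zero_mor X Y))"

lemma hom_zero_iff: "hom_zero A X Y \<longleftrightarrow> (\<forall>u. dhom A X Y u \<longrightarrow> dequiv A u (zero_mor X Y))"
  using dhom_bounded dhom_zero by (fastforce simp: hom_zero_def deq_def)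

lemma hom_zero_dsum_source:
  assumes "hom_zero A X Z" "hom_zero A Y Z" and X: "bounded_complex A X" and Y: "bounded_complex A Y"
  shows "hom_zero A (dsum X Y) Z"
  unfolding hom_zero_def
proof (intro allI impI)
  fix w assume w: "dhom A (dsum X Y) Z w"
  have "dhom A X (dsum X Y) (Arr X (\<lambda>i x. vpair x 0) (dsum X Y))"
    by (rule dhom_arr[OF chain_map_vpair[OF chain_map_id[OF X] chain_map_zero[OF X Y]]])
  moreover have "dhom A Y (dsum X Y) (Arr Y (\<lambda>i x. vpair 0 x) (dsum X Y))"
    by (rule dhom_arr[OF chain_map_vpair[OF chain_map_zero[OF Y X] chain_map_id[OF Y]]])
  ultimately show "deq A (dsum X Y) Z w (zero_mor (dsum X Y) Z)"
    using assms w by (intro hom_dsum_source_zero[OF w X Y]) (auto simp: hom_zero_def intro: dhom_comp)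
qed

lemma hom_zero_dsum_target:
  assumes "hom_zero A Z X" "hom_zero A Z Y" and X: "bounded_complex A X" and Y: "bounded_complex A Y"
  shows "hom_zero A Z (dsum X Y)"
  unfolding hom_zero_def
proof (intro allI impI)
  fix w assume w: "dhom A Z (dsum X Y) w"
  show "deq A Z (dsum X Y) w (zero_mor Z (dsum X Y))"
    using assms w dhom_arr[OF chain_map_vfst[OF X Y]] dhom_arr[OF chain_map_vsnd[OF X Y]]
    by (intro hom_dsum_target_zero[OF w X Y]) (auto simp: hom_zero_def intro: dhom_comp)
qed

lemma did_zero_cpx: "deq A zero_cpx zero_cpx (did zero_cpx) (zero_mor zero_cpx zero_cpx)"
  unfolding did_def
  by (rule deq_arr) (auto intro: chain_map_id chain_map_zero bounded_complex_zero)

lemma hom_zero_zero_source: "hom_zero A zero_cpx Z"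
  unfolding hom_zero_def
proof (intro allI impI)
  fix u assume u: "dhom A zero_cpx Z u"
  have "deq A zero_cpx Z u (Comp u (did zero_cpx))" by (rule deq_sym[OF deq_id_right[OF u]])
  also have "deq A zero_cpx Z \<dots> (Comp u (zero_mor zero_cpx zero_cpx))"
    by (rule deq_comp_left[OF u did_zero_cpx])
  also have "deq A zero_cpx Z \<dots> (zero_mor zero_cpx Z)" by (rule zero_comp_right[OF u bounded_complex_zero])
  finally show "deq A zero_cpx Z u (zero_mor zero_cpx Z)" .
qed

lemma hom_zero_zero_target: "hom_zero A Z zero_cpx"
  unfolding hom_zero_def
proof (intro allI impI)
  fix u assume u: "dhom A Z zero_cpx u"
  have "deq A Z zero_cpx u (Comp (did zero_cpx) u)" by (rule deq_sym[OF deq_id_left[OF u]])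
  also have "deq A Z zero_cpx \<dots> (Comp (zero_mor zero_cpx zero_cpx) u)"
    by (rule deq_comp_right[OF u did_zero_cpx])
  also have "deq A Z zero_cpx \<dots> (zero_mor Z zero_cpx)" by (rule zero_comp_left[OF u bounded_complex_zero])
  finally show "deq A Z zero_cpx u (zero_mor Z zero_cpx)" .
qed

lemma bounded_complex_dsum_power: "bounded_complex A T \<Longrightarrow> bounded_complex A (dsum_power n T)"
  by (induction n) (auto intro: bounded_complex_zero bounded_complex_dsum)

lemma hom_zero_dsum_power:
  assumes "hom_zero A X Y" "bounded_complex A X" "bounded_complex A Y"
  shows "hom_zero A (dsum_power n X) (dsum_power m Y)"
proof -
  have "hom_zero A X (dsum_power m Y)"
    by (induction m) (auto intro: hom_zero_zero_target hom_zero_dsum_target assms bounded_complex_dsum_power)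
  then show ?thesis
    by (induction n) (auto intro: hom_zero_zero_source hom_zero_dsum_source assms bounded_complex_dsum_power)
qed

lemma shift_dsum_power: "shift i (dsum_power n T) = dsum_power n (shift i T)"
  by (induction n) (auto simp: shift_zero_cpx shift_dsum)

lemma hom_zero_iso:
  assumes "hom_zero A X Y" "cpx_iso A X X'" "cpx_iso A Y Y'"
  shows "hom_zero A X' Y'"
proof -
  obtain f where f: "diso A X X' f" using assms(2) by (auto simp: cpx_iso_def)
  obtain g where g: "diso A Y Y' g" using assms(3) by (auto simp: cpx_iso_def)
  obtain f' where f': "dhom A X X' f" "dhom A X' X f'" "deq A X' X' (Comp f f') (did X')"
    using diso_inverse[OF f] by metis
  obtain g' where g': "dhom A Y Y' g" "dhom A Y' Y g'" "deq A Y' Y' (Comp g g') (did Y')"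
    using diso_inverse[OF g] by metis
  show ?thesis
    unfolding hom_zero_def
  proof (intro allI impI)
    fix u assume u: "dhom A X' Y' u"
    have "deq A X Y (Comp (Comp g' u) f) (zero_mor X Y)"
      using assms(1) f' g' u by (auto simp: hom_zero_def intro: dhom_comp)
    then have "deq A X' Y (Comp g' u) (zero_mor X' Y)"
      using zero_cancel_right[OF f'(3,2,1) dhom_comp[OF u g'(2)]] by blast
    then show "deq A X' Y' u (zero_mor X' Y')"
      using zero_cancel_left[OF g'(3,2,1) u] by blast
  qed
qed

section \<open>Direct sums up to isomorphism and the category add\<close>

lemma cpx_iso_dsum: "cpx_iso A X X' \<Longrightarrow> cpx_iso A Y Y' \<Longrightarrow> cpx_iso A (dsum X Y) (dsum X' Y')"
  using cpx_functor.map_iso[OF cpx_functor_dsum1, of A Y X X'] cpx_functor.map_iso[OF cpx_functor_dsum2, of A X' Y Y']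
    cpx_iso_bounded[of A X X'] cpx_iso_bounded[of A Y Y'] cpx_iso_trans by blast

lemma cpx_iso_dsum_commute:
  assumes X: "bounded_complex A X" and Y: "bounded_complex A Y"
  shows "cpx_iso A (dsum X Y) (dsum Y X)"
proof (rule bij_chain_map_iso[OF chain_map_vpair[OF chain_map_vsnd[OF X Y] chain_map_vfst[OF X Y]]])
  show "bij_betw (\<lambda>z. vpair (vsnd z) (vfst z)) (space (obj (dsum X Y) i)) (space (obj (dsum Y X) i))" for i
    by (rule bij_betw_byWitness[where f' = "\<lambda>z. vpair (vsnd z) (vfst z)"]) auto
qed

text \<open>Interleaving sequences is not associative on the nose, so the entries have to be
  rearranged by an explicit bijection.\<close>

lemma cpx_iso_dsum_assoc:
  assumes X: "bounded_complex A X" and Y: "bounded_complex A Y" and Z: "bounded_complex A Z"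
  shows "cpx_iso A (dsum (dsum X Y) Z) (dsum X (dsum Y Z))"
proof -
  note XY = bounded_complex_dsum[OF X Y]
  note p = chain_map_vfst[OF XY Z]
  show ?thesis
  proof (rule bij_chain_map_iso[OF chain_map_vpair[OF chain_map_comp[OF p chain_map_vfst[OF X Y]]
            chain_map_vpair[OF chain_map_comp[OF p chain_map_vsnd[OF X Y]] chain_map_vsnd[OF XY Z]]]])
    show "bij_betw (\<lambda>z. vpair (vfst (vfst z)) (vpair (vsnd (vfst z)) (vsnd z)))
        (space (obj (dsum (dsum X Y) Z) i)) (space (obj (dsum X (dsum Y Z)) i))" for i
      by (rule bij_betw_byWitness[where f' = "\<lambda>z. vpair (vpair (vfst z) (vfst (vsnd z))) (vsnd (vsnd z))"]) auto
  qed
qed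

lemma cpx_iso_dsum_zero:
  assumes X: "bounded_complex A X"
  shows "cpx_iso A (dsum zero_cpx X) X"
proof (rule bij_chain_map_iso[OF chain_map_vsnd[OF bounded_complex_zero X]])
  show "bij_betw vsnd (space (obj (dsum zero_cpx X) i)) (space (obj X i))" for i
    by (rule bij_betw_byWitness[where f' = "vpair 0"]) (auto, metis vpair_vfst_vsnd)
qed

lemma cpx_iso_dsum_power: "cpx_iso A X Y \<Longrightarrow> cpx_iso A (dsum_power n X) (dsum_power n Y)"
  by (induction n) (auto intro: cpx_iso_dsum cpx_iso_refl bounded_complex_zero)

lemma cpx_iso_dsum_power_add:
  assumes "bounded_complex A X"
  shows "cpx_iso A (dsum (dsum_power m X) (dsum_power n X)) (dsum_power (m + n) X)"
proof (induction m)
  case 0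
  then show ?case using cpx_iso_dsum_zero[OF bounded_complex_dsum_power[OF assms]] by simp
next
  case (Suc m)
  have "cpx_iso A (dsum (dsum_power (Suc m) X) (dsum_power n X)) (dsum X (dsum (dsum_power m X) (dsum_power n X)))"
    by (simp add: cpx_iso_dsum_assoc bounded_complex_dsum_power assms)
  also have "cpx_iso A \<dots> (dsum_power (Suc m + n) X)"
    using cpx_iso_dsum[OF cpx_iso_refl[OF assms] Suc] by simp
  finally show ?case .
qed

lemma cpx_iso_dsum_power_power:
  assumes "bounded_complex A X"
  shows "cpx_iso A (dsum_power m (dsum_power n X)) (dsum_power (m * n) X)"
proof (induction m)
  case 0
  then show ?case by (simp add: cpx_iso_refl bounded_complex_zero)
next
  case (Suc m)
  have "cpx_iso A (dsum_power (Suc m) (dsum_power n X)) (dsum (dsum_power n X) (dsum_power (m * n) X))"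
    using cpx_iso_dsum[OF cpx_iso_refl[OF bounded_complex_dsum_power[OF assms]] Suc] by simp
  also have "cpx_iso A \<dots> (dsum_power (Suc m * n) X)"
    using cpx_iso_dsum_power_add[OF assms] by simp
  finally show ?case .
qed

lemma cpx_iso_dsum_power_dsum:
  assumes X: "bounded_complex A X" and Y: "bounded_complex A Y"
  shows "cpx_iso A (dsum_power n (dsum X Y)) (dsum (dsum_power n X) (dsum_power n Y))"
proof (induction n)
  case 0
  then show ?case by (simp add: cpx_iso_sym[OF cpx_iso_dsum_zero] bounded_complex_zero)
next
  case (Suc n)
  let ?X = "dsum_power n X" and ?Y = "dsum_power n Y"
  note b = bounded_complex_dsum_power[OF X, of n] bounded_complex_dsum_power[OF Y, of n]
  have "cpx_iso A (dsum_power (Suc n) (dsum X Y)) (dsum (dsum X Y) (dsum ?X ?Y))"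
    using cpx_iso_dsum[OF cpx_iso_refl[OF bounded_complex_dsum[OF X Y]] Suc] by simp
  also have "cpx_iso A \<dots> (dsum X (dsum Y (dsum ?X ?Y)))"
    using X Y b by (intro cpx_iso_dsum_assoc bounded_complex_dsum)
  also have "cpx_iso A \<dots> (dsum X (dsum ?X (dsum Y ?Y)))"
  proof (rule cpx_iso_dsum[OF cpx_iso_refl[OF X]])
    have "cpx_iso A (dsum Y (dsum ?X ?Y)) (dsum (dsum Y ?X) ?Y)"
      using X Y b by (intro cpx_iso_sym[OF cpx_iso_dsum_assoc])
    also have "cpx_iso A \<dots> (dsum (dsum ?X Y) ?Y)"
      using X Y b by (intro cpx_iso_dsum cpx_iso_dsum_commute cpx_iso_refl)
    also have "cpx_iso A \<dots> (dsum ?X (dsum Y ?Y))"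
      using X Y b by (intro cpx_iso_dsum_assoc)
    finally show "cpx_iso A (dsum Y (dsum ?X ?Y)) (dsum ?X (dsum Y ?Y))" .
  qed
  also have "cpx_iso A \<dots> (dsum (dsum X ?X) (dsum Y ?Y))"
    using X Y b by (intro cpx_iso_sym[OF cpx_iso_dsum_assoc] bounded_complex_dsum)
  finally show ?case by simp
qed

lemma add_cat_iff:
  "X \<in> add_cat A T \<longleftrightarrow> bounded_complex A X \<and> (\<exists>Y n. bounded_complex A Y \<and> cpx_iso A (dsum X Y) (dsum_power n T))"
  by (auto simp: add_cat_def cpx_iso_def)

text \<open>If X \<oplus> Y is isomorphic to T^n and T \<oplus> Z to T'^m, then Y \<oplus> Z^n is a
  complement of X in T'^(nm).\<close>

lemma add_cat_subset:
  assumes T: "bounded_complex A T" and T': "bounded_complex A T'" and "T \<in> add_cat A T'"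
  shows "add_cat A T \<subseteq> add_cat A T'"
proof
  fix X assume "X \<in> add_cat A T"
  then obtain Y n where X: "bounded_complex A X" "bounded_complex A Y" "cpx_iso A (dsum X Y) (dsum_power n T)"
    unfolding add_cat_iff by blast
  obtain Z m where Z: "bounded_complex A Z" "cpx_iso A (dsum T Z) (dsum_power m T')"
    using assms(3) unfolding add_cat_iff by blast
  let ?Z = "dsum_power n Z"
  note bZ = bounded_complex_dsum_power[OF Z(1), of n]
  have "cpx_iso A (dsum X (dsum Y ?Z)) (dsum (dsum X Y) ?Z)"
    by (rule cpx_iso_sym[OF cpx_iso_dsum_assoc[OF X(1,2) bZ]])
  also have "cpx_iso A \<dots> (dsum (dsum_power n T) ?Z)"
    by (rule cpx_iso_dsum[OF X(3) cpx_iso_refl[OF bZ]])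
  also have "cpx_iso A \<dots> (dsum_power n (dsum T Z))"
    by (rule cpx_iso_sym[OF cpx_iso_dsum_power_dsum[OF T Z(1)]])
  also have "cpx_iso A \<dots> (dsum_power n (dsum_power m T'))"
    by (rule cpx_iso_dsum_power[OF Z(2)])
  also have "cpx_iso A \<dots> (dsum_power (n * m) T')"
    by (rule cpx_iso_dsum_power_power[OF T'])
  finally show "X \<in> add_cat A T'"
    unfolding add_cat_iff using X(1) bounded_complex_dsum[OF X(2) bZ] by blast
qed

lemma add_cat_self:
  assumes "bounded_complex A T"
  shows "T \<in> add_cat A T"
proof -
  have "cpx_iso A (dsum T zero_cpx) (dsum_power 1 T)"
    using cpx_iso_refl[OF bounded_complex_dsum[OF assms bounded_complex_zero]] by simp
  then show ?thesis unfolding add_cat_iff using assms bounded_complex_zero by blast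
qed

text \<open>Each object is a summand of a power of the other: T' of T^n with complement 0, and T of
  a single copy of T' with complement T^(n-1), which is available since n is positive.\<close>

lemma add_cat_power_eq:
  assumes T: "bounded_complex A T" and T': "cpx_iso A T' (dsum_power n T)" and n: "n > 0"
  shows "add_cat A T' = add_cat A T"
proof
  note b = cpx_iso_bounded[OF T', THEN conjunct1]
  have p: "cpx_iso A (dsum T' zero_cpx) (dsum_power n T)"
    using cpx_iso_trans[OF cpx_iso_dsum_commute[OF b bounded_complex_zero] cpx_iso_trans[OF cpx_iso_dsum_zero[OF b] T']] .
  then show "add_cat A T' \<subseteq> add_cat A T"
    using add_cat_subset[OF b T] b bounded_complex_zero unfolding add_cat_iff[of T'] by blast
  obtain m where m: "n = Suc m" using n by (cases n) auto
  have "cpx_iso A (dsum T (dsum_power m T)) T'" using cpx_iso_sym[OF T'] m by simp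
  also have "cpx_iso A \<dots> (dsum_power 1 T')"
    using cpx_iso_sym[OF cpx_iso_trans[OF cpx_iso_dsum_commute[OF b bounded_complex_zero] cpx_iso_dsum_zero[OF b]]] by simp
  finally show "add_cat A T \<subseteq> add_cat A T'"
    using add_cat_subset[OF T b] T bounded_complex_dsum_power[OF T] unfolding add_cat_iff[of T] by blast
qed

section \<open>Exact functors given by coordinates\<close>

definition cpx_map ::
  "(('k, 'a) rmodule \<Rightarrow> ('k, 'b) rmodule) \<Rightarrow>
   (('k, 'a) rmodule \<Rightarrow> ('k, 'a) rmodule \<Rightarrow> ('k vec \<Rightarrow> 'k vec) \<Rightarrow> 'k vec \<Rightarrow> 'k vec) \<Rightarrow>
   ('k, 'a) cpx \<Rightarrow> ('k, 'b) cpx" where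
  "cpx_map Fo Fm X = \<lparr>obj = (\<lambda>i. Fo (obj X i)), diff = (\<lambda>i. Fm (obj X i) (obj X (i + 1)) (diff X i))\<rparr>"

definition cmap_map ::
  "(('k, 'a) rmodule \<Rightarrow> ('k, 'a) rmodule \<Rightarrow> ('k vec \<Rightarrow> 'k vec) \<Rightarrow> 'k vec \<Rightarrow> 'k vec) \<Rightarrow>
   ('k, 'a) cpx \<Rightarrow> ('k, 'a) cpx \<Rightarrow> 'k cmap \<Rightarrow> 'k cmap" where
  "cmap_map Fm X Y f = (\<lambda>i. Fm (obj X i) (obj Y i) (f i))"

lemma cpx_map_simps [simp]:
  "obj (cpx_map Fo Fm X) i = Fo (obj X i)"
  "diff (cpx_map Fo Fm X) i = Fm (obj X i) (obj X (i + 1)) (diff X i)"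
  by (auto simp: cpx_map_def)

text \<open>
  The functor sends \<open>M\<close> to a module whose underlying vector space is a direct sum of copies of \<open>M\<close>
  indexed by \<open>J\<close>, naturally in \<open>M\<close>; \<open>c M j\<close> is the \<open>j\<close>-th projection, which need not be a
  module homomorphism.
\<close>

locale coord_functor =
  fixes A :: "('k::field, 'a) module" and B :: "('k, 'b) module" and J :: "'j set"
    and Fo :: "('k, 'a) rmodule \<Rightarrow> ('k, 'b) rmodule"
    and Fm :: "('k, 'a) rmodule \<Rightarrow> ('k, 'a) rmodule \<Rightarrow> ('k vec \<Rightarrow> 'k vec) \<Rightarrow> 'k vec \<Rightarrow> 'k vec"
    and c :: "('k, 'a) rmodule \<Rightarrow> 'j \<Rightarrow> 'k vec \<Rightarrow> 'k vec"
  assumes obj_module: "right_module A M \<Longrightarrow> right_module B (Fo M)"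
    and map_hom: "right_module A M \<Longrightarrow> right_module A N \<Longrightarrow> rmodule_hom A M N f \<Longrightarrow>
      rmodule_hom B (Fo M) (Fo N) (Fm M N f)"
    and coord_linear: "right_module A M \<Longrightarrow> j \<in> J \<Longrightarrow> linear_on (space (Fo M)) (c M j)"
    and coord_into: "right_module A M \<Longrightarrow> j \<in> J \<Longrightarrow> t \<in> space (Fo M) \<Longrightarrow> c M j t \<in> space M"
    and coord_inj: "right_module A M \<Longrightarrow> t \<in> space (Fo M) \<Longrightarrow> t' \<in> space (Fo M) \<Longrightarrow>
      (\<And>j. j \<in> J \<Longrightarrow> c M j t = c M j t') \<Longrightarrow> t = t'"
    and coord_surj: "right_module A M \<Longrightarrow> (\<And>j. j \<in> J \<Longrightarrow> x j \<in> space M) \<Longrightarrow>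
      \<exists>t\<in>space (Fo M). \<forall>j\<in>J. c M j t = x j"
    and coord_map: "right_module A M \<Longrightarrow> right_module A N \<Longrightarrow> rmodule_hom A M N f \<Longrightarrow>
      t \<in> space (Fo M) \<Longrightarrow> j \<in> J \<Longrightarrow> c N j (Fm M N f t) = f (c M j t)"
begin

abbreviation "FC \<equiv> cpx_map Fo Fm"
abbreviation "FM \<equiv> cmap_map Fm"

lemma coord_add:
  assumes "right_module A M" "j \<in> J" "t \<in> space (Fo M)" "t' \<in> space (Fo M)"
  shows "c M j (t + t') = c M j t + c M j t'"
  using linear_onD(1)[OF coord_linear[OF assms(1,2)] assms(3,4)] .

lemma coord_diffs:
  assumes M: "right_module A M" and j: "j \<in> J"
  shows "c M j 0 = 0"
    and "t \<in> space (Fo M) \<Longrightarrow> c M j (- t) = - c M j t"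
    and "t \<in> space (Fo M) \<Longrightarrow> t' \<in> space (Fo M) \<Longrightarrow> c M j (t - t') = c M j t - c M j t'"
  using linear_on_subspace(1,2,3)[OF coord_linear[OF M j] right_module_subspace[OF obj_module[OF M]]] by auto

lemma FC_zero_space:
  assumes "right_module A M" "space M = {0}"
  shows "space (Fo M) = {0}"
proof -
  note S = right_module_subspace[OF obj_module[OF assms(1)]]
  have "t = 0" if "t \<in> space (Fo M)" for t
    using coord_inj[OF assms(1) that vs.subspace_0[OF S]] coord_into[OF assms(1) _ that]
      coord_diffs(1)[OF assms(1)] assms(2) by auto
  then show ?thesis using vs.subspace_0[OF S] by auto
qed

lemma bounded_FC:
  assumes X: "bounded_complex A X"
  shows "bounded_complex B (FC X)"
proof -
  obtain n where n: "\<And>i. \<bar>i\<bar> > n \<Longrightarrow> space (obj X i) = {0}" using bounded_complex_bound[OF X] by metis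
  note m = bounded_complexD(1)[OF X] and d = bounded_complexD(2)[OF X]
  note hom = map_hom[OF m m d]
  show ?thesis
  proof (rule bounded_complexI[where n = n])
    show "right_module B (obj (FC X) i)" for i by (simp add: obj_module m)
    show "rmodule_hom B (obj (FC X) i) (obj (FC X) (i + 1)) (diff (FC X) i)" for i
      using hom by simp
    show "diff (FC X) (i + 1) (diff (FC X) i t) = 0" if "t \<in> space (obj (FC X) i)" for i t
    proof (rule coord_inj[OF m[of "i + 1 + 1"]])
      have t: "t \<in> space (Fo (obj X i))" using that by simp
      note dt = rmodule_homD(2)[OF hom t]
      show "diff (FC X) (i + 1) (diff (FC X) i t) \<in> space (Fo (obj X (i + 1 + 1)))"
        using rmodule_homD(2)[OF hom dt] by simp
      show "0 \<in> space (Fo (obj X (i + 1 + 1)))"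
        by (rule vs.subspace_0[OF right_module_subspace[OF obj_module[OF m]]])
      show "c (obj X (i + 1 + 1)) j (diff (FC X) (i + 1) (diff (FC X) i t)) = c (obj X (i + 1 + 1)) j 0"
        if j: "j \<in> J" for j
        unfolding cpx_map_simps coord_map[OF m m d dt j] coord_map[OF m m d t j] coord_diffs(1)[OF m j]
        by (rule bounded_complexD(3)[OF X coord_into[OF m j t]])
    qed
    show "space (obj (FC X) i) \<subseteq> {0}" if "\<bar>i\<bar> > n" for i
      using FC_zero_space[OF m n[OF that]] by simp
  qed
qed

lemma chain_map_FM:
  assumes f: "chain_map A X Y f"
  shows "chain_map B (FC X) (FC Y) (FM X Y f)"
proof (rule chain_mapI)
  note X = chain_mapD(1)[OF f] and Y = chain_mapD(2)[OF f]
  show "bounded_complex B (FC X)" "bounded_complex B (FC Y)" using X Y by (auto intro: bounded_FC)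
  note m = bounded_complexD(1)[OF X] and d = bounded_complexD(2)[OF X]
  note m' = bounded_complexD(1)[OF Y] and d' = bounded_complexD(2)[OF Y]
  note h = chain_mapD(3)[OF f]
  show "rmodule_hom B (obj (FC X) i) (obj (FC Y) i) (FM X Y f i)" for i
    using map_hom[OF m m' h] by (simp add: cmap_map_def)
  fix i t assume "t \<in> space (obj (FC X) i)"
  then have t: "t \<in> space (Fo (obj X i))" by simp
  note dt = rmodule_homD(2)[OF map_hom[OF m m d] t] and ft = rmodule_homD(2)[OF map_hom[OF m m' h] t]
  show "FM X Y f (i + 1) (diff (FC X) i t) = diff (FC Y) i (FM X Y f i t)"
    unfolding cmap_map_def cpx_map_simps
  proof (rule coord_inj[OF m'[of "i + 1"]])
    show "Fm (obj X (i + 1)) (obj Y (i + 1)) (f (i + 1)) (Fm (obj X i) (obj X (i + 1)) (diff X i) t)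
        \<in> space (Fo (obj Y (i + 1)))"
      by (rule rmodule_homD(2)[OF map_hom[OF m m' h] dt])
    show "Fm (obj Y i) (obj Y (i + 1)) (diff Y i) (Fm (obj X i) (obj Y i) (f i) t) \<in> space (Fo (obj Y (i + 1)))"
      by (rule rmodule_homD(2)[OF map_hom[OF m' m' d'] ft])
    fix j assume j: "j \<in> J"
    show "c (obj Y (i + 1)) j (Fm (obj X (i + 1)) (obj Y (i + 1)) (f (i + 1)) (Fm (obj X i) (obj X (i + 1)) (diff X i) t)) =
        c (obj Y (i + 1)) j (Fm (obj Y i) (obj Y (i + 1)) (diff Y i) (Fm (obj X i) (obj Y i) (f i) t))"
      unfolding coord_map[OF m m' h dt j] coord_map[OF m m d t j] coord_map[OF m' m' d' ft j] coord_map[OF m m' h t j]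
      by (rule chain_mapD(4)[OF f coord_into[OF m j t]])
  qed
qed

lemma FM_into:
  assumes "chain_map A X Y f" "t \<in> space (obj (FC X) i)"
  shows "FM X Y f i t \<in> space (Fo (obj Y i))"
  using chain_mapD(6)[OF chain_map_FM[OF assms(1)] assms(2)] by simp

lemma coord_FM:
  assumes f: "chain_map A X Y f" and t: "t \<in> space (obj (FC X) i)" and j: "j \<in> J"
  shows "c (obj Y i) j (FM X Y f i t) = f i (c (obj X i) j t)"
  using coord_map[OF bounded_complexD(1)[OF chain_mapD(1)[OF f]] bounded_complexD(1)[OF chain_mapD(2)[OF f]]
      chain_mapD(3)[OF f] _ j] t by (simp add: cmap_map_def)

lemma coord_diff:
  assumes X: "bounded_complex A X" and t: "t \<in> space (obj (FC X) i)" and j: "j \<in> J"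
  shows "c (obj X (i + 1)) j (diff (FC X) i t) = diff X i (c (obj X i) j t)"
  using coord_map[OF bounded_complexD(1)[OF X] bounded_complexD(1)[OF X] bounded_complexD(2)[OF X] _ j] t by simp

text \<open>Joint injectivity of the coordinates allows the equation d t = 0 to be tested in each
  copy of X.\<close>

lemma cycles_FC:
  assumes X: "bounded_complex A X"
  shows "t \<in> cycles (FC X) i \<longleftrightarrow> t \<in> space (Fo (obj X i)) \<and> (\<forall>j\<in>J. c (obj X i) j t \<in> cycles X i)"
proof (cases "t \<in> space (Fo (obj X i))")
  case True
  then have t: "t \<in> space (obj (FC X) i)" by simp
  note m = bounded_complexD(1)[OF X]
  have "diff (FC X) i t = 0 \<longleftrightarrow> (\<forall>j\<in>J. c (obj X (i + 1)) j (diff (FC X) i t) = 0)"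
    using coord_inj[OF m, of "diff (FC X) i t" "i + 1" 0] coord_diffs(1)[OF m]
      bounded_complexD(6)[OF bounded_FC[OF X] t] vs.subspace_0[OF right_module_subspace[OF obj_module[OF m]]]
    by auto
  then show ?thesis
    using True coord_diff[OF X t] coord_into[OF m _ True] by (auto simp: cycles_def)
qed (auto simp: cycles_def)

text \<open>One direction is naturality of the coordinates. For the other, a preimage is chosen in
  every copy of X, and joint surjectivity assembles these into one element.\<close>

lemma boundaries_FC:
  assumes X: "bounded_complex A X" and t: "t \<in> space (Fo (obj X i))"
  shows "t \<in> boundaries (FC X) i \<longleftrightarrow> (\<forall>j\<in>J. c (obj X i) j t \<in> boundaries X i)"
proof
  note m = bounded_complexD(1)[OF X]
  assume "t \<in> boundaries (FC X) i"
  then obtain w where w: "w \<in> space (obj (FC X) (i - 1))" "t = diff (FC X) (i - 1) w"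
    unfolding boundaries_def by blast
  have w': "w \<in> space (Fo (obj X (i - 1)))" using w(1) by simp
  show "\<forall>j\<in>J. c (obj X i) j t \<in> boundaries X i"
  proof
    fix j assume j: "j \<in> J"
    have "c (obj X i) j t = diff X (i - 1) (c (obj X (i - 1)) j w)"
      using coord_diff[OF X w(1) j] w(2) by simp
    then show "c (obj X i) j t \<in> boundaries X i"
      using coord_into[OF m j w'] unfolding boundaries_def by blast
  qed
next
  note m = bounded_complexD(1)[OF X]
  assume "\<forall>j\<in>J. c (obj X i) j t \<in> boundaries X i"
  then have "\<forall>j\<in>J. \<exists>x\<in>space (obj X (i - 1)). c (obj X i) j t = diff X (i - 1) x"
    unfolding boundaries_def by blast
  then obtain x where x: "\<And>j. j \<in> J \<Longrightarrow> x j \<in> space (obj X (i - 1))"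
      "\<And>j. j \<in> J \<Longrightarrow> c (obj X i) j t = diff X (i - 1) (x j)"
    by metis
  obtain w where w: "w \<in> space (Fo (obj X (i - 1)))" "\<forall>j\<in>J. c (obj X (i - 1)) j w = x j"
    using coord_surj[OF m, of x] x(1) by metis
  have w': "w \<in> space (obj (FC X) (i - 1))" using w(1) by simp
  have "t = diff (FC X) (i - 1) w"
  proof (rule coord_inj[OF m t])
    show "diff (FC X) (i - 1) w \<in> space (Fo (obj X i))"
      using bounded_complexD(6)[OF bounded_FC[OF X] w'] by simp
    show "c (obj X i) j t = c (obj X i) j (diff (FC X) (i - 1) w)" if "j \<in> J" for j
      using coord_diff[OF X w' that] x(2)[OF that] w(2) that by simp
  qed
  then show "t \<in> boundaries (FC X) i" using w' unfolding boundaries_def by blast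
qed

text \<open>With cycles and boundaries read off coordinatewise, both conditions of
  \<open>quasi_iso_iff\<close> hold because they hold in every copy of X. This is the exactness that
  lets the functor act on derived categories as it stands.\<close>

lemma quasi_iso_FM:
  assumes s: "quasi_iso A X Y s"
  shows "quasi_iso B (FC X) (FC Y) (FM X Y s)"
  unfolding quasi_iso_iff
proof (intro conjI allI ballI impI)
  note f = quasi_isoD(1)[OF s]
  note X = chain_mapD(1)[OF f] and Y = chain_mapD(2)[OF f]
  note m = bounded_complexD(1)[OF X] and m' = bounded_complexD(1)[OF Y]
  show "chain_map B (FC X) (FC Y) (FM X Y s)" by (rule chain_map_FM[OF f])
  {
    fix i t assume t: "t \<in> cycles (FC X) i" and b: "FM X Y s i t \<in> boundaries (FC Y) i"
    have t': "t \<in> space (obj (FC X) i)" using t by (simp add: cycles_def)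
    then have tX: "t \<in> space (Fo (obj X i))" by simp
    have "c (obj X i) j t \<in> boundaries X i" if j: "j \<in> J" for j
    proof (rule quasi_isoD(2)[OF s])
      show "c (obj X i) j t \<in> cycles X i" using t j unfolding cycles_FC[OF X] by blast
      have "c (obj Y i) j (FM X Y s i t) \<in> boundaries Y i"
        using b j unfolding boundaries_FC[OF Y FM_into[OF f t']] by blast
      then show "s i (c (obj X i) j t) \<in> boundaries Y i" unfolding coord_FM[OF f t' j] .
    qed
    then show "t \<in> boundaries (FC X) i" unfolding boundaries_FC[OF X tX] by blast
  next
    fix i t assume t: "t \<in> cycles (FC Y) i"
    then have t': "t \<in> space (Fo (obj Y i))" by (simp add: cycles_def)
    have "\<forall>j\<in>J. \<exists>x\<in>cycles X i. c (obj Y i) j t - s i x \<in> boundaries Y i"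
      using t quasi_isoD(3)[OF s] by (auto simp: cycles_FC[OF Y])
    then obtain x where x: "\<And>j. j \<in> J \<Longrightarrow> x j \<in> cycles X i"
        "\<And>j. j \<in> J \<Longrightarrow> c (obj Y i) j t - s i (x j) \<in> boundaries Y i"
      by metis
    have xs: "x j \<in> space (obj X i)" if "j \<in> J" for j using x(1)[OF that] by (simp add: cycles_def)
    obtain w where w: "w \<in> space (Fo (obj X i))" "\<forall>j\<in>J. c (obj X i) j w = x j"
      using coord_surj[OF m, of x] xs by metis
    have w': "w \<in> space (obj (FC X) i)" using w(1) by simp
    have "t - FM X Y s i w \<in> boundaries (FC Y) i"
      using x(2) w(2) coord_FM[OF f w'] coord_diffs(3)[OF m' _ t' FM_into[OF f w']]
        vs.subspace_diff[OF right_module_subspace[OF obj_module[OF m']] t' FM_into[OF f w']]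
      by (simp add: boundaries_FC[OF Y])
    moreover have "w \<in> cycles (FC X) i" using w x(1) by (simp add: cycles_FC[OF X])
    ultimately show "\<exists>w\<in>cycles (FC X) i. t - FM X Y s i w \<in> boundaries (FC Y) i" by blast
  }
qed

lemma FM_eqI:
  assumes "chain_map A X Y f" "t \<in> space (obj (FC X) i)" "t' \<in> space (Fo (obj Y i))"
    and "\<And>j. j \<in> J \<Longrightarrow> f i (c (obj X i) j t) = c (obj Y i) j t'"
  shows "FM X Y f i t = t'"
  by (rule coord_inj[OF bounded_complexD(1)[OF chain_mapD(2)[OF assms(1)]] FM_into[OF assms(1,2)] assms(3)])
    (simp only: coord_FM[OF assms(1,2)] assms(4))

text \<open>Every functor law is an equation between elements of some \<open>Fo M\<close>, hence can
  be checked on coordinates, where the functor just applies the given chain map.\<close>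

sublocale FC: cpx_functor A B FC FM
proof unfold_locales
  show "chain_map B (FC X) (FC Y) (FM X Y f)" if "chain_map A X Y f" for X Y f
    by (rule chain_map_FM[OF that])
  show "quasi_iso B (FC X) (FC Y) (FM X Y f)" if "quasi_iso A X Y f" for X Y f
    by (rule quasi_iso_FM[OF that])
  show "FM X Y f i t = FM X Y f' i t"
    if f: "chain_map A X Y f" "chain_map A X Y f'" "\<And>i x. x \<in> space (obj X i) \<Longrightarrow> f i x = f' i x"
      and t: "t \<in> space (obj (FC X) i)" for X Y f f' t i
    by (rule FM_eqI[OF f(1) t FM_into[OF f(2) t]])
      (use f t coord_into[OF bounded_complexD(1)[OF chain_mapD(1)[OF f(1)]]] in \<open>simp add: coord_FM\<close>)
  show "FM X X (\<lambda>i x. x) i t = t" if X: "bounded_complex A X" and t: "t \<in> space (obj (FC X) i)" for X t i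
    by (rule FM_eqI[OF chain_map_id[OF X] t]) (use t in simp_all)
  show "FM X Z (\<lambda>i x. g i (f i x)) i t = FM Y Z g i (FM X Y f i t)"
    if f: "chain_map A X Y f" and g: "chain_map A Y Z g" and t: "t \<in> space (obj (FC X) i)" for X Y Z f g t i
  proof (rule FM_eqI[OF chain_map_comp[OF f g] t])
    have ft: "FM X Y f i t \<in> space (obj (FC Y) i)" using FM_into[OF f t] by simp
    then show "FM Y Z g i (FM X Y f i t) \<in> space (Fo (obj Z i))" by (rule FM_into[OF g])
    show "g i (f i (c (obj X i) j t)) = c (obj Z i) j (FM Y Z g i (FM X Y f i t))" if "j \<in> J" for j
      using coord_FM[OF g ft that] coord_FM[OF f t that] by simp
  qed
qed

lemma FM_zero:
  assumes "bounded_complex A X" "bounded_complex A Y" "t \<in> space (obj (FC X) i)"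
  shows "FM X Y (\<lambda>i x. 0) i t = 0"
proof (rule FM_eqI[OF chain_map_zero[OF assms(1,2)] assms(3)])
  note m = bounded_complexD(1)[OF assms(2)]
  show "0 \<in> space (Fo (obj Y i))" by (rule vs.subspace_0[OF right_module_subspace[OF obj_module[OF m]]])
  show "0 = c (obj Y i) j 0" if "j \<in> J" for j using coord_diffs(1)[OF m that] by simp
qed

lemma zmap_zero:
  assumes "bounded_complex A X" "bounded_complex A Y"
  shows "deq B (FC X) (FC Y) (zmap FC FM (zero_mor X Y)) (zero_mor (FC X) (FC Y))"
  unfolding zmap.simps
  by (rule deq_arr[OF chain_map_FM[OF chain_map_zero[OF assms]]
        chain_map_zero[OF bounded_FC[OF assms(1)] bounded_FC[OF assms(2)]] FM_zero[OF assms]])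

text \<open>The comparison map is the identity, but the two complexes need not be equal: for odd n
  one differential is the image of a negated map and the other the negative of an image. The two
  agree on the space, by coordinates.\<close>

lemma FC_shift:
  assumes X: "bounded_complex A X"
  shows "cpx_iso B (FC (shift n X)) (shift n (FC X))"
proof (rule bij_chain_map_iso)
  note m = bounded_complexD(1)[OF X]
  note X' = bounded_complex_shift[OF X, of n]
  show "chain_map B (FC (shift n X)) (shift n (FC X)) (\<lambda>i x. x)"
  proof (rule chain_mapI[OF bounded_FC[OF X'] bounded_complex_shift[OF bounded_FC[OF X]]])
    show "rmodule_hom B (obj (FC (shift n X)) i) (obj (shift n (FC X)) i) (\<lambda>x. x)" for i
      by (auto simp: rmodule_hom_def linear_on_def)
    fix i t assume t: "t \<in> space (obj (FC (shift n X)) i)"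
    then have t': "t \<in> space (obj (FC X) (i + n))" "t \<in> space (obj (shift n (FC X)) i)" by simp_all
    show "diff (FC (shift n X)) i t = diff (shift n (FC X)) i t"
    proof (rule coord_inj[OF m[of "i + n + 1"]])
      have e: "i + 1 + n = i + n + 1" by simp
      show "diff (FC (shift n X)) i t \<in> space (Fo (obj X (i + n + 1)))"
        using bounded_complexD(6)[OF bounded_FC[OF X'] t] by (simp add: e)
      show "diff (shift n (FC X)) i t \<in> space (Fo (obj X (i + n + 1)))"
        using bounded_complexD(6)[OF bounded_complex_shift[OF bounded_FC[OF X]] t'(2)] by (simp add: e)
      show "c (obj X (i + n + 1)) j (diff (FC (shift n X)) i t) = c (obj X (i + n + 1)) j (diff (shift n (FC X)) i t)"
        if j: "j \<in> J" for j
      proof -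
        have "c (obj X (i + n + 1)) j (diff (FC (shift n X)) i t) = diff (shift n X) i (c (obj X (i + n)) j t)"
          using coord_diff[OF X' t j] by (simp only: shift_simps e)
        also have "\<dots> = c (obj X (i + n + 1)) j (diff (shift n (FC X)) i t)"
        proof (cases "even n")
          case True
          then show ?thesis using coord_diff[OF X t'(1) j] by (simp del: cpx_map_simps(2))
        next
          case False
          have "diff (FC X) (i + n) t \<in> space (Fo (obj X (i + n + 1)))"
            using bounded_complexD(6)[OF bounded_FC[OF X] t'(1)] by simp
          from coord_diffs(2)[OF m j this] show ?thesis
            using coord_diff[OF X t'(1) j] False by (simp del: cpx_map_simps(2))
        qed
        finally show ?thesis .
      qed
    qed
  qed
qed (auto simp: bij_betw_def)

text \<open>Additivity on modules: an element over M \<oplus> N is determined by the halves of its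
  coordinates, and any two families of coordinates can be paired and realized.\<close>

lemma bij_FM_pair:
  assumes M: "right_module A M" and N: "right_module A N"
  shows "bij_betw (\<lambda>t. vpair (Fm (dsum_module M N) M vfst t) (Fm (dsum_module M N) N vsnd t))
    (space (Fo (dsum_module M N))) (space (dsum_module (Fo M) (Fo N)))"
proof -
  note MN = right_module_dsum[OF M N]
  have h1: "rmodule_hom A (dsum_module M N) M vfst" and h2: "rmodule_hom A (dsum_module M N) N vsnd"
    by (auto simp: rmodule_hom_def linear_on_def vfst_add vsnd_add)
  note c1 = coord_map[OF MN M h1] and c2 = coord_map[OF MN N h2]
  show ?thesis
    unfolding bij_betw_def
  proof (intro conjI inj_onI equalityI subsetI)
    fix t t' assume t: "t \<in> space (Fo (dsum_module M N))" "t' \<in> space (Fo (dsum_module M N))"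
      and eq: "vpair (Fm (dsum_module M N) M vfst t) (Fm (dsum_module M N) N vsnd t) =
        vpair (Fm (dsum_module M N) M vfst t') (Fm (dsum_module M N) N vsnd t')"
    show "t = t'"
    proof (rule coord_inj[OF MN t])
      fix j assume j: "j \<in> J"
      have "vfst (c (dsum_module M N) j t) = vfst (c (dsum_module M N) j t')"
        using eq c1[OF t(1) j] c1[OF t(2) j] by simp
      moreover have "vsnd (c (dsum_module M N) j t) = vsnd (c (dsum_module M N) j t')"
        using eq c2[OF t(1) j] c2[OF t(2) j] by simp
      ultimately show "c (dsum_module M N) j t = c (dsum_module M N) j t'"
        by (metis vpair_vfst_vsnd)
    qed
  next
    fix z assume "z \<in> (\<lambda>t. vpair (Fm (dsum_module M N) M vfst t) (Fm (dsum_module M N) N vsnd t)) `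
      space (Fo (dsum_module M N))"
    then show "z \<in> space (dsum_module (Fo M) (Fo N))"
      using rmodule_homD(2)[OF map_hom[OF MN M h1]] rmodule_homD(2)[OF map_hom[OF MN N h2]] by auto
  next
    fix z assume "z \<in> space (dsum_module (Fo M) (Fo N))"
    then have z: "vfst z \<in> space (Fo M)" "vsnd z \<in> space (Fo N)" by simp_all
    obtain t where t: "t \<in> space (Fo (dsum_module M N))"
        "\<forall>j\<in>J. c (dsum_module M N) j t = vpair (c M j (vfst z)) (c N j (vsnd z))"
      using coord_surj[OF MN, of "\<lambda>j. vpair (c M j (vfst z)) (c N j (vsnd z))"]
        coord_into[OF M _ z(1)] coord_into[OF N _ z(2)] by auto
    have "Fm (dsum_module M N) M vfst t = vfst z"
      by (rule coord_inj[OF M rmodule_homD(2)[OF map_hom[OF MN M h1] t(1)] z(1)]) (use c1[OF t(1)] t(2) in simp)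
    moreover have "Fm (dsum_module M N) N vsnd t = vsnd z"
      by (rule coord_inj[OF N rmodule_homD(2)[OF map_hom[OF MN N h2] t(1)] z(2)]) (use c2[OF t(1)] t(2) in simp)
    ultimately show "z \<in> (\<lambda>t. vpair (Fm (dsum_module M N) M vfst t) (Fm (dsum_module M N) N vsnd t)) `
        space (Fo (dsum_module M N))"
      using t(1) by (intro image_eqI[of _ _ t]) simp_all
  qed
qed

lemma FC_dsum:
  assumes X: "bounded_complex A X" and Y: "bounded_complex A Y"
  shows "cpx_iso B (FC (dsum X Y)) (dsum (FC X) (FC Y))"
proof (rule bij_chain_map_iso[OF chain_map_vpair[OF chain_map_FM[OF chain_map_vfst[OF X Y]]
          chain_map_FM[OF chain_map_vsnd[OF X Y]]]])
  show "bij_betw (\<lambda>z. vpair (FM (dsum X Y) X (\<lambda>i. vfst) i z) (FM (dsum X Y) Y (\<lambda>i. vsnd) i z))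
      (space (obj (FC (dsum X Y)) i)) (space (obj (dsum (FC X) (FC Y)) i))" for i
    using bij_FM_pair[OF bounded_complexD(1)[OF X] bounded_complexD(1)[OF Y]]
    by (simp add: cmap_map_def)
qed

text \<open>The underlying modules of a cone are direct sums, so the bijection is that of
  \<open>bij_FM_pair\<close>. Compatibility with the differentials of the two cones is verified for
  each component on coordinates.\<close>

lemma FC_cone:
  assumes f: "chain_map A X Y f"
  shows "cpx_iso B (FC (cone X f Y)) (cone (FC X) (FM X Y f) (FC Y))"
proof (rule bij_chain_map_iso)
  note X = chain_mapD(1)[OF f] and Y = chain_mapD(2)[OF f]
  note C = bounded_complex_cone[OF f]
  note m = bounded_complexD(1)[OF X] and m' = bounded_complexD(1)[OF Y] and mC = bounded_complexD(1)[OF C]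
  let ?C = "cone X f Y"
  let ?p = "\<lambda>i. Fm (obj ?C i) (obj X (i + 1)) vfst" and ?q = "\<lambda>i. Fm (obj ?C i) (obj Y i) vsnd"
  have h1: "rmodule_hom A (obj ?C i) (obj X (i + 1)) vfst" and h2: "rmodule_hom A (obj ?C i) (obj Y i) vsnd" for i
    by (auto simp: rmodule_hom_def linear_on_def vfst_add vsnd_add)
  note hp = map_hom[OF mC m h1] and hq = map_hom[OF mC m' h2]
  note cp = coord_map[OF mC m h1] and cq = coord_map[OF mC m' h2]
  show "bij_betw (\<lambda>t. vpair (?p i t) (?q i t)) (space (obj (FC ?C) i)) (space (obj (cone (FC X) (FM X Y f) (FC Y)) i))" for i
    using bij_FM_pair[OF m m'] by simp
  show "chain_map B (FC ?C) (cone (FC X) (FM X Y f) (FC Y)) (\<lambda>i t. vpair (?p i t) (?q i t))"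
  proof (rule chain_mapI[OF bounded_FC[OF C] bounded_complex_cone[OF chain_map_FM[OF f]]])
    show "rmodule_hom B (obj (FC ?C) i) (obj (cone (FC X) (FM X Y f) (FC Y)) i) (\<lambda>t. vpair (?p i t) (?q i t))" for i
      using rmodule_homD[OF hp] rmodule_homD[OF hq]
      by (auto simp: rmodule_hom_def linear_on_def vpair_add vpair_scale)
    fix i t assume t: "t \<in> space (obj (FC ?C) i)"
    then have t': "t \<in> space (Fo (obj ?C i))" by simp
    note dt = bounded_complexD(6)[OF bounded_FC[OF C] t]
    have dt': "diff (FC ?C) i t \<in> space (Fo (obj ?C (i + 1)))" using dt by simp
    note p = rmodule_homD(2)[OF hp t'] and q = rmodule_homD(2)[OF hq t']
    have p': "?p i t \<in> space (obj (FC X) (i + 1))" and q': "?q i t \<in> space (obj (FC Y) i)"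
      using p q by simp_all
    have dp: "diff (FC X) (i + 1) (?p i t) \<in> space (Fo (obj X (i + 1 + 1)))"
      using bounded_complexD(6)[OF bounded_FC[OF X] p'] unfolding cpx_map_simps(1) .
    have dq: "diff (FC Y) i (?q i t) \<in> space (Fo (obj Y (i + 1)))"
      using bounded_complexD(6)[OF bounded_FC[OF Y] q'] unfolding cpx_map_simps(1) .
    note fp = FM_into[OF f p']
    have "?p (i + 1) (diff (FC ?C) i t) = - diff (FC X) (i + 1) (?p i t)"
    proof (rule coord_inj[OF m rmodule_homD(2)[OF hp dt']])
      show "- diff (FC X) (i + 1) (?p i t) \<in> space (Fo (obj X (i + 1 + 1)))"
        by (rule vs.subspace_neg[OF right_module_subspace[OF obj_module[OF m]] dp])
      fix j assume j: "j \<in> J"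
      show "c (obj X (i + 1 + 1)) j (?p (i + 1) (diff (FC ?C) i t)) =
          c (obj X (i + 1 + 1)) j (- diff (FC X) (i + 1) (?p i t))"
        unfolding cp[OF dt' j] coord_diff[OF C t j] coord_diffs(2)[OF m j dp] coord_diff[OF X p' j] cp[OF t' j]
        by simp
    qed
    moreover have "?q (i + 1) (diff (FC ?C) i t) = FM X Y f (i + 1) (?p i t) + diff (FC Y) i (?q i t)"
    proof (rule coord_inj[OF m' rmodule_homD(2)[OF hq dt']])
      show "FM X Y f (i + 1) (?p i t) + diff (FC Y) i (?q i t) \<in> space (Fo (obj Y (i + 1)))"
        by (rule vs.subspace_add[OF right_module_subspace[OF obj_module[OF m']] fp dq])
      fix j assume j: "j \<in> J"
      show "c (obj Y (i + 1)) j (?q (i + 1) (diff (FC ?C) i t)) =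
          c (obj Y (i + 1)) j (FM X Y f (i + 1) (?p i t) + diff (FC Y) i (?q i t))"
        unfolding cq[OF dt' j] coord_diff[OF C t j] coord_add[OF m' j fp dq] coord_diff[OF Y q' j]
          coord_FM[OF f p' j] cp[OF t' j] cq[OF t' j]
        by simp
    qed
    ultimately show "vpair (?p (i + 1) (diff (FC ?C) i t)) (?q (i + 1) (diff (FC ?C) i t)) =
        diff (cone (FC X) (FM X Y f) (FC Y)) i (vpair (?p i t) (?q i t))"
      unfolding cone_simps vpair_simps by (simp only:)
  qed
qed

lemma FC_zero: "cpx_iso B (FC zero_cpx) zero_cpx"
proof (rule bij_chain_map_iso[OF chain_map_zero[OF bounded_FC bounded_complex_zero]])
  have "space (obj (FC zero_cpx) i) = {0}" for i
    using FC_zero_space[OF bounded_complexD(1)[OF bounded_complex_zero]] by simp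
  then show "bij_betw (\<lambda>x. 0) (space (obj (FC zero_cpx) i)) (space (obj zero_cpx i))" for i
    by (simp add: bij_betw_def)
qed (rule bounded_complex_zero)

lemma FC_dsum_power:
  assumes "bounded_complex A T"
  shows "cpx_iso B (FC (dsum_power n T)) (dsum_power n (FC T))"
proof (induction n)
  case (Suc n)
  have "cpx_iso B (FC (dsum_power (Suc n) T)) (dsum (FC T) (FC (dsum_power n T)))"
    using FC_dsum[OF assms bounded_complex_dsum_power[OF assms]] by simp
  also have "cpx_iso B \<dots> (dsum_power (Suc n) (FC T))"
    using cpx_iso_dsum[OF cpx_iso_refl[OF bounded_FC[OF assms]] Suc] by simp
  finally show ?case .
qed (simp add: FC_zero)

text \<open>The functor commutes with each operation that generates the thick subcategory, up to
  isomorphism. Boundedness is carried along in the induction since the comparison isomorphism for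
  shifts requires it.\<close>

lemma thick_FC: "X \<in> thick A T \<Longrightarrow> bounded_complex A X \<and> FC X \<in> thick B (FC T)"
proof (induction rule: thick.induct)
  case thick_base
  then show ?case by (auto intro: bounded_FC thick.thick_base)
next
  case (thick_iso X Y u)
  then have "diso B (FC X) (FC Y) (zmap FC FM u)" by (intro FC.zmap_diso)
  moreover have "bounded_complex A Y" using thick_iso dhom_bounded by (auto simp: diso_def)
  ultimately show ?case using thick_iso thick.thick_iso by blast
next
  case (thick_shift X n)
  then have "cpx_iso B (shift n (FC X)) (FC (shift n X))" by (intro cpx_iso_sym[OF FC_shift]) auto
  then show ?case
    using thick_shift thick.thick_shift thick.thick_iso bounded_complex_shift unfolding cpx_iso_def by blast
next
  case (thick_cone X Y f)
  have "cone (FC X) (FM X Y f) (FC Y) \<in> thick B (FC T)"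
    using thick_cone by (intro thick.thick_cone chain_map_FM) auto
  moreover have "cpx_iso B (cone (FC X) (FM X Y f) (FC Y)) (FC (cone X f Y))"
    by (rule cpx_iso_sym[OF FC_cone[OF thick_cone(3)]])
  ultimately show ?case
    using bounded_complex_cone[OF thick_cone(3)] thick.thick_iso unfolding cpx_iso_def by blast
next
  case (thick_summand X Y)
  have "cpx_iso B (FC (dsum X Y)) (dsum (FC X) (FC Y))" by (rule FC_dsum) fact+
  then have "dsum (FC X) (FC Y) \<in> thick B (FC T)"
    using thick_summand thick.thick_iso unfolding cpx_iso_def by blast
  then show ?case using thick_summand bounded_FC thick.thick_summand by blast
qed

lemma add_cat_FC:
  assumes T: "bounded_complex A T" and T': "bounded_complex A T'" and sub: "T \<in> add_cat A T'"
  shows "add_cat B (FC T) \<subseteq> add_cat B (FC T')"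
proof (rule add_cat_subset[OF bounded_FC[OF T] bounded_FC[OF T']])
  obtain Y n where Y: "bounded_complex A Y" "cpx_iso A (dsum T Y) (dsum_power n T')"
    using sub unfolding add_cat_iff by blast
  have "cpx_iso B (dsum (FC T) (FC Y)) (FC (dsum T Y))" by (rule cpx_iso_sym[OF FC_dsum[OF T Y(1)]])
  also have "cpx_iso B \<dots> (FC (dsum_power n T'))" by (rule FC.map_iso[OF Y(2)])
  also have "cpx_iso B \<dots> (dsum_power n (FC T'))" by (rule FC_dsum_power[OF T'])
  finally show "FC T \<in> add_cat B (FC T')"
    unfolding add_cat_iff using bounded_FC[OF T] bounded_FC[OF Y(1)] by blast
qed

text \<open>Additive functors preserve summands of powers, so the category generated by the image
  depends only on the category generated by T. The maps on tilting subcategories are thereby well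
  defined.\<close>

lemma add_cat_FC_cong:
  assumes "bounded_complex A T" "bounded_complex A T'" "add_cat A T = add_cat A T'"
  shows "add_cat B (FC T) = add_cat B (FC T')"
  using add_cat_FC[of T T'] add_cat_FC[of T' T] add_cat_self[of A T] add_cat_self[of A T'] assms by auto

end

section \<open>Finite direct sums\<close>

definition dsum_list :: "('k::field, 'a) cpx list \<Rightarrow> ('k, 'a) cpx" where
  "dsum_list Xs = foldr dsum Xs zero_cpx"

definition vtuple :: "'k::field vec list \<Rightarrow> 'k vec" where
  "vtuple xs = foldr vpair xs 0"

lemma dsum_list_simps [simp]: "dsum_list [] = zero_cpx" "dsum_list (X # Xs) = dsum X (dsum_list Xs)"
  by (simp_all add: dsum_list_def)

lemma vtuple_simps [simp]: "vtuple [] = 0" "vtuple (x # xs) = vpair x (vtuple xs)"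
  by (simp_all add: vtuple_def)

lemma bounded_complex_dsum_list:
  "(\<And>X. X \<in> set Xs \<Longrightarrow> bounded_complex A X) \<Longrightarrow> bounded_complex A (dsum_list Xs)"
  by (induction Xs) (auto intro: bounded_complex_dsum bounded_complex_zero)

text \<open>Distinctness of the indices is what allows the entries of v to be recorded as a function
  of the index.\<close>

lemma space_dsum_list:
  assumes "distinct js" "v \<in> space (obj (dsum_list (map W js)) i)"
  shows "\<exists>x. (\<forall>j\<in>set js. x j \<in> space (obj (W j) i)) \<and> v = vtuple (map x js)"
  using assms
proof (induction js arbitrary: v)
  case (Cons j js)
  then obtain x where x: "\<forall>j\<in>set js. x j \<in> space (obj (W j) i)" "vsnd v = vtuple (map x js)"
    by auto
  have e: "map (x(j := vfst v)) js = map x js" using Cons.prems(1) by simp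
  have "\<forall>l\<in>set (j # js). (x(j := vfst v)) l \<in> space (obj (W l) i)" using x(1) Cons.prems(2) by auto
  moreover have "v = vtuple (map (x(j := vfst v)) (j # js))"
    unfolding list.map(2) vtuple_simps e x(2)[symmetric] by simp
  ultimately show ?case by blast
qed simp

lemma vtuple_map_eq_iff: "vtuple (map x js) = vtuple (map y js) \<longleftrightarrow> (\<forall>j\<in>set js. x j = y j)"
  by (induction js) auto

lemma chain_map_vtuple:
  assumes Z: "bounded_complex A Z" and "\<And>j. j \<in> set js \<Longrightarrow> chain_map A Z (W j) (p j)"
  shows "chain_map A Z (dsum_list (map W js)) (\<lambda>i z. vtuple (map (\<lambda>j. p j i z) js))"
  using assms(2) by (induction js) (auto intro: chain_map_zero[OF Z bounded_complex_zero] chain_map_vpair)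

text \<open>A family of chain maps that is jointly bijective in each degree identifies the source
  with the direct sum of the targets. Both decompositions, over G and over its dual, are obtained in
  this way.\<close>

lemma quasi_iso_vtuple:
  assumes Z: "bounded_complex A Z" and p: "\<And>j. j \<in> set js \<Longrightarrow> chain_map A Z (W j) (p j)"
    and js: "distinct js"
    and inj: "\<And>i z z'. z \<in> space (obj Z i) \<Longrightarrow> z' \<in> space (obj Z i) \<Longrightarrow>
      (\<And>j. j \<in> set js \<Longrightarrow> p j i z = p j i z') \<Longrightarrow> z = z'"
    and surj: "\<And>i x. (\<And>j. j \<in> set js \<Longrightarrow> x j \<in> space (obj (W j) i)) \<Longrightarrow>
      \<exists>z\<in>space (obj Z i). \<forall>j\<in>set js. p j i z = x j"
  shows "quasi_iso A Z (dsum_list (map W js)) (\<lambda>i z. vtuple (map (\<lambda>j. p j i z) js))"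
proof (rule bij_chain_map_quasi_iso)
  show c: "chain_map A Z (dsum_list (map W js)) (\<lambda>i z. vtuple (map (\<lambda>j. p j i z) js))"
    by (rule chain_map_vtuple[OF Z p])
  show "bij_betw (\<lambda>z. vtuple (map (\<lambda>j. p j i z) js)) (space (obj Z i)) (space (obj (dsum_list (map W js)) i))" for i
    unfolding bij_betw_def
  proof (intro conjI inj_onI equalityI subsetI)
    fix z z' assume z: "z \<in> space (obj Z i)" "z' \<in> space (obj Z i)"
      and "vtuple (map (\<lambda>j. p j i z) js) = vtuple (map (\<lambda>j. p j i z') js)"
    then show "z = z'" using inj[OF z] by (simp add: vtuple_map_eq_iff)
  next
    fix v assume "v \<in> (\<lambda>z. vtuple (map (\<lambda>j. p j i z) js)) ` space (obj Z i)"
    then show "v \<in> space (obj (dsum_list (map W js)) i)" using chain_mapD(6)[OF c] by auto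
  next
    fix v assume "v \<in> space (obj (dsum_list (map W js)) i)"
    from space_dsum_list[OF js this] obtain x
      where x: "\<forall>j\<in>set js. x j \<in> space (obj (W j) i)" "v = vtuple (map x js)" by blast
    obtain z where z: "z \<in> space (obj Z i)" "\<forall>j\<in>set js. p j i z = x j"
      using surj[of x i] x(1) by blast
    have "v = vtuple (map (\<lambda>j. p j i z) js)" unfolding x(2) vtuple_map_eq_iff using z(2) by simp
    then show "v \<in> (\<lambda>z. vtuple (map (\<lambda>j. p j i z) js)) ` space (obj Z i)" using z(1) by blast
  qed
qed

lemma cpx_iso_dsum_list:
  assumes "\<And>j. j \<in> set js \<Longrightarrow> cpx_iso A (W j) T"
  shows "cpx_iso A (dsum_list (map W js)) (dsum_power (length js) T)"
  using assms by (induction js) (auto intro: cpx_iso_dsum cpx_iso_refl[OF bounded_complex_zero])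

section \<open>Transfer of tilting objects\<close>

text \<open>Functor laws hold only on the spaces, so a law of the inner functor has to be moved
  through the outer one by its congruence property.\<close>

lemma cpx_functor_comp:
  assumes "cpx_functor A B Fo Fm" "cpx_functor B C Go Gm"
  shows "cpx_functor A C (\<lambda>X. Go (Fo X)) (\<lambda>X Y f. Gm (Fo X) (Fo Y) (Fm X Y f))"
proof -
  interpret F: cpx_functor A B Fo Fm by fact
  interpret G: cpx_functor B C Go Gm by fact
  show ?thesis
  proof unfold_locales
    fix X Y f f' x i assume f: "chain_map A X Y f" "chain_map A X Y f'" "\<And>i x. x \<in> space (obj X i) \<Longrightarrow> f i x = f' i x"
      and x: "x \<in> space (obj (Go (Fo X)) i)"
    show "Gm (Fo X) (Fo Y) (Fm X Y f) i x = Gm (Fo X) (Fo Y) (Fm X Y f') i x"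
      by (rule G.map_cong[OF F.map_chain_map[OF f(1)] F.map_chain_map[OF f(2)] F.map_cong[OF f] x])
  next
    fix X x i assume X: "bounded_complex A X" and x: "x \<in> space (obj (Go (Fo X)) i)"
    note c = F.map_chain_map[OF chain_map_id[OF X]]
    have "Gm (Fo X) (Fo X) (Fm X X (\<lambda>i x. x)) i x = Gm (Fo X) (Fo X) (\<lambda>i x. x) i x"
      by (rule G.map_cong[OF c chain_map_id[OF chain_mapD(1)[OF c]] F.map_id[OF X] x])
    then show "Gm (Fo X) (Fo X) (Fm X X (\<lambda>i x. x)) i x = x"
      using G.map_id[OF F.obj_bounded[OF X] x] by simp
  next
    fix X Y f Z g x i assume f: "chain_map A X Y f" and g: "chain_map A Y Z g" and x: "x \<in> space (obj (Go (Fo X)) i)"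
    note F = F.map_chain_map[OF f] F.map_chain_map[OF g]
    have "Gm (Fo X) (Fo Z) (Fm X Z (\<lambda>i x. g i (f i x))) i x =
        Gm (Fo X) (Fo Z) (\<lambda>i x. Fm Y Z g i (Fm X Y f i x)) i x"
      by (rule G.map_cong[OF F.map_chain_map[OF chain_map_comp[OF f g]] chain_map_comp[OF F] F.map_comp[OF f g] x])
    then show "Gm (Fo X) (Fo Z) (Fm X Z (\<lambda>i x. g i (f i x))) i x =
        Gm (Fo Y) (Fo Z) (Fm Y Z g) i (Gm (Fo X) (Fo Y) (Fm X Y f) i x)"
      using G.map_comp[OF F x] by simp
  qed (auto intro: F.map_chain_map G.map_chain_map F.map_quasi_iso G.map_quasi_iso)
qed

lemma zmap_comp: "zmap (\<lambda>X. Go (Fo X)) (\<lambda>X Y f. Gm (Fo X) (Fo Y) (Fm X Y f)) u = zmap Go Gm (zmap Fo Fm u)"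
  by (induction u) auto

text \<open>
  If \<open>p\<close> exhibits every \<open>Y\<close> as a natural direct summand of \<open>F (R Y)\<close>, then a morphism vanishes as
  soon as \<open>R\<close> kills it, and every object lies in the thick subcategory generated by the image of \<open>F\<close>.
\<close>

locale separable_pair =
  F: coord_functor A B J Fo Fm c + R: coord_functor B A J' Ro Rm c'
  for A :: "('k::field, 'a) module" and B :: "('k, 'b) module" and J :: "'j set" and Fo Fm c
    and J' :: "'l set" and Ro Rm c' +
  fixes p :: "('k, 'b) cpx \<Rightarrow> 'k cmap"
  assumes counit_map: "bounded_complex B Y \<Longrightarrow> chain_map B (F.FC (R.FC Y)) Y (p Y)"
    and counit_natural: "chain_map B X Y f \<Longrightarrow> t \<in> space (obj (F.FC (R.FC X)) i) \<Longrightarrow>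
      p Y i (F.FM (R.FC X) (R.FC Y) (R.FM X Y f) i t) = f i (p X i t)"
    and counit_split: "bounded_complex B Y \<Longrightarrow>
      \<exists>Z \<Phi>. bounded_complex B Z \<and> quasi_iso B (F.FC (R.FC Y)) (dsum Y Z) \<Phi> \<and>
        (\<forall>i. \<forall>t\<in>space (obj (F.FC (R.FC Y)) i). vfst (\<Phi> i t) = p Y i t)"
begin

text \<open>The section is the inclusion of Y into Y \<oplus> Z followed by the inverse of \<Phi>.
  As \<Phi> is only assumed to be a quasi-isomorphism, it is a zigzag and not a chain map.\<close>

lemma counit_section:
  assumes Y: "bounded_complex B Y"
  obtains s where "dhom B Y (F.FC (R.FC Y)) s"
    "deq B Y Y (Comp (Arr (F.FC (R.FC Y)) (p Y) Y) s) (did Y)"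
proof -
  let ?FR = "F.FC (R.FC Y)"
  obtain Z \<Phi> where Z: "bounded_complex B Z" and q: "quasi_iso B ?FR (dsum Y Z) \<Phi>"
    and p: "\<And>i t. t \<in> space (obj ?FR i) \<Longrightarrow> vfst (\<Phi> i t) = p Y i t"
    using counit_split[OF Y] by blast
  let ?D = "dsum Y Z"
  let ?in = "Arr Y (\<lambda>i y. vpair y 0) ?D" and ?pr = "Arr ?D (\<lambda>i. vfst) Y"
    and ?ph = "Arr ?FR \<Phi> ?D" and ?ih = "Inv ?FR \<Phi> ?D"
  have ci: "chain_map B Y ?D (\<lambda>i y. vpair y 0)"
    by (rule chain_map_vpair[OF chain_map_id[OF Y] chain_map_zero[OF Y Z]])
  note cp = chain_map_vfst[OF Y Z] and cq = quasi_isoD(1)[OF q]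
  note h = dhom_arr[OF ci] dhom_inv[OF q] dhom_arr[OF cq] dhom_arr[OF cp] dhom_arr[OF counit_map[OF Y]]
  have s: "dhom B Y ?FR (Comp ?ih ?in)" by (rule dhom_comp[OF h(1,2)])
  have "deq B Y Y (Comp (Arr ?FR (p Y) Y) (Comp ?ih ?in)) (Comp (Comp ?pr ?ph) (Comp ?ih ?in))"
    by (rule deq_comp_right[OF s deq_sym[OF deq_arr_comp[OF cq cp counit_map[OF Y] p]]])
  also have "deq B Y Y \<dots> (Comp ?pr (Comp ?ph (Comp ?ih ?in)))"
    by (rule deq_assoc[OF s h(3,4)])
  also have "deq B Y Y \<dots> (Comp ?pr ?in)"
    by (rule deq_comp_left[OF h(4) deq_cancel_left[OF deq_inv_right[OF q] h(1,2,3)]])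
  also have "deq B Y Y \<dots> (did Y)"
    unfolding did_def by (rule deq_arr_comp[OF ci cp chain_map_id[OF Y]]) simp
  finally show ?thesis using that[OF s] by blast
qed

text \<open>Naturality of p gives u p_X = p_Y F(R u), where R u is zero by assumption. Hence u p_X
  vanishes, and p_X is a split epimorphism.\<close>

lemma hom_zero_reflect:
  assumes u: "dhom B X Y u" and z: "hom_zero A (R.FC X) (R.FC Y)"
  shows "deq B X Y u (zero_mor X Y)"
proof -
  let ?FRX = "F.FC (R.FC X)" and ?FRY = "F.FC (R.FC Y)"
  note X = dhom_bounded[OF u, THEN conjunct1] and Y = dhom_bounded[OF u, THEN conjunct2]
  obtain s where s: "dhom B X ?FRX s" "deq B X X (Comp (Arr ?FRX (p X) X) s) (did X)"
    using counit_section[OF X] by metis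
  note pX = dhom_arr[OF counit_map[OF X]] and pY = dhom_arr[OF counit_map[OF Y]]
  have "deq A (R.FC X) (R.FC Y) (zmap R.FC R.FM u) (zero_mor (R.FC X) (R.FC Y))"
    using z R.FC.zmap_dhom[OF u] by (auto simp: hom_zero_def)
  from deq_trans[OF F.FC.zmap_deq[OF this] F.zmap_zero[OF R.bounded_FC[OF X] R.bounded_FC[OF Y]]]
  have 0: "deq B ?FRX ?FRY (zmap F.FC F.FM (zmap R.FC R.FM u)) (zero_mor ?FRX ?FRY)" .
  have "deq B ?FRX Y (Comp (Arr ?FRY (p Y) Y) (zmap F.FC F.FM (zmap R.FC R.FM u))) (Comp u (Arr ?FRX (p X) X))"
    using zmap_natural[where \<eta> = p, OF cpx_functor_comp[OF R.FC.cpx_functor_axioms F.FC.cpx_functor_axioms]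
        cpx_functor_id counit_map counit_natural u]
    by (simp add: zmap_comp zmap_id)
  from deq_sym[OF this]
  have "deq B ?FRX Y (Comp u (Arr ?FRX (p X) X)) (Comp (Arr ?FRY (p Y) Y) (zero_mor ?FRX ?FRY))"
    using deq_comp_left[OF pY 0] by (rule deq_trans)
  also have "deq B ?FRX Y \<dots> (zero_mor ?FRX Y)"
    by (rule zero_comp_right[OF pY F.bounded_FC[OF R.bounded_FC[OF X]]])
  finally show ?thesis by (rule zero_cancel_right[OF s(2,1) pX u])
qed

text \<open>The isomorphism of R F T with a power of T is the only place where invariance of T is
  felt. It reduces the vanishing of morphisms between shifts of F T to the same statement for
  T.\<close>

theorem tilting_FC:
  assumes T: "tilting A T" and iso: "cpx_iso A (R.FC (F.FC T)) (dsum_power n T)"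
  shows "tilting B (F.FC T)"
  unfolding tilting_def
proof (intro conjI allI impI)
  let ?U = "F.FC T"
  have bT: "bounded_complex A T" using T by (simp add: tilting_def)
  show bU: "bounded_complex B ?U" by (rule F.bounded_FC[OF bT])
  show "thick B ?U = {X. bounded_complex B X}"
  proof (intro equalityI subsetI CollectI)
    fix X assume "X \<in> thick B ?U"
    then show "bounded_complex B X" using R.thick_FC by blast
  next
    fix X assume "X \<in> {X. bounded_complex B X}"
    then have X: "bounded_complex B X" by simp
    \<comment> \<open>For a tilting T the thick subcategory contains every bounded complex, in
      particular R X; applying F moves this to the thick subcategory of F T.\<close>
    have "R.FC X \<in> thick A T" using T R.bounded_FC[OF X] by (simp add: tilting_def)
    then have FR: "F.FC (R.FC X) \<in> thick B ?U" using F.thick_FC by blast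
    obtain Z \<Phi> where Z: "bounded_complex B Z" and q: "quasi_iso B (F.FC (R.FC X)) (dsum X Z) \<Phi>"
      using counit_split[OF X] by blast
    from thick.thick_iso[OF FR quasi_iso_diso[OF q]] show "X \<in> thick B ?U"
      by (rule thick.thick_summand[OF _ X Z])
  qed
  fix i u assume i: "i \<noteq> (0::int)" and u: "dhom B ?U (shift i ?U) u"
  have "hom_zero A T (shift i T)" using T i by (simp add: tilting_def hom_zero_iff)
  then have "hom_zero A (dsum_power n T) (dsum_power n (shift i T))"
    by (rule hom_zero_dsum_power[OF _ bT bounded_complex_shift[OF bT]])
  \<comment> \<open>The target is a power as well: shifts commute with powers exactly and with R up
    to isomorphism.\<close>
  moreover have "cpx_iso A (dsum_power n (shift i T)) (R.FC (shift i ?U))"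
  proof -
    have sh: "cpx_functor A A (shift i) (\<lambda>X Y f j. f (j + i))"
      by unfold_locales (auto intro: chain_map_shift quasi_iso_shift)
    have "cpx_iso A (shift i (dsum_power n T)) (shift i (R.FC ?U))"
      by (rule cpx_functor.map_iso[OF sh cpx_iso_sym[OF iso]])
    also have "cpx_iso A \<dots> (R.FC (shift i ?U))" by (rule cpx_iso_sym[OF R.FC_shift[OF bU]])
    finally show ?thesis by (simp add: shift_dsum_power)
  qed
  ultimately have "hom_zero A (R.FC ?U) (R.FC (shift i ?U))"
    using hom_zero_iso cpx_iso_sym[OF iso] by blast
  from hom_zero_reflect[OF u this] show "dequiv B u (Arr ?U (\<lambda>j x. 0) (shift i ?U))" by (rule deqD(3))
qed

end

section \<open>Skew group algebras\<close>

lemma (in abelian_monoid) finsum_single: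
  assumes "finite I" "i \<in> I" "f i \<in> carrier G" "\<And>j. j \<in> I \<Longrightarrow> j \<noteq> i \<Longrightarrow> f j = \<zero>"
  shows "finsum G f I = f i"
proof -
  have c: "f \<in> I \<rightarrow> carrier G" using assms(3,4) by (metis Pi_I zero_closed)
  have "finsum G f I = finsum G (\<lambda>j. if i = j then f j else \<zero>) I"
    using assms c by (intro finsum_cong') auto
  also have "\<dots> = f i" by (rule finsum_singleton[OF assms(2,1) c])
  finally show ?thesis .
qed

lemma (in abelian_monoid) finsum_swap:
  assumes "finite I" "finite J" "\<And>i j. i \<in> I \<Longrightarrow> j \<in> J \<Longrightarrow> f i j \<in> carrier G"
  shows "finsum G (\<lambda>i. finsum G (f i) J) I = finsum G (\<lambda>j. finsum G (\<lambda>i. f i j) I) J"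
  using assms(1,3)
proof (induction I)
  case empty
  then show ?case by (simp add: finsum_zero)
next
  case (insert i I)
  have "finsum G (\<lambda>i. finsum G (f i) J) (insert i I) =
      finsum G (f i) J \<oplus> finsum G (\<lambda>i. finsum G (f i) J) I"
    using insert assms(2) by (intro finsum_insert) (auto intro!: finsum_closed)
  also have "\<dots> = finsum G (f i) J \<oplus> finsum G (\<lambda>j. finsum G (\<lambda>i. f i j) I) J"
    using insert by simp
  also have "\<dots> = finsum G (\<lambda>j. f i j \<oplus> finsum G (\<lambda>i. f i j) I) J"
    using insert assms(2) by (intro finsum_addf[symmetric]) (auto intro!: finsum_closed)
  also have "\<dots> = finsum G (\<lambda>j. finsum G (\<lambda>i. f i j) (insert i I)) J"
    using insert assms(2) by (intro finsum_cong') (auto intro!: finsum_closed)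
  finally show ?case .
qed

lemma finsum_hom:
  assumes "abelian_monoid A" "abelian_monoid B" "finite I" "\<And>i. i \<in> I \<Longrightarrow> f i \<in> carrier A"
    and "\<And>x. x \<in> carrier A \<Longrightarrow> \<phi> x \<in> carrier B"
    and "\<And>x y. x \<in> carrier A \<Longrightarrow> y \<in> carrier A \<Longrightarrow> \<phi> (x \<oplus>\<^bsub>A\<^esub> y) = \<phi> x \<oplus>\<^bsub>B\<^esub> \<phi> y"
    and "\<phi> \<zero>\<^bsub>A\<^esub> = \<zero>\<^bsub>B\<^esub>"
  shows "\<phi> (finsum A f I) = finsum B (\<lambda>i. \<phi> (f i)) I"
proof -
  interpret A: abelian_monoid A by fact
  interpret B: abelian_monoid B by fact
  show ?thesis
    using assms(3,4)
  proof (induction I)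
    case empty
    then show ?case using assms(7) by simp
  next
    case (insert i I)
    then show ?case
      using assms(5,6) by (simp add: A.finsum_closed Pi_def)
  qed
qed

text \<open>The scalar ring is \<open>ring_of_type_algebra\<close>, whose operations are those of
  the field type; the module laws are restated with the operations of the type.\<close>

lemma type_moduleD:
  fixes A :: "('k::field, 'a) module"
  assumes "module (ring_of_type_algebra :: 'k ring) A"
  shows "x \<in> carrier A \<Longrightarrow> k \<odot>\<^bsub>A\<^esub> x \<in> carrier A"
    and "x \<in> carrier A \<Longrightarrow> y \<in> carrier A \<Longrightarrow> k \<odot>\<^bsub>A\<^esub> (x \<oplus>\<^bsub>A\<^esub> y) = k \<odot>\<^bsub>A\<^esub> x \<oplus>\<^bsub>A\<^esub> k \<odot>\<^bsub>A\<^esub> y"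
    and "x \<in> carrier A \<Longrightarrow> (k + l) \<odot>\<^bsub>A\<^esub> x = k \<odot>\<^bsub>A\<^esub> x \<oplus>\<^bsub>A\<^esub> l \<odot>\<^bsub>A\<^esub> x"
    and "x \<in> carrier A \<Longrightarrow> (k * l) \<odot>\<^bsub>A\<^esub> x = k \<odot>\<^bsub>A\<^esub> (l \<odot>\<^bsub>A\<^esub> x)"
    and "x \<in> carrier A \<Longrightarrow> 1 \<odot>\<^bsub>A\<^esub> x = x"
    and "x \<in> carrier A \<Longrightarrow> 0 \<odot>\<^bsub>A\<^esub> x = \<zero>\<^bsub>A\<^esub>"
    and "k \<odot>\<^bsub>A\<^esub> \<zero>\<^bsub>A\<^esub> = \<zero>\<^bsub>A\<^esub>"
proof -
  interpret M: module "ring_of_type_algebra :: 'k ring" A by fact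
  note r = ring_of_type_algebra_def
  show "x \<in> carrier A \<Longrightarrow> k \<odot>\<^bsub>A\<^esub> x \<in> carrier A"
    using M.smult_closed[of k x] by (simp add: r)
  show "x \<in> carrier A \<Longrightarrow> y \<in> carrier A \<Longrightarrow> k \<odot>\<^bsub>A\<^esub> (x \<oplus>\<^bsub>A\<^esub> y) = k \<odot>\<^bsub>A\<^esub> x \<oplus>\<^bsub>A\<^esub> k \<odot>\<^bsub>A\<^esub> y"
    using M.smult_r_distr[of k x y] by (simp add: r)
  show "x \<in> carrier A \<Longrightarrow> (k + l) \<odot>\<^bsub>A\<^esub> x = k \<odot>\<^bsub>A\<^esub> x \<oplus>\<^bsub>A\<^esub> l \<odot>\<^bsub>A\<^esub> x"
    using M.smult_l_distr[of k l x] by (simp add: r)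
  show "x \<in> carrier A \<Longrightarrow> (k * l) \<odot>\<^bsub>A\<^esub> x = k \<odot>\<^bsub>A\<^esub> (l \<odot>\<^bsub>A\<^esub> x)"
    using M.smult_assoc1[of k l x] by (simp add: r)
  show "x \<in> carrier A \<Longrightarrow> 1 \<odot>\<^bsub>A\<^esub> x = x"
    using M.smult_one[of x] by (simp add: r)
  show "x \<in> carrier A \<Longrightarrow> 0 \<odot>\<^bsub>A\<^esub> x = \<zero>\<^bsub>A\<^esub>"
    using M.smult_l_null[of x] by (simp add: r)
  show "k \<odot>\<^bsub>A\<^esub> \<zero>\<^bsub>A\<^esub> = \<zero>\<^bsub>A\<^esub>"
    using M.smult_r_null[of k] by (simp add: r)
qed

lemma fd_algebraD:
  fixes A :: "('k::field, 'a) module"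
  assumes "fd_algebra A"
  shows "ring A" and "module (ring_of_type_algebra :: 'k ring) A"
    and "x \<in> carrier A \<Longrightarrow> y \<in> carrier A \<Longrightarrow> (k \<odot>\<^bsub>A\<^esub> x) \<otimes>\<^bsub>A\<^esub> y = k \<odot>\<^bsub>A\<^esub> (x \<otimes>\<^bsub>A\<^esub> y)"
    and "x \<in> carrier A \<Longrightarrow> y \<in> carrier A \<Longrightarrow> x \<otimes>\<^bsub>A\<^esub> (k \<odot>\<^bsub>A\<^esub> y) = k \<odot>\<^bsub>A\<^esub> (x \<otimes>\<^bsub>A\<^esub> y)"
  using assms by (simp_all add: fd_algebra_def)

text \<open>In \<open>fd_algebra\<close> a linear combination is one sum over the entire generating
  set S. These closure rules let such combinations be used like elements of a span.\<close>

lemma span_closed: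
  fixes A :: "('k::field, 'a) module"
  assumes M: "module (ring_of_type_algebra :: 'k ring) A"
    and S: "finite S" "S \<subseteq> carrier A"
  defines "P \<equiv> \<lambda>x. \<exists>c. x = (\<Oplus>\<^bsub>A\<^esub>s\<in>S. c s \<odot>\<^bsub>A\<^esub> s)"
  shows "P \<zero>\<^bsub>A\<^esub>" and "P x \<Longrightarrow> P y \<Longrightarrow> P (x \<oplus>\<^bsub>A\<^esub> y)" and "P x \<Longrightarrow> P (k \<odot>\<^bsub>A\<^esub> x)" and "s \<in> S \<Longrightarrow> P s"
    and "finite I \<Longrightarrow> (\<And>i. i \<in> I \<Longrightarrow> P (f i)) \<Longrightarrow> P (finsum A f I)"
proof -
  interpret A: abelian_group A using M by (rule module.axioms)
  note cl = type_moduleD(1)[OF M] and distr = type_moduleD(2)[OF M] and add = type_moduleD(3)[OF M]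
    and mul = type_moduleD(4)[OF M] and one = type_moduleD(5)[OF M] and null = type_moduleD(6)[OF M]
    and rnull = type_moduleD(7)[OF M]
  have Sc: "s \<in> carrier A" if "s \<in> S" for s using that S by auto
  have Pc: "x \<in> carrier A" if "P x" for x
    using that by (auto simp: P_def Pi_def cl Sc intro!: A.finsum_closed)
  have "\<zero>\<^bsub>A\<^esub> = (\<Oplus>\<^bsub>A\<^esub>s\<in>S. 0 \<odot>\<^bsub>A\<^esub> s)"
    by (rule A.add.finprod_one_eqI[symmetric]) (simp add: null Sc)
  then show z: "P \<zero>\<^bsub>A\<^esub>" unfolding P_def by (intro exI[of _ "\<lambda>s. 0"])
  show a: "P (x \<oplus>\<^bsub>A\<^esub> y)" if xy: "P x" "P y" for x y
  proof -
    obtain c d where "x = (\<Oplus>\<^bsub>A\<^esub>s\<in>S. c s \<odot>\<^bsub>A\<^esub> s)" "y = (\<Oplus>\<^bsub>A\<^esub>s\<in>S. d s \<odot>\<^bsub>A\<^esub> s)" using xy unfolding P_def by blast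
    then have "x \<oplus>\<^bsub>A\<^esub> y = (\<Oplus>\<^bsub>A\<^esub>s\<in>S. c s \<odot>\<^bsub>A\<^esub> s \<oplus>\<^bsub>A\<^esub> d s \<odot>\<^bsub>A\<^esub> s)"
      using cl Sc by (simp add: A.finsum_addf Pi_def)
    also have "\<dots> = (\<Oplus>\<^bsub>A\<^esub>s\<in>S. (c s + d s) \<odot>\<^bsub>A\<^esub> s)"
      by (rule A.finsum_cong') (auto simp: add cl Sc)
    finally show ?thesis unfolding P_def by (intro exI[of _ "\<lambda>s. c s + d s"])
  qed
  show "P (k \<odot>\<^bsub>A\<^esub> x)" if x: "P x"
  proof -
    obtain c where c: "x = (\<Oplus>\<^bsub>A\<^esub>s\<in>S. c s \<odot>\<^bsub>A\<^esub> s)" using x by (auto simp: P_def)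
    have "k \<odot>\<^bsub>A\<^esub> x = (\<Oplus>\<^bsub>A\<^esub>s\<in>S. k \<odot>\<^bsub>A\<^esub> (c s \<odot>\<^bsub>A\<^esub> s))"
      unfolding c
      by (rule finsum_hom[OF A.abelian_monoid_axioms A.abelian_monoid_axioms S(1)]) (auto simp: cl Sc distr rnull)
    also have "\<dots> = (\<Oplus>\<^bsub>A\<^esub>s\<in>S. (k * c s) \<odot>\<^bsub>A\<^esub> s)"
      by (rule A.finsum_cong') (auto simp: mul cl Sc)
    finally show ?thesis unfolding P_def by (intro exI[of _ "\<lambda>s. k * c s"])
  qed
  show "P s" if s: "s \<in> S"
  proof -
    have "(\<Oplus>\<^bsub>A\<^esub>t\<in>S. (if t = s then 1 else 0) \<odot>\<^bsub>A\<^esub> t) = (if s = s then 1 else 0) \<odot>\<^bsub>A\<^esub> s"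
      by (rule A.finsum_single[OF S(1) s]) (use Sc s in \<open>auto simp: cl null\<close>)
    then show ?thesis using one[OF Sc[OF s]] unfolding P_def by (intro exI[of _ "\<lambda>t. if t = s then 1 else 0"]) simp
  qed
  show "P (finsum A f I)" if "finite I" "\<And>i. i \<in> I \<Longrightarrow> P (f i)"
    using that
  proof (induction I)
    case (insert i I)
    then show ?case using a[of "f i" "finsum A f I"] Pc by (simp add: Pi_def)
  qed (simp add: z)
qed

lemma H_algebraD:
  assumes "H_algebra H A act" and h: "h \<in> carrier H"
  shows "x \<in> carrier A \<Longrightarrow> act h x \<in> carrier A"
    and "x \<in> carrier A \<Longrightarrow> y \<in> carrier A \<Longrightarrow> act h (x \<oplus>\<^bsub>A\<^esub> y) = act h x \<oplus>\<^bsub>A\<^esub> act h y"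
    and "x \<in> carrier A \<Longrightarrow> y \<in> carrier A \<Longrightarrow> act h (x \<otimes>\<^bsub>A\<^esub> y) = act h x \<otimes>\<^bsub>A\<^esub> act h y"
    and "act h \<one>\<^bsub>A\<^esub> = \<one>\<^bsub>A\<^esub>"
    and "x \<in> carrier A \<Longrightarrow> act h (c \<odot>\<^bsub>A\<^esub> x) = c \<odot>\<^bsub>A\<^esub> act h x"
    and "x \<in> carrier A \<Longrightarrow> act \<one>\<^bsub>H\<^esub> x = x"
    and "x \<in> carrier A \<Longrightarrow> g \<in> carrier H \<Longrightarrow> act (h \<otimes>\<^bsub>H\<^esub> g) x = act h (act g x)"
proof -
  have r: "act h \<in> ring_hom A A" and ga: "group_action H (carrier A) act"
    using assms by (auto simp: H_algebra_def)
  show "x \<in> carrier A \<Longrightarrow> act h x \<in> carrier A"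
    and "x \<in> carrier A \<Longrightarrow> y \<in> carrier A \<Longrightarrow> act h (x \<oplus>\<^bsub>A\<^esub> y) = act h x \<oplus>\<^bsub>A\<^esub> act h y"
    and "x \<in> carrier A \<Longrightarrow> y \<in> carrier A \<Longrightarrow> act h (x \<otimes>\<^bsub>A\<^esub> y) = act h x \<otimes>\<^bsub>A\<^esub> act h y"
    and "act h \<one>\<^bsub>A\<^esub> = \<one>\<^bsub>A\<^esub>"
    using ring_hom_closed[OF r] ring_hom_mult[OF r] ring_hom_add[OF r] ring_hom_one[OF r] by auto
  show "x \<in> carrier A \<Longrightarrow> act h (c \<odot>\<^bsub>A\<^esub> x) = c \<odot>\<^bsub>A\<^esub> act h x"
    using assms by (auto simp: H_algebra_def)
  show "x \<in> carrier A \<Longrightarrow> act \<one>\<^bsub>H\<^esub> x = x"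
    using group_action.id_eq_one[OF ga] by (metis restrict_apply')
  show "x \<in> carrier A \<Longrightarrow> g \<in> carrier H \<Longrightarrow> act (h \<otimes>\<^bsub>H\<^esub> g) x = act h (act g x)"
    using group_action.composition_rule[OF ga _ h] by auto
qed

locale skew_setting = comm_group G for G :: "'g monoid" (structure) +
  fixes A :: "('k::field, 'a) module" and act
  assumes finite_G: "finite (carrier G)" and alg: "H_algebra G A act"
begin

lemma fd: "fd_algebra A" using alg by (simp add: H_algebra_def)

sublocale A: ring A by (rule fd_algebraD(1)[OF fd])

lemmas smult_A = type_moduleD[OF fd_algebraD(2)[OF fd]] fd_algebraD(3,4)[OF fd]
lemmas act = H_algebraD[OF alg]

lemma act_zero: "h \<in> carrier G \<Longrightarrow> act h \<zero>\<^bsub>A\<^esub> = \<zero>\<^bsub>A\<^esub>"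
  using act(1)[of h "\<zero>\<^bsub>A\<^esub>"] act(2)[of h "\<zero>\<^bsub>A\<^esub>" "\<zero>\<^bsub>A\<^esub>"] A.add.r_cancel_one' by force

lemma act_finsum:
  "h \<in> carrier G \<Longrightarrow> finite I \<Longrightarrow> (\<And>i. i \<in> I \<Longrightarrow> f i \<in> carrier A) \<Longrightarrow>
    act h (finsum A f I) = (\<Oplus>\<^bsub>A\<^esub>i\<in>I. act h (f i))"
  by (rule finsum_hom[OF A.abelian_monoid_axioms A.abelian_monoid_axioms]) (auto simp: act act_zero)

abbreviation S where "S \<equiv> skew_group_algebra G A act"
abbreviation pure where "pure \<equiv> skew_pure G A"

lemma carrier_S: "f \<in> carrier S \<longleftrightarrow> f \<in> (\<Pi>\<^sub>E g\<in>carrier G. carrier A)"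
  by (simp add: skew_group_algebra_def)

lemma S_apply: "f \<in> carrier S \<Longrightarrow> g \<in> carrier G \<Longrightarrow> f g \<in> carrier A"
  by (auto simp: carrier_S)

lemma S_eqI:
  "f \<in> carrier S \<Longrightarrow> f' \<in> carrier S \<Longrightarrow> (\<And>x. x \<in> carrier G \<Longrightarrow> f x = f' x) \<Longrightarrow> f = f'"
  unfolding carrier_S by (rule PiE_ext)

lemma S_simps:
  "x \<in> carrier G \<Longrightarrow> (f \<oplus>\<^bsub>S\<^esub> f') x = f x \<oplus>\<^bsub>A\<^esub> f' x"
  "x \<in> carrier G \<Longrightarrow> \<zero>\<^bsub>S\<^esub> x = \<zero>\<^bsub>A\<^esub>"
  "x \<in> carrier G \<Longrightarrow> (c \<odot>\<^bsub>S\<^esub> f) x = c \<odot>\<^bsub>A\<^esub> f x"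
  "x \<in> carrier G \<Longrightarrow> (f \<otimes>\<^bsub>S\<^esub> f') x = (\<Oplus>\<^bsub>A\<^esub>g\<in>carrier G. f g \<otimes>\<^bsub>A\<^esub> act g (f' (inv g \<otimes> x)))"
  "\<one>\<^bsub>S\<^esub> = pure \<one>\<^bsub>A\<^esub> \<one>"
  by (auto simp: skew_group_algebra_def)

lemma pure_apply: "x \<in> carrier G \<Longrightarrow> pure l g x = (if x = g then l else \<zero>\<^bsub>A\<^esub>)"
  by (simp add: skew_pure_def)

lemma pure_closed [simp]: "l \<in> carrier A \<Longrightarrow> pure l g \<in> carrier S"
  by (auto simp: carrier_S skew_pure_def)

lemma S_closed [simp]:
  "f \<in> carrier S \<Longrightarrow> f' \<in> carrier S \<Longrightarrow> f \<oplus>\<^bsub>S\<^esub> f' \<in> carrier S"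
  "\<zero>\<^bsub>S\<^esub> \<in> carrier S" "\<one>\<^bsub>S\<^esub> \<in> carrier S"
  "f \<in> carrier S \<Longrightarrow> c \<odot>\<^bsub>S\<^esub> f \<in> carrier S"
  "f \<in> carrier S \<Longrightarrow> f' \<in> carrier S \<Longrightarrow> f \<otimes>\<^bsub>S\<^esub> f' \<in> carrier S"
proof -
  show "f \<otimes>\<^bsub>S\<^esub> f' \<in> carrier S" if "f \<in> carrier S" "f' \<in> carrier S"
    using S_apply that
    by (auto simp: skew_group_algebra_def intro!: A.finsum_closed act)
  show "c \<odot>\<^bsub>S\<^esub> f \<in> carrier S" if "f \<in> carrier S"
    using S_apply[OF that] by (auto simp: skew_group_algebra_def smult_A)
  show "\<one>\<^bsub>S\<^esub> \<in> carrier S" unfolding S_simps(5) by simp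
qed (auto simp: skew_group_algebra_def)

lemma pure_mult:
  assumes f: "f \<in> carrier S" and l: "l \<in> carrier A" and h: "h \<in> carrier G" and x: "x \<in> carrier G"
  shows "(pure l h \<otimes>\<^bsub>S\<^esub> f) x = l \<otimes>\<^bsub>A\<^esub> act h (f (inv h \<otimes> x))"
proof -
  have "(pure l h \<otimes>\<^bsub>S\<^esub> f) x = pure l h h \<otimes>\<^bsub>A\<^esub> act h (f (inv h \<otimes> x))"
    unfolding S_simps(4)[OF x]
    by (rule A.finsum_single[OF finite_G h]) (use f l h x in \<open>auto simp: pure_apply act S_apply\<close>)
  then show ?thesis using h by (simp add: pure_apply)
qed

text \<open>One term of the convolution survives, at g = x h^-1, the only index with g^-1 x =
  h.\<close>

lemma mult_pure:
  assumes f: "f \<in> carrier S" and l: "l \<in> carrier A" and h: "h \<in> carrier G" and x: "x \<in> carrier G"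
  shows "(f \<otimes>\<^bsub>S\<^esub> pure l h) x = f (x \<otimes> inv h) \<otimes>\<^bsub>A\<^esub> act (x \<otimes> inv h) l"
proof -
  have e: "inv (x \<otimes> inv h) \<otimes> x = h" using h x by (simp add: inv_mult_group m_assoc)
  have "(f \<otimes>\<^bsub>S\<^esub> pure l h) x = f (x \<otimes> inv h) \<otimes>\<^bsub>A\<^esub> act (x \<otimes> inv h) (pure l h (inv (x \<otimes> inv h) \<otimes> x))"
    unfolding S_simps(4)[OF x]
  proof (rule A.finsum_single[OF finite_G])
    fix g assume g: "g \<in> carrier G" "g \<noteq> x \<otimes> inv h"
    then have "inv g \<otimes> x \<noteq> h"
      using h x by (metis inv_closed inv_inv inv_solve_left inv_solve_right m_closed)
    then show "f g \<otimes>\<^bsub>A\<^esub> act g (pure l h (inv g \<otimes> x)) = \<zero>\<^bsub>A\<^esub>"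
      using f g h x by (simp add: pure_apply act_zero S_apply)
  qed (use f l h x in \<open>auto simp: e pure_apply act S_apply\<close>)
  then show ?thesis using h by (simp add: e pure_apply)
qed

lemma abelian_group_S: "abelian_group S"
proof (rule abelian_groupI)
  fix f assume f: "f \<in> carrier S"
  have "(\<lambda>g\<in>carrier G. \<ominus>\<^bsub>A\<^esub> f g) \<in> carrier S" using f by (auto simp: carrier_S)
  moreover then have "(\<lambda>g\<in>carrier G. \<ominus>\<^bsub>A\<^esub> f g) \<oplus>\<^bsub>S\<^esub> f = \<zero>\<^bsub>S\<^esub>"
    using f by (intro S_eqI) (auto simp: S_simps S_apply A.l_neg)
  ultimately show "\<exists>y\<in>carrier S. y \<oplus>\<^bsub>S\<^esub> f = \<zero>\<^bsub>S\<^esub>" by blast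
qed (auto intro!: S_eqI simp: S_simps S_apply A.a_ac)

text \<open>Both sides are double sums over factorizations of x. After exchanging the sums, the
  substitution a = b c turns one into the other, and the terms match since the action of b c is that
  of b after that of c.\<close>

lemma S_assoc:
  assumes f: "f \<in> carrier S" "f' \<in> carrier S" "f'' \<in> carrier S"
  shows "(f \<otimes>\<^bsub>S\<^esub> f') \<otimes>\<^bsub>S\<^esub> f'' = f \<otimes>\<^bsub>S\<^esub> (f' \<otimes>\<^bsub>S\<^esub> f'')"
proof (rule S_eqI)
  fix x assume x: "x \<in> carrier G"
  let ?h = "\<lambda>a b. f b \<otimes>\<^bsub>A\<^esub> act b (f' (inv b \<otimes> a)) \<otimes>\<^bsub>A\<^esub> act a (f'' (inv a \<otimes> x))"
  have hc: "?h a b \<in> carrier A" if "a \<in> carrier G" "b \<in> carrier G" for a b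
    using that f x by (auto simp: act(1) S_apply)
  have "((f \<otimes>\<^bsub>S\<^esub> f') \<otimes>\<^bsub>S\<^esub> f'') x =
      (\<Oplus>\<^bsub>A\<^esub>a\<in>carrier G. (\<Oplus>\<^bsub>A\<^esub>b\<in>carrier G. f b \<otimes>\<^bsub>A\<^esub> act b (f' (inv b \<otimes> a))) \<otimes>\<^bsub>A\<^esub> act a (f'' (inv a \<otimes> x)))"
    unfolding S_simps(4)[OF x]
    by (rule A.finsum_cong') (use f x in \<open>auto simp: S_simps(4) act(1) S_apply intro!: A.finsum_closed\<close>)
  also have "\<dots> = (\<Oplus>\<^bsub>A\<^esub>a\<in>carrier G. \<Oplus>\<^bsub>A\<^esub>b\<in>carrier G. ?h a b)"
    by (rule A.finsum_cong'[OF refl _ A.finsum_ldistr[OF finite_G]])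
      (use f x hc in \<open>auto simp: act(1) S_apply intro!: A.finsum_closed\<close>)
  also have "\<dots> = (\<Oplus>\<^bsub>A\<^esub>b\<in>carrier G. \<Oplus>\<^bsub>A\<^esub>a\<in>carrier G. ?h a b)"
    by (rule A.finsum_swap[OF finite_G finite_G hc])
  also have "\<dots> = (\<Oplus>\<^bsub>A\<^esub>b\<in>carrier G. f b \<otimes>\<^bsub>A\<^esub> act b ((f' \<otimes>\<^bsub>S\<^esub> f'') (inv b \<otimes> x)))"
  proof (rule A.finsum_cong')
    fix b assume b: "b \<in> carrier G"
    have bij: "(\<lambda>c. b \<otimes> c) ` carrier G = carrier G"
    proof (intro equalityI subsetI)
      fix a assume a: "a \<in> carrier G"
      then have "a = b \<otimes> (inv b \<otimes> a)" using b by (simp add: m_assoc[symmetric])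
      then show "a \<in> (\<lambda>c. b \<otimes> c) ` carrier G" using a b by blast
    qed (use b in auto)
    have "(\<Oplus>\<^bsub>A\<^esub>a\<in>carrier G. ?h a b) = (\<Oplus>\<^bsub>A\<^esub>c\<in>carrier G. ?h (b \<otimes> c) b)"
      using A.finsum_reindex[of "\<lambda>a. ?h a b" "\<lambda>c. b \<otimes> c" "carrier G"] hc b
      by (simp add: bij inj_on_def Pi_def)
    also have "\<dots> = (\<Oplus>\<^bsub>A\<^esub>c\<in>carrier G. f b \<otimes>\<^bsub>A\<^esub> act b (f' c \<otimes>\<^bsub>A\<^esub> act c (f'' (inv c \<otimes> (inv b \<otimes> x)))))"
    proof (rule A.finsum_cong')
      fix c assume c: "c \<in> carrier G"
      have "inv b \<otimes> (b \<otimes> c) = c" "inv (b \<otimes> c) \<otimes> x = inv c \<otimes> (inv b \<otimes> x)"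
        using b c x by (simp_all add: m_assoc[symmetric] inv_mult_group)
      then show "?h (b \<otimes> c) b = f b \<otimes>\<^bsub>A\<^esub> act b (f' c \<otimes>\<^bsub>A\<^esub> act c (f'' (inv c \<otimes> (inv b \<otimes> x))))"
        using b c x f by (simp add: act S_apply A.m_assoc)
    qed (use b x f in \<open>auto simp: act(1) S_apply\<close>)
    also have "\<dots> = f b \<otimes>\<^bsub>A\<^esub> (\<Oplus>\<^bsub>A\<^esub>c\<in>carrier G. act b (f' c \<otimes>\<^bsub>A\<^esub> act c (f'' (inv c \<otimes> (inv b \<otimes> x)))))"
      by (rule A.finsum_rdistr[symmetric, OF finite_G])
        (use b x f in \<open>auto simp: act(1) S_apply\<close>)
    also have "\<dots> = f b \<otimes>\<^bsub>A\<^esub> act b ((f' \<otimes>\<^bsub>S\<^esub> f'') (inv b \<otimes> x))"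
      using b x f by (simp add: S_simps(4) act_finsum finite_G act S_apply)
    finally show "(\<Oplus>\<^bsub>A\<^esub>a\<in>carrier G. ?h a b) = f b \<otimes>\<^bsub>A\<^esub> act b ((f' \<otimes>\<^bsub>S\<^esub> f'') (inv b \<otimes> x))" .
  qed (use f x in \<open>auto simp: act(1) S_apply\<close>)
  also have "\<dots> = (f \<otimes>\<^bsub>S\<^esub> (f' \<otimes>\<^bsub>S\<^esub> f'')) x"
    by (rule S_simps(4)[OF x, symmetric])
  finally show "((f \<otimes>\<^bsub>S\<^esub> f') \<otimes>\<^bsub>S\<^esub> f'') x = (f \<otimes>\<^bsub>S\<^esub> (f' \<otimes>\<^bsub>S\<^esub> f'')) x" .
qed (use f in auto)

lemma ring_S: "ring S"
proof (rule ringI[OF abelian_group_S monoidI])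
  fix f assume f: "f \<in> carrier S"
  show "\<one>\<^bsub>S\<^esub> \<otimes>\<^bsub>S\<^esub> f = f"
    using f by (intro S_eqI) (auto simp: S_simps(5) pure_mult S_apply act)
  show "f \<otimes>\<^bsub>S\<^esub> \<one>\<^bsub>S\<^esub> = f"
    using f by (intro S_eqI) (auto simp: S_simps(5) mult_pure S_apply act)
next
  fix f f' f'' assume f: "f \<in> carrier S" "f' \<in> carrier S" "f'' \<in> carrier S"
  show "(f \<otimes>\<^bsub>S\<^esub> f') \<otimes>\<^bsub>S\<^esub> f'' = f \<otimes>\<^bsub>S\<^esub> (f' \<otimes>\<^bsub>S\<^esub> f'')" by (rule S_assoc[OF f])
  show "(f \<oplus>\<^bsub>S\<^esub> f') \<otimes>\<^bsub>S\<^esub> f'' = f \<otimes>\<^bsub>S\<^esub> f'' \<oplus>\<^bsub>S\<^esub> f' \<otimes>\<^bsub>S\<^esub> f''"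
  proof (rule S_eqI)
    fix x assume x: "x \<in> carrier G"
    show "((f \<oplus>\<^bsub>S\<^esub> f') \<otimes>\<^bsub>S\<^esub> f'') x = (f \<otimes>\<^bsub>S\<^esub> f'' \<oplus>\<^bsub>S\<^esub> f' \<otimes>\<^bsub>S\<^esub> f'') x"
      using f x by (simp add: S_simps A.l_distr S_apply act A.finsum_addf Pi_def cong: A.finsum_cong)
  qed (use f in auto)
  show "f'' \<otimes>\<^bsub>S\<^esub> (f \<oplus>\<^bsub>S\<^esub> f') = f'' \<otimes>\<^bsub>S\<^esub> f \<oplus>\<^bsub>S\<^esub> f'' \<otimes>\<^bsub>S\<^esub> f'"
  proof (rule S_eqI)
    fix x assume x: "x \<in> carrier G"
    show "(f'' \<otimes>\<^bsub>S\<^esub> (f \<oplus>\<^bsub>S\<^esub> f')) x = (f'' \<otimes>\<^bsub>S\<^esub> f \<oplus>\<^bsub>S\<^esub> f'' \<otimes>\<^bsub>S\<^esub> f') x"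
      using f x by (simp add: S_simps A.r_distr S_apply act A.finsum_addf Pi_def cong: A.finsum_cong)
  qed (use f in auto)
qed auto

sublocale S: ring S by (rule ring_S)

lemma pure_linear:
  "l \<in> carrier A \<Longrightarrow> m \<in> carrier A \<Longrightarrow> pure (l \<oplus>\<^bsub>A\<^esub> m) g = pure l g \<oplus>\<^bsub>S\<^esub> pure m g"
  "pure \<zero>\<^bsub>A\<^esub> g = \<zero>\<^bsub>S\<^esub>"
  "l \<in> carrier A \<Longrightarrow> pure (c \<odot>\<^bsub>A\<^esub> l) g = c \<odot>\<^bsub>S\<^esub> pure l g"
  by (auto intro!: S_eqI simp: S_simps pure_apply smult_A)

lemma pure_pure:
  assumes "l \<in> carrier A" "m \<in> carrier A" "g \<in> carrier G" "h \<in> carrier G"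
  shows "pure l g \<otimes>\<^bsub>S\<^esub> pure m h = pure (l \<otimes>\<^bsub>A\<^esub> act g m) (g \<otimes> h)"
proof (rule S_eqI)
  fix x assume x: "x \<in> carrier G"
  have "inv g \<otimes> x = h \<longleftrightarrow> x = g \<otimes> h"
    using assms x by (metis inv_closed inv_inv inv_solve_left)
  then show "(pure l g \<otimes>\<^bsub>S\<^esub> pure m h) x = pure (l \<otimes>\<^bsub>A\<^esub> act g m) (g \<otimes> h) x"
    using assms x by (simp add: pure_mult pure_apply act_zero)
qed (use assms in \<open>auto simp: act\<close>)

lemma finsum_S_apply:
  assumes "finite I" "\<And>i. i \<in> I \<Longrightarrow> f i \<in> carrier S" "x \<in> carrier G"
  shows "(finsum S f I) x = (\<Oplus>\<^bsub>A\<^esub>i\<in>I. f i x)"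
  by (rule finsum_hom[where \<phi> = "\<lambda>f. f x", OF S.abelian_monoid_axioms A.abelian_monoid_axioms assms(1,2)])
    (use assms(3) in \<open>auto simp: S_simps S_apply\<close>)

lemma S_decomp:
  assumes f: "f \<in> carrier S"
  shows "f = (\<Oplus>\<^bsub>S\<^esub>g\<in>carrier G. pure (f g) g)"
proof (rule S_eqI[OF f])
  show "(\<Oplus>\<^bsub>S\<^esub>g\<in>carrier G. pure (f g) g) \<in> carrier S"
    using f by (auto intro!: S.finsum_closed simp: S_apply)
  fix x assume x: "x \<in> carrier G"
  have "(\<Oplus>\<^bsub>S\<^esub>g\<in>carrier G. pure (f g) g) x = (\<Oplus>\<^bsub>A\<^esub>g\<in>carrier G. pure (f g) g x)"
    using f x by (intro finsum_S_apply finite_G) (auto simp: S_apply)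
  also have "\<dots> = pure (f x) x x"
    by (rule A.finsum_single[OF finite_G x]) (use f x in \<open>auto simp: pure_apply S_apply\<close>)
  finally show "f x = (\<Oplus>\<^bsub>S\<^esub>g\<in>carrier G. pure (f g) g) x" using x by (simp add: pure_apply)
qed

lemma S_smult:
  assumes "f \<in> carrier S" "f' \<in> carrier S"
  shows "k \<odot>\<^bsub>S\<^esub> (f \<oplus>\<^bsub>S\<^esub> f') = k \<odot>\<^bsub>S\<^esub> f \<oplus>\<^bsub>S\<^esub> k \<odot>\<^bsub>S\<^esub> f'"
    and "(k + l) \<odot>\<^bsub>S\<^esub> f = k \<odot>\<^bsub>S\<^esub> f \<oplus>\<^bsub>S\<^esub> l \<odot>\<^bsub>S\<^esub> f"
    and "(k * l) \<odot>\<^bsub>S\<^esub> f = k \<odot>\<^bsub>S\<^esub> (l \<odot>\<^bsub>S\<^esub> f)"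
    and "1 \<odot>\<^bsub>S\<^esub> f = f"
    and "0 \<odot>\<^bsub>S\<^esub> f = \<zero>\<^bsub>S\<^esub>"
    and "k \<odot>\<^bsub>S\<^esub> \<zero>\<^bsub>S\<^esub> = \<zero>\<^bsub>S\<^esub>"
    and "(k \<odot>\<^bsub>S\<^esub> f) \<otimes>\<^bsub>S\<^esub> f' = k \<odot>\<^bsub>S\<^esub> (f \<otimes>\<^bsub>S\<^esub> f')"
    and "f \<otimes>\<^bsub>S\<^esub> (k \<odot>\<^bsub>S\<^esub> f') = k \<odot>\<^bsub>S\<^esub> (f \<otimes>\<^bsub>S\<^esub> f')"
proof -
  have ks: "k \<odot>\<^bsub>A\<^esub> finsum A h (carrier G) = (\<Oplus>\<^bsub>A\<^esub>g\<in>carrier G. k \<odot>\<^bsub>A\<^esub> h g)"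
    if "\<And>g. g \<in> carrier G \<Longrightarrow> h g \<in> carrier A" for h
    by (rule finsum_hom[OF A.abelian_monoid_axioms A.abelian_monoid_axioms finite_G that]) (auto simp: smult_A)
  show "(k \<odot>\<^bsub>S\<^esub> f) \<otimes>\<^bsub>S\<^esub> f' = k \<odot>\<^bsub>S\<^esub> (f \<otimes>\<^bsub>S\<^esub> f')"
  proof (rule S_eqI)
    fix x assume x: "x \<in> carrier G"
    show "((k \<odot>\<^bsub>S\<^esub> f) \<otimes>\<^bsub>S\<^esub> f') x = (k \<odot>\<^bsub>S\<^esub> (f \<otimes>\<^bsub>S\<^esub> f')) x"
      unfolding S_simps(3,4)[OF x]
      by (subst ks) (use assms x in \<open>auto simp: S_simps(3) S_apply act smult_A intro!: A.finsum_cong'\<close>)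
  qed (use assms in auto)
  show "f \<otimes>\<^bsub>S\<^esub> (k \<odot>\<^bsub>S\<^esub> f') = k \<odot>\<^bsub>S\<^esub> (f \<otimes>\<^bsub>S\<^esub> f')"
  proof (rule S_eqI)
    fix x assume x: "x \<in> carrier G"
    show "(f \<otimes>\<^bsub>S\<^esub> (k \<odot>\<^bsub>S\<^esub> f')) x = (k \<odot>\<^bsub>S\<^esub> (f \<otimes>\<^bsub>S\<^esub> f')) x"
      unfolding S_simps(3,4)[OF x]
      by (subst ks) (use assms x in \<open>auto simp: S_simps(3) S_apply act smult_A intro!: A.finsum_cong'\<close>)
  qed (use assms in auto)
qed (use assms in \<open>auto intro!: S_eqI simp: S_simps S_apply smult_A\<close>)

lemma module_S: "module (ring_of_type_algebra :: 'k ring) S"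
  by (rule moduleI[OF cring_from_type_algebra abelian_group_S]) (auto simp: ring_of_type_algebra_def S_smult)

text \<open>If B spans A, the elements s \<otimes> g with s in B and g in G span the skew group
  algebra: f is the sum of the f(g) \<otimes> g, and each f(g) is expanded in B.\<close>

lemma fd_S: "fd_algebra S"
  unfolding fd_algebra_def
proof (intro conjI allI ballI)
  show "ring S" by (rule ring_S)
  show "module (ring_of_type_algebra :: 'k ring) S" by (rule module_S)
  obtain B where B: "finite B" "B \<subseteq> carrier A" "\<And>x. x \<in> carrier A \<Longrightarrow> \<exists>c. x = (\<Oplus>\<^bsub>A\<^esub>s\<in>B. c s \<odot>\<^bsub>A\<^esub> s)"
    using fd unfolding fd_algebra_def by blast
  let ?B = "(\<lambda>(s, g). pure s g) ` (B \<times> carrier G)"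
  have fB: "finite ?B" and cB: "?B \<subseteq> carrier S" using B finite_G by auto
  note sp = span_closed[OF module_S fB cB]
  have "\<exists>c. f = (\<Oplus>\<^bsub>S\<^esub>s\<in>?B. c s \<odot>\<^bsub>S\<^esub> s)" if f: "f \<in> carrier S" for f
  proof -
    have "\<exists>c. pure (f g) g = (\<Oplus>\<^bsub>S\<^esub>s\<in>?B. c s \<odot>\<^bsub>S\<^esub> s)" if g: "g \<in> carrier G" for g
    proof -
      obtain c where c: "f g = (\<Oplus>\<^bsub>A\<^esub>s\<in>B. c s \<odot>\<^bsub>A\<^esub> s)" using B(3)[OF S_apply[OF f g]] by blast
      have "pure (f g) g = (\<Oplus>\<^bsub>S\<^esub>s\<in>B. pure (c s \<odot>\<^bsub>A\<^esub> s) g)"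
        unfolding c
        by (rule finsum_hom[OF A.abelian_monoid_axioms S.abelian_monoid_axioms B(1)])
          (use B(2) in \<open>auto simp: pure_linear smult_A\<close>)
      also have "\<dots> = (\<Oplus>\<^bsub>S\<^esub>s\<in>B. c s \<odot>\<^bsub>S\<^esub> pure s g)"
        by (rule S.finsum_cong') (use B(2) in \<open>auto simp: pure_linear\<close>)
      finally show ?thesis
        using sp(5)[OF B(1), of "\<lambda>s. c s \<odot>\<^bsub>S\<^esub> pure s g"] sp(3)[OF sp(4)] g by auto
    qed
    then show ?thesis
      using sp(5)[OF finite_G, of "\<lambda>g. pure (f g) g"] S_decomp[OF f] by simp
  qed
  then show "\<exists>B. finite B \<and> B \<subseteq> carrier S \<and> (\<forall>x\<in>carrier S. \<exists>c. x = (\<Oplus>\<^bsub>S\<^esub>s\<in>B. c s \<odot>\<^bsub>S\<^esub> s))"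
    using fB cB by blast
qed (auto simp: S_smult)

end

section \<open>Tensor products with free bimodules\<close>

lemma tensor_universal:
  assumes "is_tensor B C M N (T, \<tau>)" "balanced B M N \<beta>"
  shows "\<exists>\<phi>. linear_on (space T) \<phi> \<and> (\<forall>x\<in>space M. \<forall>n\<in>bspace N. \<phi> (\<tau> x n) = \<beta> x n) \<and>
    (\<forall>\<psi>. linear_on (space T) \<psi> \<and> (\<forall>x\<in>space M. \<forall>n\<in>bspace N. \<psi> (\<tau> x n) = \<beta> x n) \<longrightarrow>
      (\<forall>t\<in>space T. \<psi> t = \<phi> t))"
  using assms(1) unfolding is_tensor_def prod.case by (elim conjE allE[of _ \<beta>] impE) (rule assms(2))

lemma tensor_lift:
  assumes "is_tensor B C M N (T, \<tau>)" "balanced B M N \<beta>"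
  obtains \<phi> where "linear_on (space T) \<phi>" "\<And>x n. x \<in> space M \<Longrightarrow> n \<in> bspace N \<Longrightarrow> \<phi> (\<tau> x n) = \<beta> x n"
proof -
  obtain \<phi> where \<phi>: "linear_on (space T) \<phi>" "\<forall>x\<in>space M. \<forall>n\<in>bspace N. \<phi> (\<tau> x n) = \<beta> x n"
    using tensor_universal[OF assms] by (elim exE conjE)
  show thesis by (rule that[OF \<phi>(1)]) (use \<phi>(2) in blast)
qed

lemma balanced_linear_comp:
  assumes t: "is_tensor B C M N (T, \<tau>)" and M: "right_module B M" and f: "linear_on (space T) \<phi>"
  shows "balanced B M N (\<lambda>x n. \<phi> (\<tau> x n))"
proof -
  have b: "balanced B M N \<tau>" and \<tau>: "\<And>x n. x \<in> space M \<Longrightarrow> n \<in> bspace N \<Longrightarrow> \<tau> x n \<in> space T"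
    using t by (auto simp: is_tensor_def)
  show ?thesis
    using b \<tau> linear_onD[OF f]
    unfolding balanced_def linear_on_def by simp
qed

text \<open>Both maps lift the same balanced map, \<psi> composed with \<tau>, so the uniqueness
  clause of the universal property identifies them.\<close>

lemma tensor_ext:
  assumes t: "is_tensor B C M N (T, \<tau>)" and M: "right_module B M"
    and f: "linear_on (space T) \<phi>" and g: "linear_on (space T) \<psi>"
    and eq: "\<And>x n. x \<in> space M \<Longrightarrow> n \<in> bspace N \<Longrightarrow> \<phi> (\<tau> x n) = \<psi> (\<tau> x n)"
    and v: "v \<in> space T"
  shows "\<phi> v = \<psi> v"
proof -
  obtain \<chi> where \<chi>: "\<forall>\<psi>'. linear_on (space T) \<psi>' \<and>
      (\<forall>x\<in>space M. \<forall>n\<in>bspace N. \<psi>' (\<tau> x n) = \<psi> (\<tau> x n)) \<longrightarrow> (\<forall>t\<in>space T. \<psi>' t = \<chi> t)"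
    using tensor_universal[OF t balanced_linear_comp[OF t M g]] by (elim exE conjE)
  have "\<phi> v = \<chi> v" using \<chi> f eq v by simp
  moreover have "\<psi> v = \<chi> v" using \<chi> g v by simp
  ultimately show ?thesis by simp
qed


lemma linear_on_sum:
  assumes "\<And>j. j \<in> J \<Longrightarrow> linear_on V (f j)"
  shows "linear_on V (\<lambda>x. \<Sum>j\<in>J. f j x)"
  using linear_onD[OF assms]
  by (auto simp: linear_on_def sum.distrib vs.scale_sum_right intro!: sum.cong)

lemma linear_on_comp:
  "linear_on V f \<Longrightarrow> f ` V \<subseteq> W \<Longrightarrow> linear_on W g \<Longrightarrow> linear_on V (\<lambda>x. g (f x))"
  unfolding linear_on_def by (simp add: image_subset_iff)

text \<open>\<open>N\<close> is free as a left \<open>B\<close>-module with basis \<open>e\<close> and coordinate functions \<open>\<kappa>\<close>.\<close>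

locale free_bimodule =
  fixes B :: "('k::field, 'b) module" and C :: "('k, 'c) module" and N :: "('b, 'c, 'n) bimodule"
    and J :: "'j set" and e :: "'j \<Rightarrow> 'n" and \<kappa> :: "'j \<Rightarrow> 'n \<Rightarrow> 'b"
  assumes ring_B: "ring B" and finite_J: "finite J"
    and tensor_ex: "\<And>M. right_module B M \<Longrightarrow> \<exists>p. is_tensor B C M N p"
    and basis: "\<And>j. j \<in> J \<Longrightarrow> e j \<in> bspace N"
    and coef: "\<And>j n. j \<in> J \<Longrightarrow> n \<in> bspace N \<Longrightarrow> \<kappa> j n \<in> carrier B"
    and coef_add: "\<And>j n n'. j \<in> J \<Longrightarrow> n \<in> bspace N \<Longrightarrow> n' \<in> bspace N \<Longrightarrow> \<kappa> j (badd N n n') = \<kappa> j n \<oplus>\<^bsub>B\<^esub> \<kappa> j n'"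
    and coef_lact: "\<And>j b n. j \<in> J \<Longrightarrow> b \<in> carrier B \<Longrightarrow> n \<in> bspace N \<Longrightarrow> \<kappa> j (blact N b n) = b \<otimes>\<^bsub>B\<^esub> \<kappa> j n"
    and coef_basis: "\<And>i j. i \<in> J \<Longrightarrow> j \<in> J \<Longrightarrow> \<kappa> j (e i) = (if i = j then \<one>\<^bsub>B\<^esub> else \<zero>\<^bsub>B\<^esub>)"
    and expand: "\<And>M \<beta> x n. right_module B M \<Longrightarrow> balanced B M N \<beta> \<Longrightarrow> x \<in> space M \<Longrightarrow> n \<in> bspace N \<Longrightarrow>
      \<beta> x n = (\<Sum>j\<in>J. \<beta> (ract M x (\<kappa> j n)) (e j))"
    and bract_closed: "\<And>n c. n \<in> bspace N \<Longrightarrow> c \<in> carrier C \<Longrightarrow> bract N n c \<in> bspace N"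
begin

abbreviation "TM M \<equiv> tensor_module B C M N"
abbreviation "te M \<equiv> tensor_elt B C M N"

lemma is_tensor_TM: "right_module B M \<Longrightarrow> is_tensor B C M N (TM M, te M)"
  using someI_ex[OF tensor_ex] by (simp add: tensor_module_def tensor_elt_def tensor_def)

lemma TM_module: "right_module B M \<Longrightarrow> right_module C (TM M)"
  and te_balanced: "right_module B M \<Longrightarrow> balanced B M N (te M)"
  and te_closed: "right_module B M \<Longrightarrow> x \<in> space M \<Longrightarrow> n \<in> bspace N \<Longrightarrow> te M x n \<in> space (TM M)"
  and te_ract: "right_module B M \<Longrightarrow> x \<in> space M \<Longrightarrow> n \<in> bspace N \<Longrightarrow> c \<in> carrier C \<Longrightarrow>
    ract (TM M) (te M x n) c = te M x (bract N n c)"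
  using is_tensor_TM by (auto simp: is_tensor_def)

lemma TM_ext:
  assumes "right_module B M" "linear_on (space (TM M)) \<phi>" "linear_on (space (TM M)) \<psi>"
    and "\<And>x n. x \<in> space M \<Longrightarrow> n \<in> bspace N \<Longrightarrow> \<phi> (te M x n) = \<psi> (te M x n)" "v \<in> space (TM M)"
  shows "\<phi> v = \<psi> v"
  by (rule tensor_ext[OF is_tensor_TM[OF assms(1)] assms(1-3) _ assms(5)]) (rule assms(4))

lemma te_linear: "right_module B M \<Longrightarrow> n \<in> bspace N \<Longrightarrow> linear_on (space M) (\<lambda>x. te M x n)"
  using te_balanced by (auto simp: balanced_def)

lemma balanced_coef:
  assumes M: "right_module B M" and j: "j \<in> J"
  shows "balanced B M N (\<lambda>x n. ract M x (\<kappa> j n))"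
  unfolding balanced_def
  using right_moduleD[OF M] coef[OF j] coef_add[OF j] coef_lact[OF j] by simp

text \<open>The linear map sending x \<otimes> n to x \<kappa>_j(n). The universal property yields
  it, uniquely on the tensor product; in general it is not a module homomorphism.\<close>

definition coord where
  "coord M j = (SOME \<phi>. linear_on (space (TM M)) \<phi> \<and>
     (\<forall>x\<in>space M. \<forall>n\<in>bspace N. \<phi> (te M x n) = ract M x (\<kappa> j n)))"

lemma coord:
  assumes M: "right_module B M" and j: "j \<in> J"
  shows "linear_on (space (TM M)) (coord M j)"
    and "x \<in> space M \<Longrightarrow> n \<in> bspace N \<Longrightarrow> coord M j (te M x n) = ract M x (\<kappa> j n)"
proof -
  obtain \<phi> where "linear_on (space (TM M)) \<phi>"
      "\<And>x n. x \<in> space M \<Longrightarrow> n \<in> bspace N \<Longrightarrow> \<phi> (te M x n) = ract M x (\<kappa> j n)"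
    using tensor_lift[OF is_tensor_TM[OF M] balanced_coef[OF M j]] by blast
  then have "\<exists>\<phi>. linear_on (space (TM M)) \<phi> \<and>
     (\<forall>x\<in>space M. \<forall>n\<in>bspace N. \<phi> (te M x n) = ract M x (\<kappa> j n))" by blast
  from someI_ex[OF this]
  show "linear_on (space (TM M)) (coord M j)"
    and "x \<in> space M \<Longrightarrow> n \<in> bspace N \<Longrightarrow> coord M j (te M x n) = ract M x (\<kappa> j n)"
    by (auto simp: coord_def)
qed

text \<open>The uniqueness half of the universal property forces elementary tensors to span:
  otherwise some nonzero linear map would kill all of them and hence agree with zero.\<close>

lemma TM_span:
  assumes M: "right_module B M" and W: "vs.subspace W"
    and gen: "\<And>x n. x \<in> space M \<Longrightarrow> n \<in> bspace N \<Longrightarrow> te M x n \<in> W" and v: "v \<in> space (TM M)"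
  shows "v \<in> W"
proof -
  let ?G = "{te M x n |x n. x \<in> space M \<and> n \<in> bspace N}"
  let ?P = "vs.span ?G"
  interpret vsp: vector_space_pair "vscale :: 'k \<Rightarrow> 'k vec \<Rightarrow> 'k vec" "vscale :: 'k \<Rightarrow> 'k vec \<Rightarrow> 'k vec" ..
  have P: "v \<in> ?P"
  proof (rule ccontr)
    assume nv: "v \<notin> ?P"
    obtain D where D: "D \<subseteq> ?G" "vs.independent D" "vs.span D = ?P" by (rule basis_in)
    have nD: "v \<notin> vs.span D" using nv D(3) by metis
    have ind: "vs.independent (insert v D)" by (rule vs.independent_insertI[OF nD D(2)])
    \<comment> \<open>f vanishes on a basis of the span of the elementary tensors and fixes
      v.\<close>
    obtain f where f: "Vector_Spaces.linear vscale vscale f" "\<And>x. x \<in> insert v D \<Longrightarrow> f x = (if x = v then v else 0)"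
      using vsp.linear_independent_extend[OF ind, of "\<lambda>x. if x = v then v else 0"] by blast
    interpret f: Vector_Spaces.linear vscale vscale f by (rule f(1))
    have vD: "v \<notin> D" using nD vs.span_base by blast
    have f0: "f x = 0" if "x \<in> ?P" for x
      by (rule f.eq_0_on_span[of D]) (use that D(3) f(2) vD in auto)
    have "f v = (\<lambda>x. 0) v"
    proof (rule TM_ext[OF M _ _ _ v])
      show "linear_on (space (TM M)) f" by (simp add: linear_on_def f.add f.scale)
      show "linear_on (space (TM M)) (\<lambda>x. 0)" by (simp add: linear_on_def)
      show "f (te M x n) = 0" if "x \<in> space M" "n \<in> bspace N" for x n
        by (rule f0, rule vs.span_base) (use that in blast)
    qed
    then have "v = 0" using f(2)[of v] by simp
    then show False using nv vs.span_zero by blast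
  qed
  have "?P \<subseteq> W" by (rule vs.span_minimal[OF _ W]) (use gen in blast)
  then show ?thesis using P by blast
qed

text \<open>The universal property gives a map with values in arbitrary sequences. That the values
  lie in M is visible on elementary tensors and extends to their span.\<close>

lemma coord_closed:
  assumes M: "right_module B M" and j: "j \<in> J" and t: "t \<in> space (TM M)"
  shows "coord M j t \<in> space M"
proof -
  let ?W = "{v \<in> space (TM M). coord M j v \<in> space M}"
  note lin = coord(1)[OF M j]
  note S = right_module_subspace[OF M] and T = right_module_subspace[OF TM_module[OF M]]
  have "t \<in> ?W"
  proof (rule TM_span[OF M _ _ t])
    show "vs.subspace ?W"
      unfolding vs.subspace_def
      using vs.subspace_0[OF T] vs.subspace_0[OF S] vs.subspace_add[OF T] vs.subspace_add[OF S]
        vs.subspace_scale[OF T] vs.subspace_scale[OF S] linear_onD[OF lin] linear_on_subspace(1)[OF lin T]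
      by simp
    show "te M x n \<in> ?W" if "x \<in> space M" "n \<in> bspace N" for x n
      using that te_closed[OF M that] coord(2)[OF M j that] right_moduleD(1)[OF M _ coef[OF j]] by simp
  qed
  then show ?thesis by simp
qed

text \<open>The axiom \<open>expand\<close>, applied to the universal balanced map, is the formula
  on elementary tensors, and both sides are linear. Freeness is phrased through balanced maps
  because a bimodule record has an addition but no zero from which to form sums.\<close>

lemma TM_expand:
  assumes M: "right_module B M" and t: "t \<in> space (TM M)"
  shows "t = (\<Sum>j\<in>J. te M (coord M j t) (e j))"
proof (rule TM_ext[OF M _ _ _ t])
  show "linear_on (space (TM M)) (\<lambda>t. t)" by (simp add: linear_on_def)
  show "linear_on (space (TM M)) (\<lambda>t. \<Sum>j\<in>J. te M (coord M j t) (e j))"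
    by (intro linear_on_sum linear_on_comp[OF coord(1)[OF M] _ te_linear[OF M basis]])
      (auto simp: coord_closed[OF M])
  fix x n assume x: "x \<in> space M" "n \<in> bspace N"
  show "te M x n = (\<Sum>j\<in>J. te M (coord M j (te M x n)) (e j))"
    using expand[OF M te_balanced[OF M] x] coord(2)[OF M _ x] by simp
qed

lemma tensor_map:
  assumes M: "right_module B M" and M': "right_module B M'" and f: "rmodule_hom B M M' f"
  shows "linear_on (space (TM M)) (tensor_map B C M M' N f)"
    and "x \<in> space M \<Longrightarrow> n \<in> bspace N \<Longrightarrow> tensor_map B C M M' N f (te M x n) = te M' (f x) n"
proof -
  have "balanced B M N (\<lambda>x n. te M' (f x) n)"
    using te_balanced[OF M'] rmodule_homD[OF f]
    by (auto simp: balanced_def linear_on_def)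
  then obtain \<phi> where "linear_on (space (TM M)) \<phi>"
      "\<And>x n. x \<in> space M \<Longrightarrow> n \<in> bspace N \<Longrightarrow> \<phi> (te M x n) = te M' (f x) n"
    using tensor_lift[OF is_tensor_TM[OF M]] by blast
  then have "\<exists>\<phi>. linear_on (space (TM M)) \<phi> \<and>
     (\<forall>x\<in>space M. \<forall>n\<in>bspace N. \<phi> (te M x n) = te M' (f x) n)" by blast
  from someI_ex[OF this]
  show "linear_on (space (TM M)) (tensor_map B C M M' N f)"
    and "x \<in> space M \<Longrightarrow> n \<in> bspace N \<Longrightarrow> tensor_map B C M M' N f (te M x n) = te M' (f x) n"
    by (auto simp: tensor_map_def)
qed

lemma tensor_map_closed:
  assumes M: "right_module B M" and M': "right_module B M'" and f: "rmodule_hom B M M' f"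
    and t: "t \<in> space (TM M)"
  shows "tensor_map B C M M' N f t \<in> space (TM M')"
proof -
  let ?f = "tensor_map B C M M' N f"
  let ?W = "{v \<in> space (TM M). ?f v \<in> space (TM M')}"
  note lin = tensor_map(1)[OF M M' f]
  note S = right_module_subspace[OF TM_module[OF M']] and T = right_module_subspace[OF TM_module[OF M]]
  have "t \<in> ?W"
  proof (rule TM_span[OF M _ _ t])
    show "vs.subspace ?W"
      unfolding vs.subspace_def
      using vs.subspace_0[OF T] vs.subspace_0[OF S] vs.subspace_add[OF T] vs.subspace_add[OF S]
        vs.subspace_scale[OF T] vs.subspace_scale[OF S] linear_onD[OF lin] linear_on_subspace(1)[OF lin T]
      by simp
    show "te M x n \<in> ?W" if "x \<in> space M" "n \<in> bspace N" for x n
      using that te_closed[OF M that] tensor_map(2)[OF M M' f that] te_closed[OF M' _ that(2)] rmodule_homD(2)[OF f]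
      by simp
  qed
  then show ?thesis by simp
qed

lemma coord_tensor_map:
  assumes M: "right_module B M" and M': "right_module B M'" and f: "rmodule_hom B M M' f"
    and t: "t \<in> space (TM M)" and j: "j \<in> J"
  shows "coord M' j (tensor_map B C M M' N f t) = f (coord M j t)"
proof (rule TM_ext[OF M _ _ _ t])
  show "linear_on (space (TM M)) (\<lambda>t. coord M' j (tensor_map B C M M' N f t))"
    by (rule linear_on_comp[OF tensor_map(1)[OF M M' f] _ coord(1)[OF M' j]]) (auto simp: tensor_map_closed[OF M M' f])
  show "linear_on (space (TM M)) (\<lambda>t. f (coord M j t))"
    by (rule linear_on_comp[OF coord(1)[OF M j] _ rmodule_homD(1)[OF f]]) (auto simp: coord_closed[OF M j])
  fix x n assume x: "x \<in> space M" "n \<in> bspace N"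
  show "coord M' j (tensor_map B C M M' N f (te M x n)) = f (coord M j (te M x n))"
    using tensor_map(2)[OF M M' f x] coord(2)[OF M j x] coord(2)[OF M' j rmodule_homD(2)[OF f x(1)] x(2)]
      rmodule_homD(3)[OF f x(1) coef[OF j x(2)]] by simp
qed

lemma tensor_map_hom:
  assumes M: "right_module B M" and M': "right_module B M'" and f: "rmodule_hom B M M' f"
  shows "rmodule_hom C (TM M) (TM M') (tensor_map B C M M' N f)"
  unfolding rmodule_hom_def
proof (intro conjI ballI)
  let ?f = "tensor_map B C M M' N f"
  note R = right_moduleD[OF TM_module[OF M]] and R' = right_moduleD[OF TM_module[OF M']]
  show "linear_on (space (TM M)) ?f" by (rule tensor_map(1)[OF M M' f])
  show "?f ` space (TM M) \<subseteq> space (TM M')" using tensor_map_closed[OF M M' f] by auto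
  fix t c assume t: "t \<in> space (TM M)" and c: "c \<in> carrier C"
  show "?f (ract (TM M) t c) = ract (TM M') (?f t) c"
  proof (rule TM_ext[OF M _ _ _ t])
    show "linear_on (space (TM M)) (\<lambda>t. ?f (ract (TM M) t c))"
      by (rule linear_on_comp[OF R(2)[OF c] _ tensor_map(1)[OF M M' f]]) (auto simp: R(1) c)
    show "linear_on (space (TM M)) (\<lambda>t. ract (TM M') (?f t) c)"
      by (rule linear_on_comp[OF tensor_map(1)[OF M M' f] _ R'(2)[OF c]]) (auto simp: tensor_map_closed[OF M M' f])
    fix x n assume x: "x \<in> space M" "n \<in> bspace N"
    show "?f (ract (TM M) (te M x n) c) = ract (TM M') (?f (te M x n)) c"
      using tensor_map(2)[OF M M' f x] tensor_map(2)[OF M M' f x(1) bract_closed[OF x(2) c]]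
        te_ract[OF M x c] te_ract[OF M' rmodule_homD(2)[OF f x(1)] x(2) c] by simp
  qed
qed

text \<open>Joint injectivity is the expansion of an element. For joint surjectivity the sum of the
  x_j \<otimes> e_j is taken; its coordinates are the x_j because \<open>coef_basis\<close> is a
  Kronecker delta.\<close>

sublocale coord_functor B C J "\<lambda>M. tensor_module B C M N" "\<lambda>M M'. tensor_map B C M M' N" coord
proof unfold_locales
  fix M assume M: "right_module B M"
  show "right_module C (TM M)" by (rule TM_module[OF M])
  show "linear_on (space (TM M)) (coord M j)" if "j \<in> J" for j by (rule coord(1)[OF M that])
  show "coord M j t \<in> space M" if "j \<in> J" "t \<in> space (TM M)" for j t by (rule coord_closed[OF M that])
  show "t = t'" if "t \<in> space (TM M)" "t' \<in> space (TM M)" "\<And>j. j \<in> J \<Longrightarrow> coord M j t = coord M j t'" for t t'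
    using TM_expand[OF M that(1)] TM_expand[OF M that(2)] that(3) by simp
  show "\<exists>t\<in>space (TM M). \<forall>j\<in>J. coord M j t = x j" if x: "\<And>j. j \<in> J \<Longrightarrow> x j \<in> space M" for x
  proof
    let ?t = "\<Sum>j\<in>J. te M (x j) (e j)"
    have cl: "te M (x j) (e j) \<in> space (TM M)" if "j \<in> J" for j
      by (rule te_closed[OF M x[OF that] basis[OF that]])
    note T = right_module_subspace[OF TM_module[OF M]]
    show "?t \<in> space (TM M)" by (rule vs.subspace_sum[OF T cl])
    show "\<forall>j\<in>J. coord M j ?t = x j"
    proof
      interpret B: ring B by (rule ring_B)
      have z: "ract M y \<zero>\<^bsub>B\<^esub> = 0" if "y \<in> space M" for y
        using right_moduleD(3)[OF M that, of "\<zero>\<^bsub>B\<^esub>" "\<zero>\<^bsub>B\<^esub>"] by simp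
      fix j assume j: "j \<in> J"
      have "coord M j ?t = (\<Sum>i\<in>J. coord M j (te M (x i) (e i)))"
        by (rule linear_on_subspace(4)[OF coord(1)[OF M j] T cl])
      also have "\<dots> = (\<Sum>i\<in>J. if i = j then x i else 0)"
        by (rule sum.cong)
          (use j coord(2)[OF M j x basis] coef_basis[OF _ j] right_moduleD(6)[OF M x] z[OF x] in simp_all)
      also have "\<dots> = x j" using j finite_J by simp
      finally show "coord M j ?t = x j" .
    qed
  qed
next
  fix M M' f assume M: "right_module B M" "right_module B M'" "rmodule_hom B M M' f"
  show "rmodule_hom C (TM M) (TM M') (tensor_map B C M M' N f)" by (rule tensor_map_hom[OF M])
  show "coord M' j (tensor_map B C M M' N f t) = f (coord M j t)" if "t \<in> space (TM M)" "j \<in> J" for t j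
    by (rule coord_tensor_map[OF M that])
qed

lemma tensor_cpx_eq: "tensor_cpx B C N X = FC X"
  by (simp add: tensor_cpx_def cpx_map_def)

lemma tensor_cmap_eq: "tensor_cmap B C N X f Y = FM X Y f"
  by (simp add: tensor_cmap_def cmap_map_def)

end

section \<open>Twisted modules and invariant objects\<close>

text \<open>A concrete model of M \<otimes> B_h in which x \<otimes> b corresponds to x b, so that b
  acts through h(b). It replaces the chosen tensor product by a module with the same space as
  M.\<close>

definition tw_module :: "('h \<Rightarrow> 'b \<Rightarrow> 'b) \<Rightarrow> 'h \<Rightarrow> ('k, 'b) rmodule \<Rightarrow> ('k, 'b) rmodule" where
  "tw_module act h M = \<lparr>space = space M, ract = (\<lambda>x b. ract M x (act h b))\<rparr>"

definition tw_cpx :: "('h \<Rightarrow> 'b \<Rightarrow> 'b) \<Rightarrow> 'h \<Rightarrow> ('k, 'b) cpx \<Rightarrow> ('k, 'b) cpx" where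
  "tw_cpx act h X = \<lparr>obj = (\<lambda>i. tw_module act h (obj X i)), diff = diff X\<rparr>"

lemma tw_simps [simp]:
  "space (tw_module act h M) = space M" "ract (tw_module act h M) x b = ract M x (act h b)"
  "obj (tw_cpx act h X) i = tw_module act h (obj X i)" "diff (tw_cpx act h X) = diff X"
  by (simp_all add: tw_module_def tw_cpx_def)

locale twist_setting =
  fixes H :: "'h monoid" and B :: "('k::field, 'b) module" and act :: "'h \<Rightarrow> 'b \<Rightarrow> 'b"
  assumes alg: "H_algebra H B act"
begin

lemma fd: "fd_algebra B" and comm_group_H: "comm_group H"
  using alg by (simp_all add: H_algebra_def)

sublocale H: comm_group H by (rule comm_group_H)
sublocale B: ring B by (rule fd_algebraD(1)[OF fd])

lemmas act = H_algebraD[OF alg]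

lemma right_module_tw:
  assumes "right_module B M" "h \<in> carrier H"
  shows "right_module B (tw_module act h M)"
proof -
  have "\<exists>S. finite S \<and> space M = vs.span S" using assms(1) by (simp add: right_module_def)
  then show ?thesis
    using right_moduleD[OF assms(1)] act[OF assms(2)] by (simp add: right_module_def)
qed

lemma bounded_complex_tw:
  assumes X: "bounded_complex B X" and h: "h \<in> carrier H"
  shows "bounded_complex B (tw_cpx act h X)"
proof -
  obtain n where n: "\<And>i. \<bar>i\<bar> > n \<Longrightarrow> space (obj X i) = {0}" using bounded_complex_bound[OF X] by metis
  show ?thesis
    by (rule bounded_complexI[where n = n])
      (use right_module_tw[OF bounded_complexD(1)[OF X] h] rmodule_homD[OF bounded_complexD(2)[OF X]]
        bounded_complexD(3)[OF X] n act(1)[OF h] in \<open>auto simp: rmodule_hom_def\<close>)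
qed

abbreviation "TB \<equiv> twist_bimodule B act"

text \<open>As a left B-module, B_h is free on 1. One coordinate suffices, with index set
  \<open>{()}\<close>, and the coefficient of b is b itself.\<close>

lemma free_bimodule_twist:
  assumes h: "h \<in> carrier H"
  shows "free_bimodule B B (TB h) {()} (\<lambda>_. \<one>\<^bsub>B\<^esub>) (\<lambda>_ b. b)"
proof unfold_locales
  show "\<exists>p. is_tensor B B M (TB h) p" if "right_module B M" for M
    by (rule twist_tensor_exists[OF that alg h])
  show "\<beta> x n = (\<Sum>j\<in>{()}. \<beta> (ract M x n) \<one>\<^bsub>B\<^esub>)"
    if "right_module B M" "balanced B M (TB h) \<beta>" "x \<in> space M" "n \<in> bspace (TB h)" for M \<beta> x n
    using that by (simp add: balanced_def twist_bimodule_def)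
qed (auto simp: twist_bimodule_def act(1)[OF h])

text \<open>The coordinate sends x \<otimes> n to x n, and acting with b replaces n by n h(b). Hence
  it is linear over B as a map into the twisted module.\<close>

lemma coord_ract:
  assumes h: "h \<in> carrier H" and M: "right_module B M"
    and t: "t \<in> space (tensor_module B B M (TB h))" and b: "b \<in> carrier B"
  defines "c \<equiv> free_bimodule.coord B B (TB h) (\<lambda>_ b. b) M ()"
  shows "c (ract (tensor_module B B M (TB h)) t b) = ract M (c t) (act h b)"
proof -
  interpret T: free_bimodule B B "TB h" "{()}" "\<lambda>_. \<one>\<^bsub>B\<^esub>" "\<lambda>_ b. b" by (rule free_bimodule_twist[OF h])
  note R = right_moduleD[OF T.TM_module[OF M]]
  have j: "() \<in> {()}" by simp
  show ?thesis
    unfolding c_def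
  proof (rule T.TM_ext[OF M _ _ _ t])
    show "linear_on (space (T.TM M)) (\<lambda>t. T.coord M () (ract (T.TM M) t b))"
      by (rule linear_on_comp[OF R(2)[OF b] _ T.coord(1)[OF M j]]) (auto simp: R(1) b)
    show "linear_on (space (T.TM M)) (\<lambda>t. ract M (T.coord M () t) (act h b))"
      by (rule linear_on_comp[OF T.coord(1)[OF M j] _ right_moduleD(2)[OF M act(1)[OF h b]]])
        (auto simp: T.coord_closed[OF M j])
    fix x n assume x: "x \<in> space M" "n \<in> bspace (TB h)"
    then have n: "n \<in> carrier B" by (simp add: twist_bimodule_def)
    have "ract (T.TM M) (T.te M x n) b = T.te M x (n \<otimes>\<^bsub>B\<^esub> act h b)"
      using T.te_ract[OF M x b] by (simp add: twist_bimodule_def)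
    moreover have "T.coord M () (T.te M x (n \<otimes>\<^bsub>B\<^esub> act h b)) = ract M x (n \<otimes>\<^bsub>B\<^esub> act h b)"
      using n b act(1)[OF h] by (intro T.coord(2)[OF M j x(1)]) (simp add: twist_bimodule_def)
    ultimately show "T.coord M () (ract (T.TM M) (T.te M x n) b) = ract M (T.coord M () (T.te M x n)) (act h b)"
      using T.coord(2)[OF M j x] right_moduleD(4)[OF M x(1) n act(1)[OF h b]] by simp
  qed
qed

text \<open>The canonical isomorphism from X \<otimes> B_h to the concrete twist, x \<otimes> b to x
  b.\<close>

definition kap :: "'h \<Rightarrow> ('k, 'b) cpx \<Rightarrow> 'k cmap" where
  "kap h X = (\<lambda>i. free_bimodule.coord B B (TB h) (\<lambda>_ b. b) (obj X i) ())"

lemma bounded_complex_twist: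
  assumes "h \<in> carrier H" "bounded_complex B X"
  shows "bounded_complex B (twist B act h X)"
proof -
  interpret T: free_bimodule B B "TB h" "{()}" "\<lambda>_. \<one>\<^bsub>B\<^esub>" "\<lambda>_ b. b" by (rule free_bimodule_twist[OF assms(1)])
  show ?thesis unfolding T.tensor_cpx_eq by (rule T.bounded_FC[OF assms(2)])
qed

lemma obj_twist: "obj (twist B act h X) i = tensor_module B B (obj X i) (TB h)"
  by (simp add: tensor_cpx_def)

lemma chain_map_kap:
  assumes h: "h \<in> carrier H" and X: "bounded_complex B X"
  shows "chain_map B (twist B act h X) (tw_cpx act h X) (kap h X)"
    and "bij_betw (kap h X i) (space (obj (twist B act h X) i)) (space (obj X i))"
proof -
  interpret T: free_bimodule B B "TB h" "{()}" "\<lambda>_. \<one>\<^bsub>B\<^esub>" "\<lambda>_ b. b" by (rule free_bimodule_twist[OF h])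
  have j: "() \<in> {()}" by simp
  note m = bounded_complexD(1)[OF X]
  show "chain_map B (twist B act h X) (tw_cpx act h X) (kap h X)"
  proof (rule chain_mapI[OF bounded_complex_twist[OF h X] bounded_complex_tw[OF X h]])
    show "rmodule_hom B (obj (twist B act h X) i) (obj (tw_cpx act h X) i) (kap h X i)" for i
      using T.coord(1)[OF m j] T.coord_closed[OF m j] coord_ract[OF h m]
      by (auto simp: rmodule_hom_def kap_def obj_twist)
    show "kap h X (i + 1) (diff (twist B act h X) i t) = diff (tw_cpx act h X) i (kap h X i t)"
      if "t \<in> space (obj (twist B act h X) i)" for i t
      using T.coord_diff[OF X _ j, of t i] that by (simp add: kap_def T.tensor_cpx_eq)
  qed
  show "bij_betw (kap h X i) (space (obj (twist B act h X) i)) (space (obj X i))"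
    unfolding bij_betw_def
  proof (intro conjI inj_onI equalityI subsetI)
    fix t t' assume "t \<in> space (obj (twist B act h X) i)" "t' \<in> space (obj (twist B act h X) i)"
      and eq: "kap h X i t = kap h X i t'"
    then have t: "t \<in> space (T.TM (obj X i))" "t' \<in> space (T.TM (obj X i))" by (simp_all add: obj_twist)
    show "t = t'" by (rule T.coord_inj[OF m t]) (use eq in \<open>simp add: kap_def\<close>)
  next
    fix x assume "x \<in> kap h X i ` space (obj (twist B act h X) i)"
    then show "x \<in> space (obj X i)" using T.coord_closed[OF m j] by (auto simp: obj_twist kap_def)
  next
    fix x assume "x \<in> space (obj X i)"
    then show "x \<in> kap h X i ` space (obj (twist B act h X) i)"
      using T.coord_surj[OF m, of "\<lambda>_. x"] by (auto simp: obj_twist kap_def)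
  qed
qed

lemma cpx_iso_twist_tw:
  assumes "h \<in> carrier H" "bounded_complex B X"
  shows "cpx_iso B (twist B act h X) (tw_cpx act h X)"
  by (rule bij_chain_map_iso[OF chain_map_kap(1)[OF assms]]) (simp add: chain_map_kap(2)[OF assms])

lemma H_invariant_tw:
  assumes inv: "H_invariant H B act X" and h: "h \<in> carrier H" and X: "bounded_complex B X"
  shows "cpx_iso B (tw_cpx act h X) X"
proof -
  obtain \<iota> where "\<And>h. h \<in> carrier H \<Longrightarrow> diso B (twist B act (inv\<^bsub>H\<^esub> h) X) X (\<iota> h)"
    using inv unfolding H_invariant_def by blast
  \<comment> \<open>\<iota>_h starts from the twist by the inverse of h, so the instance at the
    inverse concerns the twist by h.\<close>
  from this[of "inv\<^bsub>H\<^esub> h"] have "cpx_iso B (twist B act h X) X"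
    using h by (auto simp: cpx_iso_def)
  then show ?thesis using cpx_iso_trans[OF cpx_iso_sym[OF cpx_iso_twist_tw[OF h X]]] by blast
qed

lemma kap_elt:
  assumes h: "h \<in> carrier H" and X: "bounded_complex B X" and x: "x \<in> space (obj X i)" and b: "b \<in> carrier B"
  shows "kap h X i (tensor_elt B B (obj X i) (TB h) x b) = ract (obj X i) x b"
proof -
  interpret T: free_bimodule B B "TB h" "{()}" "\<lambda>_. \<one>\<^bsub>B\<^esub>" "\<lambda>_ b. b" by (rule free_bimodule_twist[OF h])
  show ?thesis
    using T.coord(2)[OF bounded_complexD(1)[OF X] _ x, of "()" b] b by (simp add: kap_def twist_bimodule_def)
qed

end

text \<open>For maps produced by \<open>SOME\<close>, linearity and compatibility with differentials
  are not visible. They are inherited from the composite g, because k is injective.\<close>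

lemma chain_map_factor:
  assumes k: "chain_map A Y W k" and inj: "\<And>i. inj_on (k i) (space (obj Y i))"
    and g: "chain_map A Z W g"
    and \<phi>: "\<And>i z. z \<in> space (obj Z i) \<Longrightarrow> \<phi> i z \<in> space (obj Y i)"
    and eq: "\<And>i z. z \<in> space (obj Z i) \<Longrightarrow> k i (\<phi> i z) = g i z"
  shows "chain_map A Z Y \<phi>"
proof (rule chain_mapI[OF chain_mapD(1)[OF g] chain_mapD(1)[OF k]])
  note Y = bounded_complexD[OF chain_mapD(1)[OF k]] and Z = bounded_complexD[OF chain_mapD(1)[OF g]]
  note kh = rmodule_homD[OF chain_mapD(3)[OF k]] and gh = rmodule_homD[OF chain_mapD(3)[OF g]]
  have I: "y = y'" if "k i y = k i y'" "y \<in> space (obj Y i)" "y' \<in> space (obj Y i)" for i y y'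
    using inj_onD[OF inj that] .
  show "rmodule_hom A (obj Z i) (obj Y i) (\<phi> i)" for i
    unfolding rmodule_hom_def linear_on_def
  proof (intro conjI ballI allI)
    fix x y assume xy: "x \<in> space (obj Z i)" "y \<in> space (obj Z i)"
    note s = vs.subspace_add[OF Z(4) xy]
    show "\<phi> i (x + y) = \<phi> i x + \<phi> i y"
      by (rule I[of i]) (use xy s \<phi> vs.subspace_add[OF Y(4)] linear_onD(1)[OF kh(1)] linear_onD(1)[OF gh(1)] in
        \<open>simp_all add: eq\<close>)
  next
    fix c x assume x: "x \<in> space (obj Z i)"
    note s = vs.subspace_scale[OF Z(4) x]
    show "\<phi> i (vscale c x) = vscale c (\<phi> i x)"
      by (rule I[of i]) (use x s \<phi> vs.subspace_scale[OF Y(4)] linear_onD(2)[OF kh(1)] linear_onD(2)[OF gh(1)] in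
        \<open>simp_all add: eq\<close>)
  next
    fix x a assume x: "x \<in> space (obj Z i)" and a: "a \<in> carrier A"
    note s = right_moduleD(1)[OF Z(1) x a]
    show "\<phi> i (ract (obj Z i) x a) = ract (obj Y i) (\<phi> i x) a"
      by (rule I[of i]) (use x a s \<phi> right_moduleD(1)[OF Y(1) _ a] kh(3)[OF _ a] gh(3)[OF _ a] in \<open>simp_all add: eq\<close>)
  qed (use \<phi> in auto)
  fix i x assume x: "x \<in> space (obj Z i)"
  note dx = Z(6)[OF x]
  have "k (i + 1) (\<phi> (i + 1) (diff Z i x)) = k (i + 1) (diff Y i (\<phi> i x))"
    unfolding eq[OF dx] chain_mapD(4)[OF g x] chain_mapD(4)[OF k \<phi>[OF x]] eq[OF x] ..
  then show "\<phi> (i + 1) (diff Z i x) = diff Y i (\<phi> i x)"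
    by (rule I[of "i + 1"]) (use \<phi>[OF dx] Y(6)[OF \<phi>[OF x]] in auto)
qed

section \<open>Equivariant structures and sums of twists\<close>

context twist_setting
begin

lemma chain_map_tw:
  assumes f: "chain_map B X Y f" and h: "h \<in> carrier H"
  shows "chain_map B (tw_cpx act h X) (tw_cpx act h Y) f"
  by (rule chain_mapI)
    (use bounded_complex_tw[OF _ h] chain_mapD(1,2,4)[OF f] rmodule_homD[OF chain_mapD(3)[OF f]] act(1)[OF h] in
      \<open>auto simp: rmodule_hom_def\<close>)

text \<open>In the iterated concrete twist b acts through h(h'(b)), so the comparison with the twist
  by h h' is the identity on spaces.\<close>

lemma chain_map_tw_tw:
  assumes h: "h \<in> carrier H" and h': "h' \<in> carrier H" and X: "bounded_complex B X"
  shows "chain_map B (tw_cpx act h' (tw_cpx act h X)) (tw_cpx act (h \<otimes>\<^bsub>H\<^esub> h') X) (\<lambda>i x. x)"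
  by (rule chain_mapI)
    (use bounded_complex_tw X h h' act(7)[OF h _ h'] in \<open>auto simp: rmodule_hom_def linear_on_def\<close>)

text \<open>Read through \<open>kap\<close>, the canonical isomorphism is the identity of X. The
  chosen \<open>twist_twist_map\<close> is pinned down by its values on iterated elementary tensors,
  so it agrees with an explicit candidate, and its properties are read off from that.\<close>

lemma twist_twist:
  assumes h: "h \<in> carrier H" and h': "h' \<in> carrier H" and X: "bounded_complex B X"
  defines "Y \<equiv> twist B act h X"
  shows "chain_map B (twist B act h' Y) (twist B act (h \<otimes>\<^bsub>H\<^esub> h') X) (twist_twist_map H B act h h' X)"
    and "t \<in> space (obj (twist B act h' Y) i) \<Longrightarrow>
      kap (h \<otimes>\<^bsub>H\<^esub> h') X i (twist_twist_map H B act h h' X i t) = kap h X i (kap h' Y i t)"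
proof -
  let ?hh = "h \<otimes>\<^bsub>H\<^esub> h'"
  have hh: "?hh \<in> carrier H" using h h' by simp
  have Y: "bounded_complex B Y" unfolding Y_def by (rule bounded_complex_twist[OF h X])
  interpret T: free_bimodule B B "TB h" "{()}" "\<lambda>_. \<one>\<^bsub>B\<^esub>" "\<lambda>_ b. b" by (rule free_bimodule_twist[OF h])
  interpret T': free_bimodule B B "TB h'" "{()}" "\<lambda>_. \<one>\<^bsub>B\<^esub>" "\<lambda>_ b. b" by (rule free_bimodule_twist[OF h'])
  interpret TT: free_bimodule B B "TB ?hh" "{()}" "\<lambda>_. \<one>\<^bsub>B\<^esub>" "\<lambda>_ b. b" by (rule free_bimodule_twist[OF hh])
  note m = bounded_complexD(1)[OF X]
  note mY = T.TM_module[OF m]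
  have oY: "obj Y i = T.TM (obj X i)" for i by (simp add: Y_def obj_twist)
  have N: "bspace (TB g) = carrier B" for g by (simp add: twist_bimodule_def)
  have g: "chain_map B (twist B act h' Y) (tw_cpx act ?hh X) (\<lambda>i t. kap h X i (kap h' Y i t))"
    using chain_map_comp[OF chain_map_comp[OF chain_map_kap(1)[OF h' Y]
          chain_map_tw[OF chain_map_kap(1)[OF h X, folded Y_def] h']] chain_map_tw_tw[OF h h' X]] .
  \<comment> \<open>The candidate strips both tensor factors from t, which leaves an element of X,
    and tensors it with 1 in the twist by the product.\<close>
  let ?\<psi> = "\<lambda>i t. TT.te (obj X i) (kap h X i (kap h' Y i t)) \<one>\<^bsub>B\<^esub>"
  have gs: "kap h X i (kap h' Y i t) \<in> space (obj X i)" if "t \<in> space (obj (twist B act h' Y) i)" for t i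
    using chain_mapD(6)[OF g that] by simp
  have \<psi>_lin: "linear_on (space (T'.TM (obj Y i))) (?\<psi> i)" for i
    by (rule linear_on_comp[OF chain_mapD(5)[OF g, unfolded obj_twist] _ TT.te_linear[OF m]])
      (use gs in \<open>auto simp: obj_twist N\<close>)
  have spec: "?\<psi> i (T'.te (obj Y i) (T.te (obj X i) x b) b') = TT.te (obj X i) x (b \<otimes>\<^bsub>B\<^esub> act h b')"
    if x: "x \<in> space (obj X i)" and b: "b \<in> carrier B" "b' \<in> carrier B" for i x b b'
  proof -
    have w: "T.te (obj X i) x b \<in> space (obj Y i)" using T.te_closed[OF m x] b by (simp add: oY N)
    have bb: "b \<otimes>\<^bsub>B\<^esub> act h b' \<in> carrier B" using b act(1)[OF h] by simp
    have "kap h' Y i (T'.te (obj Y i) (T.te (obj X i) x b) b') = ract (obj Y i) (T.te (obj X i) x b) b'"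
      by (rule kap_elt[OF h' Y w b(2)])
    also have "\<dots> = T.te (obj X i) x (b \<otimes>\<^bsub>B\<^esub> act h b')"
      using T.te_ract[OF m x _ b(2), of b] b by (simp add: oY twist_bimodule_def)
    finally have "?\<psi> i (T'.te (obj Y i) (T.te (obj X i) x b) b') =
        TT.te (obj X i) (ract (obj X i) x (b \<otimes>\<^bsub>B\<^esub> act h b')) \<one>\<^bsub>B\<^esub>"
      using kap_elt[OF h X x bb] by simp
    also have "\<dots> = TT.te (obj X i) x (b \<otimes>\<^bsub>B\<^esub> act h b')"
      using TT.te_balanced[OF m] x bb by (simp add: balanced_def twist_bimodule_def)
    finally show ?thesis .
  qed
  let ?P = "\<lambda>i \<phi>. linear_on (space (T'.TM (obj Y i))) \<phi> \<and>
      (\<forall>x\<in>space (obj X i). \<forall>b\<in>carrier B. \<forall>b'\<in>carrier B.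
         \<phi> (T'.te (obj Y i) (T.te (obj X i) x b) b') = TT.te (obj X i) x (b \<otimes>\<^bsub>B\<^esub> act h b'))"
  have some: "twist_twist_map H B act h h' X i = (SOME \<phi>. ?P i \<phi>)" for i
    by (simp only: twist_twist_map_def Let_def oY)
  have ex: "?P i (?\<psi> i)" for i using \<psi>_lin spec by blast
  have P: "?P i (twist_twist_map H B act h h' X i)" for i
    unfolding some by (rule someI[of "?P i"]) (rule ex)
  \<comment> \<open>Uniqueness is used twice: for the outer tensor product, and for the inner one
    with the outer factor b' fixed.\<close>
  have eq: "twist_twist_map H B act h h' X i t = ?\<psi> i t" if t: "t \<in> space (obj (twist B act h' Y) i)" for i t
  proof (rule T'.TM_ext[OF bounded_complexD(1)[OF Y] conjunct1[OF P] \<psi>_lin])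
    show "t \<in> space (T'.TM (obj Y i))" using t by (simp add: obj_twist)
    fix w b' assume w: "w \<in> space (obj Y i)" and b': "b' \<in> bspace (TB h')"
    note tl = T'.te_linear[OF bounded_complexD(1)[OF Y] b', of i]
    have img: "(\<lambda>w. T'.te (obj Y i) w b') ` space (obj Y i) \<subseteq> space (T'.TM (obj Y i))"
      using T'.te_closed[OF bounded_complexD(1)[OF Y] _ b'] by auto
    show "twist_twist_map H B act h h' X i (T'.te (obj Y i) w b') = ?\<psi> i (T'.te (obj Y i) w b')"
    proof (rule T.TM_ext[OF m[of i], where v = w and \<phi> = "\<lambda>w. twist_twist_map H B act h h' X i (T'.te (obj Y i) w b')"
          and \<psi> = "\<lambda>w. ?\<psi> i (T'.te (obj Y i) w b')"])
      show "linear_on (space (T.TM (obj X i))) (\<lambda>w. twist_twist_map H B act h h' X i (T'.te (obj Y i) w b'))"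
        using linear_on_comp[OF tl img conjunct1[OF P]] by (simp add: oY)
      show "linear_on (space (T.TM (obj X i))) (\<lambda>w. ?\<psi> i (T'.te (obj Y i) w b'))"
        using linear_on_comp[OF tl img \<psi>_lin] by (simp add: oY)
      show "w \<in> space (T.TM (obj X i))" using w by (simp add: oY)
      show "twist_twist_map H B act h h' X i (T'.te (obj Y i) (T.te (obj X i) x b) b') =
          ?\<psi> i (T'.te (obj Y i) (T.te (obj X i) x b) b')" if "x \<in> space (obj X i)" "b \<in> bspace (TB h)" for x b
        using P[of i] spec[of x i b b'] that b' by (simp add: N)
    qed
  qed
  have cl: "?\<psi> i t \<in> space (obj (twist B act ?hh X) i)" if t: "t \<in> space (obj (twist B act h' Y) i)" for t i
    using TT.te_closed[OF m gs[OF t]] by (simp add: obj_twist N)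
  have kk: "kap ?hh X i (?\<psi> i t) = kap h X i (kap h' Y i t)" if t: "t \<in> space (obj (twist B act h' Y) i)" for t i
    using kap_elt[OF hh X gs[OF t]] right_moduleD(6)[OF m gs[OF t]] by simp
  show "kap ?hh X i (twist_twist_map H B act h h' X i t) = kap h X i (kap h' Y i t)"
    if "t \<in> space (obj (twist B act h' Y) i)" for t i
    using eq[OF that] kk[OF that] by simp
  show "chain_map B (twist B act h' Y) (twist B act ?hh X) (twist_twist_map H B act h h' X)"
    by (rule chain_map_factor[OF chain_map_kap(1)[OF hh X] _ g])
      (use chain_map_kap(2)[OF hh X] cl eq kk in \<open>auto simp: bij_betw_def\<close>)
qed

text \<open>\<theta> is an action of H on the complex itself, semilinear over the action on B.
  Semilinearity says that \<theta>_h is linear from the twist by the inverse of h to X, and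
  multiplicativity becomes the cocycle condition once tensor products are read through
  \<open>kap\<close>.\<close>

theorem H_invariantI:
  assumes X: "bounded_complex B X"
    and lin: "\<And>h i. h \<in> carrier H \<Longrightarrow> linear_on (space (obj X i)) (\<theta> h i)"
    and bij: "\<And>h i. h \<in> carrier H \<Longrightarrow> bij_betw (\<theta> h i) (space (obj X i)) (space (obj X i))"
    and d: "\<And>h i x. h \<in> carrier H \<Longrightarrow> x \<in> space (obj X i) \<Longrightarrow> \<theta> h (i + 1) (diff X i x) = diff X i (\<theta> h i x)"
    and semi: "\<And>h i x b. h \<in> carrier H \<Longrightarrow> x \<in> space (obj X i) \<Longrightarrow> b \<in> carrier B \<Longrightarrow>
      \<theta> h i (ract (obj X i) x b) = ract (obj X i) (\<theta> h i x) (act h b)"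
    and mult: "\<And>h h' i x. h \<in> carrier H \<Longrightarrow> h' \<in> carrier H \<Longrightarrow> x \<in> space (obj X i) \<Longrightarrow>
      \<theta> (h \<otimes>\<^bsub>H\<^esub> h') i x = \<theta> h i (\<theta> h' i x)"
  shows "H_invariant H B act X"
proof -
  define io where "io = (\<lambda>h i t. \<theta> h i (kap (inv\<^bsub>H\<^esub> h) X i t))"
  have th: "chain_map B (tw_cpx act (inv\<^bsub>H\<^esub> h) X) X (\<theta> h)" if h: "h \<in> carrier H" for h
  proof (rule chain_mapI)
    have hi: "inv\<^bsub>H\<^esub> h \<in> carrier H" using h by simp
    show "bounded_complex B (tw_cpx act (inv\<^bsub>H\<^esub> h) X)" "bounded_complex B X"
      using bounded_complex_tw[OF X hi] X by auto
    have "act h (act (inv\<^bsub>H\<^esub> h) b) = b" if "b \<in> carrier B" for b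
      using act(7)[OF h that hi] act(6)[OF h that] h by simp
    then show "rmodule_hom B (obj (tw_cpx act (inv\<^bsub>H\<^esub> h) X) i) (obj X i) (\<theta> h i)" for i
      using lin[OF h] bij[OF h, of i] semi[OF h] act(1)[OF hi] by (auto simp: rmodule_hom_def bij_betw_def)
  qed (use d[OF h] in simp)
  have io: "chain_map B (twist B act (inv\<^bsub>H\<^esub> h) X) X (io h)" if h: "h \<in> carrier H" for h
    unfolding io_def by (rule chain_map_comp[OF chain_map_kap(1)[OF _ X] th[OF h]]) (use h in simp)
  have dis: "diso B (twist B act (inv\<^bsub>H\<^esub> h) X) X (Arr (twist B act (inv\<^bsub>H\<^esub> h) X) (io h) X)"
    if h: "h \<in> carrier H" for h
  proof (rule quasi_iso_diso[OF bij_chain_map_quasi_iso[OF io[OF h]]])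
    have hi: "inv\<^bsub>H\<^esub> h \<in> carrier H" using h by simp
    show "bij_betw (io h i) (space (obj (twist B act (inv\<^bsub>H\<^esub> h) X) i)) (space (obj X i))" for i
      unfolding io_def using bij_betw_trans[OF chain_map_kap(2)[OF hi X] bij[OF h]] by (simp add: comp_def)
  qed
  have coc: "dequiv B (Comp (Arr (twist B act (inv\<^bsub>H\<^esub> (h \<otimes>\<^bsub>H\<^esub> h')) X) (io (h \<otimes>\<^bsub>H\<^esub> h')) X)
        (twist_twist H B act (inv\<^bsub>H\<^esub> h') (inv\<^bsub>H\<^esub> h) X))
      (Comp (Arr (twist B act (inv\<^bsub>H\<^esub> h) X) (io h) X)
        (twist_mor B act (inv\<^bsub>H\<^esub> h) (Arr (twist B act (inv\<^bsub>H\<^esub> h') X) (io h') X)))"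
    if h: "h \<in> carrier H" and h': "h' \<in> carrier H" for h h'
  proof -
    let ?a = "inv\<^bsub>H\<^esub> h'" and ?b = "inv\<^bsub>H\<^esub> h"
    have a: "?a \<in> carrier H" and b: "?b \<in> carrier H" and hh: "h \<otimes>\<^bsub>H\<^esub> h' \<in> carrier H" using h h' by auto
    \<comment> \<open>Inversion reverses the product; this is why the twists in the condition occur
      in the order inverse of h', then inverse of h.\<close>
    have e: "inv\<^bsub>H\<^esub> (h \<otimes>\<^bsub>H\<^esub> h') = ?a \<otimes>\<^bsub>H\<^esub> ?b" by (rule H.inv_mult_group[OF h h'])
    interpret T: free_bimodule B B "TB ?b" "{()}" "\<lambda>_. \<one>\<^bsub>B\<^esub>" "\<lambda>_ b. b" by (rule free_bimodule_twist[OF b])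
    let ?Y = "twist B act ?a X"
    note Y = bounded_complex_twist[OF a X]
    note tt = twist_twist[OF a b X]
    have FMc: "chain_map B (twist B act ?b ?Y) (twist B act ?b X) (tensor_cmap B B (TB ?b) ?Y (io h') X)"
      unfolding T.tensor_cpx_eq T.tensor_cmap_eq by (rule T.chain_map_FM[OF io[OF h', unfolded T.tensor_cpx_eq]])
    show ?thesis
      unfolding twist_twist_def tensor_zigzag.simps e
    proof (rule deqD(3)[OF deq_arr_square[OF tt(1) io[OF hh, unfolded e] FMc io[OF h]]])
      fix i t assume t: "t \<in> space (obj (twist B act ?b ?Y) i)"
      have k2: "kap ?b ?Y i t \<in> space (obj ?Y i)" using chain_map_kap(2)[OF b Y] t by (auto simp: bij_betw_def)
      have k1: "kap ?a X i (kap ?b ?Y i t) \<in> space (obj X i)"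
        using chain_map_kap(2)[OF a X] k2 by (auto simp: bij_betw_def)
      have "kap ?b X i (tensor_cmap B B (TB ?b) ?Y (io h') X i t) = io h' i (kap ?b ?Y i t)"
        using T.coord_FM[OF io[OF h'], of t i "()"] t by (simp add: T.tensor_cpx_eq T.tensor_cmap_eq kap_def)
      \<comment> \<open>Both sides are now expressed by coordinates: tensoring \<open>io h'\<close>
        with a twist applies \<open>io h'\<close> to the coordinate, and the rest is
        multiplicativity of \<theta>.\<close>
      then show "io (h \<otimes>\<^bsub>H\<^esub> h') i (twist_twist_map H B act ?a ?b X i t) =
          io h i (tensor_cmap B B (TB ?b) ?Y (io h') X i t)"
        using tt(2)[OF t] mult[OF h h' k1] by (simp add: io_def e)
    qed
  qed
  show ?thesis
    unfolding H_invariant_def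
    by (rule exI[of _ "\<lambda>h. Arr (twist B act (inv\<^bsub>H\<^esub> h) X) (io h) X"]) (use dis coc in blast)
qed

text \<open>The q_h are jointly bijective in each degree, so Z is the direct sum of the twists of X
  over H. Listing the identity first exposes X as a summand with projection q at the identity;
  invariance replaces every twist by X. Both composites of induction and restriction are instances,
  one for G and one for its dual.\<close>

lemma twist_decomposition:
  assumes X: "bounded_complex B X" and Z: "bounded_complex B Z"
    and q: "\<And>h. h \<in> carrier H \<Longrightarrow> chain_map B Z (tw_cpx act h X) (q h)"
    and inj: "\<And>i z z'. z \<in> space (obj Z i) \<Longrightarrow> z' \<in> space (obj Z i) \<Longrightarrow>
      (\<And>h. h \<in> carrier H \<Longrightarrow> q h i z = q h i z') \<Longrightarrow> z = z'"
    and surj: "\<And>i x. (\<And>h. h \<in> carrier H \<Longrightarrow> x h \<in> space (obj X i)) \<Longrightarrow>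
      \<exists>z\<in>space (obj Z i). \<forall>h\<in>carrier H. q h i z = x h"
  shows "\<exists>W \<Phi>. bounded_complex B W \<and> quasi_iso B Z (dsum X W) \<Phi> \<and>
      (\<forall>i. \<forall>z\<in>space (obj Z i). vfst (\<Phi> i z) = q \<one>\<^bsub>H\<^esub> i z)"
    and "H_invariant H B act X \<Longrightarrow> cpx_iso B Z (dsum_power (card (carrier H)) X)"
proof -
  have fin: "finite (carrier H)" using alg by (simp add: H_algebra_def)
  obtain js where js: "set js = carrier H - {\<one>\<^bsub>H\<^esub>}" "distinct js"
    using finite_distinct_list[of "carrier H - {\<one>\<^bsub>H\<^esub>}"] fin by auto
  let ?js = "\<one>\<^bsub>H\<^esub> # js"
  have js': "set ?js = carrier H" "distinct ?js" using js by auto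
  \<comment> \<open>At the identity X itself is used: the identity of H acts as the identity only on
    the carrier of B, so the twist by it need not be the same record as X.\<close>
  define W where "W = (\<lambda>h. if h = \<one>\<^bsub>H\<^esub> then X else tw_cpx act h X)"
  have bW: "bounded_complex B (W h)" if "h \<in> carrier H" for h
    using that X bounded_complex_tw[OF X] by (simp add: W_def)
  have oW: "space (obj (W h) i) = space (obj X i)" for h i by (simp add: W_def)
  have one: "chain_map B (tw_cpx act \<one>\<^bsub>H\<^esub> X) X (\<lambda>i x. x)"
    by (rule chain_mapI[OF bounded_complex_tw[OF X H.one_closed] X])
      (auto simp: rmodule_hom_def linear_on_def act(6)[OF H.one_closed])
  have qW: "chain_map B Z (W h) (q h)" if "h \<in> carrier H" for h
    using q[OF that] chain_map_comp[OF q[OF H.one_closed] one] by (auto simp: W_def)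
  have qi: "quasi_iso B Z (dsum_list (map W ?js)) (\<lambda>i z. vtuple (map (\<lambda>h. q h i z) ?js))"
  proof (rule quasi_iso_vtuple[OF Z qW js'(2)])
    show "h \<in> carrier H" if "h \<in> set ?js" for h using that js'(1) by blast
    show "z = z'" if "z \<in> space (obj Z i)" "z' \<in> space (obj Z i)" "\<And>j. j \<in> set ?js \<Longrightarrow> q j i z = q j i z'" for i z z'
      by (rule inj[OF that(1,2)]) (use that(3) js'(1) in blast)
    show "\<exists>z\<in>space (obj Z i). \<forall>j\<in>set ?js. q j i z = x j"
      if "\<And>j. j \<in> set ?js \<Longrightarrow> x j \<in> space (obj (W j) i)" for i x
      using surj[of x i] that unfolding oW js'(1) by blast
  qed
  have "W \<one>\<^bsub>H\<^esub> = X" by (simp add: W_def)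
  then have e: "dsum_list (map W ?js) = dsum X (dsum_list (map W js))" by simp
  have "bounded_complex B (dsum_list (map W js))"
    by (rule bounded_complex_dsum_list) (use bW js(1) in auto)
  moreover have "vfst (vtuple (map (\<lambda>h. q h i z) ?js)) = q \<one>\<^bsub>H\<^esub> i z" for i z by simp
  ultimately show "\<exists>W \<Phi>. bounded_complex B W \<and> quasi_iso B Z (dsum X W) \<Phi> \<and>
      (\<forall>i. \<forall>z\<in>space (obj Z i). vfst (\<Phi> i z) = q \<one>\<^bsub>H\<^esub> i z)"
    using qi[unfolded e] by blast
  assume inv: "H_invariant H B act X"
  have "cpx_iso B (W h) X" if "h \<in> set ?js" for h
    using H_invariant_tw[OF inv _ X] that js'(1) cpx_iso_refl[OF X] by (auto simp: W_def)
  then have "cpx_iso B (dsum_list (map W ?js)) (dsum_power (length ?js) X)"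
    by (rule cpx_iso_dsum_list)
  from cpx_iso_trans[OF quasi_iso_cpx_iso[OF qi] this] show "cpx_iso B Z (dsum_power (card (carrier H)) X)"
    using distinct_card[OF js'(2)] js'(1) by metis
qed

end

lemma finsum_to_sum:
  fixes \<phi> :: "'a \<Rightarrow> 'b::ab_group_add"
  assumes "abelian_monoid A" "finite I" "\<And>i. i \<in> I \<Longrightarrow> f i \<in> carrier A"
    and add: "\<And>x y. x \<in> carrier A \<Longrightarrow> y \<in> carrier A \<Longrightarrow> \<phi> (x \<oplus>\<^bsub>A\<^esub> y) = \<phi> x + \<phi> y"
  shows "\<phi> (finsum A f I) = (\<Sum>i\<in>I. \<phi> (f i))"
proof -
  interpret A: abelian_monoid A by fact
  show ?thesis
    using assms(2,3)
  proof (induction I)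
    case empty
    show ?case using add[of "\<zero>\<^bsub>A\<^esub>" "\<zero>\<^bsub>A\<^esub>"] by simp
  next
    case (insert i I)
    then show ?case by (simp add: add A.finsum_closed Pi_def)
  qed
qed

lemma ract_finsum:
  assumes "ring A" "right_module A M" "x \<in> space M" "finite I" "\<And>i. i \<in> I \<Longrightarrow> f i \<in> carrier A"
  shows "ract M x (finsum A f I) = (\<Sum>i\<in>I. ract M x (f i))"
proof -
  interpret A: ring A by fact
  show ?thesis
    by (rule finsum_to_sum[OF A.abelian_monoid_axioms assms(4,5)])
      (auto simp: right_moduleD(3)[OF assms(2,3)])
qed

section \<open>Characters\<close>

text \<open>\<open>char_card\<close> makes |G| invertible in the field. \<open>card_dual\<close>
  says that the field has enough roots of unity, so that the characters are numerous enough to span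
  the functions on G.\<close>

locale skew_dual = skew_setting G A act for G :: "'g monoid" (structure) and A :: "('k::field, 'a) module" and act +
  assumes char_card: "\<not> CHAR('k) dvd card (carrier G)"
    and card_dual: "card (carrier (dual_group G :: ('g \<Rightarrow> 'k) monoid)) = card (carrier G)"
begin

abbreviation D :: "('g \<Rightarrow> 'k) monoid" where "D \<equiv> dual_group G"
abbreviation n :: 'k where "n \<equiv> of_nat (card (carrier G))"

lemma n_nonzero: "n \<noteq> 0"
  using char_card by (simp add: of_nat_eq_0_iff_char_dvd)

lemma card_pos: "card (carrier G) > 0"
  using finite_G one_closed by (auto simp: card_gt_0_iff)

lemma finite_D: "finite (carrier D)"
  using card_dual card_pos by (metis card_gt_0_iff)

lemma dual_carrier:
  "\<chi> \<in> carrier D \<longleftrightarrow> \<chi> \<in> extensional (carrier G) \<and> (\<forall>g\<in>carrier G. \<chi> g \<noteq> 0) \<and>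
    (\<forall>g\<in>carrier G. \<forall>h\<in>carrier G. \<chi> (g \<otimes> h) = \<chi> g * \<chi> h)"
proof -
  have u: "carrier (units_of (ring_of_type_algebra :: 'k ring)) = {x. x \<noteq> 0}"
    by (auto simp: units_of_def Units_def ring_of_type_algebra_def intro: exI[of _ "inverse _"])
      (metis left_inverse right_inverse)
  have m: "x \<otimes>\<^bsub>units_of (ring_of_type_algebra :: 'k ring)\<^esub> y = x * y" for x y
    by (simp add: units_of_def ring_of_type_algebra_def)
  show ?thesis by (auto simp: dual_group_def hom_def u m)
qed

lemma dual_simps:
  "\<chi> \<otimes>\<^bsub>D\<^esub> \<psi> = (\<lambda>g\<in>carrier G. \<chi> g * \<psi> g)" "\<one>\<^bsub>D\<^esub> = (\<lambda>g\<in>carrier G. 1)"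
  by (simp_all add: dual_group_def)

lemma char:
  assumes "\<chi> \<in> carrier D"
  shows "g \<in> carrier G \<Longrightarrow> \<chi> g \<noteq> 0"
    and "g \<in> carrier G \<Longrightarrow> h \<in> carrier G \<Longrightarrow> \<chi> (g \<otimes> h) = \<chi> g * \<chi> h"
    and "\<chi> \<one> = 1"
    and "g \<in> carrier G \<Longrightarrow> \<chi> g * \<chi> (inv g) = 1"
    and "\<psi> \<in> carrier D \<Longrightarrow> (\<And>g. g \<in> carrier G \<Longrightarrow> \<chi> g = \<psi> g) \<Longrightarrow> \<chi> = \<psi>"
proof -
  show nz: "\<chi> g \<noteq> 0" if "g \<in> carrier G" for g using assms that by (simp add: dual_carrier)
  show m: "\<chi> (g \<otimes> h) = \<chi> g * \<chi> h" if "g \<in> carrier G" "h \<in> carrier G" for g h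
    using assms that by (simp add: dual_carrier)
  show o: "\<chi> \<one> = 1" using m[of \<one> \<one>] nz[of \<one>] by simp
  show "\<chi> g * \<chi> (inv g) = 1" if "g \<in> carrier G" using m[of g "inv g"] that o by simp
  show "\<chi> = \<psi>" if "\<psi> \<in> carrier D" "\<And>g. g \<in> carrier G \<Longrightarrow> \<chi> g = \<psi> g"
    using assms that by (intro extensionalityI[of _ "carrier G"]) (auto simp: dual_carrier)
qed

lemma comm_group_D: "comm_group D"
proof (rule comm_groupI)
  fix \<chi> assume \<chi>: "\<chi> \<in> carrier D"
  let ?i = "\<lambda>g\<in>carrier G. inverse (\<chi> g)"
  have "?i \<in> carrier D" using \<chi> by (auto simp: dual_carrier)
  moreover have "?i \<otimes>\<^bsub>D\<^esub> \<chi> = \<one>\<^bsub>D\<^esub>" using char(1)[OF \<chi>] by (auto simp: dual_simps fun_eq_iff)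
  ultimately show "\<exists>\<psi>\<in>carrier D. \<psi> \<otimes>\<^bsub>D\<^esub> \<chi> = \<one>\<^bsub>D\<^esub>" by blast
next
  fix \<chi> assume \<chi>: "\<chi> \<in> carrier D"
  show "\<one>\<^bsub>D\<^esub> \<otimes>\<^bsub>D\<^esub> \<chi> = \<chi>"
    using \<chi> by (intro extensionalityI[of _ "carrier G"]) (auto simp: dual_simps dual_carrier)
qed (auto simp: dual_carrier dual_simps fun_eq_iff mult_ac)

lemma dual_action_apply:
  "f \<in> carrier S \<Longrightarrow> g \<in> carrier G \<Longrightarrow> dual_action G A \<chi> f g = \<chi> g \<odot>\<^bsub>A\<^esub> f g"
  by (simp add: dual_action_def carrier_S)

lemma dual_action_closed: "f \<in> carrier S \<Longrightarrow> dual_action G A \<chi> f \<in> carrier S"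
  using S_apply[of f] by (auto simp: dual_action_def carrier_S intro!: smult_A(1))

lemma dual_action_mult:
  assumes "f \<in> carrier S" "\<chi> \<in> carrier D" "\<psi> \<in> carrier D"
  shows "dual_action G A (\<chi> \<otimes>\<^bsub>D\<^esub> \<psi>) f = dual_action G A \<chi> (dual_action G A \<psi> f)"
  by (rule S_eqI) (use assms in \<open>auto simp: dual_action_apply dual_action_closed dual_simps S_apply smult_A\<close>)

lemma dual_action_one: "f \<in> carrier S \<Longrightarrow> dual_action G A \<one>\<^bsub>D\<^esub> f = f"
  by (rule S_eqI) (auto simp: dual_action_apply dual_action_closed dual_simps S_apply smult_A)

text \<open>Makes the results on twists available for the dual group. The step with content is
  multiplicativity: in the convolution at x, the factor \<chi>(x) splits as \<chi>(g) \<chi>(g^-1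
  x).\<close>

lemma H_algebra_dual: "H_algebra D S (dual_action G A)"
  unfolding H_algebra_def
proof (intro conjI ballI allI)
  interpret D: comm_group D by (rule comm_group_D)
  show "comm_group D" by (rule comm_group_D)
  show "finite (carrier D)" by (rule finite_D)
  show "fd_algebra S" by (rule fd_S)
  have bij: "dual_action G A \<chi> \<in> Bij (carrier S)" if \<chi>: "\<chi> \<in> carrier D" for \<chi>
  proof -
    have "bij_betw (dual_action G A \<chi>) (carrier S) (carrier S)"
      by (rule bij_betw_byWitness[where f' = "dual_action G A (inv\<^bsub>D\<^esub> \<chi>)"])
        (use \<chi> in \<open>auto simp: dual_action_closed dual_action_mult[symmetric] dual_action_one\<close>)
    moreover have "dual_action G A \<chi> \<in> extensional (carrier S)"
      by (auto simp: dual_action_def carrier_S extensional_def)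
    ultimately show ?thesis by (simp add: Bij_def)
  qed
  show "group_action D (carrier S) (dual_action G A)"
    unfolding group_action_def group_hom_def group_hom_axioms_def
  proof (intro conjI D.group_axioms group_BijGroup homI)
    show "dual_action G A \<chi> \<in> carrier (BijGroup (carrier S))" if "\<chi> \<in> carrier D" for \<chi>
      using bij[OF that] by (simp add: BijGroup_def)
    show "dual_action G A (\<chi> \<otimes>\<^bsub>D\<^esub> \<psi>) = dual_action G A \<chi> \<otimes>\<^bsub>BijGroup (carrier S)\<^esub> dual_action G A \<psi>"
      if "\<chi> \<in> carrier D" "\<psi> \<in> carrier D" for \<chi> \<psi>
    proof (rule extensionalityI[of _ "carrier S"])
      show "dual_action G A (\<chi> \<otimes>\<^bsub>D\<^esub> \<psi>) \<in> extensional (carrier S)"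
        by (auto simp: dual_action_def carrier_S extensional_def)
    qed (use bij[OF that(1)] bij[OF that(2)] that in
        \<open>auto simp: BijGroup_def compose_def dual_action_mult\<close>)
  qed
next
  fix \<chi> assume \<chi>: "\<chi> \<in> carrier D"
  show "dual_action G A \<chi> \<in> ring_hom S S"
  proof (rule ring_hom_memI)
    fix f f' assume f: "f \<in> carrier S" "f' \<in> carrier S"
    show "dual_action G A \<chi> f \<in> carrier S" by (rule dual_action_closed[OF f(1)])
    show "dual_action G A \<chi> (f \<oplus>\<^bsub>S\<^esub> f') = dual_action G A \<chi> f \<oplus>\<^bsub>S\<^esub> dual_action G A \<chi> f'"
      by (rule S_eqI) (use f in \<open>auto simp: dual_action_closed dual_action_apply S_simps S_apply smult_A\<close>)
    show "dual_action G A \<chi> (f \<otimes>\<^bsub>S\<^esub> f') = dual_action G A \<chi> f \<otimes>\<^bsub>S\<^esub> dual_action G A \<chi> f'"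
    proof (rule S_eqI)
      fix x assume x: "x \<in> carrier G"
      have "\<chi> x \<odot>\<^bsub>A\<^esub> (\<Oplus>\<^bsub>A\<^esub>g\<in>carrier G. f g \<otimes>\<^bsub>A\<^esub> act g (f' (inv g \<otimes> x))) =
          (\<Oplus>\<^bsub>A\<^esub>g\<in>carrier G. \<chi> x \<odot>\<^bsub>A\<^esub> (f g \<otimes>\<^bsub>A\<^esub> act g (f' (inv g \<otimes> x))))"
        by (rule finsum_hom[OF A.abelian_monoid_axioms A.abelian_monoid_axioms finite_G])
          (use f x in \<open>auto simp: smult_A S_apply act\<close>)
      also have "\<dots> = (\<Oplus>\<^bsub>A\<^esub>g\<in>carrier G. dual_action G A \<chi> f g \<otimes>\<^bsub>A\<^esub> act g (dual_action G A \<chi> f' (inv g \<otimes> x)))"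
      proof (rule A.finsum_cong')
        fix g assume g: "g \<in> carrier G"
        have "\<chi> x = \<chi> g * \<chi> (inv g \<otimes> x)"
          using char(2)[OF \<chi> g, of "inv g \<otimes> x"] g x by (simp add: m_assoc[symmetric])
        moreover have "\<chi> (inv g \<otimes> x) \<odot>\<^bsub>A\<^esub> (\<chi> g \<odot>\<^bsub>A\<^esub> y) = \<chi> g \<odot>\<^bsub>A\<^esub> (\<chi> (inv g \<otimes> x) \<odot>\<^bsub>A\<^esub> y)"
          if "y \<in> carrier A" for y
          using that by (simp add: smult_A(4)[symmetric] mult.commute)
        ultimately show "\<chi> x \<odot>\<^bsub>A\<^esub> (f g \<otimes>\<^bsub>A\<^esub> act g (f' (inv g \<otimes> x))) =
            dual_action G A \<chi> f g \<otimes>\<^bsub>A\<^esub> act g (dual_action G A \<chi> f' (inv g \<otimes> x))"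
          using f g x by (simp add: dual_action_apply smult_A S_apply act)
      qed (use f x in \<open>auto simp: dual_action_apply smult_A S_apply act\<close>)
      finally show "dual_action G A \<chi> (f \<otimes>\<^bsub>S\<^esub> f') x = (dual_action G A \<chi> f \<otimes>\<^bsub>S\<^esub> dual_action G A \<chi> f') x"
        using f x by (simp add: dual_action_apply S_simps(4))
    qed (use f in \<open>auto simp: dual_action_closed\<close>)
  next
    show "dual_action G A \<chi> \<one>\<^bsub>S\<^esub> = \<one>\<^bsub>S\<^esub>"
      by (rule S_eqI)
        (auto simp: dual_action_closed dual_action_apply S_simps(5) pure_apply char(3)[OF \<chi>] smult_A)
  qed
  show "dual_action G A \<chi> (c \<odot>\<^bsub>S\<^esub> f) = c \<odot>\<^bsub>S\<^esub> dual_action G A \<chi> f" if f: "f \<in> carrier S" for c f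
    by (rule S_eqI)
      (use f in \<open>auto simp: dual_action_closed dual_action_apply S_simps S_apply smult_A(4)[symmetric] mult.commute\<close>)
qed

text \<open>For distinct characters the quotient \<phi> of \<chi> by \<psi> is not 1 at some h.
  Translation by h permutes G and multiplies the sum by \<phi>(h), so the sum is 0.\<close>

lemma char_orthogonal:
  assumes \<chi>: "\<chi> \<in> carrier D" and \<psi>: "\<psi> \<in> carrier D"
  shows "(\<Sum>g\<in>carrier G. \<chi> g * \<psi> (inv g)) = (if \<chi> = \<psi> then n else 0)"
proof (cases "\<chi> = \<psi>")
  case True
  then show ?thesis using char(4)[OF \<psi>] by simp
next
  case False
  let ?\<phi> = "\<lambda>g. \<chi> g * \<psi> (inv g)"
  have m: "?\<phi> (h \<otimes> g) = ?\<phi> h * ?\<phi> g" if "g \<in> carrier G" "h \<in> carrier G" for g h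
    using that char(2)[OF \<chi>] char(2)[OF \<psi>] by (simp add: inv_mult)
  obtain h where h: "h \<in> carrier G" "?\<phi> h \<noteq> 1"
  proof -
    have "\<exists>h\<in>carrier G. \<chi> h \<noteq> \<psi> h" using False char(5)[OF \<chi> \<psi>] by blast
    then obtain h where h: "h \<in> carrier G" "\<chi> h \<noteq> \<psi> h" by blast
    have "?\<phi> h \<noteq> 1"
    proof
      assume "?\<phi> h = 1"
      then have "\<chi> h * \<psi> (inv h) = \<psi> h * \<psi> (inv h)" using char(4)[OF \<psi> h(1)] by simp
      then show False using h char(1)[OF \<psi>, of "inv h"] by simp
    qed
    then show ?thesis using that h(1) by blast
  qed
  have "(\<Sum>g\<in>carrier G. ?\<phi> g) = (\<Sum>g\<in>carrier G. ?\<phi> (h \<otimes> g))"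
    by (rule sum.reindex_bij_witness[of _ "\<lambda>g. h \<otimes> g" "\<lambda>g. inv h \<otimes> g"])
      (use h(1) in \<open>auto simp: m_assoc[symmetric]\<close>)
  also have "\<dots> = ?\<phi> h * (\<Sum>g\<in>carrier G. ?\<phi> g)"
    unfolding sum_distrib_left by (rule sum.cong) (use m h(1) in auto)
  finally have "(1 - ?\<phi> h) * (\<Sum>g\<in>carrier G. ?\<phi> g) = 0" by (simp add: algebra_simps)
  then show ?thesis using h(2) False by simp
qed

text \<open>
  The characters are linearly independent by orthogonality, and there are as many of them as
  elements of \<open>G\<close>; hence they span all functions on \<open>G\<close>.
\<close>

lemma delta_char:
  assumes h: "h \<in> carrier G"
  shows "\<exists>b. \<forall>g\<in>carrier G. (\<Sum>\<chi>\<in>carrier D. b \<chi> * \<chi> g) = (if g = h then 1 else 0)"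
proof -
  \<comment> \<open>Numbering G turns functions on G into sequences, to which the linear algebra of
    \<open>vs\<close> applies: \<open>d g\<close> is the unit vector at g, and
    \<open>v \<chi>\<close> is the vector of values of \<chi>.\<close>
  obtain e where e: "bij_betw e (carrier G) {0..<card (carrier G)}"
    using ex_bij_betw_finite_nat[OF finite_G] by blast
  define d where "d = (\<lambda>g i. if i = e g then 1 else (0::'k))"
  define v where "v = (\<lambda>\<chi>. \<Sum>g\<in>carrier G. vscale (\<chi> g) (d g))"
  have ee: "e g = e g' \<longleftrightarrow> g = g'" if "g \<in> carrier G" "g' \<in> carrier G" for g g'
    using e that by (auto simp: bij_betw_def dest: inj_onD)
  have sum_apply: "(\<Sum>x\<in>I. F x) i = (\<Sum>x\<in>I. F x i)" for F :: "'c \<Rightarrow> nat \<Rightarrow> 'k" and I i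
    by (induction I rule: infinite_finite_induct) (auto simp: zero_fun_apply plus_fun_apply)
  have v_apply: "v \<chi> (e g) = \<chi> g" if "g \<in> carrier G" for \<chi> g
  proof -
    have "v \<chi> (e g) = (\<Sum>g'\<in>carrier G. if g' = g then \<chi> g' else 0)"
      unfolding v_def sum_apply by (rule sum.cong) (use that ee in \<open>auto simp: vscale_def d_def\<close>)
    then show ?thesis using that finite_G by simp
  qed
  have inj: "inj_on v (carrier D)"
    by (rule inj_onI, rule char(5)) (use v_apply in \<open>auto, metis\<close>)
  let ?V = "vs.span (d ` carrier G)"
  have sub: "v ` carrier D \<subseteq> ?V"
    unfolding v_def image_subset_iff by (intro ballI vs.span_sum vs.span_scale vs.span_base imageI)
  have ind: "vs.independent (v ` carrier D)"
    unfolding vs.dependent_finite[OF finite_imageI[OF finite_D]]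
  proof
    assume "\<exists>u. (\<exists>w\<in>v ` carrier D. u w \<noteq> 0) \<and> (\<Sum>w\<in>v ` carrier D. vscale (u w) w) = 0"
    then obtain u \<psi> where u: "\<psi> \<in> carrier D" "u (v \<psi>) \<noteq> 0" and 0: "(\<Sum>w\<in>v ` carrier D. vscale (u w) w) = 0"
      by blast
    from 0 have u3: "(\<Sum>\<chi>\<in>carrier D. vscale (u (v \<chi>)) (v \<chi>)) = 0"
      unfolding sum.reindex[OF inj] by simp
    have z: "(\<Sum>\<chi>\<in>carrier D. u (v \<chi>) * \<chi> g) = 0" if "g \<in> carrier G" for g
      using fun_cong[OF u3, of "e g"] that by (simp add: sum_apply vscale_def v_apply zero_fun_apply)
    \<comment> \<open>Pairing the linear relation with the inverse of \<psi> isolates the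
      coefficient of \<psi>, multiplied by |G|.\<close>
    have "0 = (\<Sum>g\<in>carrier G. (\<Sum>\<chi>\<in>carrier D. u (v \<chi>) * \<chi> g) * \<psi> (inv g))"
      using z by simp
    also have "\<dots> = (\<Sum>\<chi>\<in>carrier D. u (v \<chi>) * (\<Sum>g\<in>carrier G. \<chi> g * \<psi> (inv g)))"
      unfolding sum_distrib_left sum_distrib_right by (subst sum.swap) (simp add: mult.assoc)
    also have "\<dots> = (\<Sum>\<chi>\<in>carrier D. if \<chi> = \<psi> then u (v \<psi>) * n else 0)"
      by (rule sum.cong) (use char_orthogonal[OF _ u(1)] in auto)
    also have "\<dots> = u (v \<psi>) * n" using u(1) finite_D by simp
    finally show False using u(2) n_nonzero by simp
  qed
  have dh: "d h \<in> ?V" by (rule vs.span_base[OF imageI[OF h]])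
  have "d h \<in> vs.span (v ` carrier D)"
  proof (rule ccontr)
    \<comment> \<open>Otherwise |G| + 1 independent vectors would lie in a space spanned by |G|
      vectors.\<close>
    assume nd: "d h \<notin> vs.span (v ` carrier D)"
    then have "d h \<notin> v ` carrier D" using vs.span_base[of "d h" "v ` carrier D"] by metis
    then have "card (insert (d h) (v ` carrier D)) = Suc (card (carrier G))"
      using finite_D card_image[OF inj] card_dual by simp
    moreover have "card (insert (d h) (v ` carrier D)) \<le> card (d ` carrier G)"
    proof (rule conjunct2[OF vs.independent_span_bound[OF finite_imageI[OF finite_G] vs.independent_insertI[OF nd ind]]])
      show "insert (d h) (v ` carrier D) \<subseteq> ?V" using dh sub by (intro insert_subsetI)
    qed
    ultimately show False using card_image_le[OF finite_G, of d] by simp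
  qed
  then obtain b where b: "d h = (\<Sum>w\<in>v ` carrier D. vscale (b w) w)"
    unfolding vs.span_finite[OF finite_imageI[OF finite_D]] by auto
  have "(\<Sum>\<chi>\<in>carrier D. b (v \<chi>) * \<chi> g) = (if g = h then 1 else 0)" if g: "g \<in> carrier G" for g
  proof -
    have "(\<Sum>\<chi>\<in>carrier D. b (v \<chi>) * \<chi> g) = (\<Sum>\<chi>\<in>carrier D. vscale (b (v \<chi>)) (v \<chi>)) (e g)"
      using g by (simp add: sum_apply vscale_def v_apply)
    also have "\<dots> = d h (e g)" unfolding b sum.reindex[OF inj] by simp
    finally show ?thesis using ee[OF g h] by (simp add: d_def)
  qed
  then show ?thesis by (intro exI[of _ "\<lambda>\<chi>. b (v \<chi>)"]) blast
qed

end

section \<open>Induction and restriction\<close>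

context skew_setting
begin

section \<open>Induction as a tensor product with a free bimodule\<close>

abbreviation "SB \<equiv> skew_bimodule G A act"

lemma SB_simps [simp]:
  "bspace SB = carrier S" "badd SB = ring.add S" "bract SB = monoid.mult S"
  "blact SB l f = pure l \<one> \<otimes>\<^bsub>S\<^esub> f"
  by (simp_all add: skew_bimodule_def)

lemma pure_one_mult: "l \<in> carrier A \<Longrightarrow> g \<in> carrier G \<Longrightarrow> pure l \<one> \<otimes>\<^bsub>S\<^esub> pure \<one>\<^bsub>A\<^esub> g = pure l g"
  by (simp add: pure_pure act)

text \<open>Every l \<otimes> g equals (l \<otimes> 1)(1 \<otimes> g), and every element is a finite
  sum of such. These generators are what \<open>tensor_exists\<close> asks for.\<close>

lemma left_gen_SB: "left_gen (carrier A) SB (pure \<one>\<^bsub>A\<^esub> ` carrier G) = carrier S" (is "?L = _")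
proof (intro equalityI subsetI)
  fix f assume "f \<in> ?L"
  then show "f \<in> carrier S" by induction auto
next
  fix f assume f: "f \<in> carrier S"
  have p: "pure l g \<in> ?L" if "l \<in> carrier A" "g \<in> carrier G" for l g
    using left_gen.intros(1)[of l "carrier A" "pure \<one>\<^bsub>A\<^esub> g" "pure \<one>\<^bsub>A\<^esub> ` carrier G" SB] that
    by (simp add: pure_one_mult)
  \<comment> \<open>\<open>left_gen\<close> has no rule for zero, which is needed for the empty sum;
    it is obtained as 0 \<otimes> 1.\<close>
  have z: "\<zero>\<^bsub>S\<^esub> \<in> ?L" using p[of "\<zero>\<^bsub>A\<^esub>" \<one>] by (simp add: pure_linear)
  have "finsum S (\<lambda>g. pure (f g) g) I \<in> ?L" if "finite I" "I \<subseteq> carrier G" for I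
    using that
  proof (induction I)
    case (insert g I)
    have "pure (f g) g \<oplus>\<^bsub>S\<^esub> finsum S (\<lambda>g. pure (f g) g) I \<in> ?L"
      using left_gen.intros(2)[of "pure (f g) g" "carrier A" SB _ "finsum S (\<lambda>g. pure (f g) g) I"]
        insert p S_apply[OF f] by simp
    moreover have "finsum S (\<lambda>g. pure (f g) g) (insert g I) = pure (f g) g \<oplus>\<^bsub>S\<^esub> finsum S (\<lambda>g. pure (f g) g) I"
      using insert S_apply[OF f] by (intro S.finsum_insert) auto
    ultimately show ?case by simp
  qed (simp add: z)
  from this[OF finite_G subset_refl] show "f \<in> ?L" unfolding S_decomp[OF f, symmetric] .
qed

text \<open>The skew group algebra is free as a left A-module on the elements 1 \<otimes> g, and the
  coefficient of f there is the value f(g).\<close>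

lemma free_bimodule_SB: "free_bimodule A S SB (carrier G) (pure \<one>\<^bsub>A\<^esub>) (\<lambda>g f. f g)"
proof unfold_locales
  fix M :: "('k, 'a) rmodule" assume M: "right_module A M"
  have assoc1: "pure k \<one> \<otimes>\<^bsub>S\<^esub> f \<otimes>\<^bsub>S\<^esub> f' = pure k \<one> \<otimes>\<^bsub>S\<^esub> (f \<otimes>\<^bsub>S\<^esub> f')" if "k \<in> carrier A" "f \<in> carrier S" "f' \<in> carrier S" for k f f'
    using that by (simp add: S.m_assoc)
  show "\<exists>p. is_tensor A S M SB p"
  proof (rule tensor_exists[OF M, where F = "pure \<one>\<^bsub>A\<^esub> ` carrier G"])
    show "bspace SB = left_gen (carrier A) SB (pure \<one>\<^bsub>A\<^esub> ` carrier G)" using left_gen_SB by simp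
    fix f f' k assume f: "f \<in> bspace SB" "f' \<in> carrier S"
    \<comment> \<open>Scalars act alike from both sides, as (k 1) \<otimes> 1 is k times the unit of
      the skew group algebra.\<close>
    have "pure (k \<odot>\<^bsub>A\<^esub> \<one>\<^bsub>A\<^esub>) \<one> = k \<odot>\<^bsub>S\<^esub> \<one>\<^bsub>S\<^esub>" by (simp add: pure_linear S_simps(5))
    then show "bract SB f (k \<odot>\<^bsub>S\<^esub> f') = blact SB (k \<odot>\<^bsub>A\<^esub> \<one>\<^bsub>A\<^esub>) (bract SB f f')"
      using f by (simp add: S_smult)
  qed (use fd fd_S finite_G in \<open>auto simp: S.l_distr S.r_distr S.m_assoc\<close>)
  fix \<beta> x f assume \<beta>: "balanced A M SB \<beta>" and x: "x \<in> space M" and f: "f \<in> bspace SB"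
  have "\<beta> x f = (\<Sum>g\<in>carrier G. \<beta> x (pure (f g) g))"
    using finsum_to_sum[OF S.abelian_monoid_axioms finite_G, of "\<lambda>g. pure (f g) g" "\<beta> x"]
      S_decomp[of f] f \<beta> x S_apply[of f] by (simp add: balanced_def)
  also have "\<dots> = (\<Sum>g\<in>carrier G. \<beta> (ract M x (f g)) (pure \<one>\<^bsub>A\<^esub> g))"
  proof (rule sum.cong[OF refl])
    fix g assume g: "g \<in> carrier G"
    have fg: "f g \<in> carrier A" using S_apply[of f g] f g by simp
    have "\<beta> (ract M x (f g)) (pure \<one>\<^bsub>A\<^esub> g) = \<beta> x (pure (f g) \<one> \<otimes>\<^bsub>S\<^esub> pure \<one>\<^bsub>A\<^esub> g)"
      using \<beta> x fg by (simp add: balanced_def)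
    then show "\<beta> x (pure (f g) g) = \<beta> (ract M x (f g)) (pure \<one>\<^bsub>A\<^esub> g)"
      using pure_one_mult[OF fg g] by simp
  qed
  finally show "\<beta> x f = (\<Sum>g\<in>carrier G. \<beta> (ract M x (f g)) (pure \<one>\<^bsub>A\<^esub> g))" .
qed (auto simp: finite_G S_apply S_simps(1) pure_mult pure_apply act)

sublocale T: free_bimodule A S SB "carrier G" "pure \<one>\<^bsub>A\<^esub>" "\<lambda>g f. f g" by (rule free_bimodule_SB)

lemma skew_induction_eq: "skew_induction G A act X = T.FC X"
  by (simp add: skew_induction_def T.tensor_cpx_eq)

text \<open>The h-coordinate of x \<otimes> f' is x f'(h), so the right action is the convolution
  product with the coordinates in place of the first factor. The equivariance computations for
  induced modules all start from this formula.\<close>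

lemma coord_ract:
  assumes M: "right_module A M" and t: "t \<in> space (T.TM M)" and f: "f \<in> carrier S" and h: "h \<in> carrier G"
  shows "T.coord M h (ract (T.TM M) t f) = (\<Sum>a\<in>carrier G. ract M (T.coord M a t) (act a (f (inv a \<otimes> h))))"
proof (rule T.TM_ext[OF M _ _ _ t, where \<phi> = "\<lambda>t. T.coord M h (ract (T.TM M) t f)"
      and \<psi> = "\<lambda>t. \<Sum>a\<in>carrier G. ract M (T.coord M a t) (act a (f (inv a \<otimes> h)))"])
  note R = right_moduleD[OF T.TM_module[OF M]]
  have fa: "act a (f (inv a \<otimes> h)) \<in> carrier A" if "a \<in> carrier G" for a
    using f h that by (simp add: act S_apply)
  show "linear_on (space (T.TM M)) (\<lambda>t. T.coord M h (ract (T.TM M) t f))"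
    by (rule linear_on_comp[OF R(2)[OF f] _ T.coord(1)[OF M h]]) (auto simp: R(1) f)
  show "linear_on (space (T.TM M)) (\<lambda>t. \<Sum>a\<in>carrier G. ract M (T.coord M a t) (act a (f (inv a \<otimes> h))))"
    by (rule linear_on_sum, rule linear_on_comp[OF T.coord(1)[OF M] _ right_moduleD(2)[OF M fa]])
      (auto simp: T.coord_closed[OF M])
  fix x f' assume x: "x \<in> space M" and f': "f' \<in> bspace SB"
  have f'S: "f' \<in> carrier S" using f' by simp
  have "T.coord M h (ract (T.TM M) (T.te M x f') f) = ract M x ((f' \<otimes>\<^bsub>S\<^esub> f) h)"
    using T.te_ract[OF M x f' f] T.coord(2)[OF M h x, of "f' \<otimes>\<^bsub>S\<^esub> f"] f'S f by simp
  also have "\<dots> = (\<Sum>a\<in>carrier G. ract M x (f' a \<otimes>\<^bsub>A\<^esub> act a (f (inv a \<otimes> h))))"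
    unfolding S_simps(4)[OF h]
    by (rule ract_finsum[OF A.ring_axioms M x finite_G]) (use f'S fa in \<open>simp add: S_apply\<close>)
  also have "\<dots> = (\<Sum>a\<in>carrier G. ract M (T.coord M a (T.te M x f')) (act a (f (inv a \<otimes> h))))"
    by (rule sum.cong[OF refl])
      (use T.coord(2)[OF M _ x f'] right_moduleD(4)[OF M x _ fa] S_apply[OF f'S] in simp)
  finally show "T.coord M h (ract (T.TM M) (T.te M x f') f) =
      (\<Sum>a\<in>carrier G. ract M (T.coord M a (T.te M x f')) (act a (f (inv a \<otimes> h))))" .
qed

text \<open>For f = l \<otimes> 1 the single surviving term is a = g, and it carries the action of g
  on l. So the g-th coordinate is A-linear from the restricted module to the twist by g.\<close>

lemma coord_ract_pure:
  assumes M: "right_module A M" and t: "t \<in> space (T.TM M)" and l: "l \<in> carrier A" and g: "g \<in> carrier G"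
  shows "T.coord M g (ract (T.TM M) t (pure l \<one>)) = ract M (T.coord M g t) (act g l)"
proof -
  have z: "ract M y \<zero>\<^bsub>A\<^esub> = 0" if "y \<in> space M" for y
    using right_moduleD(3)[OF M that, of "\<zero>\<^bsub>A\<^esub>" "\<zero>\<^bsub>A\<^esub>"] by simp
  have "T.coord M g (ract (T.TM M) t (pure l \<one>)) =
      (\<Sum>a\<in>carrier G. ract M (T.coord M a t) (act a (pure l \<one> (inv a \<otimes> g))))"
    using coord_ract[OF M t _ g] l by simp
  also have "\<dots> = (\<Sum>a\<in>carrier G. if a = g then ract M (T.coord M a t) (act a l) else 0)"
  proof (rule sum.cong[OF refl])
    fix a assume a: "a \<in> carrier G"
    have "inv a \<otimes> g = \<one> \<longleftrightarrow> a = g" using a g by (metis inv_closed inv_equality inv_inv l_inv)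
    then show "ract M (T.coord M a t) (act a (pure l \<one> (inv a \<otimes> g))) =
        (if a = g then ract M (T.coord M a t) (act a l) else 0)"
      using a g z[OF T.coord_closed[OF M a t]] by (simp add: pure_apply act_zero)
  qed
  also have "\<dots> = ract M (T.coord M g t) (act g l)" using g finite_G by simp
  finally show ?thesis .
qed

section \<open>Restriction along the inclusion of A\<close>

definition res_module :: "('k, 'g \<Rightarrow> 'a) rmodule \<Rightarrow> ('k, 'a) rmodule" where
  "res_module M = \<lparr>space = space M, ract = (\<lambda>x l. ract M x (pure l \<one>))\<rparr>"

lemma res_simps [simp]: "space (res_module M) = space M" "ract (res_module M) x l = ract M x (pure l \<one>)"
  by (simp_all add: res_module_def)

lemma right_module_res:
  assumes M: "right_module S M"
  shows "right_module A (res_module M)"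
proof -
  have sp: "\<exists>B. finite B \<and> space M = vs.span B" using M by (simp add: right_module_def)
  have mult: "pure (a \<otimes>\<^bsub>A\<^esub> b) \<one> = pure a \<one> \<otimes>\<^bsub>S\<^esub> pure b \<one>" if "a \<in> carrier A" "b \<in> carrier A" for a b
    using that by (simp add: pure_pure act(6)[OF one_closed])
  show ?thesis
    unfolding right_module_def
    using sp right_moduleD[OF M] by (simp add: pure_linear mult S_simps(5)[symmetric])
qed

text \<open>Restriction keeps the space, so it has a single coordinate, the identity; the general
  results on coordinate functors then apply to it too.\<close>

sublocale R: coord_functor S A "{()}" res_module "\<lambda>M N f. f" "\<lambda>M j t. t"
proof unfold_locales
  show "right_module A (res_module M)" if "right_module S M" for M by (rule right_module_res[OF that])
  show "rmodule_hom A (res_module M) (res_module N) f" if "rmodule_hom S M N f" for M N f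
    using that by (auto simp: rmodule_hom_def)
qed (auto simp: linear_on_def)

lemma skew_restriction_eq: "skew_restriction G A U = R.FC U"
  by (simp add: skew_restriction_def cpx_map_def res_module_def)

end

section \<open>Restriction after induction\<close>

context skew_setting
begin

sublocale TA: twist_setting G A act by unfold_locales (rule alg)

lemma chain_map_coord:
  assumes X: "bounded_complex A X" and g: "g \<in> carrier G"
  shows "chain_map A (R.FC (T.FC X)) (tw_cpx act g X) (\<lambda>i. T.coord (obj X i) g)"
proof (rule chain_mapI[OF R.bounded_FC[OF T.bounded_FC[OF X]] TA.bounded_complex_tw[OF X g]])
  note m = bounded_complexD(1)[OF X]
  show "rmodule_hom A (obj (R.FC (T.FC X)) i) (obj (tw_cpx act g X) i) (T.coord (obj X i) g)" for i
    using T.coord(1)[OF m g] T.coord_closed[OF m g] coord_ract_pure[OF m _ _ g]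
    by (auto simp: rmodule_hom_def)
  show "T.coord (obj X (i + 1)) g (diff (R.FC (T.FC X)) i t) = diff (tw_cpx act g X) i (T.coord (obj X i) g t)"
    if "t \<in> space (obj (R.FC (T.FC X)) i)" for i t
    using T.coord_diff[OF X _ g, of t i] that by simp
qed

lemma RT_decomposition:
  assumes X: "bounded_complex A X"
  shows "\<exists>W \<Phi>. bounded_complex A W \<and> quasi_iso A (R.FC (T.FC X)) (dsum X W) \<Phi> \<and>
      (\<forall>i. \<forall>z\<in>space (obj (R.FC (T.FC X)) i). vfst (\<Phi> i z) = T.coord (obj X i) \<one> z)"
    and "H_invariant G A act X \<Longrightarrow> cpx_iso A (R.FC (T.FC X)) (dsum_power (card (carrier G)) X)"
proof -
  note m = bounded_complexD(1)[OF X]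
  note d = TA.twist_decomposition[OF X R.bounded_FC[OF T.bounded_FC[OF X]], where q = "\<lambda>g i. T.coord (obj X i) g",
      OF chain_map_coord[OF X]]
  have inj: "t = t'" if "t \<in> space (obj (R.FC (T.FC X)) i)" "t' \<in> space (obj (R.FC (T.FC X)) i)"
      "\<And>g. g \<in> carrier G \<Longrightarrow> T.coord (obj X i) g t = T.coord (obj X i) g t'" for i t t'
    by (rule T.coord_inj[OF m]) (use that in simp_all)
  have surj: "\<exists>t\<in>space (obj (R.FC (T.FC X)) i). \<forall>g\<in>carrier G. T.coord (obj X i) g t = x g"
    if "\<And>g. g \<in> carrier G \<Longrightarrow> x g \<in> space (obj X i)" for i x
    using T.coord_surj[OF m that] by simp
  show "\<exists>W \<Phi>. bounded_complex A W \<and> quasi_iso A (R.FC (T.FC X)) (dsum X W) \<Phi> \<and>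
      (\<forall>i. \<forall>z\<in>space (obj (R.FC (T.FC X)) i). vfst (\<Phi> i z) = T.coord (obj X i) \<one> z)"
    by (rule d(1)[OF _ inj surj])
  show "H_invariant G A act X \<Longrightarrow> cpx_iso A (R.FC (T.FC X)) (dsum_power (card (carrier G)) X)"
    by (rule d(2)[OF _ inj surj])
qed

text \<open>Restriction is the first functor and induction the second; the natural projection is the
  coordinate at the identity of G. This instance transfers tilting objects from the skew group
  algebra to A.\<close>

sublocale PA: separable_pair S A "{()}" res_module "\<lambda>M N f. f" "\<lambda>M j t. t"
  "carrier G" "\<lambda>M. tensor_module A S M SB" "\<lambda>M M'. tensor_map A S M M' SB" T.coord
  "\<lambda>X i. T.coord (obj X i) \<one>"
proof unfold_locales
  fix X Y f t i assume f: "chain_map A X Y f" and t: "t \<in> space (obj (R.FC (T.FC X)) i)"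
  show "T.coord (obj Y i) \<one> (R.FM (T.FC X) (T.FC Y) (T.FM X Y f) i t) = f i (T.coord (obj X i) \<one> t)"
    using T.coord_FM[OF f _ one_closed, of t i] t by (simp add: cmap_map_def)
next
  fix Y assume Y: "bounded_complex A Y"
  have "chain_map A (tw_cpx act \<one> Y) Y (\<lambda>i x. x)"
    by (rule chain_mapI[OF TA.bounded_complex_tw[OF Y one_closed] Y])
      (auto simp: rmodule_hom_def linear_on_def act(6)[OF one_closed])
  from chain_map_comp[OF chain_map_coord[OF Y one_closed] this]
  show "chain_map A (R.FC (T.FC Y)) Y (\<lambda>i. T.coord (obj Y i) \<one>)" .
  show "\<exists>Z \<Phi>. bounded_complex A Z \<and> quasi_iso A (R.FC (T.FC Y)) (dsum Y Z) \<Phi> \<and>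
      (\<forall>i. \<forall>t\<in>space (obj (R.FC (T.FC Y)) i). vfst (\<Phi> i t) = T.coord (obj Y i) \<one> t)"
    by (rule RT_decomposition(1)[OF Y])
qed

text \<open>G acts on every module over the skew group algebra through the units 1 \<otimes> g. For
  right modules the inverse is needed to obtain a left action, and (l \<otimes> 1)(1 \<otimes> g^-1)
  = (1 \<otimes> g^-1)(g(l) \<otimes> 1) is the semilinearity.\<close>

lemma H_invariant_restriction:
  assumes U: "bounded_complex S U"
  shows "H_invariant G A act (R.FC U)"
proof (rule TA.H_invariantI[OF R.bounded_FC[OF U], where \<theta> = "\<lambda>g i x. ract (obj U i) x (pure \<one>\<^bsub>A\<^esub> (inv g))"])
  note m = bounded_complexD(1)[OF U]
  note r = right_moduleD[OF m]
  have p: "pure \<one>\<^bsub>A\<^esub> g \<in> carrier S" if "g \<in> carrier G" for g by simp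
  have pp: "pure \<one>\<^bsub>A\<^esub> g \<otimes>\<^bsub>S\<^esub> pure \<one>\<^bsub>A\<^esub> h = pure \<one>\<^bsub>A\<^esub> (g \<otimes> h)" if "g \<in> carrier G" "h \<in> carrier G" for g h
    using that by (simp add: pure_pure act)
  have cancel: "ract (obj U i) (ract (obj U i) x (pure \<one>\<^bsub>A\<^esub> g)) (pure \<one>\<^bsub>A\<^esub> h) = x"
    if "x \<in> space (obj U i)" "g \<in> carrier G" "h \<in> carrier G" "g \<otimes> h = \<one>" for i x g h
    using r(4)[OF that(1) p[OF that(2)] p[OF that(3)]] r(6)[OF that(1)] pp[OF that(2,3)] that(4)
    by (simp add: S_simps(5))
  fix g i assume g: "g \<in> carrier G"
  show "linear_on (space (obj (R.FC U) i)) (\<lambda>x. ract (obj U i) x (pure \<one>\<^bsub>A\<^esub> (inv g)))"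
    using r(2)[OF p] g by simp
  show "bij_betw (\<lambda>x. ract (obj U i) x (pure \<one>\<^bsub>A\<^esub> (inv g))) (space (obj (R.FC U) i)) (space (obj (R.FC U) i))"
    by (rule bij_betw_byWitness[where f' = "\<lambda>x. ract (obj U i) x (pure \<one>\<^bsub>A\<^esub> g)"])
      (use g r(1) p cancel in auto)
  fix x assume "x \<in> space (obj (R.FC U) i)"
  then have x: "x \<in> space (obj U i)" by simp
  show "ract (obj U (i + 1)) (diff (R.FC U) i x) (pure \<one>\<^bsub>A\<^esub> (inv g)) =
      diff (R.FC U) i (ract (obj U i) x (pure \<one>\<^bsub>A\<^esub> (inv g)))"
    using rmodule_homD(3)[OF bounded_complexD(2)[OF U] x p[of "inv g"]] g by simp
  show "ract (obj U i) (ract (obj (R.FC U) i) x l) (pure \<one>\<^bsub>A\<^esub> (inv g)) =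
      ract (obj (R.FC U) i) (ract (obj U i) x (pure \<one>\<^bsub>A\<^esub> (inv g))) (act g l)" if l: "l \<in> carrier A" for l
  proof -
    have "pure l \<one> \<otimes>\<^bsub>S\<^esub> pure \<one>\<^bsub>A\<^esub> (inv g) = pure l (inv g)"
      using l g by (simp add: pure_one_mult)
    moreover have "act (inv g) (act g l) = l"
      using act(7)[of "inv g" l g] act(6)[OF g l] g l by simp
    then have "pure \<one>\<^bsub>A\<^esub> (inv g) \<otimes>\<^bsub>S\<^esub> pure (act g l) \<one> = pure l (inv g)"
      using l g by (simp add: pure_pure act(1))
    ultimately show ?thesis
      using r(4)[OF x, of "pure l \<one>" "pure \<one>\<^bsub>A\<^esub> (inv g)"]
        r(4)[OF x, of "pure \<one>\<^bsub>A\<^esub> (inv g)" "pure (act g l) \<one>"] l g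
      by (simp add: act(1))
  qed
  fix g' assume g': "g' \<in> carrier G"
  show "ract (obj U i) x (pure \<one>\<^bsub>A\<^esub> (inv (g \<otimes> g'))) =
      ract (obj U i) (ract (obj U i) x (pure \<one>\<^bsub>A\<^esub> (inv g'))) (pure \<one>\<^bsub>A\<^esub> (inv g))"
    using r(4)[OF x p[of "inv g'"] p[of "inv g"]] pp[of "inv g'" "inv g"] g g' by (simp add: inv_mult_group)
qed

end

section \<open>Induction after restriction\<close>

context skew_dual
begin

sublocale TD: twist_setting D S "dual_action G A" by unfold_locales (rule H_algebra_dual)

text \<open>
  The projections of \<open>Res Y \<otimes> \<Lambda>G\<close> onto the twists of \<open>Y\<close> by characters: \<open>x \<otimes> g\<close> goes to \<open>\<chi>(g) x g\<close>.
\<close>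

definition char_proj :: "('g \<Rightarrow> 'k) \<Rightarrow> ('k, 'g \<Rightarrow> 'a) rmodule \<Rightarrow> 'k vec \<Rightarrow> 'k vec" where
  "char_proj \<chi> M t = (\<Sum>g\<in>carrier G. vscale (\<chi> g) (ract M (T.coord (res_module M) g t) (pure \<one>\<^bsub>A\<^esub> g)))"

lemma char_proj_summand_closed:
  assumes M: "right_module S M" and t: "t \<in> space (T.TM (res_module M))" and g: "g \<in> carrier G"
  shows "T.coord (res_module M) g t \<in> space M"
    and "ract M (T.coord (res_module M) g t) (pure \<one>\<^bsub>A\<^esub> g) \<in> space M"
proof -
  show *: "T.coord (res_module M) g t \<in> space M" using T.coord_closed[OF right_module_res[OF M] g t] by simp
  show "ract M (T.coord (res_module M) g t) (pure \<one>\<^bsub>A\<^esub> g) \<in> space M"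
    using right_moduleD(1)[OF M *] by simp
qed

lemma char_proj_linear:
  assumes M: "right_module S M"
  shows "linear_on (space (T.TM (res_module M))) (char_proj \<chi> M)"
proof -
  have "linear_on (space (T.TM (res_module M))) (\<lambda>t. vscale (\<chi> g) (ract M (T.coord (res_module M) g t) (pure \<one>\<^bsub>A\<^esub> g)))"
    if g: "g \<in> carrier G" for g
  proof (rule linear_on_comp[OF T.coord(1)[OF right_module_res[OF M] g], where W = "space M"])
    show "T.coord (res_module M) g ` space (T.TM (res_module M)) \<subseteq> space M"
      using char_proj_summand_closed(1)[OF M _ g] by auto
    have "linear_on (space M) (\<lambda>x. ract M x (pure \<one>\<^bsub>A\<^esub> g))" by (rule right_moduleD(2)[OF M]) simp
    then show "linear_on (space M) (\<lambda>x. vscale (\<chi> g) (ract M x (pure \<one>\<^bsub>A\<^esub> g)))"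
      by (simp add: linear_on_def vs.scale_right_distrib mult.commute)
  qed
  then show ?thesis unfolding char_proj_def by (rule linear_on_sum)
qed

lemma char_proj_closed:
  assumes M: "right_module S M" and t: "t \<in> space (T.TM (res_module M))"
  shows "char_proj \<chi> M t \<in> space M"
  unfolding char_proj_def
  by (intro vs.subspace_sum[OF right_module_subspace[OF M]] vs.subspace_scale[OF right_module_subspace[OF M]]
      char_proj_summand_closed(2)[OF M t])

text \<open>The coordinate formula produces a double sum over b and h. For fixed b, splitting
  \<chi>(h) as \<chi>(b) \<chi>(b^-1 h) makes the inner sum the action of (1 \<otimes> b) times the
  twisted f. Thus the projection is linear into the twist by \<chi>.\<close>

lemma char_proj_ract:
  assumes M: "right_module S M" and t: "t \<in> space (T.TM (res_module M))" and f: "f \<in> carrier S"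
    and \<chi>: "\<chi> \<in> carrier D"
  shows "char_proj \<chi> M (ract (T.TM (res_module M)) t f) = ract M (char_proj \<chi> M t) (dual_action G A \<chi> f)"
proof -
  note r = right_moduleD[OF M] and MS = right_module_subspace[OF M]
  let ?c = "\<lambda>g. T.coord (res_module M) g t"
  let ?a = "\<lambda>a h. act a (f (inv a \<otimes> h))"
  have c: "?c g \<in> space M" if "g \<in> carrier G" for g by (rule char_proj_summand_closed(1)[OF M t that])
  have a: "?a b h \<in> carrier A" if "b \<in> carrier G" "h \<in> carrier G" for b h
    using f that by (simp add: act S_apply)
  have "char_proj \<chi> M (ract (T.TM (res_module M)) t f) =
      (\<Sum>h\<in>carrier G. \<Sum>b\<in>carrier G. vscale (\<chi> h) (ract M (?c b) (pure (?a b h) h)))"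
    unfolding char_proj_def
  proof (rule sum.cong[OF refl])
    fix h assume h: "h \<in> carrier G"
    have "ract M (T.coord (res_module M) h (ract (T.TM (res_module M)) t f)) (pure \<one>\<^bsub>A\<^esub> h) =
        ract M (\<Sum>b\<in>carrier G. ract M (?c b) (pure (?a b h) \<one>)) (pure \<one>\<^bsub>A\<^esub> h)"
      using coord_ract[OF right_module_res[OF M] t f h] by simp
    also have "\<dots> = (\<Sum>b\<in>carrier G. ract M (ract M (?c b) (pure (?a b h) \<one>)) (pure \<one>\<^bsub>A\<^esub> h))"
      by (rule linear_on_subspace(4)[OF r(2) MS]) (use r(1)[OF c] a h in auto)
    also have "\<dots> = (\<Sum>b\<in>carrier G. ract M (?c b) (pure (?a b h) h))"
    proof (rule sum.cong[OF refl])
      fix b assume b: "b \<in> carrier G"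
      show "ract M (ract M (?c b) (pure (?a b h) \<one>)) (pure \<one>\<^bsub>A\<^esub> h) = ract M (?c b) (pure (?a b h) h)"
        using r(4)[OF c[OF b], of "pure (?a b h) \<one>" "pure \<one>\<^bsub>A\<^esub> h"] a[OF b h] h by (simp add: pure_one_mult)
    qed
    finally show "vscale (\<chi> h) (ract M (T.coord (res_module M) h (ract (T.TM (res_module M)) t f)) (pure \<one>\<^bsub>A\<^esub> h)) =
        (\<Sum>b\<in>carrier G. vscale (\<chi> h) (ract M (?c b) (pure (?a b h) h)))"
      by (simp add: vs.scale_sum_right)
  qed
  also have "\<dots> = (\<Sum>b\<in>carrier G. \<Sum>h\<in>carrier G. vscale (\<chi> h) (ract M (?c b) (pure (?a b h) h)))"
    by (rule sum.swap)
  also have "\<dots> = (\<Sum>b\<in>carrier G. vscale (\<chi> b) (ract M (ract M (?c b) (pure \<one>\<^bsub>A\<^esub> b)) (dual_action G A \<chi> f)))"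
  proof (rule sum.cong[OF refl])
    fix b assume b: "b \<in> carrier G"
    let ?f = "pure \<one>\<^bsub>A\<^esub> b \<otimes>\<^bsub>S\<^esub> dual_action G A \<chi> f"
    have fS: "?f \<in> carrier S" using dual_action_closed[OF f] by simp
    have fh: "?f h = \<chi> (inv b \<otimes> h) \<odot>\<^bsub>A\<^esub> ?a b h" if h: "h \<in> carrier G" for h
    proof -
      have "?f h = \<one>\<^bsub>A\<^esub> \<otimes>\<^bsub>A\<^esub> act b (dual_action G A \<chi> f (inv b \<otimes> h))"
        by (rule pure_mult[OF dual_action_closed[OF f] A.one_closed b h])
      also have "\<dots> = \<one>\<^bsub>A\<^esub> \<otimes>\<^bsub>A\<^esub> (\<chi> (inv b \<otimes> h) \<odot>\<^bsub>A\<^esub> ?a b h)"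
        using f b h by (simp add: dual_action_apply act(5) S_apply)
      finally show ?thesis using smult_A(1)[OF a[OF b h]] by simp
    qed
    have "ract M (ract M (?c b) (pure \<one>\<^bsub>A\<^esub> b)) (dual_action G A \<chi> f) = ract M (?c b) ?f"
      using r(4)[OF c[OF b], of "pure \<one>\<^bsub>A\<^esub> b"] dual_action_closed[OF f] by simp
    also have "\<dots> = ract M (?c b) (\<Oplus>\<^bsub>S\<^esub>h\<in>carrier G. pure (?f h) h)"
      using S_decomp[OF fS] by simp
    also have "\<dots> = (\<Sum>h\<in>carrier G. ract M (?c b) (pure (?f h) h))"
      by (rule ract_finsum[OF ring_S M c[OF b] finite_G]) (use S_apply[OF fS] in simp)
    also have "\<dots> = (\<Sum>h\<in>carrier G. vscale (\<chi> (inv b \<otimes> h)) (ract M (?c b) (pure (?a b h) h)))"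
    proof (rule sum.cong[OF refl])
      fix h assume h: "h \<in> carrier G"
      show "ract M (?c b) (pure (?f h) h) = vscale (\<chi> (inv b \<otimes> h)) (ract M (?c b) (pure (?a b h) h))"
        unfolding fh[OF h] pure_linear(3)[OF a[OF b h]]
        by (rule r(5)[OF c[OF b]]) (simp add: a b h)
    qed
    finally have "vscale (\<chi> b) (ract M (ract M (?c b) (pure \<one>\<^bsub>A\<^esub> b)) (dual_action G A \<chi> f)) =
        (\<Sum>h\<in>carrier G. vscale (\<chi> b * \<chi> (inv b \<otimes> h)) (ract M (?c b) (pure (?a b h) h)))"
      by (simp add: vs.scale_sum_right)
    also have "\<dots> = (\<Sum>h\<in>carrier G. vscale (\<chi> h) (ract M (?c b) (pure (?a b h) h)))"
    proof (rule sum.cong[OF refl])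
      fix h assume h: "h \<in> carrier G"
      have "\<chi> b * \<chi> (inv b \<otimes> h) = \<chi> h"
        using char(2)[OF \<chi> b, of "inv b \<otimes> h"] b h by (simp add: m_assoc[symmetric])
      then show "vscale (\<chi> b * \<chi> (inv b \<otimes> h)) (ract M (?c b) (pure (?a b h) h)) =
          vscale (\<chi> h) (ract M (?c b) (pure (?a b h) h))" by simp
    qed
    finally show "(\<Sum>h\<in>carrier G. vscale (\<chi> h) (ract M (?c b) (pure (?a b h) h))) =
        vscale (\<chi> b) (ract M (ract M (?c b) (pure \<one>\<^bsub>A\<^esub> b)) (dual_action G A \<chi> f))" by simp
  qed
  also have "\<dots> = ract M (char_proj \<chi> M t) (dual_action G A \<chi> f)"
  proof -
    note l = r(2)[OF dual_action_closed[OF f, of \<chi>]]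
    have y: "ract M (?c b) (pure \<one>\<^bsub>A\<^esub> b) \<in> space M" if "b \<in> carrier G" for b
      by (rule char_proj_summand_closed(2)[OF M t that])
    have "ract M (char_proj \<chi> M t) (dual_action G A \<chi> f) =
        (\<Sum>b\<in>carrier G. ract M (vscale (\<chi> b) (ract M (?c b) (pure \<one>\<^bsub>A\<^esub> b))) (dual_action G A \<chi> f))"
      unfolding char_proj_def by (rule linear_on_subspace(4)[OF l MS]) (rule vs.subspace_scale[OF MS y])
    also have "\<dots> = (\<Sum>b\<in>carrier G. vscale (\<chi> b) (ract M (ract M (?c b) (pure \<one>\<^bsub>A\<^esub> b)) (dual_action G A \<chi> f)))"
      by (rule sum.cong[OF refl]) (rule linear_onD(2)[OF l y])
    finally show ?thesis by simp
  qed
  finally show ?thesis .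
qed

lemma char_proj_natural:
  assumes M: "right_module S M" and M': "right_module S M'" and f: "rmodule_hom S M M' f"
    and t: "t \<in> space (T.TM (res_module M))"
  shows "char_proj \<chi> M' (tensor_map A S (res_module M) (res_module M') SB f t) = f (char_proj \<chi> M t)"
proof -
  have fR: "rmodule_hom A (res_module M) (res_module M') f" by (rule R.map_hom[OF M M' f])
  note cl = char_proj_summand_closed[OF M t]
  have "f (char_proj \<chi> M t) =
      (\<Sum>g\<in>carrier G. f (vscale (\<chi> g) (ract M (T.coord (res_module M) g t) (pure \<one>\<^bsub>A\<^esub> g))))"
    unfolding char_proj_def
    by (rule linear_on_subspace(4)[OF rmodule_homD(1)[OF f] right_module_subspace[OF M]])
      (rule vs.subspace_scale[OF right_module_subspace[OF M] cl(2)])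
  also have "\<dots> = char_proj \<chi> M' (tensor_map A S (res_module M) (res_module M') SB f t)"
    unfolding char_proj_def
  proof (rule sum.cong[OF refl])
    fix g assume g: "g \<in> carrier G"
    show "f (vscale (\<chi> g) (ract M (T.coord (res_module M) g t) (pure \<one>\<^bsub>A\<^esub> g))) =
        vscale (\<chi> g) (ract M' (T.coord (res_module M') g (tensor_map A S (res_module M) (res_module M') SB f t)) (pure \<one>\<^bsub>A\<^esub> g))"
      using linear_onD(2)[OF rmodule_homD(1)[OF f] cl(2)[OF g]] rmodule_homD(3)[OF f cl(1)[OF g]]
        T.coord_tensor_map[OF right_module_res[OF M] right_module_res[OF M'] fR t g] by simp
  qed
  finally show ?thesis by simp
qed

lemma pure_inverse:
  assumes M: "right_module S M" and x: "x \<in> space M" and g: "g \<in> carrier G"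
  shows "ract M (ract M x (pure \<one>\<^bsub>A\<^esub> g)) (pure \<one>\<^bsub>A\<^esub> (inv g)) = x"
    and "ract M (ract M x (pure \<one>\<^bsub>A\<^esub> (inv g))) (pure \<one>\<^bsub>A\<^esub> g) = x"
proof -
  have "pure \<one>\<^bsub>A\<^esub> g \<otimes>\<^bsub>S\<^esub> pure \<one>\<^bsub>A\<^esub> (inv g) = \<one>\<^bsub>S\<^esub>" "pure \<one>\<^bsub>A\<^esub> (inv g) \<otimes>\<^bsub>S\<^esub> pure \<one>\<^bsub>A\<^esub> g = \<one>\<^bsub>S\<^esub>"
    using g by (simp_all add: pure_pure act S_simps(5))
  then show "ract M (ract M x (pure \<one>\<^bsub>A\<^esub> g)) (pure \<one>\<^bsub>A\<^esub> (inv g)) = x"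
    and "ract M (ract M x (pure \<one>\<^bsub>A\<^esub> (inv g))) (pure \<one>\<^bsub>A\<^esub> g) = x"
    using right_moduleD(4)[OF M x, of "pure \<one>\<^bsub>A\<^esub> g" "pure \<one>\<^bsub>A\<^esub> (inv g)"]
      right_moduleD(4)[OF M x, of "pure \<one>\<^bsub>A\<^esub> (inv g)" "pure \<one>\<^bsub>A\<^esub> g"] right_moduleD(6)[OF M x]
    by simp_all
qed

text \<open>The coefficients from \<open>delta_char\<close> combine the projections to the single
  term x_h (1 \<otimes> h), and multiplication by 1 \<otimes> h^-1 recovers the coordinate
  x_h.\<close>

lemma char_proj_inj:
  assumes M: "right_module S M" and t: "t \<in> space (T.TM (res_module M))" "t' \<in> space (T.TM (res_module M))"
    and eq: "\<And>\<chi>. \<chi> \<in> carrier D \<Longrightarrow> char_proj \<chi> M t = char_proj \<chi> M t'"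
  shows "t = t'"
proof (rule T.coord_inj[OF right_module_res[OF M] t])
  fix h assume h: "h \<in> carrier G"
  let ?y = "\<lambda>t g. ract M (T.coord (res_module M) g t) (pure \<one>\<^bsub>A\<^esub> g)"
  obtain b where b: "\<And>g. g \<in> carrier G \<Longrightarrow> (\<Sum>\<chi>\<in>carrier D. b \<chi> * \<chi> g) = (if g = h then 1 else 0)"
    using delta_char[OF h] by blast
  have y: "?y s h = (\<Sum>\<chi>\<in>carrier D. vscale (b \<chi>) (char_proj \<chi> M s))" for s
  proof -
    have "(\<Sum>\<chi>\<in>carrier D. vscale (b \<chi>) (char_proj \<chi> M s)) =
        (\<Sum>g\<in>carrier G. \<Sum>\<chi>\<in>carrier D. vscale (b \<chi> * \<chi> g) (?y s g))"
      unfolding char_proj_def vs.scale_sum_right by (subst sum.swap) simp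
    also have "\<dots> = (\<Sum>g\<in>carrier G. if g = h then ?y s g else 0)"
      by (rule sum.cong[OF refl]) (simp add: vs.scale_sum_left[symmetric] b)
    also have "\<dots> = ?y s h" using h finite_G by simp
    finally show ?thesis by simp
  qed
  have "?y t h = ?y t' h" unfolding y using eq by simp
  then show "T.coord (res_module M) h t = T.coord (res_module M) h t'"
    using pure_inverse(1)[OF M char_proj_summand_closed(1)[OF M t(1) h] h]
      pure_inverse(1)[OF M char_proj_summand_closed(1)[OF M t(2) h] h] by metis
qed

lemma char_proj_surj:
  assumes M: "right_module S M" and z: "\<And>\<chi>. \<chi> \<in> carrier D \<Longrightarrow> z \<chi> \<in> space M"
  shows "\<exists>t\<in>space (T.TM (res_module M)). \<forall>\<chi>\<in>carrier D. char_proj \<chi> M t = z \<chi>"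
proof -
  \<comment> \<open>The inverse Fourier transform of z. Taking y(g) (1 \<otimes> g^-1) as the g-th
    coordinate lets the projections see y(g) itself, and orthogonality returns z.\<close>
  define y where "y = (\<lambda>g. \<Sum>\<psi>\<in>carrier D. vscale (inverse n * \<psi> (inv g)) (z \<psi>))"
  have y: "y g \<in> space M" if "g \<in> carrier G" for g
    unfolding y_def
    by (intro vs.subspace_sum[OF right_module_subspace[OF M]] vs.subspace_scale[OF right_module_subspace[OF M]] z)
  have "ract M (y g) (pure \<one>\<^bsub>A\<^esub> (inv g)) \<in> space (res_module M)" if "g \<in> carrier G" for g
    using right_moduleD(1)[OF M y[OF that]] by simp
  then have "\<exists>t\<in>space (T.TM (res_module M)). \<forall>g\<in>carrier G.
      T.coord (res_module M) g t = ract M (y g) (pure \<one>\<^bsub>A\<^esub> (inv g))"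
    by (rule T.coord_surj[OF right_module_res[OF M]])
  then obtain t where t: "t \<in> space (T.TM (res_module M))"
      "\<And>g. g \<in> carrier G \<Longrightarrow> T.coord (res_module M) g t = ract M (y g) (pure \<one>\<^bsub>A\<^esub> (inv g))"
    by blast
  have "char_proj \<chi> M t = z \<chi>" if \<chi>: "\<chi> \<in> carrier D" for \<chi>
  proof -
    have "char_proj \<chi> M t = (\<Sum>g\<in>carrier G. vscale (\<chi> g) (y g))"
      unfolding char_proj_def by (rule sum.cong[OF refl]) (simp add: t(2) pure_inverse(2)[OF M y])
    also have "\<dots> = (\<Sum>\<psi>\<in>carrier D. \<Sum>g\<in>carrier G. vscale (inverse n * (\<chi> g * \<psi> (inv g))) (z \<psi>))"
      unfolding y_def vs.scale_sum_right by (subst sum.swap) (simp add: mult_ac)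
    also have "\<dots> = (\<Sum>\<psi>\<in>carrier D. if \<psi> = \<chi> then z \<psi> else 0)"
    proof (rule sum.cong[OF refl])
      fix \<psi> assume \<psi>: "\<psi> \<in> carrier D"
      have "(\<Sum>g\<in>carrier G. vscale (inverse n * (\<chi> g * \<psi> (inv g))) (z \<psi>)) =
          vscale (inverse n * (\<Sum>g\<in>carrier G. \<chi> g * \<psi> (inv g))) (z \<psi>)"
        by (simp add: vs.scale_sum_left[symmetric] sum_distrib_left)
      then show "(\<Sum>g\<in>carrier G. vscale (inverse n * (\<chi> g * \<psi> (inv g))) (z \<psi>)) = (if \<psi> = \<chi> then z \<psi> else 0)"
        using char_orthogonal[OF \<chi> \<psi>] n_nonzero by auto
    qed
    also have "\<dots> = z \<chi>" using \<chi> finite_D by simp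
    finally show ?thesis .
  qed
  then show ?thesis using t(1) by blast
qed

lemma chain_map_char_proj:
  assumes Y: "bounded_complex S Y" and \<chi>: "\<chi> \<in> carrier D"
  shows "chain_map S (T.FC (R.FC Y)) (tw_cpx (dual_action G A) \<chi> Y) (\<lambda>i. char_proj \<chi> (obj Y i))"
proof (rule chain_mapI[OF T.bounded_FC[OF R.bounded_FC[OF Y]] TD.bounded_complex_tw[OF Y \<chi>]])
  note m = bounded_complexD(1)[OF Y]
  show "rmodule_hom S (obj (T.FC (R.FC Y)) i) (obj (tw_cpx (dual_action G A) \<chi> Y) i) (char_proj \<chi> (obj Y i))" for i
    using char_proj_linear[OF m] char_proj_closed[OF m] char_proj_ract[OF m _ _ \<chi>]
    by (auto simp: rmodule_hom_def)
  show "char_proj \<chi> (obj Y (i + 1)) (diff (T.FC (R.FC Y)) i t) = diff (tw_cpx (dual_action G A) \<chi> Y) i (char_proj \<chi> (obj Y i) t)"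
    if "t \<in> space (obj (T.FC (R.FC Y)) i)" for i t
    using char_proj_natural[OF m m bounded_complexD(2)[OF Y]] that by simp
qed

lemma TR_decomposition:
  assumes Y: "bounded_complex S Y"
  shows "\<exists>W \<Phi>. bounded_complex S W \<and> quasi_iso S (T.FC (R.FC Y)) (dsum Y W) \<Phi> \<and>
      (\<forall>i. \<forall>z\<in>space (obj (T.FC (R.FC Y)) i). vfst (\<Phi> i z) = char_proj \<one>\<^bsub>D\<^esub> (obj Y i) z)"
    and "H_invariant D S (dual_action G A) Y \<Longrightarrow> cpx_iso S (T.FC (R.FC Y)) (dsum_power (card (carrier D)) Y)"
proof -
  note m = bounded_complexD(1)[OF Y]
  note d = TD.twist_decomposition[OF Y T.bounded_FC[OF R.bounded_FC[OF Y]],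
      where q = "\<lambda>\<chi> i. char_proj \<chi> (obj Y i)", OF chain_map_char_proj[OF Y]]
  have inj: "t = t'" if "t \<in> space (obj (T.FC (R.FC Y)) i)" "t' \<in> space (obj (T.FC (R.FC Y)) i)"
      "\<And>\<chi>. \<chi> \<in> carrier D \<Longrightarrow> char_proj \<chi> (obj Y i) t = char_proj \<chi> (obj Y i) t'" for i t t'
    by (rule char_proj_inj[OF m]) (use that in simp_all)
  have surj: "\<exists>t\<in>space (obj (T.FC (R.FC Y)) i). \<forall>\<chi>\<in>carrier D. char_proj \<chi> (obj Y i) t = x \<chi>"
    if "\<And>\<chi>. \<chi> \<in> carrier D \<Longrightarrow> x \<chi> \<in> space (obj Y i)" for i x
    using char_proj_surj[OF m that] by simp
  show "\<exists>W \<Phi>. bounded_complex S W \<and> quasi_iso S (T.FC (R.FC Y)) (dsum Y W) \<Phi> \<and>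
      (\<forall>i. \<forall>z\<in>space (obj (T.FC (R.FC Y)) i). vfst (\<Phi> i z) = char_proj \<one>\<^bsub>D\<^esub> (obj Y i) z)"
    by (rule d(1)[OF _ inj surj])
  show "H_invariant D S (dual_action G A) Y \<Longrightarrow> cpx_iso S (T.FC (R.FC Y)) (dsum_power (card (carrier D)) Y)"
    by (rule d(2)[OF _ inj surj])
qed

text \<open>Here induction is the first functor. The projection at the trivial character is the
  multiplication x \<otimes> f to x f, the usual counit of induction and restriction.\<close>

sublocale PS: separable_pair A S "carrier G" "\<lambda>M. tensor_module A S M SB" "\<lambda>M M'. tensor_map A S M M' SB" T.coord
  "{()}" res_module "\<lambda>M N f. f" "\<lambda>M j t. t" "\<lambda>Y i. char_proj \<one>\<^bsub>D\<^esub> (obj Y i)"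
proof unfold_locales
  fix X Y f t i assume f: "chain_map S X Y f" and t: "t \<in> space (obj (T.FC (R.FC X)) i)"
  show "char_proj \<one>\<^bsub>D\<^esub> (obj Y i) (T.FM (R.FC X) (R.FC Y) (R.FM X Y f) i t) = f i (char_proj \<one>\<^bsub>D\<^esub> (obj X i) t)"
    using char_proj_natural[OF bounded_complexD(1)[OF chain_mapD(1)[OF f]] bounded_complexD(1)[OF chain_mapD(2)[OF f]]
        chain_mapD(3)[OF f], of t] t
    by (simp add: cmap_map_def)
next
  fix Y assume Y: "bounded_complex S Y"
  have "chain_map S (tw_cpx (dual_action G A) \<one>\<^bsub>D\<^esub> Y) Y (\<lambda>i x. x)"
    by (rule chain_mapI[OF TD.bounded_complex_tw[OF Y TD.H.one_closed] Y])
      (auto simp: rmodule_hom_def linear_on_def dual_action_one)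
  from chain_map_comp[OF chain_map_char_proj[OF Y TD.H.one_closed] this]
  show "chain_map S (T.FC (R.FC Y)) Y (\<lambda>i. char_proj \<one>\<^bsub>D\<^esub> (obj Y i))" .
  show "\<exists>Z \<Phi>. bounded_complex S Z \<and> quasi_iso S (T.FC (R.FC Y)) (dsum Y Z) \<Phi> \<and>
      (\<forall>i. \<forall>t\<in>space (obj (T.FC (R.FC Y)) i). vfst (\<Phi> i t) = char_proj \<one>\<^bsub>D\<^esub> (obj Y i) t)"
    by (rule TR_decomposition(1)[OF Y])
qed

text \<open>The dual group acts on the second factor of X \<otimes> S, sending x \<otimes> f to x
  \<otimes> \<chi>(f). In coordinates this scales the g-th one by \<chi>(g), and \<theta> is defined
  by that property, so all requirements are checked on coordinates.\<close>

lemma H_invariant_induction: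
  assumes X: "bounded_complex A X"
  shows "H_invariant D S (dual_action G A) (T.FC X)"
proof -
  note m = bounded_complexD(1)[OF X] and b = T.bounded_FC[OF X]
  note MS = right_module_subspace[OF m]
  have ex: "\<exists>t'\<in>space (T.TM (obj X i)). \<forall>g\<in>carrier G. T.coord (obj X i) g t' = vscale (\<chi> g) (T.coord (obj X i) g t)"
    if t: "t \<in> space (T.TM (obj X i))" for i t \<chi>
    by (rule T.coord_surj[OF m vs.subspace_scale[OF MS T.coord_closed[OF m _ t]]])
  define \<theta> where "\<theta> = (\<lambda>\<chi> i t. SOME t'. t' \<in> space (T.TM (obj X i)) \<and>
      (\<forall>g\<in>carrier G. T.coord (obj X i) g t' = vscale (\<chi> g) (T.coord (obj X i) g t)))"
  have \<theta>: "\<theta> \<chi> i t \<in> space (T.TM (obj X i))"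
      "g \<in> carrier G \<Longrightarrow> T.coord (obj X i) g (\<theta> \<chi> i t) = vscale (\<chi> g) (T.coord (obj X i) g t)"
    if t: "t \<in> space (T.TM (obj X i))" for i t \<chi> g
    using someI_ex[OF ex[OF t, unfolded Bex_def], of \<chi>] by (auto simp: \<theta>_def)
  note lin = linear_onD[OF T.coord(1)[OF m]]
  note S' = vs.subspace_add[OF right_module_subspace[OF T.TM_module[OF m]]]
    vs.subspace_scale[OF right_module_subspace[OF T.TM_module[OF m]]]
  note R' = right_moduleD(1)[OF T.TM_module[OF m]]
  show ?thesis
  proof (rule TD.H_invariantI[OF b, where \<theta> = \<theta>])
    fix \<chi> i assume \<chi>: "\<chi> \<in> carrier D"
    let ?V = "space (T.TM (obj X i))"
    have "linear_on ?V (\<theta> \<chi> i)"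
      unfolding linear_on_def
    proof (intro conjI ballI allI)
      show "\<theta> \<chi> i (t + t') = \<theta> \<chi> i t + \<theta> \<chi> i t'" if "t \<in> ?V" "t' \<in> ?V" for t t'
        by (rule T.coord_inj[OF m[of i]])
          (use that \<theta> S' in \<open>simp_all add: lin vs.scale_right_distrib\<close>)
      show "\<theta> \<chi> i (vscale k t) = vscale k (\<theta> \<chi> i t)" if "t \<in> ?V" for k t
        by (rule T.coord_inj[OF m[of i]])
          (use that \<theta> S' in \<open>simp_all add: lin mult.commute\<close>)
    qed
    then show "linear_on (space (obj (T.FC X) i)) (\<theta> \<chi> i)" by simp
    have "bij_betw (\<theta> \<chi> i) ?V ?V"
      unfolding bij_betw_def
    proof (intro conjI inj_onI equalityI subsetI)
      fix t t' assume t: "t \<in> ?V" "t' \<in> ?V" and eq: "\<theta> \<chi> i t = \<theta> \<chi> i t'"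
      show "t = t'"
      proof (rule T.coord_inj[OF m t])
        fix g assume g: "g \<in> carrier G"
        have "vscale (\<chi> g) (T.coord (obj X i) g t) = vscale (\<chi> g) (T.coord (obj X i) g t')"
          unfolding \<theta>(2)[OF t(1) g, symmetric] \<theta>(2)[OF t(2) g, symmetric] eq ..
        then show "T.coord (obj X i) g t = T.coord (obj X i) g t'"
          by (rule vs.scale_left_imp_eq[OF char(1)[OF \<chi> g]])
      qed
    next
      show "t \<in> ?V" if "t \<in> \<theta> \<chi> i ` ?V" for t using that \<theta>(1) by auto
    next
      fix t assume t: "t \<in> ?V"
      \<comment> \<open>\<theta> makes sense for every scalar function on G, in particular for the
        pointwise inverse of \<chi>, which gives the preimage.\<close>
      let ?u = "\<theta> (\<lambda>g. inverse (\<chi> g)) i t"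
      have "t = \<theta> \<chi> i ?u"
        by (rule T.coord_inj[OF m t \<theta>(1)[OF \<theta>(1)[OF t]]])
          (simp add: \<theta>(2)[OF \<theta>(1)[OF t]] \<theta>(2)[OF t] char(1)[OF \<chi>])
      then show "t \<in> \<theta> \<chi> i ` ?V" using \<theta>(1)[OF t] by blast
    qed
    then show "bij_betw (\<theta> \<chi> i) (space (obj (T.FC X) i)) (space (obj (T.FC X) i))" by simp
    fix t assume tX: "t \<in> space (obj (T.FC X) i)"
    then have t: "t \<in> ?V" by simp
    have dt: "diff (T.FC X) i t \<in> space (T.TM (obj X (i + 1)))"
      using bounded_complexD(6)[OF b tX] by simp
    have \<theta>X: "\<theta> \<chi> i t \<in> space (obj (T.FC X) i)" using \<theta>(1)[OF t] by simp
    show "\<theta> \<chi> (i + 1) (diff (T.FC X) i t) = diff (T.FC X) i (\<theta> \<chi> i t)"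
    proof (rule T.coord_inj[OF m \<theta>(1)[OF dt]])
      show "diff (T.FC X) i (\<theta> \<chi> i t) \<in> space (T.TM (obj X (i + 1)))"
        using bounded_complexD(6)[OF b \<theta>X] by simp
      fix g assume g: "g \<in> carrier G"
      show "T.coord (obj X (i + 1)) g (\<theta> \<chi> (i + 1) (diff (T.FC X) i t)) =
          T.coord (obj X (i + 1)) g (diff (T.FC X) i (\<theta> \<chi> i t))"
        unfolding \<theta>(2)[OF dt g] T.coord_diff[OF X tX g] T.coord_diff[OF X \<theta>X g] \<theta>(2)[OF t g]
        by (rule linear_onD(2)[OF bounded_complexD(5)[OF X] T.coord_closed[OF m g t], symmetric])
    qed
    show "\<theta> \<chi> i (ract (obj (T.FC X) i) t f) = ract (obj (T.FC X) i) (\<theta> \<chi> i t) (dual_action G A \<chi> f)"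
      if f: "f \<in> carrier S" for f
      unfolding cpx_map_simps
    proof (rule T.coord_inj[OF m \<theta>(1)[OF R'[OF t f]] R'[OF \<theta>(1)[OF t] dual_action_closed[OF f]]])
      fix h assume h: "h \<in> carrier G"
      have "T.coord (obj X i) h (ract (T.TM (obj X i)) (\<theta> \<chi> i t) (dual_action G A \<chi> f)) =
          (\<Sum>a\<in>carrier G. ract (obj X i) (vscale (\<chi> a) (T.coord (obj X i) a t)) (act a (dual_action G A \<chi> f (inv a \<otimes> h))))"
        using coord_ract[OF m \<theta>(1)[OF t] dual_action_closed[OF f] h] \<theta>(2)[OF t] by simp
      also have "\<dots> = (\<Sum>a\<in>carrier G. vscale (\<chi> h) (ract (obj X i) (T.coord (obj X i) a t) (act a (f (inv a \<otimes> h)))))"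
      proof (rule sum.cong[OF refl])
        fix a assume a: "a \<in> carrier G"
        have fa: "f (inv a \<otimes> h) \<in> carrier A" "act a (f (inv a \<otimes> h)) \<in> carrier A"
          using f a h by (simp_all add: S_apply act)
        note c = T.coord_closed[OF m a t]
        \<comment> \<open>The factor \<chi>(a) comes from the scaled coordinate, the factor
          \<chi>(a^-1 h) from the dual action on f.\<close>
        have "\<chi> h = \<chi> a * \<chi> (inv a \<otimes> h)"
          using char(2)[OF \<chi> a, of "inv a \<otimes> h"] a h by (simp add: m_assoc[symmetric])
        moreover have "act a (dual_action G A \<chi> f (inv a \<otimes> h)) = \<chi> (inv a \<otimes> h) \<odot>\<^bsub>A\<^esub> act a (f (inv a \<otimes> h))"
          using f a h fa by (simp add: dual_action_apply act(5))
        ultimately show "ract (obj X i) (vscale (\<chi> a) (T.coord (obj X i) a t)) (act a (dual_action G A \<chi> f (inv a \<otimes> h))) =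
            vscale (\<chi> h) (ract (obj X i) (T.coord (obj X i) a t) (act a (f (inv a \<otimes> h))))"
          using right_moduleD(5)[OF m vs.subspace_scale[OF MS c] fa(2)]
            linear_onD(2)[OF right_moduleD(2)[OF m fa(2)] c] by (simp add: mult.commute)
      qed
      also have "\<dots> = vscale (\<chi> h) (T.coord (obj X i) h (ract (T.TM (obj X i)) t f))"
        unfolding coord_ract[OF m t f h] vs.scale_sum_right ..
      also have "\<dots> = T.coord (obj X i) h (\<theta> \<chi> i (ract (T.TM (obj X i)) t f))"
        by (rule \<theta>(2)[OF R'[OF t f] h, symmetric])
      finally show "T.coord (obj X i) h (\<theta> \<chi> i (ract (T.TM (obj X i)) t f)) =
          T.coord (obj X i) h (ract (T.TM (obj X i)) (\<theta> \<chi> i t) (dual_action G A \<chi> f))" by simp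
    qed
    show "\<theta> (\<chi> \<otimes>\<^bsub>D\<^esub> \<psi>) i t = \<theta> \<chi> i (\<theta> \<psi> i t)" if \<psi>: "\<psi> \<in> carrier D" for \<psi>
      by (rule T.coord_inj[OF m \<theta>(1)[OF t] \<theta>(1)[OF \<theta>(1)[OF t]]])
        (simp add: \<theta>(2)[OF \<theta>(1)[OF t]] \<theta>(2)[OF t] dual_simps)
  qed
qed

section \<open>The bijection of tilting subcategories\<close>

lemma invariant_tilting_bounded: "invariant_tilting H B ac X \<Longrightarrow> bounded_complex B X"
  by (simp add: invariant_tilting_def tilting_def)

text \<open>By invariance the restriction of the induced object is the power of X with exponent |G|.
  This feeds \<open>tilting_FC\<close>, and since the exponent is positive it also shows that the
  round trip returns the same category.\<close>

lemma invariant_tilting_induction: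
  assumes "invariant_tilting G A act X"
  shows "invariant_tilting D S (dual_action G A) (T.FC X)"
    and "add_cat A (R.FC (T.FC X)) = add_cat A X"
proof -
  have X: "tilting A X" "H_invariant G A act X" and b: "bounded_complex A X"
    using assms by (auto simp: invariant_tilting_def tilting_def)
  note i = RT_decomposition(2)[OF b X(2)]
  show "invariant_tilting D S (dual_action G A) (T.FC X)"
    using PS.tilting_FC[OF X(1) i] H_invariant_induction[OF b] by (simp add: invariant_tilting_def)
  show "add_cat A (R.FC (T.FC X)) = add_cat A X"
    by (rule add_cat_power_eq[OF b i card_pos])
qed

text \<open>The same argument with characters in place of group elements; the exponent is the order
  of the dual group, which is that of G.\<close>

lemma invariant_tilting_restriction:
  assumes "invariant_tilting D S (dual_action G A) U"
  shows "invariant_tilting G A act (R.FC U)"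
    and "add_cat S (T.FC (R.FC U)) = add_cat S U"
proof -
  have U: "tilting S U" "H_invariant D S (dual_action G A) U" and b: "bounded_complex S U"
    using assms by (auto simp: invariant_tilting_def tilting_def)
  note i = TR_decomposition(2)[OF b U(2)]
  show "invariant_tilting G A act (R.FC U)"
    using PA.tilting_FC[OF U(1) i] H_invariant_restriction[OF b] by (simp add: invariant_tilting_def)
  show "add_cat S (T.FC (R.FC U)) = add_cat S U"
    by (rule add_cat_power_eq[OF b i]) (simp add: card_dual card_pos)
qed

text \<open>A tilting subcategory does not remember a generator, so both maps choose one, and
  \<open>add_cat_FC_cong\<close> makes the value independent of the choice. Bijectivity then follows
  from the two round trips.\<close>

theorem tilting_bijection:
  "\<exists>\<Phi> \<Psi>.
    (\<forall>X. invariant_tilting G A act X \<longrightarrow> \<Phi> (add_cat A X) = add_cat S (T.FC X)) \<and>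
    (\<forall>U. invariant_tilting D S (dual_action G A) U \<longrightarrow> \<Psi> (add_cat S U) = add_cat A (R.FC U)) \<and>
    bij_betw \<Phi> (tilting_subcategories G A act) (tilting_subcategories D S (dual_action G A)) \<and>
    bij_betw \<Psi> (tilting_subcategories D S (dual_action G A)) (tilting_subcategories G A act) \<and>
    (\<forall>\<T>\<in>tilting_subcategories G A act. \<Psi> (\<Phi> \<T>) = \<T>) \<and>
    (\<forall>\<U>\<in>tilting_subcategories D S (dual_action G A). \<Phi> (\<Psi> \<U>) = \<U>)"
proof -
  let ?TA = "tilting_subcategories G A act" and ?TS = "tilting_subcategories D S (dual_action G A)"
  define \<Phi> where "\<Phi> = (\<lambda>\<T>. add_cat S (T.FC (SOME X. invariant_tilting G A act X \<and> add_cat A X = \<T>)))"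
  define \<Psi> where "\<Psi> = (\<lambda>\<U>. add_cat A (R.FC (SOME U. invariant_tilting D S (dual_action G A) U \<and> add_cat S U = \<U>)))"
  have \<Phi>: "\<Phi> (add_cat A X) = add_cat S (T.FC X)" if X: "invariant_tilting G A act X" for X
  proof -
    let ?X = "SOME X'. invariant_tilting G A act X' \<and> add_cat A X' = add_cat A X"
    have "invariant_tilting G A act ?X \<and> add_cat A ?X = add_cat A X"
      by (rule someI[of _ X]) (use X in simp)
    then show ?thesis
      unfolding \<Phi>_def by (intro T.add_cat_FC_cong invariant_tilting_bounded[OF X]) (auto dest: invariant_tilting_bounded)
  qed
  have \<Psi>: "\<Psi> (add_cat S U) = add_cat A (R.FC U)" if U: "invariant_tilting D S (dual_action G A) U" for U
  proof -
    let ?U = "SOME U'. invariant_tilting D S (dual_action G A) U' \<and> add_cat S U' = add_cat S U"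
    have "invariant_tilting D S (dual_action G A) ?U \<and> add_cat S ?U = add_cat S U"
      by (rule someI[of _ U]) (use U in simp)
    then show ?thesis
      unfolding \<Psi>_def by (intro R.add_cat_FC_cong invariant_tilting_bounded[OF U]) (auto dest: invariant_tilting_bounded)
  qed
  have \<Phi>_into: "\<Phi> \<T> \<in> ?TS" and \<Psi>\<Phi>: "\<Psi> (\<Phi> \<T>) = \<T>" if "\<T> \<in> ?TA" for \<T>
  proof -
    obtain X where X: "invariant_tilting G A act X" "\<T> = add_cat A X"
      using \<open>\<T> \<in> ?TA\<close> by (auto simp: tilting_subcategories_def)
    note i = invariant_tilting_induction[OF X(1)]
    show "\<Phi> \<T> \<in> ?TS" using i(1) \<Phi>[OF X(1)] X(2) by (auto simp: tilting_subcategories_def)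
    show "\<Psi> (\<Phi> \<T>) = \<T>" using \<Phi>[OF X(1)] \<Psi>[OF i(1)] i(2) X(2) by simp
  qed
  have \<Psi>_into: "\<Psi> \<U> \<in> ?TA" and \<Phi>\<Psi>: "\<Phi> (\<Psi> \<U>) = \<U>" if "\<U> \<in> ?TS" for \<U>
  proof -
    obtain U where U: "invariant_tilting D S (dual_action G A) U" "\<U> = add_cat S U"
      using \<open>\<U> \<in> ?TS\<close> by (auto simp: tilting_subcategories_def)
    note i = invariant_tilting_restriction[OF U(1)]
    show "\<Psi> \<U> \<in> ?TA" using i(1) \<Psi>[OF U(1)] U(2) by (auto simp: tilting_subcategories_def)
    show "\<Phi> (\<Psi> \<U>) = \<U>" using \<Psi>[OF U(1)] \<Phi>[OF i(1)] i(2) U(2) by simp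
  qed
  have "bij_betw \<Phi> ?TA ?TS"
    by (rule bij_betw_byWitness[where f' = \<Psi>]) (use \<Phi>_into \<Psi>\<Phi> \<Psi>_into \<Phi>\<Psi> in auto)
  moreover have "bij_betw \<Psi> ?TS ?TA"
    by (rule bij_betw_byWitness[where f' = \<Phi>]) (use \<Phi>_into \<Psi>\<Phi> \<Psi>_into \<Phi>\<Psi> in auto)
  ultimately show ?thesis
    using \<Phi> \<Psi> \<Psi>\<Phi> \<Phi>\<Psi> by (intro exI[of _ \<Phi>] exI[of _ \<Psi>] conjI allI impI ballI)
qed

end

theorem theorem2p10:
  fixes G :: "'g monoid" and \<Lambda> :: "('k::field, 'a) module" and act :: "'g \<Rightarrow> 'a \<Rightarrow> 'a"
  assumes "comm_group G" and "finite (carrier G)"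
    and "\<not> CHAR('k) dvd card (carrier G)"
    and "card (carrier (dual_group G :: ('g \<Rightarrow> 'k) monoid)) = card (carrier G)"
    and "H_algebra G \<Lambda> act"
  shows "\<exists>\<Phi> \<Psi>.
    (\<forall>T. invariant_tilting G \<Lambda> act T \<longrightarrow>
       \<Phi> (add_cat \<Lambda> T) = add_cat (skew_group_algebra G \<Lambda> act) (skew_induction G \<Lambda> act T)) \<and>
    (\<forall>U. invariant_tilting (dual_group G) (skew_group_algebra G \<Lambda> act) (dual_action G \<Lambda>) U \<longrightarrow>
       \<Psi> (add_cat (skew_group_algebra G \<Lambda> act) U) = add_cat \<Lambda> (skew_restriction G \<Lambda> U)) \<and>
    bij_betw \<Phi> (tilting_subcategories G \<Lambda> act)
      (tilting_subcategories (dual_group G) (skew_group_algebra G \<Lambda> act) (dual_action G \<Lambda>)) \<and>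
    bij_betw \<Psi>
      (tilting_subcategories (dual_group G) (skew_group_algebra G \<Lambda> act) (dual_action G \<Lambda>))
      (tilting_subcategories G \<Lambda> act) \<and>
    (\<forall>\<T>\<in>tilting_subcategories G \<Lambda> act. \<Psi> (\<Phi> \<T>) = \<T>) \<and>
    (\<forall>\<U>\<in>tilting_subcategories (dual_group G) (skew_group_algebra G \<Lambda> act) (dual_action G \<Lambda>).
       \<Phi> (\<Psi> \<U>) = \<U>)"
proof -
  interpret comm_group G by fact
  interpret skew_dual G \<Lambda> act by unfold_locales (fact assms)+
  \<comment> \<open>The functors in the statement are, as equations between complexes, the
    coordinate functors \<open>T.FC\<close> and \<open>R.FC\<close>.\<close>
  show ?thesis unfolding skew_induction_eq skew_restriction_eq by (rule tilting_bijection)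
qed

end
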